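(* Let $\nu,\Omega\in\mathbb{R}$ and let $I\subset\mathbb{R}$ be an open interval. Let $\mathbf{u}=\mathbf{u}(t,\mathbf{x})\in\mathcal{H}_I$. Then $\mathbf{u}$ is a solution on $I$ of the Fourier-side Navier–Stokes–Coriolis system $$\partial_t\mathbf{u}_{\mathbf{n}}+\nu|\mathbf{n}|^2\mathbf{u}_{\mathbf{n}}+\Omega J_{\mathbf{n}}\mathbf{u}_{\mathbf{n}}+\frac{i}{2}\hat{\mathbb{P}}_{\mathbf{n}}\sum_{\substack{\mathbf{n}_1,\mathbf{n}_2\in S\\ \mathbf{n}_1+\mathbf{n}_2=\mathbf{n}}}\big[(\mathbf{u}_{\mathbf{n}_1}\cdot\mathbf{n}_2)\mathbf{u}_{\mathbf{n}_2}+(\mathbf{u}_{\mathbf{n}_2}\cdot\mathbf{n}_1)\mathbf{u}_{\mathbf{n}_1}\big]=\mathbf{0},\qquad \mathbf{n}\cdot\mathbf{u}_{\mathbf{n}}=0,$$ for $t\in I$ and $\mathbf{n}\in\widetilde S:=S\cup[(S+S)\setminus\{\mathbf{0}\}]$ (with $S$ the Fourier support of $\mathbf{u}$), if and only if $\mathbf{u}$ evolves according to the linear equation $\partial_t\mathbf{u}_{\mathbf{n}}+\nu|\mathbf{n}|^2\mathbf{u}_{\mathbf{n}}+\Omega J_{\mathbf{n}}\mathbf{u}_{\mathbf{n}}=\mathbf{0}$ and satisfies one of the following for some $t_*\in I$ (or equivalently, for any $t_*\in I$): (i) The Fourier support $S$ of $\mathbf{u}(t_* )\in\mathcal{H}$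 is a subset of a line passing through the origin. (ii) $S$ has two linearly independent points and is a subset of a plane $P$ containing the origin. Moreover, one of the following holds: (a) $\Omega=0$ or $P=P_3:=\{\mathbf{n}\in\mathbb{R}^3:\mathbf{n}\cdot\mathbf{e}^3=0\}$, and $\mathbf{u}(t_* )$ is perpendicular to $P$ everywhere. (b) $\mathbf{u}(t_* )=\mathbf{u}^\parallel(t_* )+u^\perp(t_* )\mathbf{e}^\perp$, where $\mathbf{e}^\perp$ is (one of) the unit normal vector to $P$ and $\mathbf{u}^\parallel(t_* )$, $u^\perp(t_* )$ satisfy the following: - $\mathbf{u}^\parallel(t_* )\in\mathcal{H}$ is parallel to $P$ everywhere, and its Fourier support is a subset of a circle on $P$ (with radius $\lambda>0$) centered at the origin and contains at least four points; - $u^\perp(t_*,\mathbf{x})=Q(\omega(\mathbf{x}))-\langle Q(\omega)\rangle$, where $\omega(\mathbf{x})$ is the scalar function defined by $\nabla\times\mathbf{u}^\parallel(t_* )=\lambda\omega\mathbf{e}^\perp$, $\langle Q(\omega)\rangle$ is the zero mode (mean value) of $Q(\omega(\mathbf{x}))$, and: $Q$ is a polynomial with real coefficients if ($\Omega=0$ or $P=P_3$) and $\nu=0$; $Q(\omega)=\kappa\omega$ for some $\kappa\in\mathbb{R}$ if ($\Omega=0$ or $P=P_3$) and $\nu\neq0$; $Q(\omega)$ is either $\omega$ or $-\omega$ if $\Omega\neq0$ and $P\neq P_3$. (iii) $S$ has three linearly independent points and is a subset of a sphere centered at the origin, and $\mathbf{u}(t_* )$ is a Beltrami flow.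
   Context: The dot "$\cdot$" is the $\mathbb{C}$-bilinear dot product on $\mathbb{C}^3$; "$\times$" is the cross product; $\mathbf{e}^3=(0,0,1)$. A set $S\subset\mathbb{R}^3$ is symmetric if $-S=S$. $\mathcal{H}$ is the set of all real-valued vector fields $\mathbf{u}(\mathbf{x})=\sum_{\mathbf{n}\in S}\mathbf{u}_{\mathbf{n}}e^{i\mathbf{n}\cdot\mathbf{x}}$ on $\mathbb{R}^3$ with $S\subset\mathbb{R}^3\setminus\{\mathbf{0}\}$ finite and symmetric, $\mathbf{u}_{\mathbf{n}}\in\mathbb{C}^3\setminus\{\mathbf{0}\}$, $\mathbf{u}_{-\mathbf{n}}=\overline{\mathbf{u}_{\mathbf{n}}}$, $\mathbf{n}\cdot\mathbf{u}_{\mathbf{n}}=0$ for all $\mathbf{n}\in S$. For an open interval $I\subset\mathbb{R}$, $\mathcal{H}_I$ is the set of all $\mathbf{u}(t,\mathbf{x})=\sum_{\mathbf{n}\in S}\mathbf{u}_{\mathbf{n}}(t)e^{i\mathbf{n}\cdot\mathbf{x}}$ on $I\times\mathbb{R}^3$ with $S\subset\mathbb{R}^3\setminus\{\mathbf{0}\}$ finite and symmetric, $\mathbf{u}_{\mathbf{n}}:I\to\mathbb{C}^3$, $\mathbf{u}_{\mathbf{n}}\not\equiv\mathbf{0}$, $\mathbf{u}_{-\mathbf{n}}(t)=\overline{\mathbf{u}_{\mathbf{n}}(t)}$, $\mathbf{n}\cdot\mathbf{u}_{\mathbf{n}}(t)=0$ for all $t\in I$, $\mathbf{n}\in S$. The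 set $S$ is called the Fourier support of $\mathbf{u}$. Convention: $\mathbf{u}_{\mathbf{n}}=\mathbf{0}$ if $\mathbf{n}\notin S$. Being a solution includes that each $\mathbf{u}_{\mathbf{n}}$ is differentiable in $t$. For $\mathbf{n}=(n^1,n^2,n^3)\in\mathbb{R}^3\setminus\{\mathbf{0}\}$, $\hat{\mathbb{P}}_{\mathbf{n}}$ is the orthogonal projection in $\mathbb{C}^3$ onto $\{\mathbf{v}\in\mathbb{C}^3:\mathbf{n}\cdot\mathbf{v}=0\}$, and $$J_{\mathbf{n}}=\frac{n^3}{|\mathbf{n}|^2}\begin{pmatrix}0&-n^3&n^2\\ n^3&0&-n^1\\ -n^2&n^1&0\end{pmatrix},$$ i.e. the matrix given by $J_{\mathbf{n}}\mathbf{v}=\hat{\mathbb{P}}_{\mathbf{n}}[\mathbf{e}^3\times(\hat{\mathbb{P}}_{\mathbf{n}}\mathbf{v})]$ for $\mathbf{v}\in\mathbb{C}^3$. The system is the Fourier-side form, with pressure eliminated, of $\partial_t\mathbf{u}-\nu\Delta\mathbf{u}+\Omega\mathbf{e}^3\times\mathbf{u}+(\mathbf{u}\cdot\nabla)\mathbf{u}+\nabla p=\mathbf{0}$, $\nabla\cdot\mathbf{u}=0$. A field $\mathbf{b}\in\mathcal{H}$ is a Beltrami flow if there is $\lambda\in\mathbb{C}$ with $\nabla\times\mathbf{b}=\lambda\mathbf{b}$. *)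

theory Defs
  imports
    "HOL-Analysis.Analysis"
    "HOL-Computational_Algebra.Polynomial"
begin

section \<open>Vectors in \<open>\<complex>\<^sup>3\<close>\<close>

definition cvec :: "real^3 \<Rightarrow> complex^3" where
  "cvec x = (\<chi> j. complex_of_real (x $ j))"

definition cnjv :: "complex^3 \<Rightarrow> complex^3" where
  "cnjv v = (\<chi> j. cnj (v $ j))"

text \<open>The dot product is bilinear (no complex conjugation); the Hermitian product of
  \<open>v\<close> and \<open>w\<close> is \<open>cdot v (cnjv w)\<close>.\<close>

abbreviation cdot :: "complex^3 \<Rightarrow> complex^3 \<Rightarrow> complex" where
  "cdot \<equiv> scalar_product"

lemma cdot_simps: "cdot v (w - w') = cdot v w - cdot v w'"
  "cdot v (a *s w) = a * cdot v w" "cdot (a *s w) v = a * cdot w v"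
  by (simp_all add: scalar_product_def sum_3 algebra_simps)

definition ccross :: "complex^3 \<Rightarrow> complex^3 \<Rightarrow> complex^3" where
  "ccross a b = vector [a$2 * b$3 - a$3 * b$2,
                        a$3 * b$1 - a$1 * b$3,
                        a$1 * b$2 - a$2 * b$1]"

definition e3 :: "real^3" where
  "e3 = axis 3 1"


section \<open>The operators \<open>P\<^sub>n\<close> and \<open>J\<^sub>n\<close>\<close>

text \<open>The lemmas \<open>proj_perp_range\<close>, \<open>proj_perp_fix\<close> and \<open>proj_perp_orthogonal\<close> state that, for \<open>n \<noteq> 0\<close>, this is the orthogonal
  projection (for the Hermitian product) of \<open>\<complex>\<^sup>3\<close> onto \<open>{v. n \<cdot> v = 0}\<close>.\<close>

definition proj_perp :: "real^3 \<Rightarrow> complex^3 \<Rightarrow> complex^3" where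
  "proj_perp n v = v - (cdot (cvec n) v / of_real ((norm n)\<^sup>2)) *s cvec n"

lemma norm_sq_3: "(norm (n :: real^3))\<^sup>2 = (n$1)\<^sup>2 + (n$2)\<^sup>2 + (n$3)\<^sup>2"
  unfolding power2_norm_eq_inner by (simp add: inner_vec_def sum_3 power2_eq_square)

lemma cdot_cvec_self: "cdot (cvec n) (cvec n) = of_real ((norm n)\<^sup>2)"
  unfolding norm_sq_3 by (simp add: scalar_product_def cvec_def sum_3 power2_eq_square)

lemma proj_perp_range: "n \<noteq> 0 \<Longrightarrow> cdot (cvec n) (proj_perp n v) = 0"
proof -
  assume n: "n \<noteq> 0"
  have "cdot (cvec n) (proj_perp n v)
      = cdot (cvec n) v - (cdot (cvec n) v / of_real ((norm n)\<^sup>2)) * cdot (cvec n) (cvec n)"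
    by (simp add: proj_perp_def cdot_simps)
  with n show ?thesis by (simp add: cdot_cvec_self)
qed

lemma proj_perp_fix: "cdot (cvec n) v = 0 \<Longrightarrow> proj_perp n v = v"
  by (simp add: proj_perp_def)

lemma proj_perp_orthogonal:
  assumes "cdot (cvec n) w = 0"
  shows "cdot (v - proj_perp n v) (cnjv w) = 0"
proof -
  have "cdot (cvec n) (cnjv w) = cnj (cdot (cvec n) w)"
    by (simp add: scalar_product_def cvec_def cnjv_def sum_3)
  then have "cdot (cvec n) (cnjv w) = 0" using assms by simp
  moreover have "cdot (v - proj_perp n v) (cnjv w)
      = (cdot (cvec n) v / of_real ((norm n)\<^sup>2)) * cdot (cvec n) (cnjv w)"
    by (simp add: proj_perp_def cdot_simps)
  ultimately show ?thesis by simp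
qed

definition Jmat :: "real^3 \<Rightarrow> complex^3^3" where
  "Jmat n = vector
     [cvec ((n$3 / (norm n)\<^sup>2) *\<^sub>R vector [0, - n$3, n$2]),
      cvec ((n$3 / (norm n)\<^sup>2) *\<^sub>R vector [n$3, 0, - n$1]),
      cvec ((n$3 / (norm n)\<^sup>2) *\<^sub>R vector [- n$2, n$1, 0])]"

lemma Jmat_eq:
  assumes n: "n \<noteq> 0"
  shows "Jmat n *v v = proj_perp n (ccross (cvec e3) (proj_perp n v))"
proof -
  define r where "r = complex_of_real ((norm n)\<^sup>2)"
  have r0: "r \<noteq> 0" using n by (simp add: r_def)
  define a b c where "a = complex_of_real (n$1)" "b = complex_of_real (n$2)"
    "c = complex_of_real (n$3)"
  note abc = this
  have r: "r = a\<^sup>2 + b\<^sup>2 + c\<^sup>2" unfolding r_def norm_sq_3 abc by simp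
  define s where "s = (a * v$1 + b * v$2 + c * v$3) / r"
  have s: "a * v$1 + b * v$2 + c * v$3 = s * r" using r0 by (simp add: s_def)
  have P: "proj_perp n w = (\<chi> j. w$j - ((a * w$1 + b * w$2 + c * w$3) / r) * cvec n $ j)" for w
    by (simp add: vec_eq_iff proj_perp_def scalar_product_def sum_3 cvec_def abc r_def)
  have cr: "ccross (cvec e3) w = vector [- w$2, w$1, 0]" for w
    by (simp add: ccross_def e3_def cvec_def axis_def)
  have n': "cvec n $ 1 = a" "cvec n $ 2 = b" "cvec n $ 3 = c"
    by (simp_all add: cvec_def abc)
  have J1: "(Jmat n *v v) $ 1 = (c / r) * (- c * v$2 + b * v$3)"
    "(Jmat n *v v) $ 2 = (c / r) * (c * v$1 - a * v$3)"
    "(Jmat n *v v) $ 3 = (c / r) * (- b * v$1 + a * v$2)"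
    by (simp_all add: Jmat_def matrix_vector_mult_def sum_3 cvec_def abc r_def algebra_simps
        diff_divide_distrib add_divide_distrib)
  define q where "q = (a * (- (v$2 - s * b)) + b * (v$1 - s * a)) / r"
  have q: "q * r = b * v$1 - a * v$2"
  proof -
    have "q * r = a * (- (v$2 - s * b)) + b * (v$1 - s * a)"
      using r0 by (simp add: q_def)
    then show ?thesis by (simp add: algebra_simps)
  qed
  have R: "proj_perp n (ccross (cvec e3) (proj_perp n v)) =
     vector [- (v$2 - s * b) - q * a, (v$1 - s * a) - q * b, - q * c]"
    unfolding P cr by (simp add: vec_eq_iff forall_3 n' s_def q_def)
  have 1: "c * (- c * v$2 + b * v$3) = (- (v$2 - s * b) - q * a) * r"
  proof -
    have "(- (v$2 - s * b) - q * a) * r = - v$2 * r + b * (s * r) - a * (q * r)"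
      by (simp add: algebra_simps)
    also have "\<dots> = c * (- c * v$2 + b * v$3)"
      unfolding s[symmetric] q unfolding r by (simp add: algebra_simps power2_eq_square)
    finally show ?thesis by simp
  qed
  have 2: "c * (c * v$1 - a * v$3) = ((v$1 - s * a) - q * b) * r"
  proof -
    have "((v$1 - s * a) - q * b) * r = v$1 * r - a * (s * r) - b * (q * r)"
      by (simp add: algebra_simps)
    also have "\<dots> = c * (c * v$1 - a * v$3)"
      unfolding s[symmetric] q unfolding r by (simp add: algebra_simps power2_eq_square)
    finally show ?thesis by simp
  qed
  have 3: "c * (- b * v$1 + a * v$2) = (- q * c) * r"
  proof -
    have "(- q * c) * r = - c * (q * r)" by simp
    then show ?thesis unfolding q by (simp add: algebra_simps)
  qed
  show ?thesis unfolding R vec_eq_iff forall_3 J1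
    using 1 2 3 r0 by (simp add: field_simps)
qed


section \<open>Fourier coefficients of trigonometric polynomials\<close>

text \<open>Frequencies are arbitrary points of \<open>\<real>\<^sup>3\<close>, so the functions need not be periodic. A finite
  expansion into characters is nevertheless unique, and the coefficients are defined through it.\<close>

definition trig_expansion :: "(real^3 \<Rightarrow> complex) \<Rightarrow> (real^3 \<Rightarrow> complex) \<Rightarrow> bool" where
  "trig_expansion f c \<longleftrightarrow>
     finite {n. c n \<noteq> 0} \<and> (\<forall>x. f x = (\<Sum>n | c n \<noteq> 0. c n * cis (n \<bullet> x)))"

definition fourier_coeff :: "(real^3 \<Rightarrow> complex) \<Rightarrow> real^3 \<Rightarrow> complex" where
  "fourier_coeff f = (THE c. trig_expansion f c)"

definition zero_mode :: "(real^3 \<Rightarrow> real) \<Rightarrow> real" where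
  "zero_mode f = Re (fourier_coeff (\<lambda>x. complex_of_real (f x)) 0)"

definition field_coeff :: "(real^3 \<Rightarrow> real^3) \<Rightarrow> real^3 \<Rightarrow> complex^3" where
  "field_coeff v n = (\<chi> j. fourier_coeff (\<lambda>x. complex_of_real (v x $ j)) n)"

definition fourier_support :: "(real^3 \<Rightarrow> real^3) \<Rightarrow> (real^3) set" where
  "fourier_support v = {n. field_coeff v n \<noteq> 0}"

lemma characters_independent:
  fixes d :: "real^3 \<Rightarrow> complex"
  assumes "finite A" "\<And>x. (\<Sum>n\<in>A. d n * cis (n \<bullet> x)) = 0" "n \<in> A"
  shows "d n = 0"
  using assms
proof (induction A arbitrary: d n rule: finite_induct)
  case empty
  then show ?case by simp
next
  case (insert m A)
  have A: "d k = 0" if k: "k \<in> A" for k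
  proof -
    have "d k * (cis (k \<bullet> y) - cis (m \<bullet> y)) = 0" for y
    proof (rule insert.IH[OF _ k, of "\<lambda>n. d n * (cis (n \<bullet> y) - cis (m \<bullet> y))"])
      fix x
      have "(\<Sum>n\<in>A. d n * (cis (n \<bullet> y) - cis (m \<bullet> y)) * cis (n \<bullet> x))
          = (\<Sum>n\<in>insert m A. d n * (cis (n \<bullet> y) - cis (m \<bullet> y)) * cis (n \<bullet> x))"
        using insert.hyps by simp
      also have "\<dots> = (\<Sum>n\<in>insert m A. d n * cis (n \<bullet> (x + y)))
          - cis (m \<bullet> y) * (\<Sum>n\<in>insert m A. d n * cis (n \<bullet> x))"
        unfolding sum_distrib_left sum_subtractf[symmetric]
        by (intro sum.cong refl) (simp add: inner_add_right cis_mult[symmetric] algebra_simps)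
      also have "\<dots> = 0" unfolding insert.prems(1) by simp
      finally show "(\<Sum>n\<in>A. d n * (cis (n \<bullet> y) - cis (m \<bullet> y)) * cis (n \<bullet> x)) = 0" .
    qed
    note all = this
    define w where "w = k - m"
    have w: "w \<noteq> 0" using k insert.hyps by (auto simp: w_def)
    define y where "y = (pi / (w \<bullet> w)) *\<^sub>R w"
    have "w \<bullet> y = pi" using w by (simp add: y_def)
    then have "k \<bullet> y = m \<bullet> y + pi" by (simp add: w_def inner_diff_left)
    then have "cis (k \<bullet> y) = - cis (m \<bullet> y)" by (simp add: cis_mult[symmetric])
    then have "d k * (- 2 * cis (m \<bullet> y)) = 0" using all[of y] by simp
    then show "d k = 0" by simp
  qed
  have "d m * cis (m \<bullet> 0) = 0"
    using insert.prems(1)[of 0] insert.hyps A by simp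
  then have "d m = 0" by simp
  with A insert.prems(2) show ?case by auto
qed

lemma trig_expansion_unique:
  assumes "trig_expansion f c" "trig_expansion f d"
  shows "c = d"
proof
  fix n
  let ?A = "{n. c n \<noteq> 0} \<union> {n. d n \<noteq> 0}"
  have fin: "finite ?A" using assms by (simp add: trig_expansion_def)
  have c: "f x = (\<Sum>n\<in>?A. c n * cis (n \<bullet> x))" for x
    using assms(1) fin unfolding trig_expansion_def
    by (auto intro!: sum.mono_neutral_left)
  have d: "f x = (\<Sum>n\<in>?A. d n * cis (n \<bullet> x))" for x
    using assms(2) fin unfolding trig_expansion_def
    by (auto intro!: sum.mono_neutral_left)
  have "(\<Sum>n\<in>?A. (c n - d n) * cis (n \<bullet> x)) = 0" for x
    using c[of x] d[of x] by (simp add: left_diff_distrib sum_subtractf)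
  from characters_independent[OF fin this]
  show "c n = d n" by (cases "n \<in> ?A") auto
qed

lemma fourier_coeff_eq: "trig_expansion f c \<Longrightarrow> fourier_coeff f = c"
  unfolding fourier_coeff_def by (blast intro: trig_expansion_unique)

lemma field_coeff_eq:
  assumes "finite S" "\<And>x. cvec (v x) = (\<Sum>n\<in>S. cis (n \<bullet> x) *s c n)"
  shows "field_coeff v n = (if n \<in> S then c n else 0)"
proof -
  have "fourier_coeff (\<lambda>x. complex_of_real (v x $ j)) = (\<lambda>n. if n \<in> S then c n $ j else 0)" for j
  proof (rule fourier_coeff_eq, unfold trig_expansion_def, intro conjI allI)
    let ?T = "{n. (if n \<in> S then c n $ j else 0) \<noteq> 0}"
    have T: "?T \<subseteq> S" by (auto split: if_splits)
    then show "finite ?T" using assms(1) by (rule finite_subset)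
    fix x
    have "complex_of_real (v x $ j) = cvec (v x) $ j" by (simp add: cvec_def)
    also have "\<dots> = (\<Sum>n\<in>S. (if n \<in> S then c n $ j else 0) * cis (n \<bullet> x))"
      unfolding assms(2) by (simp add: mult.commute)
    also have "\<dots> = (\<Sum>n\<in>?T. (if n \<in> S then c n $ j else 0) * cis (n \<bullet> x))"
      using assms(1) T by (intro sum.mono_neutral_right) auto
    finally show "complex_of_real (v x $ j) =
      (\<Sum>n\<in>?T. (if n \<in> S then c n $ j else 0) * cis (n \<bullet> x))" .
  qed
  then show ?thesis by (simp add: field_coeff_def vec_eq_iff)
qed


section \<open>The classes \<open>\<H>\<close> and \<open>\<H>\<^sub>I\<close>\<close>

definition Hfields :: "(real^3 \<Rightarrow> real^3) set" where
  "Hfields = {v. \<exists>S c. finite S \<and> 0 \<notin> S \<and> uminus ` S = S \<and>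
          (\<forall>n\<in>S. c n \<noteq> 0 \<and> c (- n) = cnjv (c n) \<and> cdot (cvec n) (c n) = 0) \<and>
          (\<forall>x. cvec (v x) = (\<Sum>n\<in>S. cis (n \<bullet> x) *s c n))}"

text \<open>Only the values \<open>u t\<close> for \<open>t \<in> I\<close> are relevant.\<close>

definition Hfields_on :: "real set \<Rightarrow> (real \<Rightarrow> real^3 \<Rightarrow> real^3) set" where
  "Hfields_on I = {u. \<exists>S c. finite S \<and> 0 \<notin> S \<and> uminus ` S = S \<and>
          (\<forall>n\<in>S. (\<exists>t\<in>I. c t n \<noteq> 0) \<and>
             (\<forall>t\<in>I. c t (- n) = cnjv (c t n) \<and> cdot (cvec n) (c t n) = 0)) \<and>
          (\<forall>t\<in>I. \<forall>x. cvec (u t x) = (\<Sum>n\<in>S. cis (n \<bullet> x) *s c t n))}"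

definition fourier_support_on :: "real set \<Rightarrow> (real \<Rightarrow> real^3 \<Rightarrow> real^3) \<Rightarrow> (real^3) set" where
  "fourier_support_on I u = {n. \<exists>t\<in>I. field_coeff (u t) n \<noteq> 0}"

lemma fourier_support_eq:
  assumes "finite S" "\<forall>n\<in>S. c n \<noteq> 0" "\<And>x. cvec (v x) = (\<Sum>n\<in>S. cis (n \<bullet> x) *s c n)"
  shows "fourier_support v = S"
  using assms(2) by (auto simp: fourier_support_def field_coeff_eq[OF assms(1,3)])

lemma fourier_support_on_eq:
  assumes "finite S" "\<forall>n\<in>S. \<exists>t\<in>I. c t n \<noteq> 0"
    "\<And>t x. t \<in> I \<Longrightarrow> cvec (u t x) = (\<Sum>n\<in>S. cis (n \<bullet> x) *s c t n)"
  shows "fourier_support_on I u = S"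
proof -
  have "field_coeff (u t) n = (if n \<in> S then c t n else 0)" if "t \<in> I" for t n
    by (rule field_coeff_eq) (use assms(1,3) that in auto)
  then show ?thesis using assms(2) by (auto simp: fourier_support_on_def)
qed


section \<open>The evolution equations\<close>

definition nsc_solution ::
  "real \<Rightarrow> real \<Rightarrow> real set \<Rightarrow> (real \<Rightarrow> real^3 \<Rightarrow> real^3) \<Rightarrow> bool" where
  "nsc_solution \<nu> \<Omega> I u \<longleftrightarrow>
    (let S = fourier_support_on I u;
         S' = S \<union> ({n1 + n2 | n1 n2. n1 \<in> S \<and> n2 \<in> S} - {0});
         U = (\<lambda>t. field_coeff (u t))
     in \<forall>t\<in>I. \<forall>n\<in>S'.
          (\<lambda>s. U s n) differentiable (at t) \<and>
          vector_derivative (\<lambda>s. U s n) (at t)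
            + (\<nu> * (norm n)\<^sup>2) *\<^sub>R U t n
            + \<Omega> *\<^sub>R (Jmat n *v U t n)
            + (\<i> / 2) *s proj_perp n
                (\<Sum>(n1, n2) \<in> {(n1, n2). n1 \<in> S \<and> n2 \<in> S \<and> n1 + n2 = n}.
                   cdot (U t n1) (cvec n2) *s U t n2 + cdot (U t n2) (cvec n1) *s U t n1) = 0 \<and>
          cdot (cvec n) (U t n) = 0)"

definition linear_solution ::
  "real \<Rightarrow> real \<Rightarrow> real set \<Rightarrow> (real \<Rightarrow> real^3 \<Rightarrow> real^3) \<Rightarrow> bool" where
  "linear_solution \<nu> \<Omega> I u \<longleftrightarrow>
    (let U = (\<lambda>t. field_coeff (u t))
     in \<forall>t\<in>I. \<forall>n\<in>fourier_support_on I u.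
          (\<lambda>s. U s n) differentiable (at t) \<and>
          vector_derivative (\<lambda>s. U s n) (at t)
            + (\<nu> * (norm n)\<^sup>2) *\<^sub>R U t n + \<Omega> *\<^sub>R (Jmat n *v U t n) = 0)"


section \<open>Curl and Beltrami flows\<close>

definition curl :: "(real^3 \<Rightarrow> real^3) \<Rightarrow> real^3 \<Rightarrow> real^3" where
  "curl v x =
    (let D = (\<lambda>j i. frechet_derivative v (at x) (axis j 1) $ i)
     in vector [D 2 3 - D 3 2, D 3 1 - D 1 3, D 1 2 - D 2 1])"

definition beltrami :: "(real^3 \<Rightarrow> real^3) \<Rightarrow> bool" where
  "beltrami b \<longleftrightarrow> b \<in> Hfields \<and> (\<exists>\<mu>::complex. \<forall>x. cvec (curl b x) = \<mu> *s cvec (b x))"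


section \<open>The three structural alternatives\<close>

definition P3 :: "(real^3) set" where
  "P3 = {n. n \<bullet> e3 = 0}"

definition case_line :: "(real^3 \<Rightarrow> real^3) \<Rightarrow> bool" where
  "case_line v \<longleftrightarrow> (\<exists>L. subspace L \<and> dim L = 1 \<and> fourier_support v \<subseteq> L)"

definition planar_a :: "real \<Rightarrow> (real^3) set \<Rightarrow> (real^3 \<Rightarrow> real^3) \<Rightarrow> bool" where
  "planar_a \<Omega> P v \<longleftrightarrow>
     (\<Omega> = 0 \<or> P = P3) \<and> (\<forall>x. \<forall>p\<in>P. orthogonal (v x) p)"

definition planar_b :: "real \<Rightarrow> real \<Rightarrow> (real^3) set \<Rightarrow> (real^3 \<Rightarrow> real^3) \<Rightarrow> bool" where
  "planar_b \<nu> \<Omega> P v \<longleftrightarrow>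
     (\<exists>e vpar vperp lam \<omega> Q.
        norm e = 1 \<and> (\<forall>p\<in>P. orthogonal e p) \<and>
        (\<forall>x. v x = vpar x + vperp x *\<^sub>R e) \<and>
        vpar \<in> Hfields \<and> (\<forall>x. vpar x \<in> P) \<and>
        lam > 0 \<and> fourier_support vpar \<subseteq> P \<inter> sphere 0 lam \<and> card (fourier_support vpar) \<ge> 4 \<and>
        (\<forall>x. curl vpar x = (lam * \<omega> x) *\<^sub>R e) \<and>
        (\<forall>x. vperp x = poly Q (\<omega> x) - zero_mode (\<lambda>y. poly Q (\<omega> y))) \<and>
        ((\<Omega> = 0 \<or> P = P3) \<and> \<nu> = 0
         \<or> (\<Omega> = 0 \<or> P = P3) \<and> \<nu> \<noteq> 0 \<and> (\<exists>\<kappa>. Q = [:0, \<kappa>:])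
         \<or> \<Omega> \<noteq> 0 \<and> P \<noteq> P3 \<and> (Q = [:0, 1:] \<or> Q = [:0, - 1:])))"

definition case_plane :: "real \<Rightarrow> real \<Rightarrow> (real^3 \<Rightarrow> real^3) \<Rightarrow> bool" where
  "case_plane \<nu> \<Omega> v \<longleftrightarrow>
     (\<exists>n1\<in>fourier_support v. \<exists>n2\<in>fourier_support v. n1 \<noteq> n2 \<and> independent {n1, n2}) \<and>
     (\<exists>P. subspace P \<and> dim P = 2 \<and> fourier_support v \<subseteq> P \<and>
          (planar_a \<Omega> P v \<or> planar_b \<nu> \<Omega> P v))"

definition case_sphere :: "(real^3 \<Rightarrow> real^3) \<Rightarrow> bool" where
  "case_sphere v \<longleftrightarrow>
     (\<exists>n1\<in>fourier_support v. \<exists>n2\<in>fourier_support v. \<exists>n3\<in>fourier_support v.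
        distinct [n1, n2, n3] \<and> independent {n1, n2, n3}) \<and>
     (\<exists>r>0. fourier_support v \<subseteq> sphere 0 r) \<and> beltrami v"

definition flow_structure :: "real \<Rightarrow> real \<Rightarrow> (real^3 \<Rightarrow> real^3) \<Rightarrow> bool" where
  "flow_structure \<nu> \<Omega> v \<longleftrightarrow> case_line v \<or> case_plane \<nu> \<Omega> v \<or> case_sphere v"

end

theory Submission
 imports Defs
begin

text \<open>
  A solution satisfies infinitely many cancellation conditions: at frequencies outside the support the
  interactions must sum to zero. Extreme points of the support sum uniquely, so conditions at extreme
  frequencies isolate single interactions. For a spatial support, an exposed mode with non-null
  amplitude would make the angles of the spherical triangles over each facet add up to a multiple of
  \<open>\<pi>\<close>, which exceeds the available solid angle (Girard); hence some exposed mode is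
  helical, and the class of helical modes of its frequency spreads over the whole support. For a planar
  support with vanishing effective rotation, the in-plane modes lie on a circle, and the transverse part
  is a solution of a linear transport equation whose nilpotency (or, with viscosity, a maximum argument
  along the edges of the in-plane hull) forces it to be a polynomial in the vorticity. Supports may
  vary with time, but they are constant on short intervals, so the nonlinearity vanishes on a dense set
  of times, hence always.
\<close>

section \<open>Leading classes of interacting modes\<close>

text \<open>The frequencies form an arbitrary finite symmetric set, not part of a lattice, so they
  can only be ordered by linear functionals, with ties broken by a small generic tilt. Two facts on
  a single pair of modes drive the argument. Eigenvectors of curl with the same nonzero eigenvalue
  do not interact, and a mode of another direction that does not interact with such an eigenvector
  belongs to the same class. For general amplitudes, however, a vanishing interaction may also mean
  that both are perpendicular to the common plane of their frequencies. This is why an edge yields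
  only a relation between polarizations, which has to be followed around a facet. A plane on which
  the Coriolis term acts needs its own argument: at a purely transverse exposed mode this term would
  have to be balanced by in-plane interactions, which the positions of the two hulls forbid;
  afterwards its opposite signs at \<open>n\<close> and \<open>-n\<close> force the components into
  the ratio of a curl eigenvector. Conversely, the linear evolution keeps each structure free of
  interactions, which identifies "some time" with "any time".\<close>

lemma finite_argmax:
 fixes f :: "'a => real"
 assumes "finite X" "X ~= {}"
 obtains x where "x : X" "!!y. y : X ==> f y <= f x"
proof -
 have "Max (f ` X) : f ` X" using assms by (intro Max_in) auto
 then obtain x where "x : X" "f x = Max (f ` X)" by auto
 then show ?thesis using that assms by (metis Max_ge finite_imageI image_eqI)
qed

lemma finite_argmax_lex:
 fixes f k :: "'a => real"
 assumes "finite X" "X ~= {}"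
 obtains x where "x : X" "!!y. y : X ==> f y <= f x"
 "!!y. y : X ==> f y = f x ==> k y <= k x"
proof -
 obtain x0 where x0: "x0 : X" "!!y. y : X ==> f y <= f x0"
 using finite_argmax[OF assms] by blast
 let ?Y = "{y : X. f y = f x0}"
 obtain x where x: "x : ?Y" "!!y. y : ?Y ==> k y <= k x"
 using finite_argmax[of ?Y k] assms x0 by auto
 show ?thesis by (rule that[of x]) (use x x0 in auto)
qed

lemma finite_argmax_lex3:
 fixes f k c :: "'a => real"
 assumes "finite X" "X ~= {}"
 obtains x where "x : X" "!!y. y : X ==> f y <= f x"
 "!!y. y : X ==> f y = f x ==> k y <= k x"
 "!!y. y : X ==> f y = f x ==> k y = k x ==> c y <= c x"
proof -
 obtain x0 where x0: "x0 : X" "!!y. y : X ==> f y <= f x0"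
 "!!y. y : X ==> f y = f x0 ==> k y <= k x0"
 using finite_argmax_lex[OF assms] by blast
 let ?Y = "{y : X. f y = f x0 & k y = k x0}"
 obtain x where x: "x : ?Y" "!!y. y : ?Y ==> c y <= c x"
 using finite_argmax[of ?Y c] assms x0 by auto
 show ?thesis by (rule that[of x]) (use x x0 in auto)
qed

lemma eventually_perturb_less:
 fixes a b c d :: real
 assumes "a < b"
 shows "eventually (%eps. a + eps * c < b + eps * d) (at_right 0)"
proof -
 have "((%eps. (b + eps * d) - (a + eps * c)) \<longlongrightarrow> (b + 0 * d) - (a + 0 * c)) (at_right 0)"
 by (intro tendsto_intros)
 then have "eventually (%eps. 0 < (b + eps * d) - (a + eps * c)) (at_right 0)"
 by (rule order_tendstoD) (use assms in simp)
 then show ?thesis by (auto elim: eventually_mono)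
qed

text \<open>A lexicographic preference is realised by a single functional \<open>f + \<epsilon> k\<close>.\<close>

lemma finite_perturb:
 fixes f k :: "'a => real"
 assumes "finite X" "!!y. y : X ==> f y < f x | f y = f x & k y < k x"
 shows "eventually (%eps. ALL y:X. f y + eps * k y < f x + eps * k x) (at_right 0)"
proof -
 have "eventually (%eps. f y + eps * k y < f x + eps * k x) (at_right 0)" if "y : X" for y
 using assms(2)[OF that]
 proof
 assume "f y < f x" then show ?thesis by (rule eventually_perturb_less)
 next
 assume "f y = f x & k y < k x"
 then show ?thesis
 by (auto intro!: eventually_mono[OF eventually_at_right_less[of "0::real"]])
 qed
 then show ?thesis using assms(1) by (simp add: eventually_ball_finite_distrib)
qed

lemma obtain_at_right:
 assumes "eventually P (at_right (0::real))"
 obtains e where "e > 0" "P e"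
proof -
 have "eventually (%x. P x & x > 0) (at_right 0)"
 using assms eventually_at_right_less[of "0::real"] by eventually_elim auto
 then have "\<exists>x. P x & x > 0"
 using eventually_happens'[OF trivial_limit_at_right_real] by blast
 then show ?thesis using that by auto
qed

text \<open>Tilting a functional that works for the smaller set by a small multiple of the new
  vector \<open>d\<close> keeps the nonzero values nonzero and makes the value at \<open>d\<close>
  nonzero too.\<close>

lemma separating_functional:
 fixes D :: "'a::real_inner set"
 assumes "finite D" "0 ~: D"
 shows "\<exists>c. ALL d:D. c \<bullet> d ~= 0"
 using assms
proof (induction D rule: finite_induct)
 case (insert d D)
 then obtain c where c: "ALL x:D. c \<bullet> x ~= 0" by auto
 have *: "eventually (%eps. c \<bullet> x + eps * (d \<bullet> x) ~= 0) (at_right 0)"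
 if x: "c \<bullet> x ~= 0 | x = d" for x
 proof (cases "c \<bullet> x = 0")
 case True
 then have "x = d" using x by auto
 then have "d \<bullet> x ~= 0" using insert by auto
 then show ?thesis using True
 by (auto intro!: eventually_mono[OF eventually_at_right_less[of "0::real"]])
 next
 case False
 then consider "c \<bullet> x < 0" | "0 < c \<bullet> x" by linarith
 then show ?thesis
 proof cases
 case 1 then show ?thesis using eventually_perturb_less[OF 1, of "d \<bullet> x" 0]
 by (auto elim: eventually_mono)
 next
 case 2 then show ?thesis using eventually_perturb_less[OF 2, of 0 "d \<bullet> x"]
 by (auto elim: eventually_mono)
 qed
 qed
 have "eventually (%eps. ALL x:insert d D. c \<bullet> x + eps * (d \<bullet> x) ~= 0) (at_right 0)"
 proof (rule eventually_ball_finite)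
 show "ALL x:insert d D. eventually (%eps. c \<bullet> x + eps * (d \<bullet> x) ~= 0) (at_right 0)"
 using c * by blast
 qed (use insert.hyps in simp)
 then obtain eps where "ALL x:insert d D. c \<bullet> x + eps * (d \<bullet> x) ~= 0"
 by (rule obtain_at_right)
 then have "ALL x:insert d D. (c + eps *\<^sub>R d) \<bullet> x ~= 0" by (simp add: inner_add_left)
 then show ?case by blast
qed auto

lemma injective_functional:
 fixes S :: "'a::real_inner set"
 assumes "finite S"
 obtains c where "inj_on (%x. c \<bullet> x) S"
proof -
 let ?D = "(%(x, y). x - y) ` (S \<times> S) - {0}"
 obtain c where "ALL d:?D. c \<bullet> d ~= 0"
 using separating_functional[of ?D] assms by auto
 then have "inj_on (%x. c \<bullet> x) S"
 unfolding inj_on_def by (force simp: inner_diff_right)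
 then show ?thesis by (rule that)
qed

text \<open>The interaction \<open>w\<close> of two modes is required to cancel at every frequency outside \<open>S\<close>.
  If two modes are the only interacting pair with a given sum, their interaction vanishes.\<close>

definition steady_outside :: "'a::real_inner set => ('a => 'a => 'b::real_vector) => bool" where
 "steady_outside S w \<longleftrightarrow> (\<forall>m k. w m k = w k m) &
  (\<forall>n. n ~: S --> n ~= 0 --> (\<Sum>m\<in>{m\<in>S. n - m : S}. w m (n - m)) = 0)"

lemma steady_outside_unique:
 assumes "finite S" "steady_outside S w" "a : S" "p : S" "a ~= p" "a + p ~: S" "a + p ~= 0"
 and "!!m k. m : S ==> k : S ==> m + k = a + p ==> m ~= a ==> m ~= p ==> w m k = 0"
 shows "w a p = 0"
proof -
 let ?M = "{m\<in>S. a + p - m : S}"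
 have "0 = (\<Sum>m\<in>?M. w m (a + p - m))"
 using assms(2,6,7) by (auto simp: steady_outside_def)
 also have "\<dots> = (\<Sum>m\<in>{a, p}. w m (a + p - m))"
 proof (rule sum.mono_neutral_right)
 show "finite ?M" using assms(1) by auto
 show "{a, p} \<subseteq> ?M" using assms by auto
 show "ALL m:?M - {a, p}. w m (a + p - m) = 0"
 using assms(8) by auto
 qed
 \<comment> \<open>The sum runs over ordered pairs, so the pair occurs twice.\<close>
 also have "\<dots> = w a p + w p a" using assms(5) by simp
 also have "\<dots> = 2 *\<^sub>R w a p" using assms(2) by (simp add: steady_outside_def scaleR_2)
 finally show ?thesis by simp
qed

lemma closed_dominated:
 assumes "finite A" "finite R"
 shows "closed {t::real. EX p:R. ALL a:A. ((1 - t) *\<^sub>R l0 + t *\<^sub>R l1) \<bullet> a <= ((1 - t) *\<^sub>R l0 + t *\<^sub>R l1) \<bullet> p}"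
proof -
 have "{t::real. EX p:R. ALL a:A. ((1 - t) *\<^sub>R l0 + t *\<^sub>R l1) \<bullet> a <= ((1 - t) *\<^sub>R l0 + t *\<^sub>R l1) \<bullet> p}
 = (\<Union>p\<in>R. \<Inter>a\<in>A. {t. ((1 - t) *\<^sub>R l0 + t *\<^sub>R l1) \<bullet> a <= ((1 - t) *\<^sub>R l0 + t *\<^sub>R l1) \<bullet> p})"
 by auto
 also have "closed \<dots>"
 by (intro closed_UN assms(2) closed_INT ballI closed_Collect_le continuous_intros)
 finally show ?thesis .
qed

text \<open>At the first functional on the segment for which \<open>S - A\<close> catches up with \<open>A\<close>, the last leading
  element of \<open>A\<close> and the first element of \<open>S - A\<close> to catch up are the only interacting pair with
  their sum.\<close>

lemma leading_class_propagates:
 fixes S A :: "'a::real_inner set"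
 assumes fin: "finite S" and AS: "A \<subseteq> S" and st: "steady_outside S w"
 and AA: "!!a b. a : A ==> b : A ==> w a b = 0"
 and AR: "!!a p. a : A ==> p : S - A ==> (!!c. p ~= c *\<^sub>R a) ==> w a p ~= 0"
 and l0: "EX a:A. ALL p:S - A. l0 \<bullet> p < l0 \<bullet> a"
 and nz: "!!t. 0 <= t ==> t <= 1 ==> EX n:S. ((1 - t) *\<^sub>R l0 + t *\<^sub>R l1) \<bullet> n > 0"
 shows "EX a:A. ALL p:S - A. l1 \<bullet> p < l1 \<bullet> a"
proof (rule ccontr)
 assume neg: "~ ?thesis"
 let ?R = "S - A"
 have finA: "finite A" using fin AS finite_subset by auto
 have finR: "finite ?R" using fin by auto
 define f where "f t = (1 - t) *\<^sub>R l0 + t *\<^sub>R l1" for t :: real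
 define Q where "Q t \<longleftrightarrow> (EX p:?R. ALL a:A. f t \<bullet> a <= f t \<bullet> p)" for t
 have A0: "A ~= {}" using l0 by auto
 have Q1: "Q 1"
 proof -
 obtain a where a: "a : A" "!!y. y : A ==> l1 \<bullet> y <= l1 \<bullet> a"
 using finite_argmax[OF finA A0, of "%x. l1 \<bullet> x"] by blast
 then obtain p where p: "p : ?R" "~ l1 \<bullet> p < l1 \<bullet> a" using neg by blast
 then have "ALL y:A. l1 \<bullet> y <= l1 \<bullet> p" using a by force
 then show ?thesis using p unfolding Q_def f_def by auto
 qed
 have Q0: "~ Q 0"
 proof
 assume "Q 0"
 then obtain p where "p : ?R" "ALL a:A. l0 \<bullet> a <= l0 \<bullet> p" by (auto simp: Q_def f_def)
 with l0 show False by (meson not_le)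
 qed
 let ?T = "{0..1} \<inter> {t. Q t}"
 \<comment> \<open>\<open>?T\<close> holds the parameters at which some element outside
   \<open>A\<close> dominates all of \<open>A\<close>. It is closed and contains 1, so there is a
   first one, \<open>s\<close>, and \<open>s > 0\<close> because \<open>A\<close> leads at
   \<open>l0\<close>.\<close>
 have "compact ?T"
 unfolding Q_def f_def by (intro compact_Int_closed closed_dominated finA finR) auto
 then obtain s where s: "s : ?T" "!!t. t : ?T ==> s <= t"
 using compact_attains_inf[of ?T] Q1 by (metis (no_types, lifting) IntI atLeastAtMost_iff empty_iff
 mem_Collect_eq order_refl zero_le_one)
 have s01: "0 < s" "s <= 1" "Q s" using s(1) Q0 by (auto simp: less_le)
 have notQ: "~ Q t" if "0 <= t" "t < s" for t using s(2)[of t] that s01 by force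
 \<comment> \<open>Just before \<open>s\<close> the functional is \<open>f s\<close> plus a small
   multiple of \<open>k\<close>, so \<open>k\<close> orders the ties of \<open>f s\<close> as they
   were before; \<open>c\<close> breaks the remaining ties and makes maximizers unique.\<close>
 define k where "k = l0 - l1"
 have f_shift: "f (s - eps) \<bullet> x = f s \<bullet> x + eps * (k \<bullet> x)" for eps x
 by (simp add: f_def k_def inner_add_left inner_diff_left algebra_simps)
 obtain c where c: "inj_on (%x. c \<bullet> x) S" using injective_functional[OF fin] by blast
 have R0: "?R ~= {}" using s01(3) Q_def by auto
 obtain p where p: "p : ?R" "!!y. y : ?R ==> f s \<bullet> y <= f s \<bullet> p"
  "!!y. y : ?R ==> f s \<bullet> y = f s \<bullet> p ==> k \<bullet> y <= k \<bullet> p"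
  "!!y. y : ?R ==> f s \<bullet> y = f s \<bullet> p ==> k \<bullet> y = k \<bullet> p ==> c \<bullet> y <= c \<bullet> p"
 using finite_argmax_lex3[OF finR R0, of "%x. f s \<bullet> x" "%x. k \<bullet> x" "%x. c \<bullet> x"] by blast
 have pA: "f s \<bullet> a <= f s \<bullet> p" if "a : A" for a
 using s01(3) p(2) that unfolding Q_def by force
 have pS: "f s \<bullet> a <= f s \<bullet> p" if "a : S" for a using pA p(2) that by blast
 \<comment> \<open>Otherwise \<open>p\<close> would dominate all of \<open>A\<close> already
   slightly before \<open>s\<close>, against the choice of \<open>s\<close>.\<close>
 have ex: "EX a:A. f s \<bullet> a = f s \<bullet> p & k \<bullet> p < k \<bullet> a"
 proof (rule ccontr)
 assume no: "~ ?thesis"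
 have "eventually (%eps. f s \<bullet> a + eps * (k \<bullet> a) <= f s \<bullet> p + eps * (k \<bullet> p)) (at_right 0)"
 if a: "a : A" for a
 proof (cases "f s \<bullet> a = f s \<bullet> p")
 case True
 then have "k \<bullet> a <= k \<bullet> p" using no a by force
 then show ?thesis using True
 by (auto intro!: eventually_mono[OF eventually_at_right_less[of "0::real"]] mult_left_mono)
 next
 case False
 then have "f s \<bullet> a < f s \<bullet> p" using pA[OF a] by simp
 then show ?thesis
 using eventually_perturb_less[of "f s \<bullet> a" "f s \<bullet> p" "k \<bullet> a" "k \<bullet> p"]
 by (auto elim: eventually_mono)
 qed
 then have "eventually (%eps. ALL a:A. f s \<bullet> a + eps * (k \<bullet> a) <= f s \<bullet> p + eps * (k \<bullet> p)) (at_right 0)"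
 using finA by (simp add: eventually_ball_finite_distrib)
 moreover have "eventually (%eps. eps < s) (at_right 0)"
 using s01 by (auto intro!: eventually_mono[OF eventually_at_right_real[of 0 s]])
 ultimately have "eventually (%eps. (ALL a:A. f s \<bullet> a + eps * (k \<bullet> a) <= f s \<bullet> p + eps * (k \<bullet> p)) & eps < s) (at_right 0)"
 by (rule eventually_conj)
 then obtain eps where e: "eps > 0" "ALL a:A. f (s - eps) \<bullet> a <= f (s - eps) \<bullet> p" "eps < s"
 unfolding f_shift[symmetric] by (rule obtain_at_right) auto
 then have "Q (s - eps)" using p(1) unfolding Q_def by auto
 with notQ[of "s - eps"] e show False by auto
 qed
 let ?A = "{a\<in>A. f s \<bullet> a = f s \<bullet> p}"
 have fA: "finite ?A" and nA: "?A ~= {}" using finA ex by auto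
 obtain a where a: "a : ?A" "!!y. y : ?A ==> k \<bullet> y <= k \<bullet> a"
  "!!y. y : ?A ==> k \<bullet> y = k \<bullet> a ==> c \<bullet> y <= c \<bullet> a"
 using finite_argmax_lex[OF fA nA, of "%x. k \<bullet> x" "%x. c \<bullet> x"] by blast
 have ka: "k \<bullet> p < k \<bullet> a" using ex a(2) by force
 obtain n0 where "n0 : S" "f s \<bullet> n0 > 0" using nz[of s] s01 unfolding f_def by auto
 \<comment> \<open>The top value over \<open>S\<close> is positive, so \<open>a + p\<close>, at
   twice that value, is neither in \<open>S\<close> nor zero.\<close>
 then have h: "f s \<bullet> p > 0" using pS[of n0] by linarith
 have "w a p = 0"
 proof (rule steady_outside_unique[OF fin st])
 show "a : S" "p : S" "a ~= p" using a p AS by auto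
 have lev: "f s \<bullet> (a + p) = 2 * (f s \<bullet> p)" using a(1) by (simp add: inner_add_right)
 show "a + p ~: S" using lev pS[of "a + p"] h by auto
 show "a + p ~= 0" using lev h by auto
 \<comment> \<open>The values under \<open>f s\<close>, \<open>k\<close> and \<open>c\<close> are
   additive, and \<open>a\<close> and \<open>p\<close> are lexicographically maximal in their sets.
   A pair with the same sum must match them in each value in turn, which gives
   \<open>m = p\<close>.\<close>
 have key: False if mm: "m : ?R" "m' : S" "m + m' = a + p" "m ~= p" for m m'
 proof -
 have "f s \<bullet> m + f s \<bullet> m' = 2 * (f s \<bullet> p)" using lev mm(3) by (metis inner_add_right)
 then have top: "f s \<bullet> m = f s \<bullet> p" "f s \<bullet> m' = f s \<bullet> p"
 using pS[of m] pS[of m'] mm by auto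
 have k1: "k \<bullet> m <= k \<bullet> p" using p(3)[OF mm(1) top(1)] .
 have ks: "k \<bullet> m + k \<bullet> m' = k \<bullet> a + k \<bullet> p" using mm(3) by (metis inner_add_right)
 have m'A: "m' : A"
 proof (rule ccontr)
 assume "m' ~: A"
 then have "k \<bullet> m' <= k \<bullet> p" using p(3)[of m'] mm top by auto
 then show False using ks k1 ka by linarith
 qed
 then have k2: "k \<bullet> m' <= k \<bullet> a" using a(2)[of m'] top by auto
 have keq: "k \<bullet> m = k \<bullet> p" "k \<bullet> m' = k \<bullet> a" using ks k1 k2 by auto
 have "c \<bullet> m <= c \<bullet> p" using p(4)[OF mm(1) top(1) keq(1)] .
 moreover have "c \<bullet> m' <= c \<bullet> a" using a(3)[of m'] m'A top keq by auto
 moreover have "c \<bullet> m + c \<bullet> m' = c \<bullet> a + c \<bullet> p" using mm(3) by (metis inner_add_right)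
 ultimately have "c \<bullet> m = c \<bullet> p" by auto
 then have "m = p" using c mm(1) p(1) by (auto dest: inj_onD)
 with mm show False by simp
 qed
 fix m m' assume mm: "m : S" "m' : S" "m + m' = a + p" "m ~= a" "m ~= p"
 have "m : A" using key[of m m'] mm by auto
 moreover have "m' : A" using key[of m' m] mm by (cases "m' = p") (auto simp: add.commute)
 ultimately show "w m m' = 0" by (rule AA)
 qed
 moreover have "w a p ~= 0"
 proof (rule AR)
 show "a : A" "p : ?R" using a p by auto
 fix d show "p ~= d *\<^sub>R a"
 proof
 assume pd: "p = d *\<^sub>R a"
 have fa: "f s \<bullet> a = f s \<bullet> p" using a(1) by simp
 then have "f s \<bullet> p = d * (f s \<bullet> p)" using pd by (metis inner_scaleR_right)
 then have "d = 1" using h by simp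
 then show False using pd a(1) p(1) by auto
 qed
 qed
 ultimately show False by simp
qed

text \<open>\<open>A\<close> leads in every direction that does not vanish on \<open>S\<close>, so
  the rest of \<open>S\<close> stays strictly below each edge of \<open>A\<close>. Let
  \<open>T\<close> be the topmost row of the rest under an edge with ends \<open>v\<close> and
  \<open>w'\<close>. The only competitor of an end \<open>x\<close> and a point \<open>p\<close> of
  the row is the other end with a translate of \<open>p\<close>, so \<open>T\<close> must contain
  that translate unless \<open>p\<close> is proportional to \<open>x\<close>. No finite row
  satisfies this.\<close>

lemma leading_class_is_all:
 fixes S A :: "'a::real_inner set"
 assumes fin: "finite S" and zero: "0 ~: S" and AS: "A \<subseteq> S" and st: "steady_outside S w"
 and symS: "!!n. n : S ==> - n : S" and symA: "!!n. n : A ==> - n : A"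
 and sph: "!!a. a : A ==> norm a = r" and r: "r > 0"
 and AA: "!!a b. a : A ==> b : A ==> w a b = 0"
 and AR: "!!a p. a : A ==> p : S - A ==> (!!c. p ~= c *\<^sub>R a) ==> w a p ~= 0"
 and l0: "EX a:A. ALL p:S - A. l0 \<bullet> p < l0 \<bullet> a"
 and span: "!!x. EX n:S. \<forall>c. n ~= c *\<^sub>R x"
 shows "A = S"
proof (rule ccontr)
 assume "A ~= S"
 let ?R = "S - A"
 have R0: "?R ~= {}" using AS \<open>A ~= S\<close> by auto
 have finA: "finite A" using fin AS finite_subset by auto
 have finR: "finite ?R" using fin by auto
 have pos: "EX n:S. l \<bullet> n > 0" if "EX n:S. l \<bullet> n ~= 0" for l
 using that symS by (metis inner_minus_right neg_0_less_iff_less not_less_iff_gr_or_eq)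
 obtain a0 where a0: "a0 : A" "!!p. p : ?R ==> l0 \<bullet> p < l0 \<bullet> a0" using l0 by blast
 have a00: "a0 ~= 0" using sph[OF a0(1)] r by auto
 have l0a: "l0 \<bullet> a0 > 0"
 proof -
 obtain p where p: "p : ?R" using R0 by auto
 then have mp: "- p : ?R" using symS[of p] symA[of "- p"] by auto
 show ?thesis using a0(2)[OF p] a0(2)[OF mp] by auto
 qed
 have all: "EX a:A. ALL p:?R. l \<bullet> p < l \<bullet> a" if l: "EX n:S. l \<bullet> n ~= 0" for l
 proof -
 text \<open>A functional vanishing at \<open>a0\<close>, reached from \<open>l0\<close> without passing through \<open>0\<close>.\<close>
    obtain y where y: "y \<in> S" "\<And>c. y \<noteq> c *\<^sub>R a0" using span by blast
    define q where "q = y - ((y \<bullet> a0) / (a0 \<bullet> a0)) *\<^sub>R a0"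
    have qa: "q \<bullet> a0 = 0" using a00 by (simp add: q_def inner_diff_left)
    have q0: "q \<noteq> 0" using y(2)[of "(y \<bullet> a0) / (a0 \<bullet> a0)"] by (auto simp: q_def)
    have "q \<bullet> y = q \<bullet> q" using qa by (simp add: q_def inner_diff_right inner_diff_left)
    then have qy: "q \<bullet> y > 0" using q0 by simp
    have step1: "\<exists>a\<in>A. \<forall>p\<in>?R. q \<bullet> p < q \<bullet> a"
    proof (rule leading_class_propagates[OF fin AS st AA AR l0])
      fix t :: real assume t: "0 \<le> t" "t \<le> 1"
      show "\<exists>n\<in>S. ((1 - t) *\<^sub>R l0 + t *\<^sub>R q) \<bullet> n > 0"
      proof (cases "t = 1")
        case True
        then show ?thesis using pos[of q] qy y(1) by auto
      next
        case False
        then have "((1 - t) *\<^sub>R l0 + t *\<^sub>R q) \<bullet> a0 > 0"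
          using l0a t qa by (simp add: inner_add_left)
        then show ?thesis using a0 AS by auto
      qed
    qed auto
    show ?thesis
    proof (cases "l \<bullet> a0 = 0")
      case False
      show ?thesis
      proof (rule leading_class_propagates[OF fin AS st AA AR step1])
        fix t :: real assume t: "0 \<le> t" "t \<le> 1"
        show "\<exists>n\<in>S. ((1 - t) *\<^sub>R q + t *\<^sub>R l) \<bullet> n > 0"
        proof (rule pos, cases "t = 0")
          case True then show "\<exists>n\<in>S. ((1 - t) *\<^sub>R q + t *\<^sub>R l) \<bullet> n \<noteq> 0"
            using qy by (intro bexI[OF _ y(1)]) simp
        next
          case tn: False
          then have "((1 - t) *\<^sub>R q + t *\<^sub>R l) \<bullet> a0 \<noteq> 0"
            using qa False by (simp add: inner_add_left)
          then show "\<exists>n\<in>S. ((1 - t) *\<^sub>R q + t *\<^sub>R l) \<bullet> n \<noteq> 0" using a0 AS by auto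
        qed
      qed auto
    next
      case True
      show ?thesis
      proof (rule leading_class_propagates[OF fin AS st AA AR l0])
        fix t :: real assume t: "0 \<le> t" "t \<le> 1"
        show "\<exists>n\<in>S. ((1 - t) *\<^sub>R l0 + t *\<^sub>R l) \<bullet> n > 0"
        proof (cases "t = 1")
          case True
          then show ?thesis using pos[OF l] by auto
        next
          case False
          then have "((1 - t) *\<^sub>R l0 + t *\<^sub>R l) \<bullet> a0 > 0"
            using l0a t True by (simp add: inner_add_left)
          then show ?thesis using a0 AS by auto
        qed
      qed auto
    qed
  qed
  \<comment> \<open>If \<open>A\<close> were \<open>{a0, - a0}\<close>, it would have value zero in
    the direction \<open>q\<close> orthogonal to \<open>a0\<close>, while \<open>y\<close>, then
    outside \<open>A\<close>, has a positive value there, although \<open>A\<close> leads.\<close>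
  have exb: "\<exists>b\<in>A. b \<noteq> a0 \<and> b \<noteq> - a0"
  proof (rule ccontr)
    assume no: "\<not> ?thesis"
    obtain y where y: "y \<in> S" "\<And>c. y \<noteq> c *\<^sub>R a0" using span by blast
    define q where "q = y - ((y \<bullet> a0) / (a0 \<bullet> a0)) *\<^sub>R a0"
    have qa: "q \<bullet> a0 = 0" using a00 by (simp add: q_def inner_diff_left)
    have q0: "q \<noteq> 0" using y(2)[of "(y \<bullet> a0) / (a0 \<bullet> a0)"] by (auto simp: q_def)
    have "q \<bullet> y = q \<bullet> q" using qa by (simp add: q_def inner_diff_right inner_diff_left)
    then have qy: "q \<bullet> y > 0" using q0 by simp
    then obtain a where a: "a \<in> A" "\<forall>p\<in>?R. q \<bullet> p < q \<bullet> a" using all[of q] y by fastforce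
    then have "q \<bullet> a = 0" using no qa by (metis inner_minus_right neg_0_equal_iff_equal)
    moreover have "y \<in> ?R" using no y(1) y(2)[of 1] y(2)[of "-1"] by auto
    ultimately show False using a qy by force
  qed
  text \<open>A closest pair in \<open>A\<close> spans an edge.\<close>
  let ?C = "{(x, y). x \<in> A \<and> y \<in> A \<and> x \<noteq> y}"
  have finC: "finite ?C" by (rule finite_subset[of _ "A \<times> A"]) (use finA in auto)
  have C0: "?C \<noteq> {}" using exb a0 by auto
  obtain vw where vw: "vw \<in> ?C" "\<And>z. z \<in> ?C \<Longrightarrow> fst z \<bullet> snd z \<le> fst vw \<bullet> snd vw"
    using finite_argmax[OF finC C0, of "\<lambda>z. fst z \<bullet> snd z"] by blast
  obtain v w' where vw': "vw = (v, w')" by (cases vw)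
  have v: "v \<in> A" "w' \<in> A" "v \<noteq> w'" using vw vw' by auto
  have mx: "x \<bullet> y \<le> v \<bullet> w'" if "x \<in> A" "y \<in> A" "x \<noteq> y" for x y
    using vw(2)[of "(x, y)"] that vw' by auto
  have nn: "x \<bullet> x = r\<^sup>2" if "x \<in> A" for x using sph[OF that] by (simp add: dot_square_norm)
  have lt: "x \<bullet> y < r\<^sup>2" if "x \<in> A" "y \<in> A" "x \<noteq> y" for x y
  proof -
    have "0 < (x - y) \<bullet> (x - y)" using that by simp
    also have "\<dots> = 2 * r\<^sup>2 - 2 * (x \<bullet> y)"
      using nn[OF that(1)] nn[OF that(2)] by (simp add: inner_diff inner_commute)
    finally show ?thesis by simp
  qed
  define g where "g = v + w'"
  define h where "h = r\<^sup>2 + v \<bullet> w'"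
  have gv: "g \<bullet> v = h" "g \<bullet> w' = h" using nn v by (simp_all add: g_def h_def inner_add_left inner_commute[of w' v])
  have gA: "g \<bullet> z < h" if "z \<in> A" "z \<noteq> v" "z \<noteq> w'" for z
    using mx[of v z] mx[of w' z] lt[OF v] that v by (simp add: g_def h_def inner_add_left)
  have gA': "g \<bullet> z \<le> h" if "z \<in> A" for z using gA[OF that] gv by force
  \<comment> \<open>Both \<open>a0\<close> and \<open>- a0\<close> are distinct from
    \<open>b\<close>, so the maximal inner product is at least the absolute value of
    \<open>a0 \<bullet> b\<close>.\<close>
  have h0: "h > 0"
  proof -
    obtain b where b: "b \<in> A" "b \<noteq> a0" "b \<noteq> - a0" using exb by auto
    have "- (a0 \<bullet> b) \<le> v \<bullet> w'" "a0 \<bullet> b \<le> v \<bullet> w'"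
      using mx[of "- a0" b] mx[of a0 b] b a0 symA by auto
    then have "v \<bullet> w' \<ge> 0" by linarith
    then show ?thesis using r by (simp add: h_def add_pos_nonneg)
  qed
  have "\<exists>n\<in>S. g \<bullet> n \<noteq> 0" using gv(1) h0 v(1) AS by (intro bexI[of _ v]) auto
  then obtain a1 where a1: "a1 \<in> A" "\<forall>p\<in>?R. g \<bullet> p < g \<bullet> a1" using all by blast
  have gR: "g \<bullet> p < h" if "p \<in> ?R" for p using a1 gA'[OF a1(1)] that by (meson less_le_trans)
  have gS: "n = v \<or> n = w'" if "n \<in> S" "g \<bullet> n \<ge> h" for n using gA gR that by force
  obtain p0 where p0: "p0 \<in> ?R" "\<And>y. y \<in> ?R \<Longrightarrow> g \<bullet> y \<le> g \<bullet> p0"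
    using finite_argmax[OF finR R0, of "\<lambda>x. g \<bullet> x"] by blast
  define H where "H = g \<bullet> p0"
  have Hh: "H < h" using gR p0 by (auto simp: H_def)
  have symR: "- p \<in> ?R" if "p \<in> ?R" for p using symS[of p] symA[of "- p"] that by auto
  have H0: "H \<ge> 0" using p0(2)[OF p0(1)] p0(2)[OF symR[OF p0(1)]] by (simp add: H_def)
  define T where "T = {p \<in> ?R. g \<bullet> p = H}"
  have T: "finite T" "T \<noteq> {}" unfolding T_def H_def using finR p0 fin by (auto intro: finite_subset)
  define d where "d = w' - v"
  have gd: "g \<bullet> d = 0" using gv by (simp add: d_def inner_diff_right)
  have dd: "d \<bullet> d > 0" using v by (simp add: d_def)
  \<comment> \<open>Competing pairs for \<open>x + p\<close>, at level \<open>h + H\<close>: two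
    elements outside \<open>A\<close> are too low, two elements of \<open>A\<close> do not interact,
    and a mixed pair must sit at the levels \<open>h\<close> and \<open>H\<close> exactly, where
    only \<open>v\<close> and \<open>w'\<close> reach \<open>h\<close>.\<close>
  have chain: "p + (x - y) \<in> T"
    if p: "p \<in> T" "\<And>c. p \<noteq> c *\<^sub>R x" "x + p \<notin> S" and xy: "{x, y} = {v, w'}" for p x y
  proof (rule ccontr)
    assume no: "p + (x - y) \<notin> T"
    have xA: "x \<in> A" "y \<in> A" "x \<noteq> y" "g \<bullet> x = h" "g \<bullet> y = h" using xy v gv by (auto simp: doubleton_eq_iff)
    have pR: "p \<in> ?R" "g \<bullet> p = H" using p by (auto simp: T_def)
    have "w x p = 0"
    proof (rule steady_outside_unique[OF fin st])
      show "x \<in> S" "p \<in> S" "x \<noteq> p" "x + p \<notin> S" using xA pR AS p(3) by auto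
      have "g \<bullet> (x + p) = h + H" using xA pR by (simp add: inner_add_right)
      then show "x + p \<noteq> 0" using h0 H0 by auto
      have key: "p + (x - y) \<in> T \<or> m' = p \<or> False"
        if mm: "m \<in> A" "m' \<in> ?R" "m + m' = x + p" for m m'
      proof -
        have "g \<bullet> m + g \<bullet> m' = h + H" using mm(3) xA pR by (metis inner_add_right)
        moreover have "g \<bullet> m \<le> h" "g \<bullet> m' \<le> H" using gA' mm p0 by (auto simp: H_def)
        ultimately have e: "g \<bullet> m = h" "g \<bullet> m' = H" by auto
        then have "m = v \<or> m = w'" using gS[of m] mm AS by auto
        then have "m = x \<or> m = y" using xy by auto
        then show ?thesis
        proof
          assume "m = x" then show ?thesis using mm by auto
        next
          assume "m = y"
          then have "m' = p + (x - y)" using mm by (simp add: algebra_simps)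
          then show ?thesis using e mm by (auto simp: T_def)
        qed
      qed
      fix m m' assume mm: "m \<in> S" "m' \<in> S" "m + m' = x + p" "m \<noteq> x" "m \<noteq> p"
      consider "m \<in> A" "m' \<in> A" | "m \<in> A" "m' \<in> ?R" | "m' \<in> A" "m \<in> ?R" | "m \<in> ?R" "m' \<in> ?R"
        using mm by auto
      then show "w m m' = 0"
      proof cases
        case 1 then show ?thesis by (rule AA)
      next
        case 2 then show ?thesis using key[of m m'] mm no by auto
      next
        case 3 then show ?thesis using key[of m' m] mm no by (auto simp: add.commute)
      next
        case 4
        have "g \<bullet> m + g \<bullet> m' = h + H" using mm(3) xA pR by (metis inner_add_right)
        moreover have "g \<bullet> m \<le> H" "g \<bullet> m' \<le> H" using 4 p0 by (auto simp: H_def)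
        ultimately show ?thesis using Hh by auto
      qed
    qed
    moreover have "w x p \<noteq> 0" using AR[of x p] xA pR p(2) by auto
    ultimately show False by simp
  qed
  obtain p where p: "p \<in> T" "\<And>y. y \<in> T \<Longrightarrow> d \<bullet> y \<le> d \<bullet> p"
    using finite_argmax[OF T, of "\<lambda>x. d \<bullet> x"] by blast
  have up: "p + d \<notin> T" using p(2)[of "p + d"] dd by (auto simp: inner_add_right)
  show False
  proof (cases "H = 0")
    case True
    \<comment> \<open>At level zero the row is symmetric and contains no multiple of
      \<open>w'\<close>, so translation by \<open>d\<close> cannot stop at \<open>p\<close>.\<close>
    have "- p \<in> T" using p(1) symR True by (auto simp: T_def)
    then have dp: "d \<bullet> p \<ge> 0" using p(2)[of "- p"] by auto
    have gp: "g \<bullet> p = 0" using p True by (auto simp: T_def)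
    have p0': "p \<noteq> 0" using p(1) zero by (auto simp: T_def)
    have "p + (w' - v) \<in> T"
    proof (rule chain[OF p(1)])
      show "{w', v} = {v, w'}" by auto
      show "p \<noteq> c *\<^sub>R w'" for c using gp gv h0 p0' by auto
      show "w' + p \<notin> S"
      proof
        assume "w' + p \<in> S"
        then have "w' + p = v \<or> w' + p = w'" using gS[of "w' + p"] gp gv by (simp add: inner_add_right)
        then have "w' + p = v" using p0' by auto
        then have "p = - d" by (simp add: d_def algebra_simps add_eq_0_iff)
        then show False using dp dd by simp
      qed
    qed
    then show False using up by (simp add: d_def)
  next
    case False
    then have Hp: "H > 0" using H0 by simp
    have out: "x + q \<notin> S" if "q \<in> T" "g \<bullet> x = h" for x q
    proof
      assume "x + q \<in> S"
      have "g \<bullet> (x + q) = h + H" using that by (simp add: inner_add_right T_def)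
      then have "g \<bullet> (x + q) > h" using Hp by simp
      then show False using gS[OF \<open>x + q \<in> S\<close>] gv by auto
    qed
    \<comment> \<open>The two ends of the row are multiples of \<open>w'\<close> and
      \<open>v\<close> with the same ratio \<open>s = H / h < 1\<close>. The row is thus shorter
      than the edge and has no room for a step of length \<open>d\<close>.\<close>
    have "\<exists>c. p = c *\<^sub>R w'"
      using chain[of p w' v] p(1) out[of p w'] gv up by (auto simp: d_def)
    then obtain s where s: "p = s *\<^sub>R w'" by auto
    have sH: "s * h = H" using p(1) s gv by (simp add: T_def)
    obtain q where q: "q \<in> T" "\<And>y. y \<in> T \<Longrightarrow> (- d) \<bullet> y \<le> (- d) \<bullet> q"
      using finite_argmax[OF T, of "\<lambda>x. (- d) \<bullet> x"] by blast
    have down: "q - d \<notin> T" using q(2)[of "q - d"] dd by (auto simp: inner_diff_right)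
    have "\<exists>c. q = c *\<^sub>R v"
      using chain[of q v w'] q(1) out[of q v] gv down by (auto simp: d_def algebra_simps)
    then obtain s' where s': "q = s' *\<^sub>R v" by auto
    have "s' * h = H" using q(1) s' gv by (simp add: T_def)
    then have ss: "s' = s" using sH h0 by (metis less_irrefl mult_cancel_right)
    have "s = H / h" using sH h0 by (simp add: field_simps)
    then have s1: "s < 1" "s > 0" using Hh Hp h0 by simp_all
    have npar: "p \<noteq> c *\<^sub>R v" for c
    proof
      assume pc: "p = c *\<^sub>R v"
      then have "c * h = H" using p(1) gv by (simp add: T_def)
      then have "c = s" using sH h0 by (metis less_irrefl mult_cancel_right)
      then show False using pc s s1 v by simp
    qed
    have "p + (v - w') \<in> T"
      by (rule chain[OF p(1) npar]) (use out p(1) gv in auto)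
    then have "p - d \<in> T" by (simp add: d_def algebra_simps)
    then have "d \<bullet> q \<le> d \<bullet> (p - d)" using q(2) by fastforce
    then have "s * (d \<bullet> v) \<le> s * (d \<bullet> w') - d \<bullet> d" using s s' ss by (simp add: inner_diff_right)
    moreover have "d \<bullet> d = d \<bullet> w' - d \<bullet> v" by (simp add: d_def inner_diff_right inner_diff_left)
    ultimately have "d \<bullet> d \<le> s * (d \<bullet> d)" by (simp only:) (simp add: algebra_simps)
    then show False using s1 dd by (simp add: mult_le_cancel_right1)
  qed
qed

section \<open>Interaction of two modes\<close>

lemmas vec3_simps = vec_eq_iff forall_3 ccross_def scalar_product_def sum_3 cvec_def

lemma cvec_simps [simp]: "cvec 0 = 0" "cvec (- x) = - cvec x"
 "cvec (x + y) = cvec x + cvec y" "cvec (x - y) = cvec x - cvec y"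
 "cvec (r *\<^sub>R x) = complex_of_real r *s cvec x"
 by (simp_all add: cvec_def vec_eq_iff)

lemma cvec_eq_0_iff [simp]: "cvec x = 0 \<longleftrightarrow> x = 0"
 by (simp add: cvec_def vec_eq_iff)

lemma cdot_cvec_cvec: "cdot (cvec x) (cvec y) = of_real (x \<bullet> y)"
 by (simp add: vec3_simps inner_vec_def)

lemma ccross_cvec: "ccross (cvec x) (cvec y) = cvec (cross3 x y)"
 by (simp add: vec3_simps cross3_simps)

lemma cdot_commute: "cdot a b = cdot b a"
 by (simp add: vec3_simps mult.commute)

lemma cdot_add: "cdot a (b + c) = cdot a b + cdot a c" "cdot (b + c) a = cdot b a + cdot c a"
 and cdot_diff: "cdot (b - c) a = cdot b a - cdot c a"
 and cdot_minus: "cdot (- b) a = - cdot b a" "cdot a (- b) = - cdot a b"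
 and cdot_zero [simp]: "cdot 0 a = 0" "cdot a 0 = 0"
 by (simp_all add: vec3_simps algebra_simps)

lemma cdot_scaleR: "cdot (r *\<^sub>R b) a = of_real r * cdot b a" "cdot a (r *\<^sub>R b) = of_real r * cdot a b"
 by (simp_all add: vec3_simps algebra_simps scaleR_conv_of_real[where 'a = complex])

lemma cdot_sum: "cdot a (\<Sum>x\<in>X. f x) = (\<Sum>x\<in>X. cdot a (f x))"
 by (induction X rule: infinite_finite_induct) (simp_all add: cdot_add)

lemma proj_perp_0 [simp]: "proj_perp n 0 = 0"
 by (simp add: proj_perp_def)

lemma proj_perp_add: "proj_perp n (v + w) = proj_perp n v + proj_perp n w"
 by (simp add: proj_perp_def cdot_add add_divide_distrib vec_eq_iff algebra_simps)

lemma proj_perp_sum: "proj_perp n (\<Sum>x\<in>X. f x) = (\<Sum>x\<in>X. proj_perp n (f x))"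
 by (induction X rule: infinite_finite_induct) (simp_all add: proj_perp_add)

lemma proj_perp_smult: "proj_perp n (a *s v) = a *s proj_perp n v"
 by (simp add: proj_perp_def cdot_simps vec_eq_iff algebra_simps)

lemma proj_perp_parallel: "proj_perp n (c *s cvec n) = 0"
 by (cases "n = 0") (simp_all add: proj_perp_def cdot_simps cdot_cvec_self)

lemma proj_perp_eq_0D: "proj_perp n v = 0 ==> \<exists>c. v = c *s cvec n"
 by (auto simp: proj_perp_def)

lemma cdot_proj_perp: "y \<bullet> n = 0 ==> cdot (cvec y) (proj_perp n v) = cdot (cvec y) v"
 by (simp add: proj_perp_def cdot_simps cdot_cvec_cvec)

definition bilin :: "complex^3 => real^3 => complex^3 => real^3 => complex^3" where
 "bilin u m v k = cdot u (cvec k) *s v + cdot v (cvec m) *s u"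

definition inter :: "(real^3 => complex^3) => real^3 => real^3 => complex^3" where
 "inter U m k = proj_perp (m + k) (bilin (U m) m (U k) k)"

lemma inter_commute: "inter U m k = inter U k m"
 by (simp add: inter_def bilin_def add.commute)

lemma inter_zero [simp]: "U m = 0 ==> inter U m k = 0" "U k = 0 ==> inter U m k = 0"
 by (simp_all add: inter_def bilin_def)

lemma dot_sum_left_half:
 fixes m k :: "'a::real_inner"
 assumes "norm m = norm k"
 shows "2 * ((m + k) \<bullet> m) = (m + k) \<bullet> (m + k)"
proof -
 have "m \<bullet> m = k \<bullet> k" using assms by (metis dot_square_norm)
 then show ?thesis by (simp add: inner_add_left inner_add_right inner_commute)
qed

text \<open>A vanishing projection makes \<open>bilin\<close> a multiple \<open>c\<close> of
  \<open>m + k\<close>. Pairing with \<open>m\<close> and with \<open>k\<close> gives the same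
  product \<open>a * b\<close>, so either \<open>c = 0\<close> or the two lengths agree; pairing
  with \<open>cross3 m k\<close>, which is orthogonal to \<open>m + k\<close>, gives the last
  relation.\<close>

lemma inter_eq_0D:
 assumes m: "cdot (cvec m) (U m) = 0" and k: "cdot (cvec k) (U k) = 0"
 and nz: "U m ~= 0" "U k ~= 0" "m + k ~= 0" and z: "inter U m k = 0"
 shows "cdot (U m) (cvec k) = 0 & cdot (U k) (cvec m) = 0 |
 norm m = norm k & cdot (U m) (cvec k) ~= 0 & cdot (U k) (cvec m) ~= 0 &
 cdot (U m) (cvec k) * cdot (U k) (cvec (cross3 m k))
 + cdot (U k) (cvec m) * cdot (U m) (cvec (cross3 m k)) = 0"
proof -
 define a b where "a = cdot (U m) (cvec k)" and "b = cdot (U k) (cvec m)"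
 obtain c where c: "bilin (U m) m (U k) k = c *s cvec (m + k)"
 using proj_perp_eq_0D z unfolding inter_def by blast
 have W: "cdot (bilin (U m) m (U k) k) (cvec y) = a * cdot (U k) (cvec y) + b * cdot (U m) (cvec y)" for y
 by (simp add: bilin_def a_def b_def cdot_add cdot_simps)
 have W': "cdot (bilin (U m) m (U k) k) (cvec y) = c * of_real ((m + k) \<bullet> y)" for y
 unfolding c by (simp only: cdot_simps cdot_cvec_cvec)
 have 1: "a * b = c * of_real ((m + k) \<bullet> m)"
 using W[of m] W'[of m] m by (simp add: cdot_commute a_def b_def)
 have 2: "a * b = c * of_real ((m + k) \<bullet> k)"
 using W[of k] W'[of k] k by (simp add: cdot_commute a_def b_def mult.commute)
 show ?thesis
 proof (cases "c = 0")
 case True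
 then have "a = 0 | b = 0" and z: "a *s U k + b *s U m = 0"
 using 1 c by (auto simp: bilin_def a_def b_def)
 then have "a = 0 & b = 0" using nz by auto
 then show ?thesis by (simp add: a_def b_def)
 next
 case False
 then have "(m + k) \<bullet> m = (m + k) \<bullet> k" using 1 2 by simp
 then have "m \<bullet> m = k \<bullet> k" by (simp add: inner_add_left inner_commute[of k m])
 then have n: "norm m = norm k" by (simp add: norm_eq)
 have "(m + k) \<bullet> m ~= 0" using dot_sum_left_half[OF n] nz(3) by auto
 then have ab: "a ~= 0" "b ~= 0" using 1 False by auto
 have "(m + k) \<bullet> cross3 m k = 0" by (simp add: inner_add_left dot_cross_self)
 then have "a * cdot (U k) (cvec (cross3 m k)) + b * cdot (U m) (cvec (cross3 m k)) = 0"
 using W[of "cross3 m k"] W'[of "cross3 m k"] by simp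
 then show ?thesis using n ab by (simp add: a_def b_def)
 qed
qed

text \<open>Curl acts on the amplitude at frequency \<open>n\<close> as cross product with
  \<open>n\<close> times \<open>\<i>\<close>; these are its eigenvectors.\<close>

definition helical :: "complex => real^3 => complex^3 => bool" where
 "helical mu n u \<longleftrightarrow> \<i> *s ccross (cvec n) u = mu *s u"

lemma helicalD: "helical mu n u ==> ccross (cvec n) u = (- \<i> * mu) *s u"
proof -
 assume "helical mu n u"
 then have "(- \<i>) *s (\<i> *s ccross (cvec n) u) = (- \<i>) *s (mu *s u)" by (simp add: helical_def)
 then show ?thesis by simp
qed

lemma helicalI: "ccross (cvec n) u = (- \<i> * mu) *s u ==> helical mu n u"
 by (simp add: helical_def)

text \<open>Advection as a gradient minus velocity times vorticity, symmetrized and in Fourier form.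
  The projection at \<open>m + k\<close> removes the gradient.\<close>

lemma bilin_ccross:
 "bilin u m v k = cdot u v *s cvec (m + k)
  - (ccross u (ccross (cvec k) v) + ccross v (ccross (cvec m) u))"
 by (simp add: bilin_def vec3_simps algebra_simps)

lemma ccross_smult: "ccross a (c *s b) = c *s ccross a b" "ccross (c *s a) b = c *s ccross a b"
 and ccross_anti: "ccross a b = - ccross b a" and ccross_self [simp]: "ccross a a = 0"
 and ccross_minus: "ccross (- a) b = - ccross a b" "ccross a (- b) = - ccross a b"
 and ccross_add: "ccross (a + a') b = ccross a b + ccross a' b" "ccross a (b + b') = ccross a b + ccross a b'"
 and ccross_diff: "ccross a (b - b') = ccross a b - ccross a b'"
 and ccross_zero [simp]: "ccross 0 b = 0" "ccross a 0 = 0"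
 by (simp_all add: vec3_simps algebra_simps)

text \<open>With equal eigenvalues the two cross product terms are opposite, and only the gradient
  is left.\<close>

lemma inter_helical:
 assumes "helical mu m (U m)" "helical mu k (U k)"
 shows "inter U m k = 0"
proof -
 have "ccross (U m) (ccross (cvec k) (U k)) + ccross (U k) (ccross (cvec m) (U m)) = 0"
 unfolding assms[THEN helicalD] ccross_smult by (subst ccross_anti) simp
 then have "bilin (U m) m (U k) k = cdot (U m) (U k) *s cvec (m + k)"
 by (simp add: bilin_ccross)
 then show ?thesis unfolding inter_def by (simp only: proj_perp_parallel)
qed

lemma ccross_triple: "ccross (cvec n) (ccross (cvec n) u)
 = cdot (cvec n) u *s cvec n - of_real ((norm n)\<^sup>2) *s u"
 unfolding norm_sq_3 by (simp add: vec3_simps algebra_simps power2_eq_square)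

lemma cdot_ccross_left: "cdot (ccross a b) c = cdot b (ccross c a)"
 by (simp add: vec3_simps algebra_simps)

lemma cdot_ccross_self [simp]: "cdot a (ccross a b) = 0" "cdot b (ccross a b) = 0"
 by (simp_all add: vec3_simps algebra_simps)

lemma helical_square:
 assumes "helical mu n u" "cdot (cvec n) u = 0" "u ~= 0"
 shows "mu\<^sup>2 = of_real ((norm n)\<^sup>2)"
proof -
 have "ccross (cvec n) (ccross (cvec n) u) = (- \<i> * mu) *s ((- \<i> * mu) *s u)"
 unfolding helicalD[OF assms(1)] ccross_smult ..
 moreover have "(- \<i> * mu) *s ((- \<i> * mu) *s u) = - (mu\<^sup>2 *s u)"
 by (simp add: vec_eq_iff power2_eq_square algebra_simps)
 ultimately have "of_real ((norm n)\<^sup>2) *s u = mu\<^sup>2 *s u"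
 unfolding ccross_triple assms(2) by simp
 moreover obtain i where "u $ i ~= 0" using assms(3) by (auto simp: vec_eq_iff)
 ultimately show ?thesis by (metis mult_right_cancel vector_smult_component)
qed

text \<open>Expansion in the basis dual to \<open>n\<close>, \<open>p\<close> and \<open>m\<close>,
  cleared of the common denominator \<open>m \<bullet> m\<close>.\<close>

lemma dual_basis:
 fixes n p :: "real^3" and u :: "complex^3"
 defines "m \<equiv> cross3 n p"
 shows "of_real (m \<bullet> m) *s u = cdot u (cvec n) *s cvec (cross3 p m)
 + cdot u (cvec p) *s cvec (cross3 m n) + cdot u (cvec m) *s cvec m"
 unfolding m_def by (simp add: vec3_simps cross3_def inner_vec_def) (intro conjI; algebra)

lemma perp_basis_zero:
 assumes "cross3 n p ~= 0" "cdot u (cvec n) = 0" "cdot u (cvec p) = 0" "cdot u (cvec (cross3 n p)) = 0"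
 shows "u = 0"
 using dual_basis[of n p u] assms by simp

text \<open>The triple product of \<open>u\<close>, \<open>n\<close> and \<open>p\<close> is, up to
  sign, \<open>ccross (cvec n) u\<close> tested against \<open>p\<close>, that is a multiple of
  \<open>u\<close> tested against \<open>p\<close>. So orthogonality to \<open>n\<close> and
  \<open>p\<close> implies orthogonality to the third basis vector.\<close>

lemma helical_not_perp:
 assumes h: "helical mu n u" and n: "cdot (cvec n) u = 0" and p: "cdot u (cvec p) = 0"
 and np: "cross3 n p ~= 0"
 shows "u = 0"
proof (rule perp_basis_zero[OF np])
 show "cdot u (cvec n) = 0" using n by (simp add: cdot_commute)
 have "cdot u (cvec (cross3 n p)) = cdot u (ccross (cvec n) (cvec p))" by (simp add: ccross_cvec)
 also have "\<dots> = cdot (ccross (cvec p) u) (cvec n)"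
 by (simp add: vec3_simps algebra_simps)
 also have "\<dots> = - cdot (ccross (cvec n) u) (cvec p)"
 by (simp add: vec3_simps algebra_simps)
 also have "\<dots> = 0" unfolding helicalD[OF h] by (simp add: cdot_simps cdot_minus p)
 finally show "cdot u (cvec (cross3 n p)) = 0" .
qed (use p in simp)

lemma helical_minus_cnj:
 assumes "helical mu n u"
 shows "helical (cnj mu) (- n) (cnjv u)"
proof -
 have "ccross (cvec (- n)) (cnjv u) = - cnjv (ccross (cvec n) u)"
 by (simp add: vec3_simps cnjv_def)
 also have "\<dots> = (- \<i> * cnj mu) *s cnjv u"
 unfolding helicalD[OF assms] by (simp add: cnjv_def vec_eq_iff)
 finally show ?thesis by (rule helicalI)
qed

text \<open>A mode interacting trivially with a helical mode is helical with the same eigenvalue.\<close>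

lemma inter_helical_eq_0D:
 assumes h: "helical mu a (U a)" and mu: "mu ~= 0"
 and a: "cdot (cvec a) (U a) = 0" and p: "cdot (cvec p) (U p) = 0"
 and nz: "U a ~= 0" "U p ~= 0" and np: "cross3 a p ~= 0" and z: "inter U a p = 0"
 shows "norm p = norm a & helical mu p (U p)"
proof -
 have "a + p ~= 0"
 using np by (metis add_eq_0_iff cross_refl cross_minus_right neg_0_equal_iff_equal)
 from inter_eq_0D[OF a p nz this z] have "norm a = norm p" and nz1: "cdot (U a) (cvec p) ~= 0" and
 eq: "cdot (U a) (cvec p) * cdot (U p) (cvec (cross3 a p))
 + cdot (U p) (cvec a) * cdot (U a) (cvec (cross3 a p)) = 0"
 using helical_not_perp[OF h a _ np] nz(1) by blast+
 have "cdot (U a) (cvec (cross3 a p)) = - cdot (ccross (cvec a) (U a)) (cvec p)"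
 by (simp add: ccross_cvec[symmetric]) (simp add: vec3_simps algebra_simps)
 also have "\<dots> = \<i> * mu * cdot (U a) (cvec p)" unfolding helicalD[OF h] by (simp add: cdot_simps cdot_minus)
 finally have 1: "cdot (U p) (cvec (cross3 a p)) + \<i> * mu * cdot (U p) (cvec a) = 0"
 using eq nz1 by (simp add: algebra_simps) (metis (no_types, lifting) distrib_left mult.commute mult.left_commute mult_eq_0_iff)
 \<comment> \<open>Up to a factor, \<open>w\<close> is the part of \<open>U p\<close> with the
   opposite eigenvalue \<open>- mu\<close>. The vanishing interaction makes it orthogonal to
   \<open>a\<close>, so it is zero.\<close>
 define w where "w = ccross (cvec p) (U p) + (\<i> * mu) *s U p"
 have wa: "cdot w (cvec a) = 0"
 proof -
 have "cdot (ccross (cvec p) (U p)) (cvec a) = cdot (U p) (cvec (cross3 a p))"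
 by (simp add: ccross_cvec[symmetric]) (simp add: vec3_simps algebra_simps)
 then show ?thesis using 1 by (simp add: w_def cdot_add cdot_simps)
 qed
 have wp: "cdot (cvec p) w = 0" using p by (simp add: w_def cdot_add cdot_simps)
 have mu2: "mu\<^sup>2 = of_real ((norm p)\<^sup>2)"
 using helical_square[OF h a nz(1)] \<open>norm a = norm p\<close> by simp
 have "ccross (cvec p) w = (\<i> * mu) *s ccross (cvec p) (U p) - mu\<^sup>2 *s U p"
 unfolding w_def ccross_add ccross_smult ccross_triple p mu2 by simp
 also have "\<dots> = (- \<i> * (- mu)) *s w"
 by (simp add: w_def vec_eq_iff algebra_simps power2_eq_square)
 finally have "helical (- mu) p w" by (rule helicalI)
 moreover have "cross3 p a ~= 0" using np by (metis cross_skew neg_0_equal_iff_equal)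
 ultimately have "w = 0" using helical_not_perp[OF _ wp wa] by blast
 then have "ccross (cvec p) (U p) = (- \<i> * mu) *s U p"
 by (simp add: w_def add_eq_0_iff2)
 then show ?thesis using \<open>norm a = norm p\<close> by (auto intro: helicalI)
qed

lemma ccross_eq_0D:
 assumes "ccross v u = 0" "u ~= 0"
 shows "\<exists>c. v = c *s u"
proof -
 have e: "v$2 * u$3 = v$3 * u$2" "v$3 * u$1 = v$1 * u$3" "v$1 * u$2 = v$2 * u$1"
 using assms(1) by (simp_all add: ccross_def vec_eq_iff forall_3)
 consider "u$1 ~= 0" | "u$2 ~= 0" | "u$3 ~= 0" using assms(2) by (auto simp: vec_eq_iff forall_3)
 then show ?thesis
 proof cases
 case 1 then have "v = (v$1 / u$1) *s u" using e by (simp add: vec_eq_iff forall_3 field_simps)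
 then show ?thesis by blast
 next
 case 2 then have "v = (v$2 / u$2) *s u" using e by (simp add: vec_eq_iff forall_3 field_simps)
 then show ?thesis by blast
 next
 case 3 then have "v = (v$3 / u$3) *s u" using e by (simp add: vec_eq_iff forall_3 field_simps)
 then show ?thesis by blast
 qed
qed

text \<open>Since \<open>u\<close> is orthogonal to \<open>n\<close> and to itself, the cross
  product of \<open>ccross (cvec n) u\<close> with \<open>u\<close> vanishes, so the former is a
  multiple of \<open>u\<close>; applying the cross product with \<open>n\<close> twice determines
  the factor up to sign.\<close>

lemma null_imp_helical:
 assumes n: "cdot (cvec n) u = 0" and null: "cdot u u = 0" and u: "u ~= 0"
 shows "\<exists>mu\<in>{norm n, - norm n}. helical (of_real mu) n u"
proof -
 have "ccross (ccross (cvec n) u) u = cdot (cvec n) u *s u - cdot u u *s cvec n"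
 by (simp add: vec3_simps algebra_simps)
 then have "ccross (ccross (cvec n) u) u = 0" using n null by simp
 then obtain c where c: "ccross (cvec n) u = c *s u" using ccross_eq_0D u by blast
 then have "c *s (c *s u) = - of_real ((norm n)\<^sup>2) *s u"
 using ccross_triple[of n u] n by (simp add: ccross_smult)
 then have "(c\<^sup>2 + of_real ((norm n)\<^sup>2)) *s u = 0"
 by (simp add: vec_eq_iff power2_eq_square algebra_simps)
 then have "c\<^sup>2 = - of_real ((norm n)\<^sup>2)"
 using u by (simp only: vector_mul_eq_0 add_eq_0_iff2) simp
 then have "(\<i> * c)\<^sup>2 = (of_real (norm n))\<^sup>2" by (simp add: power_mult_distrib)
 then have "\<i> * c = of_real (norm n) | \<i> * c = of_real (- norm n)"
 by (simp add: power2_eq_iff)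
 then obtain mu where mu: "mu : {norm n, - norm n}" "\<i> * c = of_real mu" by blast
 have "\<i> *s ccross (cvec n) u = of_real mu *s u" unfolding c mu(2)[symmetric] by simp
 then show ?thesis using mu(1) by (auto simp: helical_def)
qed

section \<open>Spherical triangles\<close>

text \<open>For a cone this is the solid angle up to the constant factor
  \<open>bmeas UNIV / (4 * pi)\<close>: volume in the ball stands in for area on the sphere.\<close>

definition bmeas :: "(real^3) set => real" where
 "bmeas X = measure lebesgue (X \<inter> ball 0 1)"

lemma bmeas_nonneg: "0 <= bmeas X"
 by (simp add: bmeas_def)

lemma lmeasurable_Int_ball: "open X ==> X \<inter> ball (0::real^3) 1 : lmeasurable"
 by (rule lmeasurable_open) (auto intro: bounded_subset[OF bounded_ball])

lemma bmeas_mono: "open X ==> open Y ==> X \<subseteq> Y ==> bmeas X <= bmeas Y"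
 unfolding bmeas_def by (intro measure_mono_fmeasurable lmeasurable_Int_ball fmeasurableD) auto

lemma bmeas_UNIV_pos: "0 < bmeas UNIV"
 unfolding bmeas_def by (simp add: content_ball_pos)

lemma bmeas_Union:
 assumes "finite I" "!!i. i : I ==> open (F i)"
 "!!i j. i : I ==> j : I ==> i ~= j ==> F i \<inter> F j = {}"
 shows "(\<Sum>i\<in>I. bmeas (F i)) = bmeas (\<Union>i\<in>I. F i)"
proof -
 have "measure lebesgue (\<Union>i\<in>I. F i \<inter> ball 0 1) = (\<Sum>i\<in>I. measure lebesgue (F i \<inter> ball 0 1))"
 by (rule measure_UNION') (use assms in \<open>auto simp: lmeasurable_Int_ball pairwise_def disjnt_def\<close>)
 then show ?thesis by (simp add: bmeas_def)
qed

lemma bmeas_split: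
 assumes "open W" "open X" "open Y" "X \<inter> Y = {}" "X \<subseteq> W" "Y \<subseteq> W" "W \<subseteq> X \<union> Y \<union> N" "negligible N"
 shows "bmeas W = bmeas X + bmeas Y"
proof -
 have "bmeas W = measure lebesgue ((X \<union> Y) \<inter> ball 0 1)"
 unfolding bmeas_def
 proof (rule measure_negligible_symdiff)
 show "(X \<union> Y) \<inter> ball 0 1 : lmeasurable" using assms by (intro lmeasurable_Int_ball) auto
 show "negligible ((X \<union> Y) \<inter> ball 0 1 - W \<inter> ball 0 1 \<union> (W \<inter> ball 0 1 - (X \<union> Y) \<inter> ball 0 1))"
 by (rule negligible_subset[OF assms(8)]) (use assms in auto)
 qed
 also have "\<dots> = bmeas X + bmeas Y"
 proof -
 have "measure lebesgue (X \<inter> ball 0 1 \<union> Y \<inter> ball 0 1)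
 = measure lebesgue (X \<inter> ball 0 1) + measure lebesgue (Y \<inter> ball 0 1)"
 by (rule measure_Un_AE) (use assms in \<open>auto simp: lmeasurable_Int_ball\<close>)
 then show ?thesis by (simp add: bmeas_def Int_Un_distrib2)
 qed
 finally show ?thesis .
qed

lemma bmeas_orthogonal:
 assumes "orthogonal_transformation f" "open X"
 shows "bmeas (f ` X) = bmeas X"
proof -
 have "f ` X \<inter> ball 0 1 = f ` (X \<inter> ball 0 1)"
 using assms(1) by (auto simp: orthogonal_transformation)
 then show ?thesis
 unfolding bmeas_def using measure_orthogonal_image[OF assms(1) lmeasurable_Int_ball[OF assms(2)]]
 by simp
qed

lemma open_halfspaces: "open {p::'a::real_inner. f \<bullet> p > 0}" "open {p::'a. f \<bullet> p > 0 & g \<bullet> p > 0}"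
 "open {p::'a. f \<bullet> p > 0 & g \<bullet> p > 0 & h \<bullet> p > 0}"
 by (intro open_Collect_conj open_Collect_less continuous_intros)+

lemma bmeas_reflect:
 assumes "open X"
 shows "bmeas (uminus ` X) = bmeas X"
 by (rule bmeas_orthogonal) (auto simp: orthogonal_transformation_neg assms)

lemma uminus_image_Collect: "uminus ` {p::'a::group_add. P p} = {p. P (- p)}"
 by (auto simp: image_def)

lemma bmeas_halfspace:
 assumes "f ~= 0"
 shows "bmeas {p. f \<bullet> p > 0} = bmeas UNIV / 2"
proof -
 have "bmeas UNIV = bmeas {p. f \<bullet> p > 0} + bmeas {p. (- f) \<bullet> p > 0}"
 by (rule bmeas_split[where N = "{p. f \<bullet> p = 0}"])
 (use assms in \<open>auto simp: negligible_hyperplane intro!: open_halfspaces open_Collect_less continuous_intros\<close>)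
 moreover have "{p. (- f) \<bullet> p > 0} = uminus ` {p. f \<bullet> p > 0}"
 by (simp add: uminus_image_Collect)
 ultimately show ?thesis using bmeas_reflect[OF open_halfspaces(1)] by simp
qed

text \<open>A nonnegative additive function is monotone, so \<open>f x\<close> lies between its
  values at consecutive multiples of \<open>L / n\<close>, with an error of at most
  \<open>f L / n\<close> for every \<open>n\<close>.\<close>

lemma additive_interval_linear:
 fixes f :: "real => real"
 assumes L: "L > 0" and add: "!!x y. 0 <= x ==> 0 <= y ==> x + y <= L ==> f (x + y) = f x + f y"
 and nn: "!!x. 0 <= x ==> x <= L ==> 0 <= f x" and x: "0 <= x" "x <= L"
 shows "f x = x / L * f L"
proof -
 have f0: "f 0 = 0" using add[of 0 0] L by simp
 have mul: "f (real k * y) = real k * f y" if "0 <= y" "real k * y <= L" for k y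
 using that
 proof (induction k)
 case (Suc k)
 have "real k * y <= L" using Suc.prems by (simp add: algebra_simps)
 then have IH: "f (real k * y) = real k * f y" using Suc by auto
 have "f (real k * y + y) = f (real k * y) + f y"
 by (rule add) (use Suc.prems in \<open>auto simp: algebra_simps\<close>)
 then show ?case using IH by (simp add: algebra_simps)
 qed (simp add: f0)
 have mono: "f a <= f b" if "0 <= a" "a <= b" "b <= L" for a b
 using add[of a "b - a"] nn[of "b - a"] that by simp
 have est: "\<bar>f x - x / L * f L\<bar> <= f L / real n" if n: "n > 0" for n
 proof -
 define y where "y = L / real n"
 have y: "y > 0" "real n * y = L" using L n by (auto simp: y_def)
 have fy: "f y = f L / real n" using mul[of y n] y n by simp
 define k where "k = nat \<lfloor>x / y\<rfloor>"
 have k: "real k * y <= x" "x < real k * y + y"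
 proof -
 have "x / y >= 0" using x y by simp
 then have "real k = of_int \<lfloor>x / y\<rfloor>" by (simp add: k_def)
 then have "real k <= x / y" "x / y < real k + 1" by linarith+
 then show "real k * y <= x" "x < real k * y + y" using y by (simp_all add: field_simps)
 qed
 have lo: "real k * f y <= f x"
 using mono[of "real k * y" x] mul[of y k] k x y by simp
 have hi: "f x <= real k * f y + f y"
 proof -
 have "f x = f (real k * y) + f (x - real k * y)" using add[of "real k * y" "x - real k * y"] k x y by simp
 moreover have "f (x - real k * y) <= f y"
 proof (rule mono)
 have "1 * y <= real n * y" using y n by (intro mult_right_mono) auto
 then show "y <= L" unfolding y(2) mult_1_left .
 qed (use k in auto)
 ultimately show ?thesis using mul[of y k] k x y by simp
 qed
 have fy0: "f y >= 0" unfolding fy using nn[of L] L by simp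
 have "x / L * f L = x / y * (f L / real n)" unfolding y_def using n L by simp
 then have e: "x / L * f L = x / y * f y" unfolding fy .
 have "real k * f y <= x / y * f y" "x / y * f y <= (real k + 1) * f y"
 using k y by (intro mult_right_mono fy0; simp add: field_simps)+
 then show ?thesis using lo hi unfolding e fy[symmetric] by (simp add: algebra_simps abs_le_iff)
 qed
 show ?thesis
 proof (rule ccontr)
 assume ne: "~ ?thesis"
 define d where "d = \<bar>f x - x / L * f L\<bar>"
 have d: "d > 0" using ne by (simp add: d_def)
 obtain n :: nat where n: "f L / d < real n" using reals_Archimedean2 by blast
 have "f L / d >= 0" using d nn[of L] L by simp
 then have "n > 0" using n by (cases n) auto
 then have "d <= f L / real n" using est by (simp add: d_def)
 then show False using n d \<open>n > 0\<close> by (simp add: field_simps)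
 qed
qed

section \<open>Wedges and their angles\<close>

locale orthonormal_pair =
 fixes a b :: "real^3"
 assumes ab: "a \<bullet> a = 1" "b \<bullet> b = 1" "a \<bullet> b = 0"
begin

definition u :: "real => real^3" where "u \<phi> = - sin \<phi> *\<^sub>R a + cos \<phi> *\<^sub>R b"

definition rot :: "real => real^3 => real^3" where
 "rot \<phi> p = (p \<bullet> a) *\<^sub>R (cos \<phi> *\<^sub>R a + sin \<phi> *\<^sub>R b) + (p \<bullet> b) *\<^sub>R u \<phi>
  + (p - (p \<bullet> a) *\<^sub>R a - (p \<bullet> b) *\<^sub>R b)"

lemma ba: "b \<bullet> a = 0" using ab by (simp add: inner_commute)

lemma orthogonal_rot: "orthogonal_transformation (rot \<phi>)"
 unfolding orthogonal_transformation_def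
proof (intro conjI allI)
 show "linear (rot \<phi>)"
 by (intro linearI) (simp_all add: rot_def algebra_simps inner_add_left)
 fix p q
 have sc: "cos \<phi> * (cos \<phi> * x) + sin \<phi> * (sin \<phi> * x) = x" for x
 proof -
 have e: "cos \<phi> * (cos \<phi> * x) + sin \<phi> * (sin \<phi> * x) = (sin \<phi> * sin \<phi> + cos \<phi> * cos \<phi>) * x"
 by (simp only: distrib_right mult.assoc add.commute)
 have e': "sin \<phi> * sin \<phi> + cos \<phi> * cos \<phi> = 1"
 using sin_cos_squared_add[of \<phi>] by (simp add: power2_eq_square)
 show ?thesis unfolding e e' by simp
 qed
 show "rot \<phi> p \<bullet> rot \<phi> q = p \<bullet> q"
 unfolding rot_def u_def
 by (simp add: inner_add_left inner_add_right inner_diff_left inner_diff_right ab ba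
 inner_commute[of a p] inner_commute[of b p] inner_commute[of a q] inner_commute[of b q])
 (use sc[of "(p \<bullet> a) * (q \<bullet> a)"] sc[of "(p \<bullet> b) * (q \<bullet> b)"] in \<open>simp add: algebra_simps\<close>)
qed

lemma rot_u: "rot \<theta> (u \<phi>) = u (\<theta> + \<phi>)"
 by (simp add: rot_def u_def inner_add_left inner_diff_left ab ba sin_add cos_add algebra_simps)

lemma inner_rot: "u (\<theta> + \<phi>) \<bullet> rot \<theta> p = u \<phi> \<bullet> p"
 using orthogonal_rot[of \<theta>] by (simp add: rot_u[symmetric] orthogonal_transformation_def)

text \<open>The wedge of points whose polar angle in the plane of \<open>a\<close> and
  \<open>b\<close> lies between \<open>\<alpha>\<close> and \<open>\<beta>\<close>, for a difference
  of at most \<open>pi\<close>.\<close>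

definition sector :: "real => real => (real^3) set" where
 "sector \<alpha> \<beta> = {p. u \<alpha> \<bullet> p > 0 & (- u \<beta>) \<bullet> p > 0}"

lemma sector_rot: "sector \<theta> (\<theta> + \<phi>) = rot \<theta> ` sector 0 \<phi>"
proof -
 have "surj (rot \<theta>)" using orthogonal_rot by (simp add: orthogonal_transformation_surj)
 then have 1: "\<exists>q. p = rot \<theta> q" for p by (rule surjD)
 have 2: "rot \<theta> q : sector \<theta> (\<theta> + \<phi>) \<longleftrightarrow> q : sector 0 \<phi>" for q
 using inner_rot[of \<theta> 0 q] inner_rot[of \<theta> \<phi> q] by (simp add: sector_def)
 show ?thesis
 proof (intro equalityI subsetI)
 fix p assume p: "p : sector \<theta> (\<theta> + \<phi>)"
 obtain q where "p = rot \<theta> q" using 1 by blast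
 then show "p : rot \<theta> ` sector 0 \<phi>" using p 2 by blast
 qed (use 2 in blast)
qed

lemma u_nonzero: "u \<phi> ~= 0"
proof
 assume "u \<phi> = 0"
 then have "u \<phi> \<bullet> u \<phi> = 0" by simp
 then have "sin \<phi> * sin \<phi> + cos \<phi> * cos \<phi> = 0"
 by (simp add: u_def inner_add_left inner_add_right inner_diff_left inner_diff_right ab ba)
 then show False using sin_cos_squared_add[of \<phi>] by (simp add: power2_eq_square)
qed

lemma sector_add:
 assumes "0 <= \<theta>" "0 <= \<phi>" "\<theta> + \<phi> <= pi"
 shows "bmeas (sector 0 (\<theta> + \<phi>)) = bmeas (sector 0 \<theta>) + bmeas (sector 0 \<phi>)"
proof (cases "\<theta> = 0 | \<phi> = 0")
 case True
 have "sector 0 0 = {}" by (auto simp: sector_def)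
 then have "bmeas (sector 0 0) = 0" by (simp add: bmeas_def)
 then show ?thesis using True by auto
next
 case False
 then have sp: "sin \<theta> > 0" "sin \<phi> > 0" "sin (\<theta> + \<phi>) >= 0"
 using assms by (auto intro!: sin_gt_zero sin_ge_zero)
 \<comment> \<open>The normals at the angles \<open>0\<close>, \<open>\<theta>\<close> and
   \<open>\<theta> + \<phi>\<close> are linearly dependent; the signs of the coefficients decide
   both inclusions below.\<close>
 have id: "sin \<theta> * (u (\<theta> + \<phi>) \<bullet> p) = sin (\<theta> + \<phi>) * (u \<theta> \<bullet> p) - sin \<phi> * (u 0 \<bullet> p)" for p
 proof -
 have "sin \<phi> = sin ((\<theta> + \<phi>) - \<theta>)" by simp
 then have k: "sin \<theta> * cos (\<theta> + \<phi>) = sin (\<theta> + \<phi>) * cos \<theta> - sin \<phi>"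
 unfolding sin_diff by simp
 have up: "u \<psi> \<bullet> p = cos \<psi> * (b \<bullet> p) - sin \<psi> * (a \<bullet> p)" for \<psi>
 by (simp add: u_def inner_add_left inner_diff_left)
 have "sin \<theta> * (u (\<theta> + \<phi>) \<bullet> p) = (sin \<theta> * cos (\<theta> + \<phi>)) * (b \<bullet> p) - sin \<theta> * sin (\<theta> + \<phi>) * (a \<bullet> p)"
 unfolding up by (simp add: right_diff_distrib)
 then show ?thesis unfolding k up by (simp add: left_diff_distrib right_diff_distrib)
 qed
 have "bmeas (sector 0 (\<theta> + \<phi>)) = bmeas (sector 0 \<theta>) + bmeas (sector \<theta> (\<theta> + \<phi>))"
 proof (rule bmeas_split[where N = "{p. u \<theta> \<bullet> p = 0}"])
 show "open (sector 0 (\<theta> + \<phi>))" "open (sector 0 \<theta>)" "open (sector \<theta> (\<theta> + \<phi>))"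
 unfolding sector_def by (rule open_halfspaces)+
 show "sector 0 \<theta> \<inter> sector \<theta> (\<theta> + \<phi>) = {}" by (auto simp: sector_def)
 show "negligible {p. u \<theta> \<bullet> p = 0}" using u_nonzero by (intro negligible_hyperplane) auto
 show "sector 0 (\<theta> + \<phi>) \<subseteq> sector 0 \<theta> \<union> sector \<theta> (\<theta> + \<phi>) \<union> {p. u \<theta> \<bullet> p = 0}"
 by (auto simp: sector_def)
 show "sector 0 \<theta> \<subseteq> sector 0 (\<theta> + \<phi>)"
 proof
 fix p assume p: "p : sector 0 \<theta>"
 have "sin \<theta> * (u (\<theta> + \<phi>) \<bullet> p) < 0"
 unfolding id using p sp by (simp add: sector_def) (smt (verit) mult_pos_pos mult_nonneg_nonpos)
 then have "u (\<theta> + \<phi>) \<bullet> p < 0" using sp by (simp add: mult_less_0_iff)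
 then show "p : sector 0 (\<theta> + \<phi>)" using p by (simp add: sector_def)
 qed
 show "sector \<theta> (\<theta> + \<phi>) \<subseteq> sector 0 (\<theta> + \<phi>)"
 proof
 fix p assume p: "p : sector \<theta> (\<theta> + \<phi>)"
 have "sin \<theta> * (u (\<theta> + \<phi>) \<bullet> p) < 0" using p sp by (simp add: sector_def mult_pos_neg)
 moreover have "sin (\<theta> + \<phi>) * (u \<theta> \<bullet> p) >= 0" using p sp by (simp add: sector_def)
 ultimately have "sin \<phi> * (u 0 \<bullet> p) > 0" using id[of p] by linarith
 then have "u 0 \<bullet> p > 0" using sp by (simp add: zero_less_mult_iff)
 then show "p : sector 0 (\<theta> + \<phi>)" using p by (simp add: sector_def)
 qed
 qed
 also have "bmeas (sector \<theta> (\<theta> + \<phi>)) = bmeas (sector 0 \<phi>)"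
 unfolding sector_rot
 by (intro bmeas_orthogonal orthogonal_rot) (unfold sector_def, rule open_halfspaces)
 finally show ?thesis .
qed

lemma bmeas_sector:
 assumes "0 <= \<theta>" "\<theta> <= pi"
 shows "bmeas (sector 0 \<theta>) = \<theta> / (2 * pi) * bmeas UNIV"
proof -
 have "sector 0 pi = {p. u 0 \<bullet> p > 0}" by (auto simp: sector_def u_def)
 then have "bmeas UNIV = 2 * bmeas (sector 0 pi)" using bmeas_halfspace[OF u_nonzero, of 0] by simp
 then show ?thesis
 using additive_interval_linear[of pi "%\<theta>. bmeas (sector 0 \<theta>)" \<theta>] sector_add assms
 by (simp add: bmeas_nonneg)
qed

end

text \<open>The inner dihedral angle is \<open>pi\<close> minus the angle between the normals, hence
  the minus sign under \<open>arccos\<close>. The frame is chosen such that \<open>f\<close> and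
  \<open>- g\<close> point along the normals at the angles \<open>0\<close> and
  \<open>\<theta>\<close>.\<close>

lemma bmeas_lune:
 fixes f g :: "real^3"
 assumes "cross3 f g ~= 0"
 shows "bmeas {p. f \<bullet> p > 0 & g \<bullet> p > 0}
 = arccos (- (f \<bullet> g) / (norm f * norm g)) / (2 * pi) * bmeas UNIV"
proof -
 have nz: "f ~= 0" "g ~= 0" using assms by auto
 define b where "b = f /\<^sub>R norm f"
 define g' where "g' = g /\<^sub>R norm g"
 have b1: "b \<bullet> b = 1" "g' \<bullet> g' = 1"
 using nz by (simp_all add: b_def g'_def dot_square_norm power2_eq_square)
 define C where "C = - (b \<bullet> g')"
 have C: "- (f \<bullet> g) / (norm f * norm g) = C" using nz by (simp add: C_def b_def g'_def field_simps)
 have "b ~= g'" "b ~= - g'"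
 proof -
 show "b ~= g'"
 proof
 assume "b = g'"
 then have "norm f *\<^sub>R b = norm f *\<^sub>R g'" by simp
 then have "f = (norm f / norm g) *\<^sub>R g" using nz by (simp add: b_def g'_def divide_inverse)
 then show False using assms by (metis cross_mult_left cross_refl scaleR_zero_right)
 qed
 show "b ~= - g'"
 proof
 assume "b = - g'"
 then have "norm f *\<^sub>R b = norm f *\<^sub>R (- g')" by simp
 then have "f = (- norm f / norm g) *\<^sub>R g" using nz by (simp add: b_def g'_def divide_inverse)
 then show False using assms by (metis cross_mult_left cross_refl scaleR_zero_right)
 qed
 qed
 then have "(b - g') \<bullet> (b - g') > 0" "(b + g') \<bullet> (b + g') > 0"
 by (simp_all add: add_eq_0_iff2)
 then have C1: "- 1 < C" "C < 1" using b1
 by (simp_all add: C_def inner_diff_left inner_diff_right inner_add_left inner_add_right inner_commute[of g' b])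
 define \<theta> where "\<theta> = arccos C"
 have th: "cos \<theta> = C" "0 <= \<theta>" "\<theta> <= pi" "sin \<theta> > 0"
 using C1 arccos_lt_bounded[of C] by (auto simp: \<theta>_def arccos_lbound arccos_ubound sin_gt_zero)
 define a where "a = (C *\<^sub>R b + g') /\<^sub>R sin \<theta>"
 have s2: "sin \<theta> * sin \<theta> = 1 - C * C" using sin_cos_squared_add[of \<theta>] th by (simp add: power2_eq_square)
 have bg: "b \<bullet> g' = - C" "g' \<bullet> b = - C" by (simp_all add: C_def inner_commute)
 have ab: "a \<bullet> b = 0" by (simp add: a_def inner_add_left b1 bg)
 have "(C *\<^sub>R b + g') \<bullet> (C *\<^sub>R b + g') = sin \<theta> * sin \<theta>"
 unfolding s2 by (simp add: inner_add_left inner_add_right b1 bg)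
 then have aa: "a \<bullet> a = 1" using th(4) by (simp add: a_def) (simp add: field_simps)
 interpret orthonormal_pair a b by unfold_locales (use ab aa b1 in auto)
 have "{p. f \<bullet> p > 0 & g \<bullet> p > 0} = sector 0 \<theta>"
 proof -
 have "u \<theta> = - g'" using th unfolding u_def by (simp add: a_def algebra_simps)
 moreover have "u 0 = b" by (simp add: u_def)
 ultimately have "sector 0 \<theta> = {p. b \<bullet> p > 0 & g' \<bullet> p > 0}" unfolding sector_def by simp
 then show ?thesis using nz by (auto simp: b_def g'_def zero_less_mult_iff)
 qed
 then show ?thesis using bmeas_sector[OF th(2,3)] unfolding C \<theta>_def by simp
qed

text \<open>The angle at \<open>x\<close> of the spherical triangle, measured between the normals of
  the two planes through \<open>x\<close>.\<close>

definition vangle :: "real^3 => real^3 => real^3 => real" where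
 "vangle x y z = arccos ((cross3 x y \<bullet> cross3 x z) / (norm (cross3 x y) * norm (cross3 x z)))"

definition cone3 :: "real^3 => real^3 => real^3 => (real^3) set" where
 "cone3 x y z = {p. cross3 y z \<bullet> p > 0 & cross3 z x \<bullet> p > 0 & cross3 x y \<bullet> p > 0}"

lemma open_cone3: "open (cone3 x y z)"
 unfolding cone3_def by (rule open_halfspaces)

lemma bmeas_lune_vertex:
 assumes "x \<bullet> cross3 y z > 0"
 shows "bmeas {p. cross3 z x \<bullet> p > 0 & cross3 x y \<bullet> p > 0} = vangle x y z / (2 * pi) * bmeas UNIV"
proof -
 have "cross3 (cross3 z x) (cross3 x y) = (x \<bullet> cross3 y z) *\<^sub>R x"
 by (simp add: cross3_simps forall_3)
 then have "cross3 (cross3 z x) (cross3 x y) ~= 0" using assms by auto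
 from bmeas_lune[OF this] show ?thesis
 unfolding vangle_def
 by (simp add: cross_skew[of z x] inner_commute mult.commute)
qed

text \<open>Girard's theorem: the three lunes cover the triangle three times and its complement in a
  hemisphere, up to a reflection, once.\<close>

lemma bmeas_cone3:
 assumes D: "x \<bullet> cross3 y z > 0"
 shows "bmeas (cone3 x y z)
 = (vangle x y z + vangle y z x + vangle z x y - pi) / (4 * pi) * bmeas UNIV"
proof -
 define f g h where "f = cross3 y z" and "g = cross3 z x" and "h = cross3 x y"
 have D2: "y \<bullet> cross3 z x > 0" "z \<bullet> cross3 x y > 0"
 using D cross_triple[of x y z] cross_triple[of y z x] by (simp_all add: inner_commute)
 have nz: "f ~= 0" "g ~= 0" "h ~= 0" using D D2 by (auto simp: f_def g_def h_def)
 have neg: "negligible {p. k \<bullet> p = 0}" if "k ~= 0" for k :: "real^3" using that by (simp add: negligible_hyperplane)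
 define T where "T k l m = bmeas {p. k \<bullet> p > 0 & l \<bullet> p > 0 & m \<bullet> p > 0}" for k l m :: "real^3"
 have split: "bmeas {p. l \<bullet> p > 0 & m \<bullet> p > 0} = T k l m + T (- k) l m" if "k ~= 0" for k l m
 unfolding T_def
 by (rule bmeas_split[where N = "{p. k \<bullet> p = 0}"]) (use neg[OF that] open_halfspaces(3)[of k l m] open_halfspaces(3)[of "- k" l m] open_halfspaces(2)[of l m] in auto)
 have half: "bmeas {p. k \<bullet> p > 0} = bmeas {p. k \<bullet> p > 0 & l \<bullet> p > 0} + bmeas {p. k \<bullet> p > 0 & (- l) \<bullet> p > 0}"
 if "l ~= 0" for k l
 by (rule bmeas_split[where N = "{p. l \<bullet> p = 0}"]) (use neg[OF that] open_halfspaces(2)[of k l] open_halfspaces(2)[of k "- l"] open_halfspaces(1)[of k] in auto)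
 have refl: "T (- k) (- l) (- m) = T k l m" for k l m
 proof -
 have "{p. (- k) \<bullet> p > 0 & (- l) \<bullet> p > 0 & (- m) \<bullet> p > 0} = uminus ` {p. k \<bullet> p > 0 & l \<bullet> p > 0 & m \<bullet> p > 0}"
 by (simp add: uminus_image_Collect)
 then show ?thesis unfolding T_def using bmeas_reflect[OF open_halfspaces(3)] by simp
 qed
 have perm: "T k l m = T l m k" "T k l m = T l k m" for k l m
 unfolding T_def by (simp_all add: conj_ac)
 have 1: "bmeas {p. g \<bullet> p > 0 & h \<bullet> p > 0} = T f g h + T (- f) g h" using split[OF nz(1)] .
 have 2: "bmeas {p. h \<bullet> p > 0 & f \<bullet> p > 0} = T f g h + T f (- g) h"
 using split[OF nz(2), of h f] perm by metis
 have 3: "bmeas {p. f \<bullet> p > 0 & g \<bullet> p > 0} = T f g h + T f g (- h)"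
 using split[OF nz(3), of f g] perm by metis
 have 4: "bmeas UNIV / 2 = T f g h + T f g (- h) + T f (- g) h + T f (- g) (- h)"
 proof -
 have "bmeas {p. f \<bullet> p > 0 & (- g) \<bullet> p > 0} = T f (- g) h + T f (- g) (- h)"
 using split[OF nz(3), of f "- g"] perm by metis
 then show ?thesis using half[OF nz(2), of f] 3 bmeas_halfspace[OF nz(1)] by simp
 qed
 have 5: "T f (- g) (- h) = T (- f) g h" using refl[of "- f" g h] by simp
 have L: "bmeas {p. g \<bullet> p > 0 & h \<bullet> p > 0} = vangle x y z / (2 * pi) * bmeas UNIV"
 "bmeas {p. h \<bullet> p > 0 & f \<bullet> p > 0} = vangle y z x / (2 * pi) * bmeas UNIV"
 "bmeas {p. f \<bullet> p > 0 & g \<bullet> p > 0} = vangle z x y / (2 * pi) * bmeas UNIV"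
 using bmeas_lune_vertex[OF D] bmeas_lune_vertex[OF D2(1)] bmeas_lune_vertex[OF D2(2)]
 by (simp_all add: f_def g_def h_def)
 have "2 * T f g h = (vangle x y z + vangle y z x + vangle z x y) / (2 * pi) * bmeas UNIV - bmeas UNIV / 2"
 using 1 2 3 4 5 L by (simp add: add_divide_distrib distrib_right)
 also have "\<dots> = 2 * ((vangle x y z + vangle y z x + vangle z x y - pi) / (4 * pi) * bmeas UNIV)"
 by (simp add: field_simps)
 finally have "T f g h = (vangle x y z + vangle y z x + vangle z x y - pi) / (4 * pi) * bmeas UNIV"
 by linarith
 then show ?thesis by (simp add: T_def cone3_def f_def g_def h_def)
qed

lemma bmeas_cone3_pos:
 assumes D: "x \<bullet> cross3 y z > 0"
 shows "bmeas (cone3 x y z) > 0"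
proof -
 have "x + y + z : cone3 x y z"
 using D cross_triple[of x y z] cross_triple[of y z x]
 by (simp add: cone3_def inner_add_right dot_cross_self inner_commute)
 moreover define q where "q = (x + y + z) /\<^sub>R (2 * norm (x + y + z))"
 ultimately have q: "q : cone3 x y z \<inter> ball 0 1"
 proof -
 assume m: "x + y + z : cone3 x y z"
 then have "x + y + z ~= 0" by (auto simp: cone3_def)
 then show ?thesis using m by (auto simp: q_def cone3_def zero_less_mult_iff)
 qed
 have op: "open (cone3 x y z \<inter> ball 0 1)" by (simp add: open_cone3 open_Int)
 then have "~ negligible (cone3 x y z \<inter> ball 0 1)" using q open_not_negligible by blast
 then show ?thesis
 unfolding bmeas_def using lmeasurable_Int_ball[OF open_cone3, of x y z]
 by (metis measure_nonneg less_eq_real_def negligible_iff_measure0)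
qed

section \<open>Facets of the frequency hull\<close>

definition det3 :: "real^3 => real^3 => real^3 => real" where
 "det3 x y z = x \<bullet> cross3 y z"

lemma det3_cyc: "det3 x y z = det3 y z x"
 and det3_swap: "det3 x y z = - det3 y x z" "det3 x y z = - det3 x z y"
 and det3_add: "det3 x y (z + z') = det3 x y z + det3 x y z'"
 and det3_scale: "det3 x y (c *\<^sub>R z) = c * det3 x y z"
 and det3_neg: "det3 (- x) (- y) (- z) = - det3 x y z"
 and det3_degenerate [simp]: "det3 x x z = 0" "det3 x y x = 0" "det3 x y y = 0"
 and det3_inner: "det3 x y z = cross3 x y \<bullet> z"
 unfolding det3_def by (simp_all add: cross3_simps)

lemma det3_sum: "det3 x y (\<Sum>i\<in>I. f i) = (\<Sum>i\<in>I. det3 x y (f i))"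
 unfolding det3_inner by (rule inner_sum_right)

lemma det3_expand:
 "det3 x y z *\<^sub>R p = det3 p y z *\<^sub>R x + det3 x p z *\<^sub>R y + det3 x y p *\<^sub>R z"
 unfolding det3_def by (simp add: cross3_simps forall_3)

lemma det3_basis:
 assumes "det3 x y z ~= 0"
 shows "p = (det3 p y z / det3 x y z) *\<^sub>R x + (det3 x p z / det3 x y z) *\<^sub>R y
 + (det3 x y p / det3 x y z) *\<^sub>R z"
proof -
 have "p = (1 / det3 x y z) *\<^sub>R (det3 x y z *\<^sub>R p)" using assms by simp
 then show ?thesis unfolding det3_expand[of x y z p] by (simp add: algebra_simps)
qed

text \<open>Square of the direction of the projection of \<open>y\<close> to the plane orthogonal to \<open>x\<close>, in a frame
  of that plane: only lines matter, so directions are recorded up to sign.\<close>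

definition frame_vec :: "real^3 => real^3" where
 "frame_vec x = (SOME k. cross3 x k ~= 0)"

lemma frame_vec: "x ~= 0 ==> cross3 x (frame_vec x) ~= 0"
 unfolding frame_vec_def
proof (rule someI_ex, rule ccontr)
 assume "x ~= 0" and no: "~ (\<exists>k. cross3 x k ~= 0)"
 then have "cross3 x (axis i 1) = 0" for i by blast
 from this[of 1] this[of 2] have "x $ 1 = 0" "x $ 2 = 0" "x $ 3 = 0"
 by (simp_all add: cross3_simps forall_3 axis_def)
 with \<open>x ~= 0\<close> show False by (simp add: vec_eq_iff forall_3)
qed

definition tdir :: "real^3 => real^3 => complex" where
 "tdir x y = Complex (cross3 x (frame_vec x) \<bullet> cross3 x y) (norm x * det3 x (frame_vec x) y)"

definition dirsq :: "complex => complex" where "dirsq z = z / cnj z"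

lemma dirsq_mult: "dirsq (z * w) = dirsq z * dirsq w"
 by (simp add: dirsq_def)

lemma dirsq_real [simp]: "r ~= 0 ==> dirsq (of_real r) = 1"
 by (simp add: dirsq_def)

lemma dirsq_cnj: "dirsq (cnj z) = inverse (dirsq z)"
 by (simp add: dirsq_def)

lemma dirsq_nonzero: "z ~= 0 ==> dirsq z ~= 0"
 by (simp add: dirsq_def)

lemma dirsq_cis: "dirsq (cis x) = cis (2 * x)"
 by (simp add: dirsq_def cis_cnj cis_divide)

lemma cross3_dot_cross3: "cross3 x y \<bullet> cross3 x z = (x \<bullet> x) * (y \<bullet> z) - (x \<bullet> z) * (x \<bullet> y)"
 by (simp add: cross3_simps)

text \<open>Expansion of \<open>cross3 x y\<close> in the orthogonal basis
  \<open>cross3 x k\<close>, \<open>cross3 x (cross3 x k)\<close> of the plane orthogonal to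
  \<open>x\<close>, without denominators.\<close>

lemma cross3_decompose:
 "(cross3 x k \<bullet> cross3 x k) *\<^sub>R cross3 x y
  = (cross3 x k \<bullet> cross3 x y) *\<^sub>R cross3 x k + (cross3 x k \<bullet> y) *\<^sub>R cross3 x (cross3 x k)"
proof -
 have "cross3 (cross3 x k) (cross3 (cross3 x y) (cross3 x k))
 = (cross3 x k \<bullet> cross3 x k) *\<^sub>R cross3 x y - (cross3 x k \<bullet> cross3 x y) *\<^sub>R cross3 x k"
 by (rule Lagrange)
 moreover have "cross3 (cross3 x y) (cross3 x k) = - (cross3 x k \<bullet> y) *\<^sub>R x"
 by (simp add: cross3_simps forall_3)
 ultimately have "(cross3 x k \<bullet> cross3 x k) *\<^sub>R cross3 x y - (cross3 x k \<bullet> cross3 x y) *\<^sub>R cross3 x k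
 = cross3 (cross3 x k) (- (cross3 x k \<bullet> y) *\<^sub>R x)" by simp
 also have "\<dots> = (cross3 x k \<bullet> y) *\<^sub>R cross3 x (cross3 x k)"
 by (simp add: cross_mult_right cross_skew[of "cross3 x k" x])
 finally show ?thesis by (simp add: algebra_simps)
qed

lemma tdir_nonzero:
 assumes "cross3 x y ~= 0"
 shows "tdir x y ~= 0"
proof
 assume "tdir x y = 0"
 let ?k = "frame_vec x"
 have x: "x ~= 0" using assms by auto
 then have e: "cross3 x ?k \<bullet> cross3 x y = 0" "cross3 x ?k \<bullet> y = 0"
 using \<open>tdir x y = 0\<close> by (simp_all add: tdir_def complex_eq_iff det3_inner)
 show False using cross3_decompose[of x ?k y] e assms frame_vec[OF x] by simp
qed

text \<open>Comparing two directions at \<open>x\<close> removes the frame up to a positive factor: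
  what is left has real and imaginary parts proportional to the cosine and sine of the angle between
  them.\<close>

lemma tdir_angle:
 "tdir x z * cnj (tdir x y) = of_real ((norm (cross3 x (frame_vec x)))\<^sup>2)
  * Complex (cross3 x y \<bullet> cross3 x z) (norm x * det3 x y z)"
proof -
 let ?k = "frame_vec x"
 have n2: "norm x * norm x = x \<bullet> x" by (simp add: dot_square_norm power2_eq_square)
 let ?K = "cross3 x ?k"
 have xK: "cross3 x ?K \<bullet> cross3 x z = (x \<bullet> x) * (?K \<bullet> z)"
 by (simp add: cross3_dot_cross3 dot_cross_self)
 have xK': "cross3 x ?K \<bullet> z = - (?K \<bullet> cross3 x z)"
 by (simp add: cross3_simps)
 have re: "(?K \<bullet> cross3 x z) * (?K \<bullet> cross3 x y) + (x \<bullet> x) * (det3 x ?k z * det3 x ?k y)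
 = (?K \<bullet> ?K) * (cross3 x y \<bullet> cross3 x z)"
 using arg_cong[OF cross3_decompose[of x ?k y], of "%v. v \<bullet> cross3 x z"]
 by (simp add: inner_add_left xK det3_inner mult_ac)
 have im: "det3 x ?k z * (?K \<bullet> cross3 x y) - (?K \<bullet> cross3 x z) * det3 x ?k y
 = (?K \<bullet> ?K) * det3 x y z"
 using arg_cong[OF cross3_decompose[of x ?k y], of "%v. v \<bullet> z"]
 by (simp add: inner_add_left xK' det3_inner mult_ac)
 have "(norm x * det3 x ?k z) * (norm x * det3 x ?k y) = (x \<bullet> x) * (det3 x ?k z * det3 x ?k y)"
 unfolding n2[symmetric] by (simp add: mult_ac)
 then have re': "Re (tdir x z * cnj (tdir x y)) = (cross3 x ?k \<bullet> cross3 x ?k) * (cross3 x y \<bullet> cross3 x z)"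
 unfolding re[symmetric] by (simp add: tdir_def)
 have "Im (tdir x z * cnj (tdir x y)) = norm x * ((cross3 x ?k \<bullet> cross3 x ?k) * det3 x y z)"
 unfolding im[symmetric] by (simp add: tdir_def algebra_simps)
 with re' show ?thesis by (simp add: complex_eq_iff dot_square_norm)
qed

lemma cis_vangle:
 assumes D: "det3 x y z > 0"
 shows "Complex (cross3 x y \<bullet> cross3 x z) (norm x * det3 x y z)
 = of_real (norm (cross3 x y) * norm (cross3 x z)) * cis (vangle x y z)"
 and "norm (cross3 x y) * norm (cross3 x z) > 0"
proof -
 define c where "c = cross3 x y \<bullet> cross3 x z"
 define q where "q = norm (cross3 x y) * norm (cross3 x z)"
 have "det3 x y z = - (cross3 x z \<bullet> y)" using det3_swap(2)[of x y z] by (simp add: det3_inner)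
 then have "cross3 x y ~= 0" "cross3 x z ~= 0" "x ~= 0"
 using D by (auto simp: det3_inner)
 then show q: "norm (cross3 x y) * norm (cross3 x z) > 0" by simp
 then have q0: "q > 0" by (simp add: q_def)
 have "cross3 (cross3 x y) (cross3 x z) = det3 x y z *\<^sub>R x"
 unfolding det3_def by (simp add: cross3_simps forall_3)
 then have "(norm (det3 x y z *\<^sub>R x))\<^sup>2 = q\<^sup>2 - c\<^sup>2"
 using norm_cross_dot[of "cross3 x y" "cross3 x z"] by (simp add: q_def c_def)
 then have q2: "q\<^sup>2 = c\<^sup>2 + (norm x * det3 x y z)\<^sup>2"
 by (simp add: power_mult_distrib mult.commute)
 have s0: "norm x * det3 x y z > 0" using D \<open>x ~= 0\<close> by simp
 have "c\<^sup>2 <= q\<^sup>2" unfolding q2 by simp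
 then have "\<bar>c\<bar> <= q" using q0 by (simp add: abs_le_square_iff[symmetric])
 then have b: "-1 <= c / q" "c / q <= 1" using q0 by (auto simp: field_simps abs_le_iff)
 have v: "vangle x y z = arccos (c / q)" by (simp add: vangle_def c_def q_def)
 have "sin (arccos (c / q)) = norm x * det3 x y z / q"
 proof -
 have "sin (arccos (c / q)) = sqrt (1 - (c / q)\<^sup>2)" using b by (rule sin_arccos)
 also have "1 - (c / q)\<^sup>2 = (norm x * det3 x y z / q)\<^sup>2"
 proof -
 have "(norm x * det3 x y z)\<^sup>2 = q\<^sup>2 - c\<^sup>2" unfolding q2 by simp
 then show ?thesis unfolding power_divide using q0 by (simp only: diff_divide_distrib) simp
 qed
 also have "sqrt \<dots> = norm x * det3 x y z / q" using s0 q0 by simp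
 finally show ?thesis .
 qed
 then have "of_real q * cis (vangle x y z) = Complex c (norm x * det3 x y z)"
 unfolding v using b q0 by (simp add: complex_eq_iff)
 then show "Complex (cross3 x y \<bullet> cross3 x z) (norm x * det3 x y z)
 = of_real (norm (cross3 x y) * norm (cross3 x z)) * cis (vangle x y z)"
 by (simp add: c_def q_def)
qed

text \<open>The angle is doubled because \<open>dirsq\<close> forgets the sign of a direction; this
  loses nothing, as angle sums are only needed modulo \<open>pi\<close>.\<close>

lemma cis_2_vangle:
 assumes D: "det3 x y z > 0"
 shows "cis (2 * vangle x y z) = dirsq (tdir x z) / dirsq (tdir x y)"
proof -
 have x: "x ~= 0" using D by (auto simp: det3_def)
 have "dirsq (tdir x z * cnj (tdir x y)) = dirsq (cis (vangle x y z))"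
 proof -
 have "(norm (cross3 x (frame_vec x)))\<^sup>2 ~= 0" "norm (cross3 x y) * norm (cross3 x z) ~= 0"
 using cis_vangle(2)[OF D] frame_vec[OF x] by auto
 from this[THEN dirsq_real] show ?thesis
 unfolding tdir_angle cis_vangle(1)[OF D] dirsq_mult by (simp only: mult_1_left)
 qed
 then show ?thesis by (simp add: dirsq_mult dirsq_cnj dirsq_cis divide_inverse)
qed

definition solid_angle :: "real^3 => real^3 => real^3 => real" where
 "solid_angle x y z = vangle x y z + vangle y z x + vangle z x y - pi"

lemma bmeas_cone3_solid_angle:
 "det3 x y z > 0 ==> bmeas (cone3 x y z) = solid_angle x y z / (4 * pi) * bmeas UNIV"
 unfolding solid_angle_def by (rule bmeas_cone3) (simp add: det3_def)

lemma solid_angle_pos: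
 assumes "det3 x y z > 0"
 shows "solid_angle x y z > 0"
proof -
 have "0 < solid_angle x y z / (4 * pi) * bmeas UNIV"
 using bmeas_cone3_pos[of x y z] assms bmeas_cone3_solid_angle[OF assms] by (simp add: det3_def)
 then show ?thesis using bmeas_UNIV_pos by (simp add: zero_less_mult_iff zero_less_divide_iff)
qed

lemma cis_2_solid_angle:
 assumes "det3 x y z > 0"
 shows "cis (2 * solid_angle x y z) = (dirsq (tdir x z) / dirsq (tdir x y))
 * (dirsq (tdir y x) / dirsq (tdir y z)) * (dirsq (tdir z y) / dirsq (tdir z x))"
proof -
 have c: "det3 y z x > 0" "det3 z x y > 0" using assms det3_cyc[of x y z] det3_cyc[of y z x] by simp_all
 have "2 * solid_angle x y z = 2 * vangle x y z + 2 * vangle y z x + 2 * vangle z x y - 2 * pi"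
 by (simp add: solid_angle_def)
 then have "cis (2 * solid_angle x y z) = cis (2 * vangle x y z) * cis (2 * vangle y z x) * cis (2 * vangle z x y)"
 by (simp add: cis_mult cis_divide[symmetric])
 then show ?thesis unfolding cis_2_vangle[OF assms] cis_2_vangle[OF c(1)] cis_2_vangle[OF c(2)] by simp
qed

lemma cone3_coords:
 assumes "det3 x y z > 0" "p : cone3 x y z"
 obtains a b c where "a > 0" "b > 0" "c > 0" "p = a *\<^sub>R x + b *\<^sub>R y + c *\<^sub>R z"
proof (rule that)
 have "det3 p y z > 0" "det3 x p z > 0" "det3 x y p > 0"
 using assms(2) unfolding cone3_def det3_inner
 by (simp_all add: inner_commute) (simp_all add: cross3_simps)
 then show "det3 p y z / det3 x y z > 0" "det3 x p z / det3 x y z > 0" "det3 x y p / det3 x y z > 0"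
 using assms(1) by simp_all
 show "p = (det3 p y z / det3 x y z) *\<^sub>R x + (det3 x p z / det3 x y z) *\<^sub>R y
 + (det3 x y p / det3 x y z) *\<^sub>R z" by (rule det3_basis) (use assms in simp)
qed

text \<open>A facet functional of the polytope spanned by \<open>S\<close>, and the positively oriented boundary edges of
  the facet. Points of \<open>S\<close> in the interior of an edge are allowed.\<close>

definition facet :: "(real^3) set => real^3 => bool" where
 "facet S l \<longleftrightarrow> (ALL n:S. l \<bullet> n <= 1) & span {n\<in>S. l \<bullet> n = 1} = UNIV"

definition facet_points :: "(real^3) set => real^3 => (real^3) set" where
 "facet_points S l = {n\<in>S. l \<bullet> n = 1}"

definition facet_edges :: "(real^3) set => real^3 => ((real^3) \<times> (real^3)) set" where
 "facet_edges S l = {(v, w). v : facet_points S l & w : facet_points S l & v ~= w &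
  (ALL y:facet_points S l. det3 v w y >= 0 &
 (det3 v w y = 0 --> (EX t:{0..1}. y = (1 - t) *\<^sub>R v + t *\<^sub>R w)))}"

lemma not_spanning_orthogonal:
 fixes X :: "'a::euclidean_space set"
 assumes "span X ~= UNIV"
 obtains x where "x ~= 0" "!!y. y : span X ==> x \<bullet> y = 0"
proof -
 have "dim X < DIM('a)"
 using assms dim_subset_UNIV[of X] by (simp add: order.strict_iff_order dim_eq_full)
 then obtain x where "x ~= 0" "!!y. y : span X ==> orthogonal x y"
 by (rule orthogonal_to_subspace_exists) blast
 then show ?thesis using that by (simp add: orthogonal_def)
qed

text \<open>The facet functionals are the extreme points of the polar body \<open>K\<close>. It is
  bounded since \<open>S\<close> is symmetric and spanning, and it is a neighbourhood of the origin,
  so its extreme points span the space.\<close>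

lemma exists_facets:
 fixes S :: "(real^3) set"
 assumes fin: "finite S" and sym: "!!n. n : S ==> - n : S" and sp: "span S = UNIV"
 obtains L where "card L = 3" "independent L" "!!l. l : L ==> facet S l"
proof -
 define K where "K = {l. ALL n:S. l \<bullet> n <= 1}"
 have K_eq: "K = (\<Inter>n\<in>S. {l. l \<bullet> n <= 1})" by (auto simp: K_def)
 have clK: "closed K" unfolding K_eq by (intro closed_INT ballI closed_Collect_le continuous_intros)
 have cvK: "convex K" unfolding K_eq
 by (intro convex_INT) (simp add: inner_commute convex_halfspace_le)
 have boundK: "\<bar>l \<bullet> n\<bar> <= 1" if "l : K" "n : S" for l n
 using that sym[of n] unfolding K_def by (force simp: abs_le_iff)
 have "bounded K"
 proof -
 have "\<exists>B. ALL l:K. \<bar>l \<bullet> x\<bar> <= B" for x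
 proof -
 have "x : span S" using sp by simp
 then show ?thesis
 proof (induction rule: span_induct_alt)
 case base then show ?case by auto
 next
 case (step c n y)
 then obtain B where B: "ALL l:K. \<bar>l \<bullet> y\<bar> <= B" by blast
 have "\<bar>l \<bullet> (c *\<^sub>R n + y)\<bar> <= \<bar>c\<bar> + B" if "l : K" for l
 proof -
 have "\<bar>l \<bullet> (c *\<^sub>R n + y)\<bar> <= \<bar>c\<bar> * \<bar>l \<bullet> n\<bar> + \<bar>l \<bullet> y\<bar>"
 unfolding inner_add_right inner_scaleR_right abs_mult[symmetric] by (rule abs_triangle_ineq)
 also have "\<dots> <= \<bar>c\<bar> * 1 + B" using boundK[OF that step(1)] B that by (intro add_mono mult_left_mono) auto
 finally show ?thesis by simp
 qed
 then show ?case by blast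
 qed
 qed
 then obtain B where B: "!!x l. l : K ==> \<bar>l \<bullet> x\<bar> <= B x" by metis
 have "norm l <= (\<Sum>b\<in>Basis. B b)" if "l : K" for l
 using norm_le_l1[of l] sum_mono[of Basis "%b. \<bar>l \<bullet> b\<bar>" B] B[OF that] by (meson order_trans)
 then show ?thesis by (auto simp: bounded_iff)
 qed
 then have compK: "compact K" using clK by (simp add: compact_eq_bounded_closed)
 let ?E = "{l. l extreme_point_of K}"
 have hull: "K = convex hull ?E" by (rule Krein_Milman_Minkowski[OF compK cvK])
 have spE: "span ?E = UNIV"
 proof (rule ccontr)
 assume "span ?E ~= UNIV"
 then obtain x where x: "x ~= 0" "!!y. y : span ?E ==> x \<bullet> y = 0"
 by (rule not_spanning_orthogonal) blast
 have Kx: "x \<bullet> l = 0" if "l : K" for l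
 proof -
 have "convex hull ?E \<subseteq> span ?E"
 by (meson convex_hull_subset_span)
 then show ?thesis using x(2) hull that by blast
 qed
 \<comment> \<open>A short multiple of a vector orthogonal to all extreme points still lies in
   \<open>K\<close>, hence in their hull, which is absurd.\<close>
 have "eventually (%eps. ALL n:S. 0 + eps * (x \<bullet> n) < 1 + eps * 0) (at_right 0)"
 using fin by (simp only: eventually_ball_finite_distrib) (intro ballI eventually_perturb_less, simp)
 then obtain eps where e: "eps > 0" "ALL n:S. 0 + eps * (x \<bullet> n) < 1 + eps * 0" by (rule obtain_at_right)
 then have "eps *\<^sub>R x : K" by (auto simp: K_def less_imp_le)
 then have "x \<bullet> (eps *\<^sub>R x) = 0" by (rule Kx)
 then show False using e x by simp
 qed
 have facetE: "facet S l" if "l : ?E" for l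
 unfolding facet_def
 proof
 have l: "l extreme_point_of K" using that by simp
 then have lK: "l : K" by (simp add: extreme_point_of_def)
 then show le: "ALL n:S. l \<bullet> n <= 1" by (simp add: K_def)
 show "span {n\<in>S. l \<bullet> n = 1} = UNIV"
 proof (rule ccontr)
 let ?F = "{n\<in>S. l \<bullet> n = 1}"
 assume "span ?F ~= UNIV"
 then obtain x where x: "x ~= 0" "!!y. y : span ?F ==> x \<bullet> y = 0"
 by (rule not_spanning_orthogonal) blast
 \<comment> \<open>If the tight constraints do not span, \<open>l\<close> can be moved a little in
   both directions along \<open>x\<close> within \<open>K\<close> and is not extreme.\<close>
 have ev: "eventually (%eps. ALL n:S. l \<bullet> n + eps * (z \<bullet> n) <= 1) (at_right 0)" if z: "z = x | z = - x" for z
 proof -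
 have "eventually (%eps. l \<bullet> n + eps * (z \<bullet> n) <= 1) (at_right 0)" if n: "n : S" for n
 proof (cases "l \<bullet> n = 1")
 case True
 then have "x \<bullet> n = 0" using x(2)[of n] n by (simp add: span_base)
 then show ?thesis using True z by auto
 next
 case False
 then have "l \<bullet> n < 1" using le n by force
 then show ?thesis using eventually_perturb_less[of "l \<bullet> n" 1 "z \<bullet> n" 0]
 by (auto elim: eventually_mono)
 qed
 then show ?thesis using fin by (simp add: eventually_ball_finite_distrib)
 qed
 have "eventually (%eps. (ALL n:S. l \<bullet> n + eps * (x \<bullet> n) <= 1) & (ALL n:S. l \<bullet> n + eps * ((- x) \<bullet> n) <= 1)) (at_right 0)"
 by (intro eventually_conj ev) auto
 then obtain eps where e: "eps > 0" "ALL n:S. l \<bullet> n + eps * (x \<bullet> n) <= 1" "ALL n:S. l \<bullet> n + eps * ((- x) \<bullet> n) <= 1"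
 by (rule obtain_at_right) auto
 have k: "l + eps *\<^sub>R x : K" "l - eps *\<^sub>R x : K"
 using e by (auto simp: K_def inner_add_left inner_diff_left)
 have "l = midpoint (l + eps *\<^sub>R x) (l - eps *\<^sub>R x)" by (simp add: midpoint_def scaleR_2[symmetric])
 moreover have "l + eps *\<^sub>R x ~= l - eps *\<^sub>R x" using e x by (simp add: eq_diff_eq add_eq_0_iff2 algebra_simps scaleR_2[symmetric])
 ultimately have "l : open_segment (l + eps *\<^sub>R x) (l - eps *\<^sub>R x)" by (metis midpoint_in_open_segment)
 then show False using l k unfolding extreme_point_of_def by blast
 qed
 qed
 obtain L where L: "L \<subseteq> ?E" "independent L" "?E \<subseteq> span L" "card L = dim ?E"
 using basis_exists by blast
 have "dim ?E = DIM(real^3)" using spE by (simp only: dim_eq_full)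
 then show ?thesis using that L facetE by auto
qed

lemma cross3_eq_0D:
 assumes "cross3 v w = 0" "w ~= 0"
 shows "\<exists>c. v = c *\<^sub>R w"
proof -
 have "(w \<bullet> w) *\<^sub>R v = (w \<bullet> v) *\<^sub>R w"
 using Lagrange[of w v w] assms(1) by simp
 moreover have "v = (1 / (w \<bullet> w)) *\<^sub>R ((w \<bullet> w) *\<^sub>R v)" using assms(2) by simp
 ultimately have "v = (1 / (w \<bullet> w)) *\<^sub>R ((w \<bullet> v) *\<^sub>R w)" by simp
 then show ?thesis by (metis scaleR_scaleR)
qed

lemma cis_sum: "cis (\<Sum>x\<in>I. f x) = (\<Prod>x\<in>I. cis (f x))"
 by (induction I rule: infinite_finite_induct) (auto simp: cis_mult[symmetric])

lemma span_image_uminus: "span (uminus ` X) = uminus ` span (X::'a::real_vector set)"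
 by (rule linear_span_image) (simp add: linear_iff)

section \<open>The boundary cycle of a facet\<close>

locale polytope_facet =
 fixes S :: "(real^3) set" and l :: "real^3"
 assumes fin: "finite S" and sym: "!!n. n : S ==> - n : S" and fac: "facet S l"
begin

abbreviation F where "F \<equiv> facet_points S l"
abbreviation E where "E \<equiv> facet_edges S l"

lemma finF: "finite F" using fin by (simp add: facet_points_def)

lemma Fl: "y : F ==> l \<bullet> y = 1" and FS: "y : F ==> y : S" and Sl: "y : S ==> l \<bullet> y <= 1"
 and F_I: "y : S ==> l \<bullet> y = 1 ==> y : F"
 using fac by (auto simp: facet_points_def facet_def)

lemma spanF: "span F = UNIV" using fac by (simp add: facet_def facet_points_def)

lemma F_nonzero: "y : F ==> y ~= 0" using Fl by force

lemma F_cross: 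
 assumes "v : F" "w : F" "v ~= w" 
 shows "cross3 v w ~= 0"
proof
 assume "cross3 v w = 0"
 then obtain c where c: "v = c *\<^sub>R w" using cross3_eq_0D F_nonzero assms by blast
 then have "c = 1" using Fl[OF assms(1)] Fl[OF assms(2)] by simp
 then show False using c assms by simp
qed

lemma not_all_perp:
 assumes "m ~= 0"
 obtains y where "y : F" "m \<bullet> y ~= 0"
proof (rule ccontr)
 assume "~ thesis"
 then have "F \<subseteq> {y. m \<bullet> y = 0}" using that by auto
 then have "span F \<subseteq> {y. m \<bullet> y = 0}" by (intro span_minimal subspace_hyperplane) auto
 then have "m \<bullet> m = 0" using spanF by blast
 then show False using assms by simp
qed

lemma line_param:
 assumes "v : F" "w : F" "v ~= w" "l \<bullet> y = 1" "det3 v w y = 0"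
 obtains t where "y = (1 - t) *\<^sub>R v + t *\<^sub>R w"
proof -
 let ?m = "cross3 v w"
 have m: "det3 v w ?m ~= 0" using F_cross[OF assms(1-3)] by (simp add: det3_inner)
 define a b where "a = det3 y w ?m / det3 v w ?m" and "b = det3 v y ?m / det3 v w ?m"
 have y: "y = a *\<^sub>R v + b *\<^sub>R w"
 using det3_basis[OF m, of y] assms(5) by (simp add: a_def b_def)
 have "a + b = 1" using arg_cong[OF y, of "%x. l \<bullet> x"] assms(4) Fl[OF assms(1)] Fl[OF assms(2)]
 by (simp add: inner_add_right)
 then have "a = 1 - b" by simp
 then show ?thesis using that y by blast
qed

text \<open>Seen from the exposed point \<open>v\<close>, every other point of the facet has a slope
  \<open>\<gamma> / k\<close>. The least slope belongs to the next boundary edge in positive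
  orientation, and the farthest point of that slope is its end.\<close>

lemma out_edge:
 assumes v: "v : F" and c: "!!y. y : F ==> y ~= v ==> c \<bullet> y < c \<bullet> v"
 obtains w where "(v, w) : E"
proof -
 have nz: "v ~= 0" using F_nonzero[OF v] .
 obtain y0 where y0: "y0 : F" "y0 ~= v"
 proof -
 obtain i where "cross3 v i ~= 0" using frame_vec[OF nz] by blast
 then obtain y where y: "y : F" "cross3 v i \<bullet> y ~= 0" by (rule not_all_perp)
 then have "y ~= v" by (auto simp: inner_commute dot_cross_self)
 then show ?thesis using that y by blast
 qed
 obtain z0 where z0: "z0 : F" "cross3 v y0 \<bullet> z0 ~= 0"
 using not_all_perp[OF F_cross[OF v y0(1)]] y0(2) by metis
 have "EX y1:F. EX z1:F. det3 v y1 z1 > 0"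
 proof (cases "det3 v y0 z0 > 0")
 case True then show ?thesis using y0 z0 by blast
 next
 case False
 then have "det3 v z0 y0 > 0" using z0(2) det3_swap(2)[of v y0 z0] by (simp add: det3_inner)
 then show ?thesis using y0 z0 by blast
 qed
 then obtain y1 z1 where yz: "y1 : F" "z1 : F" "det3 v y1 z1 > 0" by blast
 define D where "D = det3 v y1 z1"
 define \<beta> \<gamma> where "\<beta> y = det3 v y z1 / D" and "\<gamma> y = det3 v y1 y / D" for y
 define k where "k y = c \<bullet> (v - y)" for y
 have D0: "D > 0" using yz by (simp add: D_def)
 have ex: "y = (1 - \<beta> y - \<gamma> y) *\<^sub>R v + \<beta> y *\<^sub>R y1 + \<gamma> y *\<^sub>R z1" if "y : F" for y
 proof -
 define a where "a = det3 y y1 z1 / D"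
 have y: "y = a *\<^sub>R v + \<beta> y *\<^sub>R y1 + \<gamma> y *\<^sub>R z1"
 using det3_basis[of v y1 z1 y] yz(3) by (simp add: a_def \<beta>_def \<gamma>_def D_def)
 have "a + \<beta> y + \<gamma> y = 1"
 using arg_cong[OF y, of "%x. l \<bullet> x"] Fl v yz that by (simp add: inner_add_right)
 then have "a = 1 - \<beta> y - \<gamma> y" by simp
 then show ?thesis using y by metis
 qed
 have k_eq: "k y = \<beta> y * k y1 + \<gamma> y * k z1" if "y : F" for y
 unfolding k_def
 by (subst ex[OF that]) (simp add: inner_diff_right inner_add_right algebra_simps)
 have kpos: "k y > 0" if "y : F" "y ~= v" for y
 using c[OF that] by (simp add: k_def inner_diff_right)
 have det: "det3 v y z = (\<beta> y * \<gamma> z - \<gamma> y * \<beta> z) * D" if "y : F" "z : F" for y z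
 proof -
 have "det3 v y z = det3 v y ((1 - \<beta> z - \<gamma> z) *\<^sub>R v + \<beta> z *\<^sub>R y1 + \<gamma> z *\<^sub>R z1)"
 using ex[OF that(2)] by simp
 also have "\<dots> = \<beta> z * det3 v y y1 + \<gamma> z * det3 v y z1" by (simp add: det3_add det3_scale)
 also have "det3 v y y1 = - \<gamma> y * D" using det3_swap(2)[of v y y1] D0 by (simp add: \<gamma>_def)
 also have "det3 v y z1 = \<beta> y * D" using D0 by (simp add: \<beta>_def)
 finally show ?thesis by (simp add: algebra_simps)
 qed
 have y1v: "y1 ~= v" "z1 ~= v" using yz by auto
 let ?X = "F - {v}"
 have X: "finite ?X" "?X ~= {}" using finF y0 by auto
 obtain w where w: "w : ?X" "!!y. y : ?X ==> - (\<gamma> y / k y) <= - (\<gamma> w / k w)"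
 "!!y. y : ?X ==> - (\<gamma> y / k y) = - (\<gamma> w / k w) ==> k y <= k w"
 using finite_argmax_lex[OF X, of "%y. - (\<gamma> y / k y)" k] by blast
 have kw: "k w > 0" using kpos w by auto
 have "(v, w) : E"
 unfolding facet_edges_def
 proof (clarify, intro conjI ballI)
 show "v : F" "w : F" "v ~= w" using v w by auto
 fix z assume z: "z : F"
 have main: "0 <= det3 v w z & (det3 v w z = 0 --> (EX t:{0..1}. z = (1 - t) *\<^sub>R v + t *\<^sub>R w))"
 proof (cases "z = v")
 case True
 then show ?thesis by (auto intro!: bexI[of _ 0])
 next
 case False
 then have kz: "k z > 0" using kpos z by auto
 have le: "\<gamma> w * k z <= \<gamma> z * k w" using w(2)[of z] z False kw kz by (simp add: field_simps)
 have A: "k y1 > 0" using kpos yz y1v by auto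
 have rew: "\<gamma> z * k w - \<gamma> w * k z = k y1 * (\<beta> w * \<gamma> z - \<gamma> w * \<beta> z)"
 unfolding k_eq[OF z] k_eq[of w, OF \<open>w : F\<close>] by (simp add: algebra_simps)
 then have "k y1 * (\<beta> w * \<gamma> z - \<gamma> w * \<beta> z) >= 0" using le by simp
 then have nn: "\<beta> w * \<gamma> z - \<gamma> w * \<beta> z >= 0" using A by (simp add: zero_le_mult_iff)
 show ?thesis
 proof (intro conjI impI)
 show "0 <= det3 v w z" unfolding det[OF \<open>w : F\<close> z] using nn D0 by simp
 assume d0: "det3 v w z = 0"
 obtain t where t: "z = (1 - t) *\<^sub>R v + t *\<^sub>R w"
 using line_param[OF v \<open>w : F\<close> \<open>v ~= w\<close> Fl[OF z] d0] by blast
 have kt: "k z = t * k w" unfolding k_def by (subst t) (simp add: inner_diff_right inner_add_right algebra_simps)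
 have "\<beta> w * \<gamma> z - \<gamma> w * \<beta> z = 0" using d0 D0 unfolding det[OF \<open>w : F\<close> z] by simp
 then have "\<gamma> z * k w = \<gamma> w * k z" using rew by simp
 then have "k z <= k w" using w(3)[of z] z False kw kz by (simp add: field_simps)
 then have "0 <= t" "t <= 1" using kt kz kw by (simp_all add: zero_less_mult_iff)
 then show "EX t:{0..1}. z = (1 - t) *\<^sub>R v + t *\<^sub>R w" using t by auto
 qed
 qed
 show "0 <= det3 v w z" "det3 v w z = 0 --> (EX t:{0..1}. z = (1 - t) *\<^sub>R v + t *\<^sub>R w)"
 using main by auto
 qed
 then show ?thesis by (rule that)
qed

lemma edgeD:
 assumes "(v, w) : E"
 shows "v : F" "w : F" "v ~= w" "!!y. y : F ==> det3 v w y >= 0"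
 "!!y. y : F ==> det3 v w y = 0 ==> EX t:{0..1}. y = (1 - t) *\<^sub>R v + t *\<^sub>R w"
 using assms by (auto simp: facet_edges_def)

text \<open>The functional supporting the edge is tilted towards the chosen end.\<close>

lemma edge_end_exposed:
 assumes e: "(v, w) : E" and x: "x = v & x' = w | x = w & x' = v"
 obtains c where "!!y. y : F ==> y ~= x ==> c \<bullet> y < c \<bullet> x"
proof -
 have "eventually (%eps. ALL y:F - {x}. - det3 v w y + eps * ((x - x') \<bullet> y) < - det3 v w x + eps * ((x - x') \<bullet> x)) (at_right 0)"
 proof (rule finite_perturb)
 show "finite (F - {x})" using finF by simp
 fix y assume y: "y : F - {x}"
 have xx: "det3 v w x = 0" using x by auto
 show "- det3 v w y < - det3 v w x | - det3 v w y = - det3 v w x & (x - x') \<bullet> y < (x - x') \<bullet> x"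
 proof (cases "det3 v w y = 0")
 case False
 then show ?thesis using edgeD(4)[OF e, of y] y xx by auto
 next
 case True
 then obtain t where t: "t : {0..1}" "y = (1 - t) *\<^sub>R v + t *\<^sub>R w" using edgeD(5)[OF e, of y] y by auto
 have "\<exists>s>0. x - y = s *\<^sub>R (x - x')"
 using x
 proof
 assume h: "x = v & x' = w"
 have "x - y = t *\<^sub>R (x - x')" using h t by (simp add: algebra_simps)
 moreover have "t ~= 0" using h t y by auto
 ultimately show ?thesis using t by (intro exI[of _ t]) auto
 next
 assume h: "x = w & x' = v"
 have "x - y = (1 - t) *\<^sub>R (x - x')" using h t by (simp add: algebra_simps)
 moreover have "t ~= 1" using h t y by auto
 ultimately show ?thesis using t by (intro exI[of _ "1 - t"]) auto
 qed
 then obtain s where s: "s > 0" "x - y = s *\<^sub>R (x - x')" by blast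
 have "x ~= x'" using x edgeD(3)[OF e] by auto
 then have "(x - x') \<bullet> (x - y) > 0" using s by simp
 then show ?thesis using True xx by (simp add: inner_diff_right)
 qed
 qed
 then obtain eps where "ALL y:F - {x}. - det3 v w y + eps * ((x - x') \<bullet> y) < - det3 v w x + eps * ((x - x') \<bullet> x)"
 by (rule obtain_at_right)
 then have "(eps *\<^sub>R (x - x') - cross3 v w) \<bullet> y < (eps *\<^sub>R (x - x') - cross3 v w) \<bullet> x" if "y : F" "y ~= x" for y
 using that by (force simp: inner_diff_left det3_inner)
 then show ?thesis by (rule that)
qed

lemma exposed_in_S:
 assumes "x : F" "!!y. y : F ==> y ~= x ==> c \<bullet> y < c \<bullet> x"
 obtains g where "!!y. y : S ==> y ~= x ==> g \<bullet> y < g \<bullet> x"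
proof -
 have "eventually (%eps. ALL y:S - {x}. l \<bullet> y + eps * (c \<bullet> y) < l \<bullet> x + eps * (c \<bullet> x)) (at_right 0)"
 proof (rule finite_perturb)
 show "finite (S - {x})" using fin by simp
 fix y assume y: "y : S - {x}"
 show "l \<bullet> y < l \<bullet> x | l \<bullet> y = l \<bullet> x & c \<bullet> y < c \<bullet> x"
 using Sl[of y] Fl[OF assms(1)] assms(2)[of y] F_I[of y] y by force
 qed
 then obtain eps where "ALL y:S - {x}. l \<bullet> y + eps * (c \<bullet> y) < l \<bullet> x + eps * (c \<bullet> x)" by (rule obtain_at_right)
 then have "(l + eps *\<^sub>R c) \<bullet> y < (l + eps *\<^sub>R c) \<bullet> x" if "y : S" "y ~= x" for y
 using that by (force simp: inner_add_left)
 then show ?thesis by (rule that)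
qed

text \<open>Turning the facet functional slightly about the edge leaves the edge as the set where
  the maximum is attained.\<close>

lemma edge_functional:
 assumes e: "(v, w) : E"
 obtains g where "g \<bullet> v = 1" "g \<bullet> w = 1" "!!y. y : S ==> g \<bullet> y <= 1"
 "!!y. y : S ==> g \<bullet> y = 1 ==> EX t:{0..1}. y = (1 - t) *\<^sub>R v + t *\<^sub>R w"
proof -
 let ?X = "{y\<in>S. ~ (EX t:{0..1}. y = (1 - t) *\<^sub>R v + t *\<^sub>R w)}"
 note vw = edgeD(1-3)[OF e]
 have "eventually (%eps. ALL y:?X. l \<bullet> y + eps * (- det3 v w y) < l \<bullet> v + eps * (- det3 v w v)) (at_right 0)"
 proof (rule finite_perturb)
 show "finite ?X" using fin by simp
 fix y assume y: "y : ?X"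
 show "l \<bullet> y < l \<bullet> v | l \<bullet> y = l \<bullet> v & - det3 v w y < - det3 v w v"
 proof (cases "l \<bullet> y = 1")
 case True
 then have "y : F" using F_I y by auto
 then have "det3 v w y > 0" using edgeD(4,5)[OF e, of y] y by force
 then show ?thesis using True Fl[OF vw(1)] by simp
 next
 case False
 then show ?thesis using Sl[of y] Fl[OF vw(1)] y by force
 qed
 qed
 then obtain eps where eps: "ALL y:?X. l \<bullet> y + eps * (- det3 v w y) < l \<bullet> v + eps * (- det3 v w v)"
 by (rule obtain_at_right)
 define g where "g = l - eps *\<^sub>R cross3 v w"
 have g: "g \<bullet> y = l \<bullet> y - eps * det3 v w y" for y by (simp add: g_def inner_diff_left det3_inner)
 have g1: "g \<bullet> v = 1" "g \<bullet> w = 1" using Fl vw by (simp_all add: g)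
 have X: "g \<bullet> y < 1" if "y : ?X" for y using eps that Fl[OF vw(1)] by (simp add: g)
 have nX: "g \<bullet> y = 1" if "y : S" "y ~: ?X" for y
 using that g1 by (auto simp: inner_add_right)
 show ?thesis
 proof (rule that[of g])
 fix y assume y: "y : S"
 show "g \<bullet> y <= 1" using X[of y] nX[of y] y by force
 show "g \<bullet> y = 1 ==> EX t:{0..1}. y = (1 - t) *\<^sub>R v + t *\<^sub>R w" using X[of y] y by force
 qed (use g1 in auto)
qed

lemma edge_next: "(v, w) : E ==> \<exists>x. (w, x) : E"
 using edge_end_exposed[of v w w v] out_edge edgeD(2) by metis

lemma edge_exists: "E ~= {}"
proof -
 obtain c where c: "inj_on (%x. c \<bullet> x) F" using injective_functional[OF finF] by blast
 have "F ~= {}"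
 proof
 assume "F = {}"
 then show False using not_all_perp[of "axis 1 1"] by auto
 qed
 then obtain v where v: "v : F" "!!y. y : F ==> c \<bullet> y <= c \<bullet> v"
 using finite_argmax[OF finF, of "%x. c \<bullet> x"] by blast
 have "c \<bullet> y < c \<bullet> v" if "y : F" "y ~= v" for y
 using v(2)[OF that(1)] inj_onD[OF c _ that(1) v(1)] that(2) by force
 then show ?thesis using out_edge[OF v(1)] by blast
qed

text \<open>The opposite facet has the reflected edges in reversed orientation. Statements on
  outgoing edges thereby yield those on incoming ones.\<close>

lemma reflect: "polytope_facet S (- l)"
proof
 have "{n : S. - l \<bullet> n = 1} = uminus ` {n : S. l \<bullet> n = 1}"
 proof (intro equalityI subsetI)
 fix x assume "x : {n : S. - l \<bullet> n = 1}"
 then have "- x : {n : S. l \<bullet> n = 1}" using sym by auto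
 then show "x : uminus ` {n : S. l \<bullet> n = 1}" by (rule rev_image_eqI) simp
 qed (use sym in auto)
 then have "span {n : S. - l \<bullet> n = 1} = uminus ` span {n : S. l \<bullet> n = 1}"
 by (simp only: span_image_uminus)
 then have "span {n : S. - l \<bullet> n = 1} = UNIV" using fac by (simp add: facet_def)
 then show "facet S (- l)" using fac sym unfolding facet_def by force
qed (use fin sym in auto)

lemma facet_points_reflect: "y : facet_points S (- l) \<longleftrightarrow> - y : F"
 using sym by (force simp: facet_points_def)

lemma reflect_edge_imp:
 assumes "(v, w) : E"
 shows "(- w, - v) : facet_edges S (- l)"
 unfolding facet_edges_def
proof (clarify, intro conjI ballI)
 note e = edgeD[OF assms]
 show "- w : facet_points S (- l)" "- v : facet_points S (- l)" "- w ~= - v"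
 using e(1-3) by (simp_all add: facet_points_reflect)
 fix y assume "y : facet_points S (- l)"
 then have y: "- y : F" by (simp add: facet_points_reflect)
 have d: "det3 (- w) (- v) y = det3 v w (- y)"
 using det3_neg[of w v "- y"] det3_swap(1)[of w v "- y"] by simp
 show "0 <= det3 (- w) (- v) y" unfolding d by (rule e(4)[OF y])
 show "det3 (- w) (- v) y = 0 --> (EX t:{0..1}. y = (1 - t) *\<^sub>R (- w) + t *\<^sub>R (- v))"
 unfolding d
 proof
 assume "det3 v w (- y) = 0"
 then obtain t where t: "t : {0..1}" "- y = (1 - t) *\<^sub>R v + t *\<^sub>R w" using e(5)[OF y] by blast
 have "y = - ((1 - t) *\<^sub>R v + t *\<^sub>R w)" unfolding t(2)[symmetric] by simp
 then have "y = (1 - (1 - t)) *\<^sub>R (- w) + (1 - t) *\<^sub>R (- v)" by (simp add: algebra_simps)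
 then show "EX t:{0..1}. y = (1 - t) *\<^sub>R (- w) + t *\<^sub>R (- v)"
 using t(1) by (intro bexI[of _ "1 - t"]) auto
 qed
qed

lemma reflect_edge: "(v, w) : E \<longleftrightarrow> (- w, - v) : facet_edges S (- l)"
 using reflect_edge_imp polytope_facet.reflect_edge_imp[OF reflect, of "- w" "- v"] by auto

lemma edge_prev: "(v, w) : E ==> \<exists>x. (x, v) : E"
proof -
 assume "(v, w) : E"
 then have "(- w, - v) : facet_edges S (- l)" by (simp add: reflect_edge)
 then obtain x where "(- v, x) : facet_edges S (- l)" using polytope_facet.edge_next[OF reflect] by blast
 then have "(- x, v) : E" by (simp add: reflect_edge)
 then show ?thesis by blast
qed

text \<open>The determinants of the two end points with respect to the two edges are nonnegative and
  opposite, so they vanish; then each end lies on the segment to the other.\<close>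

lemma edge_out_unique:
 assumes "(v, w) : E" "(v, w') : E"
 shows "w = w'"
proof -
 have z: "det3 v w w' = 0"
 using edgeD(4)[OF assms(1), of w'] edgeD(4)[OF assms(2), of w] edgeD(2)[OF assms(1)]
 edgeD(2)[OF assms(2)] det3_swap(2)[of v w w'] by simp
 then have z': "det3 v w' w = 0" using det3_swap(2)[of v w w'] by simp
 obtain t where t: "t : {0..1}" "w' = (1 - t) *\<^sub>R v + t *\<^sub>R w"
 using edgeD(5)[OF assms(1) edgeD(2)[OF assms(2)] z] by blast
 obtain s where s: "s : {0..1}" "w = (1 - s) *\<^sub>R v + s *\<^sub>R w'"
 using edgeD(5)[OF assms(2) edgeD(2)[OF assms(1)] z'] by blast
 have 1: "w' - v = t *\<^sub>R (w - v)" using t(2) by (simp add: algebra_simps)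
 have 2: "w - v = s *\<^sub>R (w' - v)" using s(2) by (simp add: algebra_simps)
 have "w - v = s *\<^sub>R (t *\<^sub>R (w - v))" using 2 unfolding 1 .
 then have "w - v = (s * t) *\<^sub>R (w - v)" unfolding scaleR_scaleR .
 then have "(1 - s * t) *\<^sub>R (w - v) = 0" by (simp only: scaleR_left_diff_distrib scaleR_one diff_self)
 then have "s * t = 1" using edgeD(3)[OF assms(1)] by simp
 moreover have "s * t <= 1 * t" using s t by (intro mult_right_mono) auto
 ultimately have "t = 1" using t by auto
 then show ?thesis using t by simp
qed

lemma edge_in_unique: "(v, w) : E ==> (v', w) : E ==> v = v'"
 using polytope_facet.edge_out_unique[OF reflect] reflect_edge by (metis neg_equal_iff_equal)

lemma finE: "finite E"
 by (rule finite_subset[of _ "F \<times> F"]) (use finF in \<open>auto simp: facet_edges_def\<close>)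

text \<open>Every vertex that occurs starts exactly one edge and ends exactly one, so quotients
  along the boundary telescope.\<close>

lemma prod_starts_ends: "(\<Prod>e\<in>E. g (fst e)) = (\<Prod>e\<in>E. (g (snd e) :: complex))"
proof -
 have 1: "inj_on fst E" using edge_out_unique by (auto simp: inj_on_def)
 have 2: "inj_on snd E" using edge_in_unique by (auto simp: inj_on_def)
 have "fst ` E = snd ` E"
 proof (intro equalityI subsetI)
 fix x assume "x : fst ` E"
 then obtain w where "(x, w) : E" by auto
 then obtain y where "(y, x) : E" using edge_prev by blast
 then show "x : snd ` E" by force
 next
 fix x assume "x : snd ` E"
 then obtain w where "(w, x) : E" by auto
 then obtain y where "(x, y) : E" using edge_next by blast
 then show "x : fst ` E" by force
 qed
 then show ?thesis
 using prod.reindex[OF 1, of g] prod.reindex[OF 2, of g] by (simp add: o_def)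
qed

text \<open>An interior direction of the cone over the facet, from which the facet is cut into one
  triangle per edge.\<close>

definition apex where "apex = (\<Sum>y\<in>F. y)"

lemma det3_apex:
 assumes e: "(v, w) : E"
 shows "det3 apex v w > 0"
proof -
 obtain y where y: "y : F" "cross3 v w \<bullet> y ~= 0"
 using not_all_perp[OF F_cross[OF edgeD(1-3)[OF e]]] by blast
 have "det3 v w y > 0" using edgeD(4)[OF e y(1)] y(2) by (simp add: det3_inner)
 then have "det3 v w apex > 0"
 unfolding apex_def det3_sum
 by (rule sum_pos2[OF finF y(1)]) (use edgeD(4)[OF e] in auto)
 then show ?thesis using det3_cyc[of apex v w] by simp
qed

text \<open>Twice the total angle is the argument of a product of direction factors. Those involving
  \<open>apex\<close> telescope around the boundary, and those along the edges do so because
  \<open>\<rho>\<close> is parallel. So the total is a multiple of \<open>pi\<close>, and it is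
  positive.\<close>

lemma facet_solid_angle:
 assumes nz: "!!v w. (v, w) : E ==> \<rho> v ~= 0"
 and par: "!!v w. (v, w) : E ==> \<rho> v * dirsq (tdir w v) = \<rho> w * dirsq (tdir v w)"
 shows "pi <= (\<Sum>(v, w)\<in>E. solid_angle apex v w)"
proof -
 let ?\<Theta> = "\<Sum>(v, w)\<in>E. solid_angle apex v w"
 define d where "d x y = dirsq (tdir x y)" for x y
 have dnz: "d x y ~= 0" if "cross3 x y ~= 0" for x y
 unfolding d_def using that by (intro dirsq_nonzero tdir_nonzero)
 have "cis (2 * ?\<Theta>) = (\<Prod>(v, w)\<in>E. cis (2 * solid_angle apex v w))"
 by (simp add: sum_distrib_left cis_sum case_prod_unfold)
 also have "\<dots> = (\<Prod>e\<in>E. (d apex (snd e) / d apex (fst e)) * (d (fst e) apex / d (snd e) apex) * (\<rho> (snd e) / \<rho> (fst e)))"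
 proof (rule prod.cong[OF refl])
 fix e assume "e : E"
 then obtain v w where e: "e = (v, w)" "(v, w) : E" by (cases e) auto
 have D: "det3 apex v w > 0" using det3_apex e(2) by simp
 have vw: "d v w ~= 0" "d w v ~= 0"
 using F_cross[of v w] F_cross[of w v] edgeD(1-3)[OF e(2)] by (auto intro!: dnz)
 have r: "d w v / d v w = \<rho> w / \<rho> v"
 using par[OF e(2)] nz[OF e(2)] vw by (simp add: d_def field_simps)
 have "cis (2 * solid_angle apex v w)
 = (d apex w / d apex v) * (d v apex / d w apex) * (d w v / d v w)"
 unfolding cis_2_solid_angle[OF D] d_def[symmetric] by simp
 then have "cis (2 * solid_angle apex v w)
 = (d apex w / d apex v) * (d v apex / d w apex) * (\<rho> w / \<rho> v)" unfolding r .
 then show "(case e of (v, w) => cis (2 * solid_angle apex v w)) =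
 (d apex (snd e) / d apex (fst e)) * (d (fst e) apex / d (snd e) apex) * (\<rho> (snd e) / \<rho> (fst e))"
 using e by simp
 qed
 also have "\<dots> = 1"
 proof -
 have ratio: "(\<Prod>e\<in>E. g (snd e) / g (fst e)) = 1" "(\<Prod>e\<in>E. g (fst e) / g (snd e)) = 1"
 if "!!v w. (v, w) : E ==> g v ~= 0" for g :: "real^3 => complex"
 proof -
 have 0: "(\<Prod>e\<in>E. g (fst e)) ~= 0" using that finE by auto
 show "(\<Prod>e\<in>E. g (snd e) / g (fst e)) = 1" "(\<Prod>e\<in>E. g (fst e) / g (snd e)) = 1"
 unfolding prod_dividef using 0 prod_starts_ends[of g] by simp_all
 qed
 have a: "d apex v ~= 0 & d v apex ~= 0" if "(v, w) : E" for v w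
 proof -
 have "cross3 apex v ~= 0" using det3_apex[OF that] by (auto simp: det3_inner)
 moreover have "cross3 v apex = - cross3 apex v" by (rule cross_skew)
 ultimately show ?thesis by (auto intro!: dnz)
 qed
 show ?thesis
 unfolding prod.distrib
 using ratio(1)[of "d apex"] ratio(2)[of "%v. d v apex"] ratio(1)[of \<rho>] a nz by simp
 qed
 finally have "cis (2 * ?\<Theta>) = 1" .
 then have "cos (2 * ?\<Theta>) = 1" by (metis Re_complex_of_real cis.sel(1) one_complex.sel(1))
 then obtain k :: int where k: "2 * ?\<Theta> = of_int k * 2 * pi" unfolding cos_one_2pi_int by blast
 have "?\<Theta> > 0"
 proof (rule sum_pos[OF finE edge_exists])
 fix e assume "e : E"
 then show "0 < (case e of (v, w) => solid_angle apex v w)"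
 using solid_angle_pos det3_apex by (cases e) auto
 qed
 then have "of_int k * pi > 0" using k by simp
 then have "k >= 1" by (simp add: zero_less_mult_iff)
 then have "1 * pi <= of_int k * pi" by (intro mult_right_mono) auto
 then show ?thesis using k by simp
qed

text \<open>Within the cone over a facet every competing facet functional is strictly smaller.\<close>

lemma cone3_functional_less:
 assumes e: "(v, w) : E" and p: "p : cone3 apex v w"
 and l': "facet S l'" "l' ~= l"
 shows "l' \<bullet> p < l \<bullet> p"
proof -
 obtain a b c where abc: "a > 0" "b > 0" "c > 0" "p = a *\<^sub>R apex + b *\<^sub>R v + c *\<^sub>R w"
 using cone3_coords[OF det3_apex[OF e] p] by blast
 have le: "l' \<bullet> y <= l \<bullet> y" if "y : F" for y
 using l'(1) FS[OF that] Fl[OF that] by (auto simp: facet_def)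
 have "l' \<bullet> apex < l \<bullet> apex"
 proof -
 obtain y where y: "y : F" "(l - l') \<bullet> y ~= 0" using not_all_perp[of "l - l'"] l' by auto
 then have "l' \<bullet> y < l \<bullet> y" using le[OF y(1)] by (simp add: inner_diff_left)
 then show ?thesis unfolding apex_def inner_sum_right
 using y le finF by (intro sum_strict_mono_ex1) auto
 qed
 then have "a * (l' \<bullet> apex) < a * (l \<bullet> apex)" using abc by simp
 moreover have "b * (l' \<bullet> v) <= b * (l \<bullet> v)" "c * (l' \<bullet> w) <= c * (l \<bullet> w)"
 using abc le edgeD(1,2)[OF e] by (auto intro!: mult_left_mono)
 ultimately show ?thesis unfolding abc(4) by (simp add: inner_add_right)
qed

text \<open>Compare the components of \<open>p\<close> transverse to one edge: unless the other edge
  lies on the same line, its coefficient of \<open>apex\<close> is strictly smaller. This cannot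
  hold both ways, so the edges are collinear and then equal.\<close>

lemma cone3_edge_unique:
 assumes e: "(v, w) : E" and e': "(v', w') : E"
 and p: "p : cone3 apex v w" "p : cone3 apex v' w'"
 shows "(v, w) = (v', w')"
proof -
 have *: "det3 v1 w1 v2 = 0 & det3 v1 w1 w2 = 0 | a2 < a1"
 if "(v1, w1) : E" "(v2, w2) : E" "b2 > 0" "c2 > 0"
 and eq: "a1 *\<^sub>R apex + b1 *\<^sub>R v1 + c1 *\<^sub>R w1 = a2 *\<^sub>R apex + b2 *\<^sub>R v2 + c2 *\<^sub>R w2"
 for v1 w1 v2 w2 a1 b1 c1 a2 b2 c2
 proof -
 have "a1 * det3 v1 w1 apex = a2 * det3 v1 w1 apex + b2 * det3 v1 w1 v2 + c2 * det3 v1 w1 w2"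
 using arg_cong[OF eq, of "det3 v1 w1"] by (simp add: det3_add det3_scale)
 moreover have "det3 v1 w1 apex > 0" using det3_apex[OF that(1)] det3_cyc[of apex v1 w1] by simp
 moreover have "det3 v1 w1 v2 >= 0" "det3 v1 w1 w2 >= 0"
 using edgeD(4)[OF that(1)] edgeD(1,2)[OF that(2)] by auto
 ultimately show ?thesis using that(3,4)
 by (smt (verit) mult_less_cancel_right mult_pos_pos mult_nonneg_nonneg)
 qed
 obtain a b c where abc: "a > 0" "b > 0" "c > 0" "p = a *\<^sub>R apex + b *\<^sub>R v + c *\<^sub>R w"
 using cone3_coords[OF det3_apex[OF e] p(1)] by blast
 obtain a' b' c' where abc': "a' > 0" "b' > 0" "c' > 0" "p = a' *\<^sub>R apex + b' *\<^sub>R v' + c' *\<^sub>R w'"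
 using cone3_coords[OF det3_apex[OF e'] p(2)] by blast
 have eq: "a *\<^sub>R apex + b *\<^sub>R v + c *\<^sub>R w = a' *\<^sub>R apex + b' *\<^sub>R v' + c' *\<^sub>R w'" using abc abc' by simp
 have or1: "det3 v w v' = 0 & det3 v w w' = 0 | a' < a" using *[OF e e' _ _ eq] abc' by auto
 have or2: "det3 v' w' v = 0 & det3 v' w' w = 0 | a < a'" using *[OF e' e _ _ eq[symmetric]] abc by auto
 note F = edgeD(1,2)[OF e] edgeD(1,2)[OF e']
 have 1: "det3 v w v' = 0 & det3 v w w' = 0 & det3 v' w' v = 0 & det3 v' w' w = 0"
 proof -
 have "~ (a < a' & a' < a)" by simp
 then consider "det3 v w v' = 0 & det3 v w w' = 0" | "det3 v' w' v = 0 & det3 v' w' w = 0" using or1 or2 by auto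
 then show ?thesis
 proof cases
 case 1
 obtain t s where t: "v' = (1 - t) *\<^sub>R v + t *\<^sub>R w" and s: "w' = (1 - s) *\<^sub>R v + s *\<^sub>R w"
 using edgeD(5)[OF e F(3)] edgeD(5)[OF e F(4)] 1 by blast
 have "det3 x v' w' = (s - t) * det3 x v w" for x
 unfolding t s det3_def by (simp add: cross3_simps)
 then show ?thesis using 1 det3_cyc[of v v' w'] det3_cyc[of w v' w'] by simp
 next
 case 2
 obtain t s where t: "v = (1 - t) *\<^sub>R v' + t *\<^sub>R w'" and s: "w = (1 - s) *\<^sub>R v' + s *\<^sub>R w'"
 using edgeD(5)[OF e' F(1)] edgeD(5)[OF e' F(2)] 2 by blast
 have "det3 x v w = (s - t) * det3 x v' w'" for x
 unfolding t s det3_def by (simp add: cross3_simps)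
 then show ?thesis using 2 det3_cyc[of v' v w] det3_cyc[of w' v w] by simp
 qed
 qed
 obtain t where t: "t : {0..1}" "v' = (1 - t) *\<^sub>R v + t *\<^sub>R w" using edgeD(5)[OF e F(3)] 1 by blast
 obtain s where s: "s : {0..1}" "w' = (1 - s) *\<^sub>R v + s *\<^sub>R w" using edgeD(5)[OF e F(4)] 1 by blast
 obtain r where r: "r : {0..1}" "v = (1 - r) *\<^sub>R v' + r *\<^sub>R w'" using edgeD(5)[OF e' F(1)] 1 by blast
 have "det3 apex v' w' = (s - t) * det3 apex v w"
 unfolding t(2) s(2) det3_def by (simp add: cross3_simps)
 then have st: "t < s" using det3_apex[OF e] det3_apex[OF e'] by (simp add: zero_less_mult_iff)
 have "v = v + ((1 - r) * t + r * s) *\<^sub>R (w - v)"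
 by (subst r(2), subst t(2), subst s(2)) (simp add: algebra_simps)
 then have z: "(1 - r) * t + r * s = 0" using edgeD(3)[OF e] by simp
 have "0 <= (1 - r) * t" "0 <= r * s" using r t s by auto
 then have "(1 - r) * t = 0" "r * s = 0" using z by linarith+
 then have "t = 0" using st t by auto
 then have vv: "v' = v" using t by simp
 then have "w' = w" using edge_out_unique[OF e] e' by simp
 then show ?thesis using vv by simp
qed

end

text \<open>A line field on the vertices, parallel along the edges of all facets: each of at least six facets
  then has solid angle at least \<open>\<pi>\<close>, exceeding the total \<open>4\<pi>\<close>.\<close>

theorem no_parallel_line_field:
 fixes S :: "(real^3) set" and \<rho> :: "real^3 => complex"
 assumes fin: "finite S" and sym: "!!n. n : S ==> - n : S" and sp: "span S = UNIV"
 and nz: "!!l v w. facet S l ==> (v, w) : facet_edges S l ==> \<rho> v ~= 0"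
 and par: "!!l v w. facet S l ==> (v, w) : facet_edges S l ==>
 \<rho> v * dirsq (tdir w v) = \<rho> w * dirsq (tdir v w)"
 shows False
proof -
 obtain L where L: "card L = 3" "independent L" "!!l. l : L ==> facet S l"
 using exists_facets[OF fin sym sp] by blast
 have finL: "finite L" using L(1) card.infinite by fastforce
 have pf: "polytope_facet S l" if "facet S l" for l
 by unfold_locales (use fin sym that in auto)
 define M where "M = L \<union> uminus ` L"
 have facM: "facet S l" if "l : M" for l
 using that L(3) polytope_facet.reflect[OF pf] polytope_facet.fac unfolding M_def by blast
 have disj: "L \<inter> uminus ` L = {}"
 proof -
 have "- l ~: L" if l: "l : L" for l
 proof
 assume m: "- l : L"
 have l0: "l ~= 0" using L(2) l dependent_zero by blast
 have "- l ~= l"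
 proof
 assume "- l = l"
 then have "2 *\<^sub>R l = 0" by (metis add.left_inverse scaleR_2)
 then show False using l0 by simp
 qed
 then have "- l : span (L - {- l})" using l by (intro span_neg span_base) auto
 then show False using L(2) m unfolding dependent_def by blast
 qed
 then show ?thesis by auto
 qed
 \<comment> \<open>Three independent facet functionals and their negatives; each facet takes at
   least a quarter of the sphere.\<close>
 have cM: "card M = 6" "finite M"
 unfolding M_def using finL disj L(1) by (simp_all add: card_Un_disjoint card_image)
 define T where "T = (%(l, e). cone3 (polytope_facet.apex S l) (fst e) (snd e))"
 let ?I = "Sigma M (facet_edges S)"
 have finI: "finite ?I" using cM polytope_facet.finE[OF pf[OF facM]] by auto
 have "(\<Sum>i\<in>?I. bmeas (T i)) = bmeas (\<Union>i\<in>?I. T i)"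
 proof (rule bmeas_Union[OF finI])
 fix i show "open (T i)" by (cases i) (simp add: T_def open_cone3)
 next
 fix i j assume ij: "i : ?I" "j : ?I" "i ~= j"
 obtain l v w where i: "i = (l, (v, w))" by (cases i) auto
 obtain l' v' w' where j: "j = (l', (v', w'))" by (cases j) auto
 have fl: "facet S l" "facet S l'" "(v, w) : facet_edges S l" "(v', w') : facet_edges S l'"
 using ij i j facM by auto
 show "T i \<inter> T j = {}"
 proof (cases "l = l'")
 case True
 then show ?thesis
 using polytope_facet.cone3_edge_unique[OF pf[OF fl(1)]] fl ij i j by (auto simp: T_def)
 next
 case False
 show ?thesis
 proof (rule equals0I)
 fix p assume "p : T i \<inter> T j"
 then have "l' \<bullet> p < l \<bullet> p" "l \<bullet> p < l' \<bullet> p"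
 using polytope_facet.cone3_functional_less[OF pf[OF fl(1)] fl(3) _ fl(2)]
 polytope_facet.cone3_functional_less[OF pf[OF fl(2)] fl(4) _ fl(1)] False i j
 by (auto simp: T_def)
 then show False by simp
 qed
 qed
 qed
 also have "\<dots> <= bmeas UNIV"
 by (rule bmeas_mono) (auto simp: T_def open_cone3)
 finally have upper: "(\<Sum>i\<in>?I. bmeas (T i)) <= bmeas UNIV" .
 have "(\<Sum>i\<in>?I. bmeas (T i)) = (\<Sum>l\<in>M. \<Sum>e\<in>facet_edges S l. bmeas (T (l, e)))"
 by (subst sum.Sigma) (use cM polytope_facet.finE[OF pf[OF facM]] in auto)
 also have "\<dots> >= (\<Sum>l\<in>M. bmeas UNIV / 4)"
 proof (rule sum_mono)
 fix l assume l: "l : M"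
 interpret polytope_facet S l by (rule pf[OF facM[OF l]])
 have "(\<Sum>e\<in>E. bmeas (T (l, e))) = (\<Sum>(v, w)\<in>E. solid_angle apex v w / (4 * pi) * bmeas UNIV)"
 by (rule sum.cong[OF refl]) (auto simp: T_def bmeas_cone3_solid_angle det3_apex)
 also have "\<dots> = (\<Sum>(v, w)\<in>E. solid_angle apex v w) * (bmeas UNIV / (4 * pi))"
 by (simp add: sum_distrib_right sum_divide_distrib case_prod_unfold)
 also have "\<dots> >= pi * (bmeas UNIV / (4 * pi))"
 by (intro mult_right_mono facet_solid_angle[of \<rho>])
 (use nz par fac bmeas_nonneg in \<open>auto intro!: divide_nonneg_pos\<close>)
 finally show "bmeas UNIV / 4 <= (\<Sum>e\<in>E. bmeas (T (l, e)))" by simp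
 qed
 also have "(\<Sum>l\<in>M. bmeas UNIV / 4) = 6 / 4 * bmeas UNIV" using cM by simp
 finally show False using upper bmeas_UNIV_pos by simp
qed

section \<open>Three-dimensional supports\<close>

text \<open>A line meets a sphere in at most two points, and the parameter \<open>0\<close> already
  is one of them.\<close>

lemma segment_norm_three:
 fixes v d :: "'a::real_inner"
 assumes "norm (v + t *\<^sub>R d) = norm v" "norm (v + s *\<^sub>R d) = norm v" "t ~= 0" "s ~= 0" "d ~= 0"
 shows "t = s"
proof -
 have *: "2 * (v \<bullet> d) + r * (d \<bullet> d) = 0" if "norm (v + r *\<^sub>R d) = norm v" "r ~= 0" for r
 proof -
 have "(v + r *\<^sub>R d) \<bullet> (v + r *\<^sub>R d) = v \<bullet> v" using that by (simp add: norm_eq)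
 then have "r * (2 * (v \<bullet> d) + r * (d \<bullet> d)) = 0"
 by (simp add: inner_add_left inner_add_right inner_commute[of d v] algebra_simps)
 then show ?thesis using that by simp
 qed
 have "t * (d \<bullet> d) = s * (d \<bullet> d)" using *[of t] *[of s] assms by linarith
 then show ?thesis using assms by simp
qed

locale modes =
 fixes S :: "(real^3) set" and U :: "real^3 => complex^3"
 assumes fin: "finite S" and zero: "0 ~: S" and sym: "!!n. n : S ==> - n : S"
 and nz: "!!n. n : S ==> U n ~= 0" and perp: "!!n. n : S ==> cdot (cvec n) (U n) = 0"
 and conj: "!!n. n : S ==> U (- n) = cnjv (U n)"
 and steady: "steady_outside S (inter U)"
begin

text \<open>Two end points of an edge either both oscillate orthogonally to their common plane, or have the
  same length and the same ratio between the components normal and tangential to it.\<close>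

lemma edge_relation:
 assumes v: "v : S" and w: "w : S" and vw: "v ~= w" and g: "g \<bullet> v = 1" "g \<bullet> w = 1"
 and le: "!!y. y : S ==> g \<bullet> y <= 1"
 and top: "!!y. y : S ==> g \<bullet> y = 1 ==> EX t:{0..1}. y = (1 - t) *\<^sub>R v + t *\<^sub>R w"
 shows "cdot (U v) (cvec w) = 0 & cdot (U w) (cvec v) = 0 |
 norm v = norm w &
 cdot (U v) (cvec w) * cdot (U w) (cvec (cross3 v w))
 + cdot (U w) (cvec v) * cdot (U v) (cvec (cross3 v w)) = 0"
proof -
 define d where "d = w - v"
 have d0: "d ~= 0" using vw by (simp add: d_def)
 have gd: "g \<bullet> d = 0" using g by (simp add: d_def inner_diff_right)
 define q where "q t = v + t *\<^sub>R d" for t :: real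
 have q01: "q 0 = v" "q 1 = w" by (simp_all add: q_def d_def)
 have gq: "g \<bullet> q t = 1" for t using g gd by (simp add: q_def inner_add_right)
 have q_inj: "q s = q t \<longleftrightarrow> s = t" for s t using d0 by (simp add: q_def)
 have topq: "\<exists>t. 0 <= t & t <= 1 & y = q t" if y: "y : S" "g \<bullet> y = 1" for y
 proof -
 obtain t where "t : {0..1}" "y = (1 - t) *\<^sub>R v + t *\<^sub>R w" using top[OF y] by blast
 then show ?thesis by (intro exI[of _ t]) (simp add: q_def d_def algebra_simps)
 qed
 define T where "T = {t. 0 <= t & t <= 1 & q t : S}"
 have finT: "finite T"
 by (rule finite_imageD[of q]) (use fin in \<open>auto simp: T_def inj_on_def q_inj intro: finite_subset\<close>)
 have T1: "1 : T" "0 : T" using v w by (simp_all add: T_def q01)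
 have Tperp: "cdot (U (q t)) (cvec (q t)) = 0" if "t : T" for t
 using perp[of "q t"] that by (simp add: T_def cdot_commute)
 have Uq: "cdot (U (q s)) (cvec (q r)) = of_real (r - s) * cdot (U (q s)) (cvec d)" if "s : T" for s r
 proof -
 have e: "q r = q s + (r - s) *\<^sub>R d" by (simp add: q_def algebra_simps)
 have "cdot (U (q s)) (cvec (q r)) = cdot (U (q s)) (cvec (q s)) + of_real (r - s) * cdot (U (q s)) (cvec d)"
 unfolding e cvec_simps cdot_add cdot_simps ..
 then show ?thesis using Tperp[OF that] by (simp add: algebra_simps)
 qed
 \<comment> \<open>Adding modes of the edge adds their parameters, and only modes of the edge can
   reach the level of the sum. So a competitor of \<open>v\<close> and \<open>q t\<close> consists
   of two positive parameters with sum \<open>t\<close>.\<close>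
 have unique: "inter U v (q t) = 0"
 if t: "t : T" "t > 0" and in0: "!!s r. s : T ==> r : T ==> 0 < s ==> 0 < r ==> s + r = t ==> inter U (q s) (q r) = 0" for t
 proof (rule steady_outside_unique[OF fin steady v])
 show "q t : S" using t by (simp add: T_def)
 show "v ~= q t" using t q_inj[of 0 t] by (auto simp: q01)
 have lev: "g \<bullet> (v + q t) = 2" using g gq by (simp add: inner_add_right)
 show "v + q t ~: S" using le[of "v + q t"] lev by auto
 show "v + q t ~= 0" using lev by auto
 fix m k assume mk: "m : S" "k : S" "m + k = v + q t" "m ~= v" "m ~= q t"
 have "g \<bullet> m + g \<bullet> k = 2" using lev mk(3) by (metis inner_add_right)
 then have "g \<bullet> m = 1" "g \<bullet> k = 1" using le[OF mk(1)] le[OF mk(2)] by linarith+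
 then obtain s r where sr: "0 <= s" "s <= 1" "m = q s" "0 <= r" "r <= 1" "k = q r"
 using topq mk by metis
 have "(s + r - t) *\<^sub>R d = 0" using mk(3) sr by (simp add: q_def algebra_simps)
 then have srt: "s + r = t" using d0 by simp
 have "s ~= 0" using mk(4) sr q01 by auto
 moreover have "r ~= 0" using mk(5) sr srt by auto
 ultimately show "inter U m k = 0" using in0[of s r] sr mk srt by (auto simp: T_def)
 qed
 have pair: "cdot (U v) (cvec (q t)) = 0 & cdot (U (q t)) (cvec v) = 0 |
 norm v = norm (q t) & cdot (U v) (cvec (q t)) ~= 0 &
 cdot (U v) (cvec (q t)) * cdot (U (q t)) (cvec (cross3 v (q t)))
 + cdot (U (q t)) (cvec v) * cdot (U v) (cvec (cross3 v (q t))) = 0"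
 if t: "t : T" "inter U v (q t) = 0" for t
 proof -
 have "q t : S" using t by (simp add: T_def)
 moreover have "g \<bullet> (v + q t) = 2" using g gq by (simp add: inner_add_right)
 then have "v + q t ~= 0" by auto
 ultimately show ?thesis using inter_eq_0D[OF perp[OF v] perp nz[OF v] nz _ t(2)] by blast
 qed
 show ?thesis
 proof (cases "cdot (U v) (cvec d) = 0")
 case True
 have all: "cdot (U (q t)) (cvec d) = 0" if "t : T" for t
 proof (rule ccontr)
 assume ne: "~ ?thesis"
 \<comment> \<open>At the first mode with a component along the edge, all competing pairs are
   earlier and interact trivially, so its interaction with \<open>v\<close> vanishes. As
   \<open>v\<close> has no such component, neither can that mode.\<close>
 let ?X = "{t : T. cdot (U (q t)) (cvec d) ~= 0}"
 have X: "finite ?X" "?X ~= {}" using finT ne that by auto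
 define t0 where "t0 = Min ?X"
 have t0: "t0 : ?X" unfolding t0_def by (rule Min_in[OF X])
 have t0le: "t0 <= t" if "t : ?X" for t unfolding t0_def by (rule Min_le[OF X(1) that])
 have "t0 ~= 0" using t0 True q01 by auto
 then have t0p: "t0 > 0" using t0 by (auto simp: T_def)
 have "inter U v (q t0) = 0"
 proof (rule unique)
 show "t0 : T" "0 < t0" using t0 t0p by auto
 fix s r assume sr: "s : T" "r : T" "0 < s" "0 < r" "s + r = t0"
 then have "s ~: ?X" "r ~: ?X" using t0le[of s] t0le[of r] by linarith+
 then have "cdot (U (q s)) (cvec (q r)) = 0" "cdot (U (q r)) (cvec (q s)) = 0"
 using Uq sr by auto
 then show "inter U (q s) (q r) = 0" by (simp add: inter_def bilin_def)
 qed
 then have "cdot (U (q t0)) (cvec v) = 0"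
 using pair[of t0] t0 Uq[OF T1(2), of t0] True q01 by auto
 then have "of_real (0 - t0) * cdot (U (q t0)) (cvec d) = 0"
 using Uq[of t0 0] t0 q01 by auto
 then show False using t0 t0p by auto
 qed
 have "cdot (U v) (cvec w) = 0" using Uq[OF T1(2), of 1] True q01 by simp
 moreover have "cdot (U w) (cvec v) = 0" using Uq[OF T1(1), of 0] all[OF T1(1)] q01 by simp
 ultimately show ?thesis by blast
 next
 case False
 have nI: "cdot (U v) (cvec (q t)) ~= 0" if "t > 0" for t
 using Uq[OF T1(2), of t] False that q01 by simp
 let ?X = "{t : T. t > 0}"
 have X: "finite ?X" "?X ~= {}" using finT T1 by auto
 define t1 where "t1 = Min ?X"
 have t1: "t1 : ?X" unfolding t1_def by (rule Min_in[OF X])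
 have t1le: "t1 <= t" if "t : ?X" for t unfolding t1_def by (rule Min_le[OF X(1) that])
 have i1: "inter U v (q t1) = 0"
 proof (rule unique)
 fix s r assume "s : T" "r : T" "0 < s" "0 < r" "s + r = t1"
 then show "inter U (q s) (q r) = 0" using t1le[of s] by auto
 qed (use t1 in auto)
 then have n1: "norm v = norm (q t1)" using pair[of t1] t1 nI[of t1] by auto
 show ?thesis
 proof (cases "t1 = 1")
 case True
 then show ?thesis using pair[of t1] i1 t1 nI[of t1] q01 by auto
 next
 case ne: False
 \<comment> \<open>Suppose \<open>w\<close> is not the first mode after \<open>v\<close>. The second
   mode competes only with the first one paired with itself, which does not interact; then
   \<open>v\<close> and both modes have equal length, too many for one line.\<close>
 let ?Y = "{t : T. t > t1}"
 have "t1 < 1" using t1 ne by (auto simp: T_def)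
 then have Y: "finite ?Y" "?Y ~= {}" using finT T1 by auto
 define t2 where "t2 = Min ?Y"
 have t2: "t2 : ?Y" unfolding t2_def by (rule Min_in[OF Y])
 have t2le: "t2 <= t" if "t : ?Y" for t unfolding t2_def by (rule Min_le[OF Y(1) that])
 have i2: "inter U v (q t2) = 0"
 proof (rule unique)
 show "t2 : T" "0 < t2" using t2 t1 by auto
 fix s r assume sr: "s : T" "r : T" "0 < s" "0 < r" "s + r = t2"
 have "s = t1" using t1le[of s] t2le[of s] sr by force
 moreover have "r = t1" using t1le[of r] t2le[of r] sr by force
 moreover have "cdot (U (q t1)) (cvec (q t1)) = 0" using Tperp t1 by auto
 ultimately show "inter U (q s) (q r) = 0" by (simp add: inter_def bilin_def)
 qed
 have "t2 > 0" using t2 t1 by auto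
 then have n2: "norm v = norm (q t2)" using pair[OF _ i2] t2 nI[of t2] by auto
 have "t1 = t2"
 by (rule segment_norm_three[of v t1 d t2]) (use n1 n2 t1 t2 d0 in \<open>auto simp: q_def\<close>)
 then show ?thesis using t2 by auto
 qed
 qed
qed

end

text \<open>For a fixed sign of the eigenvalue the helical amplitudes at \<open>v\<close> form a
  complex line, so testing them against \<open>y\<close> gives one function of \<open>y\<close> up
  to a factor, namely the complex direction \<open>tdir\<close>.\<close>

lemma helical_tdir:
 assumes v: "v ~= 0" and perp: "cdot (cvec v) u = 0" and h: "ccross (cvec v) u = (- \<i> * of_real (norm v)) *s u"
 obtains \<eta> where "!!y. cdot u (cvec y) = \<eta> * tdir v y"
proof -
 define K where "K = cross3 v (frame_vec v)"
 define m where "m = cross3 v K"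
 have K0: "K ~= 0" using frame_vec[OF v] by (simp add: K_def)
 have vK: "v \<bullet> K = 0" by (simp add: K_def dot_cross_self)
 have mm: "m \<bullet> m = (v \<bullet> v) * (K \<bullet> K)" using vK by (simp add: m_def cross3_dot_cross3)
 have mv: "cross3 m v = (v \<bullet> v) *\<^sub>R K"
 using Lagrange[of v v K] vK cross_skew[of m v] by (simp add: m_def)
 have um: "cdot u (cvec m) = \<i> * of_real (norm v) * cdot u (cvec K)"
 proof -
 have "cdot u (cvec m) = - cdot (ccross (cvec v) u) (cvec K)"
 unfolding m_def by (simp add: ccross_cvec[symmetric]) (simp add: vec3_simps algebra_simps)
 then show ?thesis unfolding h by (simp add: cdot_simps cdot_minus)
 qed
 have my: "m \<bullet> y = - (K \<bullet> cross3 v y)" for y by (simp add: m_def cross3_simps)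
 define c where "c = cdot u (cvec K)"
 have vv: "v \<bullet> v = norm v * norm v" by (simp add: dot_square_norm power2_eq_square)
 have nv: "norm v > 0" using v by simp
 have KK: "K \<bullet> K > 0" using K0 by simp
 have main: "of_real ((v \<bullet> v) * (K \<bullet> K)) * cdot u (cvec y)
  = c * of_real (v \<bullet> v) * of_real (K \<bullet> y) + \<i> * of_real (norm v) * c * of_real (- (K \<bullet> cross3 v y))" for y
 proof -
 have "of_real (m \<bullet> m) *s u = cdot u (cvec v) *s cvec (cross3 K m)
 + cdot u (cvec K) *s cvec (cross3 m v) + cdot u (cvec m) *s cvec m"
 using dual_basis[of v K u] by (simp add: m_def)
 then have "of_real (m \<bullet> m) *s u = c *s cvec ((v \<bullet> v) *\<^sub>R K) + (\<i> * of_real (norm v) * c) *s cvec m"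
 using perp by (simp add: mv um c_def cdot_commute)
 then have "of_real ((v \<bullet> v) * (K \<bullet> K)) *s u = c *s cvec ((v \<bullet> v) *\<^sub>R K) + (\<i> * of_real (norm v) * c) *s cvec m"
 unfolding mm .
 from arg_cong[OF this, of "%x. cdot x (cvec y)"]
 show ?thesis by (simp add: cdot_simps cdot_add cdot_cvec_cvec my)
 qed
 define \<eta> where "\<eta> = (- \<i> * c) / of_real (norm v * (K \<bullet> K))"
 have "cdot u (cvec y) = \<eta> * tdir v y" for y
 proof -
 have t: "tdir v y = of_real (K \<bullet> cross3 v y) + \<i> * of_real (norm v * (K \<bullet> y))"
 by (simp add: tdir_def K_def det3_inner complex_eq_iff)
 have "of_real ((v \<bullet> v) * (K \<bullet> K)) * cdot u (cvec y) = of_real ((v \<bullet> v) * (K \<bullet> K)) * (\<eta> * tdir v y)"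
 proof -
 have "of_real ((v \<bullet> v) * (K \<bullet> K)) * \<eta> = of_real (norm v) * (- \<i> * c)"
 unfolding \<eta>_def vv using nv KK by simp
 then have e': "of_real ((v \<bullet> v) * (K \<bullet> K)) * (\<eta> * tdir v y) = of_real (norm v) * (- \<i> * c) * tdir v y"
 by (simp only: mult.assoc[symmetric])
 show ?thesis unfolding e' unfolding main t by (simp add: vv algebra_simps)
 qed
 moreover have "of_real ((v \<bullet> v) * (K \<bullet> K)) ~= (0::complex)" using nv KK v by simp
 ultimately show ?thesis by (metis mult_left_cancel)
 qed
 then show ?thesis by (rule that)
qed

lemma cnjv_simps: "cnjv (cnjv u) = u" "cdot (cnjv u) (cnjv v) = cnj (cdot u v)"
 "cnjv (cvec y) = cvec y" "cnjv (c *s u) = cnj c *s cnjv u" "cnjv u = 0 \<longleftrightarrow> u = 0"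
 "ccross (cnjv u) (cnjv v) = cnjv (ccross u v)"
 by (auto simp: vec3_simps cnjv_def)

text \<open>The two left-hand sides test the helical parts \<open>p\<close> and \<open>m\<close> of
  \<open>u\<close>. Both parts are nonzero since \<open>cdot p m = 2 * cdot u u\<close>;
  \<open>\<rho>\<close> records their quotient relative to the frame at \<open>v\<close>.\<close>

lemma polarization_frame:
 assumes v: "v ~= 0" and perp: "cdot (cvec v) u = 0" and uu: "cdot u u ~= 0"
 obtains \<rho> \<eta> where "\<rho> ~= 0" "\<eta> ~= 0"
 "!!y. cdot u (cvec y) + \<i> / of_real (norm v) * cdot (ccross (cvec v) u) (cvec y) = \<eta> * tdir v y"
 "!!y. cdot u (cvec y) - \<i> / of_real (norm v) * cdot (ccross (cvec v) u) (cvec y) = \<rho> * \<eta> * cnj (tdir v y)"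
proof -
 define N where "N = complex_of_real (norm v)"
 have N0: "N ~= 0" using v by (simp add: N_def)
 have tr: "ccross (cvec v) (ccross (cvec v) u) = - (N * N) *s u"
 using ccross_triple[of v u] perp by (simp add: N_def power2_eq_square)
 define x where "x = ccross (cvec v) u"
 define p where "p = u + (\<i> / N) *s x"
 define m where "m = u - (\<i> / N) *s x"
 have trx: "ccross (cvec v) x = - (N * N) *s u" using tr by (simp add: x_def)
 have vx: "cdot (cvec v) x = 0" by (simp add: x_def)
 have p1: "cdot (cvec v) p = 0" and m1: "cdot (cvec v) m = 0"
 using perp vx by (simp_all add: p_def m_def cdot_add cdot_simps)
 have p2: "ccross (cvec v) p = (- \<i> * N) *s p"
 unfolding p_def ccross_add ccross_smult trx x_def[symmetric] using N0 by (simp add: vec_eq_iff field_simps)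
 have m2: "ccross (cvec v) m = (\<i> * N) *s m"
 unfolding m_def ccross_diff ccross_smult trx x_def[symmetric] using N0 by (simp add: vec_eq_iff field_simps)
 have pm: "cdot p m = 2 * cdot u u"
 proof -
 have xx: "cdot x x = N * N * cdot u u"
 proof -
 have "cdot x x = - cdot u (ccross (cvec v) x)"
 unfolding x_def by (simp add: vec3_simps algebra_simps)
 then show ?thesis unfolding trx by (simp add: cdot_simps cdot_minus)
 qed
 have "cdot p m = cdot u u - (\<i> / N) * (\<i> / N) * cdot x x"
 unfolding p_def m_def by (simp add: cdot_add cdot_simps cdot_commute[of x u] algebra_simps)
 then show ?thesis unfolding xx using N0 by (simp add: field_simps)
 qed
 then have p0: "p ~= 0" and m0: "m ~= 0" using uu by auto
 obtain \<eta> where eta: "!!y. cdot p (cvec y) = \<eta> * tdir v y"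
 using helical_tdir[OF v p1] p2 unfolding N_def by blast
 have c1: "cdot (cvec v) (cnjv m) = 0" using m1 cnjv_simps(2)[of "cvec v" m] by (simp add: cnjv_simps)
 have "ccross (cvec v) (cnjv m) = cnjv (ccross (cvec v) m)"
 using cnjv_simps(6)[of "cvec v" m] by (simp add: cnjv_simps)
 then have c2: "ccross (cvec v) (cnjv m) = (- \<i> * of_real (norm v)) *s cnjv m"
 unfolding m2 by (simp add: cnjv_simps N_def)
 obtain \<zeta> where zeta: "!!y. cdot (cnjv m) (cvec y) = \<zeta> * tdir v y"
 using helical_tdir[OF v c1 c2] by blast
 have zeta': "cdot m (cvec y) = cnj \<zeta> * cnj (tdir v y)" for y
 using arg_cong[OF zeta[of y], of cnj] cnjv_simps(2)[of "cnjv m" "cvec y"] by (simp add: cnjv_simps)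
 have nz: "\<exists>y. cdot q (cvec y) ~= 0" if "q ~= 0" for q
 proof -
 obtain i where "q $ i ~= 0" using \<open>q ~= 0\<close> by (auto simp: vec_eq_iff)
 moreover have "cdot q (cvec (axis i 1)) = q $ i"
 using exhaust_3[of i] by (auto simp: vec3_simps axis_def)
 ultimately show ?thesis by metis
 qed
 have "\<eta> ~= 0" using nz[OF p0] eta by auto
 have "cnj \<zeta> ~= 0" using nz[OF m0] zeta' by auto
 show ?thesis
 proof (rule that[of "cnj \<zeta> / \<eta>" \<eta>])
 show "cnj \<zeta> / \<eta> ~= 0" "\<eta> ~= 0" using \<open>\<eta> ~= 0\<close> \<open>cnj \<zeta> ~= 0\<close> by auto
 fix y
 show "cdot u (cvec y) + \<i> / of_real (norm v) * cdot (ccross (cvec v) u) (cvec y) = \<eta> * tdir v y"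
 using eta[of y] by (simp add: p_def x_def N_def cdot_add cdot_simps)
 show "cdot u (cvec y) - \<i> / of_real (norm v) * cdot (ccross (cvec v) u) (cvec y) = cnj \<zeta> / \<eta> * \<eta> * cnj (tdir v y)"
 using zeta'[of y] \<open>\<eta> ~= 0\<close> by (simp add: m_def x_def N_def cdot_diff cdot_simps)
 qed
qed

context modes
begin

text \<open>If all exposed amplitudes were non-null, the quotients \<open>\<rho>\<close> of their
  helical parts would form a line field parallel along every edge of every facet.\<close>

lemma exists_exposed_null:
 assumes sp: "span S = UNIV"
 obtains v g where "v : S" "!!y. y : S ==> y ~= v ==> g \<bullet> y < g \<bullet> v" "cdot (U v) (U v) = 0"
proof (rule ccontr)
 assume no: "~ thesis"
 note found = that
 have pf: "polytope_facet S l" if "facet S l" for l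
 by unfold_locales (use fin sym that in auto)
 have expo: "cdot (U x) (U x) ~= 0" if f: "facet S l" "(v, w) : facet_edges S l" "x = v | x = w" for l v w x
 proof -
 interpret polytope_facet S l by (rule pf[OF f(1)])
 have xF: "x : F" using f edgeD(1,2)[OF f(2)] by auto
 obtain c where "!!y. y : F ==> y ~= x ==> c \<bullet> y < c \<bullet> x"
 using f(3) edge_end_exposed[OF f(2), of x w] edge_end_exposed[OF f(2), of x v] by blast
 then obtain g where g: "!!y. y : S ==> y ~= x ==> g \<bullet> y < g \<bullet> x"
 using exposed_in_S[OF xF] by blast
 show ?thesis
 proof
 assume z: "cdot (U x) (U x) = 0"
 have thesis by (rule found[OF FS[OF xF] _ z]) (rule g)
 with no show False by contradiction
 qed
 qed
 define good where "good v \<rho> \<longleftrightarrow> \<rho> ~= 0 & (\<exists>\<eta>. \<eta> ~= 0 &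
 (\<forall>y. cdot (U v) (cvec y) + \<i> / of_real (norm v) * cdot (ccross (cvec v) (U v)) (cvec y) = \<eta> * tdir v y) &
 (\<forall>y. cdot (U v) (cvec y) - \<i> / of_real (norm v) * cdot (ccross (cvec v) (U v)) (cvec y) = \<rho> * \<eta> * cnj (tdir v y)))" for v \<rho>
 define \<rho> where "\<rho> v = (SOME r. good v r)" for v
 have good: "good x (\<rho> x)" if f: "facet S l" "(v, w) : facet_edges S l" "x = v | x = w" for l v w x
 proof -
 interpret polytope_facet S l by (rule pf[OF f(1)])
 have "x : F" using f edgeD(1,2)[OF f(2)] by auto
 then have x: "x : S" "x ~= 0" using FS F_nonzero by auto
 obtain r \<eta> where "r ~= 0" "\<eta> ~= 0"
 "!!y. cdot (U x) (cvec y) + \<i> / of_real (norm x) * cdot (ccross (cvec x) (U x)) (cvec y) = \<eta> * tdir x y"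
 "!!y. cdot (U x) (cvec y) - \<i> / of_real (norm x) * cdot (ccross (cvec x) (U x)) (cvec y) = r * \<eta> * cnj (tdir x y)"
 using polarization_frame[OF x(2) perp[OF x(1)] expo[OF f]] by blast
 then have "good x r" unfolding good_def by blast
 then show ?thesis unfolding \<rho>_def by (rule someI)
 qed
 show False
 proof (rule no_parallel_line_field[OF fin sym sp, of \<rho>])
 fix l v w assume f: "facet S l" "(v, w) : facet_edges S l"
 show "\<rho> v ~= 0" using good[OF f] unfolding good_def by blast
 interpret polytope_facet S l by (rule pf[OF f(1)])
 note vw = edgeD(1-3)[OF f(2)]
 obtain g where g: "g \<bullet> v = 1" "g \<bullet> w = 1" "!!y. y : S ==> g \<bullet> y <= 1"
 "!!y. y : S ==> g \<bullet> y = 1 ==> EX t:{0..1}. y = (1 - t) *\<^sub>R v + t *\<^sub>R w"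
 using edge_functional[OF f(2)] by blast
 have rel: "cdot (U v) (cvec w) = 0 & cdot (U w) (cvec v) = 0 |
 norm v = norm w &
 cdot (U v) (cvec w) * cdot (U w) (cvec (cross3 v w))
 + cdot (U w) (cvec v) * cdot (U v) (cvec (cross3 v w)) = 0"
 by (rule edge_relation[OF FS FS _ g]) (use vw in auto)
 define a b x y where "a = cdot (U v) (cvec w)" and "b = cdot (U w) (cvec v)"
 and "x = cdot (U v) (cvec (cross3 v w))" and "y = cdot (U w) (cvec (cross3 v w))"
 have xw: "cdot (ccross (cvec v) (U v)) (cvec w) = - x"
 unfolding x_def by (simp add: ccross_cvec[symmetric]) (simp add: vec3_simps algebra_simps)
 have yv: "cdot (ccross (cvec w) (U w)) (cvec v) = y"
 unfolding y_def by (simp add: ccross_cvec[symmetric]) (simp add: vec3_simps algebra_simps)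
 obtain \<eta> where e: "\<eta> ~= 0" "a + \<i> / of_real (norm v) * (- x) = \<eta> * tdir v w"
 "a - \<i> / of_real (norm v) * (- x) = \<rho> v * \<eta> * cnj (tdir v w)"
 using good[OF f, of v] unfolding good_def xw[symmetric] a_def by blast
 obtain \<zeta> where z: "\<zeta> ~= 0" "b + \<i> / of_real (norm w) * y = \<zeta> * tdir w v"
 "b - \<i> / of_real (norm w) * y = \<rho> w * \<zeta> * cnj (tdir w v)"
 using good[OF f, of w] unfolding good_def yv[symmetric] b_def by blast
 \<comment> \<open>Both alternatives of the edge relation give this identity: the first since
   \<open>a = b = 0\<close>, the second since the two sides differ by a multiple of
   \<open>a * y + b * x\<close>.\<close>
 have "(a + \<i> / of_real (norm v) * (- x)) * (b - \<i> / of_real (norm w) * y)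
 = (b + \<i> / of_real (norm w) * y) * (a - \<i> / of_real (norm v) * (- x))"
 proof (cases "a = 0 & b = 0")
 case True then show ?thesis by (simp add: mult_ac)
 next
 case False
 then have n: "norm v = norm w" "a * y + b * x = 0" using rel by (auto simp: a_def b_def x_def y_def)
 have "(a + \<i> / of_real (norm v) * (- x)) * (b - \<i> / of_real (norm w) * y)
  - (b + \<i> / of_real (norm w) * y) * (a - \<i> / of_real (norm v) * (- x))
  = - 2 * \<i> / of_real (norm w) * (a * y + b * x)"
 unfolding n(1) by (simp add: algebra_simps add_divide_distrib)
 then show ?thesis using n(2) by simp
 qed
 then have "\<eta> * tdir v w * (\<rho> w * \<zeta> * cnj (tdir w v)) = \<zeta> * tdir w v * (\<rho> v * \<eta> * cnj (tdir v w))"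
 unfolding e z .
 then have eq: "tdir v w * \<rho> w * cnj (tdir w v) = tdir w v * \<rho> v * cnj (tdir v w)"
 using e(1) z(1) by (simp add: mult_ac)
 have "tdir v w ~= 0" "tdir w v ~= 0"
 using F_cross[of v w] F_cross[of w v] vw by (auto intro!: tdir_nonzero)
 then show "\<rho> v * dirsq (tdir w v) = \<rho> w * dirsq (tdir v w)"
 using eq by (simp add: dirsq_def field_simps)
 qed
qed

lemma not_parallel_cross: "a : S ==> (!!c. p ~= c *\<^sub>R a) ==> cross3 a p ~= 0"
 using cross3_eq_0D[of p a] zero cross_skew[of a p] by force

text \<open>A spatial configuration is a Beltrami flow.\<close>

theorem spatial_helical:
 assumes sp: "span S = UNIV"
 obtains mu r where "r > 0" "mu : {r, - r}" "!!n. n : S ==> norm n = r & helical (of_real mu) n (U n)"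
proof -
 obtain v g where v: "v : S" "!!y. y : S ==> y ~= v ==> g \<bullet> y < g \<bullet> v" "cdot (U v) (U v) = 0"
 using exists_exposed_null[OF sp] by blast
 obtain mu where mu: "mu : {norm v, - norm v}" "helical (of_real mu) v (U v)"
 using null_imp_helical[OF perp[OF v(1)] v(3) nz[OF v(1)]] by blast
 have v0: "v ~= 0" using v(1) zero by auto
 then have mu0: "mu ~= 0" using mu(1) by auto
 define A where "A = {n : S. norm n = norm v & helical (of_real mu) n (U n)}"
 have "A = S"
 proof (rule leading_class_is_all[OF fin zero _ steady sym, where r = "norm v"])
 show "A \<subseteq> S" by (auto simp: A_def)
 \<comment> \<open>Reflection conjugates the eigenvalue, and \<open>mu\<close> is real.\<close>
 show "- n : A" if "n : A" for n
 using that sym helical_minus_cnj[of "of_real mu" n "U n"] by (auto simp: A_def conj)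
 show "norm a = norm v" if "a : A" for a using that by (simp add: A_def)
 show "norm v > 0" using v0 by simp
 show "inter U a b = 0" if "a : A" "b : A" for a b
 using that by (auto simp: A_def intro: inter_helical)
 show "inter U a p ~= 0" if "a : A" "p : S - A" "!!c. p ~= c *\<^sub>R a" for a p
 proof
 assume z: "inter U a p = 0"
 have a: "a : S" "norm a = norm v" "helical (of_real mu) a (U a)" using that(1) by (auto simp: A_def)
 have p: "p : S" using that(2) by simp
 have "norm p = norm a & helical (of_real mu) p (U p)"
 by (rule inter_helical_eq_0D[OF a(3) _ perp[OF a(1)] perp[OF p] nz[OF a(1)] nz[OF p] _ z])
 (use mu0 not_parallel_cross[OF a(1) that(3)] in auto)
 then show False using that(2) a by (simp add: A_def)
 qed
 show "EX a:A. ALL p:S - A. g \<bullet> p < g \<bullet> a"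
 using v mu by (intro bexI[of _ v]) (auto simp: A_def)
 show "EX n:S. \<forall>c. n ~= c *\<^sub>R x" for x
 proof (rule ccontr)
 assume "~ (EX n:S. \<forall>c. n ~= c *\<^sub>R x)"
 then have "S \<subseteq> span {x}" by (auto simp: span_singleton)
 then have "span S \<subseteq> span {x}" by (rule span_minimal) simp
 then have "dim (UNIV :: (real^3) set) <= dim {x}" using sp by (metis dim_span dim_subset)
 also have "\<dots> <= 1" using dim_le_card'[of "{x}"] by simp
 finally show False by simp
 qed
 qed
 then show ?thesis using that[of "norm v" mu] mu v0 by (auto simp: A_def)
qed

end

section \<open>Planar supports: top rows and convolution powers\<close>

definition supp :: "('a => complex) => 'a set" where "supp f = {n. f n ~= 0}"

definition lev :: "real^3 => (real^3 => complex) => real => bool" where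
 "lev g f H \<longleftrightarrow> (\<forall>n. f n ~= 0 --> g \<bullet> n <= H)"

lemma exists_top_level:
 assumes "finite (supp f)" "f ~= (%n. 0)"
 obtains p where "f p ~= 0" "lev g f (g \<bullet> p)"
proof -
 have "supp f ~= {}" using assms(2) by (auto simp: supp_def)
 then obtain p where p: "p : supp f" "!!y. y : supp f ==> g \<bullet> y <= g \<bullet> p"
 using finite_argmax[OF assms(1), of "%x. g \<bullet> x"] by blast
 show ?thesis by (rule that[of p]) (use p in \<open>auto simp: lev_def supp_def\<close>)
qed

lemma finite_line_escape:
 fixes x u :: "'a::real_vector"
 assumes "finite X" "u ~= 0"
 shows "\<exists>k::nat. x + real k *\<^sub>R u ~: X"
proof (rule ccontr)
 assume "~ ?thesis"
 then have "range (%k::nat. x + real k *\<^sub>R u) \<subseteq> X" by auto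
 then have "finite (range (%k::nat. x + real k *\<^sub>R u))" using assms(1) finite_subset by blast
 moreover have "inj (%k::nat. x + real k *\<^sub>R u)" using assms(2) by (auto simp: inj_on_def)
 ultimately show False using finite_imageD infinite_UNIV_nat by blast
qed

locale plane =
 fixes e :: "real^3"
 assumes e1: "e \<bullet> e = 1"
begin

definition dd :: "real^3 => real^3 => real" where "dd x y = det3 e x y"

lemma dd_add: "dd x (y + z) = dd x y + dd x z" "dd (x + y) z = dd x z + dd y z"
 and dd_scale: "dd x (c *\<^sub>R y) = c * dd x y" "dd (c *\<^sub>R x) y = c * dd x y"
 and dd_self [simp]: "dd x x = 0" and dd_minus [simp]: "dd x (- y) = - dd x y" "dd (- x) y = - dd x y"
 and dd_diff: "dd x (y - z) = dd x y - dd x z"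
 and dd_0 [simp]: "dd x 0 = 0" "dd 0 x = 0"
 unfolding dd_def det3_def by (simp_all add: cross3_simps)

lemma dd_swap: "dd y x = - dd x y"
 unfolding dd_def det3_def by (simp add: cross3_simps)

lemma plane_basis:
 assumes D: "dd v w ~= 0" and v: "e \<bullet> v = 0" and w: "e \<bullet> w = 0" and x: "e \<bullet> x = 0"
 shows "x = (dd x w / dd v w) *\<^sub>R v + (dd v x / dd v w) *\<^sub>R w"
proof -
 have eq: "x = (det3 x v w / det3 e v w) *\<^sub>R e + (det3 e x w / det3 e v w) *\<^sub>R v + (det3 e v x / det3 e v w) *\<^sub>R w"
 by (rule det3_basis) (use D in \<open>simp add: dd_def\<close>)
 have "e \<bullet> x = det3 x v w / det3 e v w"
 by (subst eq) (simp add: inner_add_right v w e1)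
 then have "det3 x v w / det3 e v w = 0" using x by simp
 then have "x = 0 *\<^sub>R e + (det3 e x w / det3 e v w) *\<^sub>R v + (det3 e v x / det3 e v w) *\<^sub>R w"
 using eq by (simp only:)
 then show ?thesis by (simp add: dd_def)
qed

text \<open>Advection by the stream function with coefficients \<open>ps\<close>: up to sign, the
  coefficients of the Jacobian of that function and the one with coefficients \<open>f\<close>. As
  \<open>dd l l = 0\<close>, the factor \<open>dd l n\<close> is the same as
  \<open>dd l (n - l)\<close>.\<close>

definition ad :: "(real^3) set => (real^3 => complex) => (real^3 => complex) => real^3 => complex" where
 "ad A ps f n = (\<Sum>l\<in>A. of_real (dd l n) * ps l * f (n - l))"

text \<open>Convolution powers: the Fourier coefficients of the powers of the function with coefficients
  \<open>ps\<close>.\<close>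

primrec pw :: "(real^3) set => (real^3 => complex) => nat => real^3 => complex" where
 "pw A ps 0 = (%n. if n = 0 then 1 else 0)"
| "pw A ps (Suc k) = (%n. \<Sum>l\<in>A. ps l * pw A ps k (n - l))"

lemma ad_diff_scale: "ad A ps (%n. f n - c * k n) n = ad A ps f n - c * ad A ps k n"
 by (simp add: ad_def sum_subtractf sum_distrib_left algebra_simps)

lemma ad_zero [simp]: "ad A ps (%n. 0) = (%n. 0)"
 by (simp add: ad_def fun_eq_iff)

text \<open>The Jacobian of a function and its powers is zero. In the induction step
  \<open>dd l n\<close> is split into \<open>dd l (n - m) + dd l m\<close>: the first part is the
  induction hypothesis, the second is antisymmetric in \<open>l\<close> and
  \<open>m\<close>.\<close>

lemma ad_pw: "ad A ps (pw A ps k) n = 0"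
proof (induction k arbitrary: n)
 case 0
 show ?case unfolding ad_def by (intro sum.neutral ballI) (auto dest: arg_cong[of _ _ "dd _"])
next
 case (Suc k)
 let ?p = "pw A ps k"
 have "ad A ps (pw A ps (Suc k)) n
 = (\<Sum>l\<in>A. \<Sum>m\<in>A. of_real (dd l n) * ps l * ps m * ?p (n - l - m))"
 by (simp add: ad_def sum_distrib_left mult_ac)
 also have "\<dots> = (\<Sum>l\<in>A. \<Sum>m\<in>A. of_real (dd l (n - m)) * ps l * ps m * ?p (n - l - m))
 + (\<Sum>l\<in>A. \<Sum>m\<in>A. of_real (dd l m) * ps l * ps m * ?p (n - l - m))"
 by (simp add: sum.distrib[symmetric] dd_diff algebra_simps)
 also have "(\<Sum>l\<in>A. \<Sum>m\<in>A. of_real (dd l (n - m)) * ps l * ps m * ?p (n - l - m))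
 = (\<Sum>m\<in>A. ps m * ad A ps ?p (n - m))"
 by (subst sum.swap) (simp add: ad_def sum_distrib_left algebra_simps)
 also have "\<dots> = 0" by (simp add: Suc)
 also have "(\<Sum>l\<in>A. \<Sum>m\<in>A. of_real (dd l m) * ps l * ps m * ?p (n - l - m)) = 0"
 proof -
 let ?s = "\<Sum>l\<in>A. \<Sum>m\<in>A. of_real (dd l m) * ps l * ps m * ?p (n - l - m)"
 have "?s = (\<Sum>m\<in>A. \<Sum>l\<in>A. of_real (dd l m) * ps l * ps m * ?p (n - l - m))" by (rule sum.swap)
 also have "\<dots> = - ?s"
 unfolding sum_negf[symmetric]
 proof (intro sum.cong refl)
 fix x y
 have "n - y - x = n - x - y" by simp
 then show "complex_of_real (dd y x) * ps y * ps x * ?p (n - y - x)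
 = - (complex_of_real (dd x y) * ps x * ps y * ?p (n - x - y))"
 by (simp only: dd_swap[of x y]) simp
 qed
 finally show ?thesis by simp
 qed
 finally show ?case by simp
qed

lemma ad_neq_0D: "ad A ps f n ~= 0 ==> EX l:A. ps l ~= 0 & f (n - l) ~= 0"
 unfolding ad_def by (auto elim!: sum.not_neutral_contains_not_neutral)

lemma finite_supp_ad:
 assumes "finite A" "finite (supp f)"
 shows "finite (supp (ad A ps f))"
proof (rule finite_subset)
 show "supp (ad A ps f) \<subseteq> (%(l, m). l + m) ` (A \<times> supp f)"
 proof
 fix n assume "n : supp (ad A ps f)"
 then obtain l where "l : A" "f (n - l) ~= 0" using ad_neq_0D[of A ps f n] unfolding supp_def by blast
 then show "n : (%(l, m). l + m) ` (A \<times> supp f)"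
 by (intro image_eqI[of _ _ "(l, n - l)"]) (auto simp: supp_def)
 qed
qed (use assms in auto)

lemma pw_neq_0D: "pw A ps (Suc k) n ~= 0 ==> EX l:A. ps l ~= 0 & pw A ps k (n - l) ~= 0"
 by (auto elim!: sum.not_neutral_contains_not_neutral)

lemma finite_supp_pw: "finite A ==> finite (supp (pw A ps k))"
proof (induction k)
 case 0
 have "supp (pw A ps 0) = {0}" by (auto simp: supp_def)
 then show ?case by simp
next
 case (Suc k)
 show ?case
 proof (rule finite_subset)
 show "supp (pw A ps (Suc k)) \<subseteq> (%(l, m). l + m) ` (A \<times> supp (pw A ps k))"
 proof
 fix n assume "n : supp (pw A ps (Suc k))"
 then obtain l where "l : A" "pw A ps k (n - l) ~= 0"
 using pw_neq_0D[of A ps k n] unfolding supp_def by blast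
 then show "n : (%(l, m). l + m) ` (A \<times> supp (pw A ps k))"
 by (intro image_eqI[of _ _ "(l, n - l)"]) (auto simp: supp_def)
 qed
 qed (use Suc in auto)
qed

lemma pw_plane: "(!!l. l : A ==> e \<bullet> l = 0) ==> pw A ps k n ~= 0 ==> e \<bullet> n = 0"
proof (induction k arbitrary: n)
 case (Suc k)
 obtain l where l: "l : A" "pw A ps k (n - l) ~= 0" using pw_neq_0D[OF Suc.prems(2)] by blast
 have "e \<bullet> (n - l) = 0" "e \<bullet> l = 0" using Suc l by auto
 then show ?case by (simp add: inner_diff_right)
qed (auto split: if_splits)

lemma lev_pw:
 assumes "!!z. z : A ==> g \<bullet> z <= h"
 shows "lev g (pw A ps k) (real k * h)"
proof (induction k)
 case (Suc k)
 show ?case unfolding lev_def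
 proof (intro allI impI)
 fix n assume "pw A ps (Suc k) n ~= 0"
 then obtain l where "l : A" "pw A ps k (n - l) ~= 0" using pw_neq_0D[of A ps k n] by blast
 then have "g \<bullet> l <= h" "g \<bullet> (n - l) <= real k * h" using assms Suc by (auto simp: lev_def)
 then show "g \<bullet> n <= real (Suc k) * h" by (simp add: inner_diff_right algebra_simps)
 qed
qed (auto simp: lev_def)

lemma lev_ad:
 assumes "!!z. z : A ==> g \<bullet> z <= h" "lev g f H"
 shows "lev g (ad A ps f) (H + h)"
 unfolding lev_def
proof (intro allI impI)
 fix n assume "ad A ps f n ~= 0"
 then obtain l where "l : A" "f (n - l) ~= 0" using ad_neq_0D[of A ps f n] by blast
 then have "g \<bullet> l <= h" "g \<bullet> (n - l) <= H" using assms by (auto simp: lev_def)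
 then show "g \<bullet> n <= H + h" by (simp add: inner_diff_right)
qed

text \<open>The extreme level in direction \<open>v\<close> is reached only by choosing
  \<open>v\<close> in each of the \<open>k\<close> factors.\<close>

lemma pw_vertex:
 assumes fin: "finite A" and v: "v : A" and ex: "!!z. z : A ==> z ~= v ==> v \<bullet> z < v \<bullet> v"
 shows "pw A ps k (real k *\<^sub>R v) = ps v ^ k"
proof (induction k)
 case (Suc k)
 have lv: "lev v (pw A ps k) (real k * (v \<bullet> v))"
 by (rule lev_pw) (use ex in force)
 have "pw A ps (Suc k) (real (Suc k) *\<^sub>R v)
 = (\<Sum>l\<in>{v}. ps l * pw A ps k (real (Suc k) *\<^sub>R v - l))"
 unfolding pw.simps
 proof (rule sum.mono_neutral_right[OF fin])
 show "ALL l:A - {v}. ps l * pw A ps k (real (Suc k) *\<^sub>R v - l) = 0"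
 proof
 fix l assume l: "l : A - {v}"
 have "v \<bullet> (real (Suc k) *\<^sub>R v - l) > real k * (v \<bullet> v)"
 using ex[of l] l by (simp add: inner_diff_right algebra_simps)
 then have "pw A ps k (real (Suc k) *\<^sub>R v - l) = 0" using lv unfolding lev_def by (meson not_le)
 then show "ps l * pw A ps k (real (Suc k) *\<^sub>R v - l) = 0" by simp
 qed
 qed (use v in auto)
 also have "\<dots> = ps v * pw A ps k (real k *\<^sub>R v)" by (simp add: algebra_simps)
 finally show ?case using Suc by simp
qed auto

end

text \<open>An edge of the hull of \<open>A\<close> without further points of \<open>A\<close> on
  it. Frequencies get coordinates along \<open>v\<close> and \<open>w\<close>, and the rows with a
  fixed sum of coordinates are parallel to the edge.\<close>

locale plane_edge = plane +
 fixes A :: "(real^3) set" and ps :: "real^3 => complex" and v w g :: "real^3" and h :: real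
 assumes finA: "finite A" and planeA: "!!z. z : A ==> e \<bullet> z = 0" and psA: "!!z. z : A ==> ps z ~= 0"
 and vw: "v : A" "w : A" and D: "dd v w ~= 0"
 and gv: "g \<bullet> v = h" "g \<bullet> w = h" and h0: "h > 0"
 and gless: "!!z. z : A ==> z ~= v ==> z ~= w ==> g \<bullet> z < h"
 and exv: "!!z. z : A ==> z ~= v ==> v \<bullet> z < v \<bullet> v"
 and exw: "!!z. z : A ==> z ~= w ==> w \<bullet> z < w \<bullet> w"
begin

lemma gle: "z : A ==> g \<bullet> z <= h" using gless[of z] gv by force

abbreviation Ad where "Ad \<equiv> ad A ps"
abbreviation Pw where "Pw \<equiv> pw A ps"

definition pt :: "real => real => real^3" where "pt a b = a *\<^sub>R v + b *\<^sub>R w"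

lemma g_pt: "g \<bullet> pt a b = (a + b) * h"
 by (simp add: pt_def inner_add_right gv algebra_simps)

lemma vneqw: "v ~= w" using D by auto

lemma pt_inj: "pt a b = pt a' b' \<longleftrightarrow> a = a' & b = b'"
proof
 assume eq: "pt a b = pt a' b'"
 have "dd v (pt a b) = b * dd v w" "dd (pt a b) w = a * dd v w" for a b
 by (simp_all add: pt_def dd_add dd_scale)
 then show "a = a' & b = b'" using eq D by (metis mult_right_cancel)
qed simp

lemma plane_pt:
 assumes "e \<bullet> p = 0"
 obtains a b where "p = pt a b"
 using plane_basis[OF D planeA[OF vw(1)] planeA[OF vw(2)] assms] unfolding pt_def by blast

text \<open>One level \<open>h\<close> above the top of \<open>f\<close>, only the steps
  \<open>v\<close> and \<open>w\<close> lead back to the support; after any other step one is still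
  above it.\<close>

lemma row_rel:
 assumes "lev g f ((a + b) * h)"
 shows "Ad f (pt (a + 1) b) = of_real (dd v w) *
 (of_real b * ps v * f (pt a b) - of_real (a + 1) * ps w * f (pt (a + 1) (b - 1)))"
proof -
 let ?n = "pt (a + 1) b"
 have "Ad f ?n = (\<Sum>l\<in>{v, w}. of_real (dd l ?n) * ps l * f (?n - l))"
 unfolding ad_def
 proof (rule sum.mono_neutral_right[OF finA])
 show "ALL l:A - {v, w}. complex_of_real (dd l ?n) * ps l * f (?n - l) = 0"
 proof
 fix l assume l: "l : A - {v, w}"
 have "g \<bullet> (?n - l) > (a + b) * h" using gless[of l] l by (simp add: inner_diff_right g_pt algebra_simps)
 then have "f (?n - l) = 0" using assms unfolding lev_def by (meson not_le)
 then show "complex_of_real (dd l ?n) * ps l * f (?n - l) = 0" by simp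
 qed
 qed (use vw in auto)
 also have "\<dots> = of_real (dd v ?n) * ps v * f (?n - v) + of_real (dd w ?n) * ps w * f (?n - w)"
 using vneqw by simp
 also have "?n - v = pt a b" by (simp add: pt_def algebra_simps)
 also have "?n - w = pt (a + 1) (b - 1)" by (simp add: pt_def algebra_simps)
 also have "dd v ?n = b * dd v w" by (simp add: pt_def dd_add dd_scale)
 also have "dd w ?n = - (a + 1) * dd v w" by (simp add: pt_def dd_add dd_scale dd_swap[of v w] algebra_simps)
 finally show ?thesis by (simp add: algebra_simps)
qed

lemma pt_line: "pt (a + real k) (b - real k) = pt a b + real k *\<^sub>R (v - w)"
 "pt (a - real k) (b + real k) = pt a b + real k *\<^sub>R (w - v)"
 by (simp_all add: pt_def algebra_simps)

text \<open>A chain along the row that does not break at a nonnegative integer would be infinite.\<close>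

lemma chain_up:
 assumes fin: "finite (supp f)" and f0: "f (pt a b) ~= 0"
 and step: "!!k::nat. f (pt (a + k) (b - k)) ~= 0 ==> b ~= k ==> f (pt (a + k + 1) (b - k - 1)) ~= 0"
 obtains k :: nat where "b = k" "f (pt (a + k) 0) ~= 0"
proof -
 have "\<exists>k::nat. b = k & f (pt (a + k) 0) ~= 0"
 proof (rule ccontr)
 assume no: "~ ?thesis"
 have all: "f (pt (a + real k) (b - real k)) ~= 0" for k
 proof (induction k)
 case (Suc k)
 have "b ~= real k" using no Suc by auto
 from step[OF Suc this] show ?case by (simp add: algebra_simps)
 qed (use f0 in simp)
 obtain k :: nat where "pt a b + real k *\<^sub>R (v - w) ~: supp f"
 using finite_line_escape[OF fin, of "v - w" "pt a b"] vneqw by auto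
 then show False using all[of k] by (simp add: supp_def pt_line(1)[symmetric])
 qed
 then show ?thesis using that by blast
qed

lemma chain_down:
 assumes fin: "finite (supp f)" and f0: "f (pt a b) ~= 0"
 and step: "!!k::nat. f (pt (a - k) (b + k)) ~= 0 ==> a ~= k ==> f (pt (a - k - 1) (b + k + 1)) ~= 0"
 obtains k :: nat where "a = k" "f (pt 0 (b + k)) ~= 0"
proof -
 have "\<exists>k::nat. a = k & f (pt 0 (b + k)) ~= 0"
 proof (rule ccontr)
 assume no: "~ ?thesis"
 have all: "f (pt (a - real k) (b + real k)) ~= 0" for k
 proof (induction k)
 case (Suc k)
 have "a ~= real k" using no Suc by auto
 from step[OF Suc this] show ?case by (simp add: algebra_simps)
 qed (use f0 in simp)
 obtain k :: nat where "pt a b + real k *\<^sub>R (w - v) ~: supp f"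
 using finite_line_escape[OF fin, of "w - v" "pt a b"] vneqw by auto
 then show False using all[of k] by (simp add: supp_def pt_line(2)[symmetric])
 qed
 then show ?thesis using that by blast
qed

text \<open>No advection above the top row means a recursion between neighbours in that row. Walking
  along it, the values can end only where a coordinate is zero; as the row is finite, this happens
  on both sides, so both coordinates are natural numbers and both ends are occupied.\<close>

lemma row_nat:
 assumes fin: "finite (supp f)" and lv: "lev g f ((a + b) * h)"
 and van: "!!n. g \<bullet> n = (a + b) * h + h ==> e \<bullet> n = 0 ==> Ad f n = 0" and f0: "f (pt a b) ~= 0"
 obtains i j :: nat where "a = i" "b = j" "f (real (i + j) *\<^sub>R v) ~= 0" "f (real (i + j) *\<^sub>R w) ~= 0"
proof -
 have rel: "of_real b' * ps v * f (pt a' b') = of_real (a' + 1) * ps w * f (pt (a' + 1) (b' - 1))"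
 if "a' + b' = a + b" for a' b'
 proof -
 have "g \<bullet> pt (a' + 1) b' = (a + b) * h + h" using that by (simp add: g_pt) (metis (no_types, opaque_lifting) add.commute add.left_commute distrib_right mult_1)
 moreover have "e \<bullet> pt (a' + 1) b' = 0" using planeA vw by (simp add: pt_def inner_add_right)
 ultimately have "Ad f (pt (a' + 1) b') = 0" by (rule van)
 then show ?thesis using row_rel[of f a' b'] lv that D by simp
 qed
 note nz = psA[OF vw(1)] psA[OF vw(2)]
 obtain j :: nat where j: "b = j" "f (pt (a + j) 0) ~= 0"
 proof (rule chain_up[OF fin f0])
 fix k :: nat assume k: "f (pt (a + k) (b - k)) ~= 0" "b ~= k"
 have "complex_of_real (b - real k) ~= 0" using k(2) by (metis eq_iff_diff_eq_0 of_real_eq_0_iff)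
 then have "of_real (b - k) * ps v * f (pt (a + k) (b - k)) ~= 0" using k(1) nz by simp
 then show "f (pt (a + k + 1) (b - k - 1)) ~= 0" using rel[of "a + k" "b - k"] by auto
 qed blast
 obtain i :: nat where i: "a = i" "f (pt 0 (b + i)) ~= 0"
 proof (rule chain_down[OF fin f0])
 fix k :: nat assume k: "f (pt (a - k) (b + k)) ~= 0" "a ~= k"
 have "complex_of_real (a - real k) ~= 0" using k(2) by (metis eq_iff_diff_eq_0 of_real_eq_0_iff)
 then have "of_real (a - k) * ps w * f (pt (a - k) (b + k)) ~= 0" using k(1) nz by simp
 then show "f (pt (a - k - 1) (b + k + 1)) ~= 0" using rel[of "a - k - 1" "b + k + 1"] by auto
 qed blast
 show ?thesis by (rule that[of i j]) (use i j in \<open>simp_all add: pt_def add.commute\<close>)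
qed

lemma row_level:
 assumes fin: "finite (supp f)" and pl: "!!n. f n ~= 0 ==> e \<bullet> n = 0" and lv: "lev g f H"
 and van: "!!n. g \<bullet> n = H + h ==> e \<bullet> n = 0 ==> Ad f n = 0" and f0: "f p ~= 0" "g \<bullet> p = H"
 obtains i j :: nat where "p = pt i j" "H = real (i + j) * h" "f (real (i + j) *\<^sub>R v) ~= 0" "f (real (i + j) *\<^sub>R w) ~= 0"
proof -
 obtain a b where p: "p = pt a b" using plane_pt pl f0 by blast
 then have H: "H = (a + b) * h" using f0 g_pt by simp
 obtain i j :: nat where "a = i" "b = j" "f (real (i + j) *\<^sub>R v) ~= 0" "f (real (i + j) *\<^sub>R w) ~= 0"
 using row_nat[of f a b] fin lv van f0 unfolding H p by blast
 then show ?thesis using that[of i j] p H by simp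
qed

lemma pw_v: "Pw k (real k *\<^sub>R v) = ps v ^ k" and pw_w: "Pw k (real k *\<^sub>R w) = ps w ^ k"
 using pw_vertex[OF finA vw(1) exv] pw_vertex[OF finA vw(2) exw] by auto

lemma lev_Pw: "lev g (Pw k) (real k * h)" by (rule lev_pw[OF gle])

lemma finite_supp_diff: "finite (supp f) ==> finite (supp (%n. f n - c * Pw k n))"
 by (rule finite_subset[of _ "supp f \<union> supp (Pw k)"]) (auto simp: supp_def finite_supp_pw[OF finA, unfolded supp_def])

text \<open>Subtracting the multiple of a power that matches at the vertex removes the whole top row.\<close>

lemma remove_row:
 assumes fin: "finite (supp f)" and pl: "!!n. f n ~= 0 ==> e \<bullet> n = 0" and lv: "lev g f (real s * h)"
 and van: "!!n. g \<bullet> n = real s * h + h ==> e \<bullet> n = 0 ==> Ad f n = 0"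
 and c: "c = f (real s *\<^sub>R v) / ps v ^ s" and p: "f p - c * Pw s p ~= 0"
 shows "g \<bullet> p < real s * h"
proof -
 let ?f = "%n. f n - c * Pw s n"
 have lv': "lev g ?f (real s * h)" using lv lev_Pw[of s] by (force simp: lev_def)
 have pl': "e \<bullet> n = 0" if "?f n ~= 0" for n
 using pl[of n] pw_plane[OF planeA, where k = s and n = n] that by fastforce
 have van': "Ad ?f n = 0" if "g \<bullet> n = real s * h + h" "e \<bullet> n = 0" for n
 using van[OF that] by (simp add: ad_diff_scale ad_pw)
 have "g \<bullet> p ~= real s * h"
 proof
 assume gp: "g \<bullet> p = real s * h"
 obtain i j :: nat where ij: "real s * h = real (i + j) * h" "?f (real (i + j) *\<^sub>R v) ~= 0"
 using row_level[OF finite_supp_diff[OF fin] pl' lv' van' p gp] by blast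
 then have "i + j = s" using h0 by (simp flip: of_nat_add)
 then show False using ij(2) psA[OF vw(1)] by (simp add: c pw_v)
 qed
 then show ?thesis using lv' p by (force simp: lev_def)
qed

text \<open>Descent on the top level: it is a multiple \<open>k * h\<close>, subtracting a multiple
  of the \<open>k\<close>-th power lowers it inside the kernel, and the new top level is again a
  multiple of \<open>h\<close>.\<close>

lemma kernel_polynomial:
 assumes "finite (supp f)" "!!n. f n ~= 0 ==> e \<bullet> n = 0" "!!n. Ad f n = 0"
 shows "\<exists>N q. \<forall>n. f n = (\<Sum>k<N. q k * Pw k n)"
proof -
 have "\<exists>N q. \<forall>n. f n = (\<Sum>k<N. q k * Pw k n)"
 if "finite (supp f)" "!!n. f n ~= 0 ==> e \<bullet> n = 0" "!!n. Ad f n = 0" "lev g f (real s * h)" for s f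
 using that
 proof (induction s arbitrary: f rule: less_induct)
 case (less s)
 show ?case
 proof (cases "f = (%n. 0)")
 case True then show ?thesis by (intro exI[of _ 0]) simp
 next
 case False
 obtain p where p: "f p ~= 0" "lev g f (g \<bullet> p)" using exists_top_level[OF less.prems(1) False] by blast
 obtain i j where ij: "g \<bullet> p = real (i + j) * h"
 using row_level[OF less.prems(1,2) p(2) less.prems(3) p(1) refl] by blast
 define k where "k = i + j"
 have k: "g \<bullet> p = real k * h" using ij by (simp add: k_def)
 have "real k * h <= real s * h" using less.prems(4) p(1) k by (auto simp: lev_def)
 then have ks: "k <= s" using h0 by simp
 define c where "c = f (real k *\<^sub>R v) / ps v ^ k"
 let ?f = "%n. f n - c * Pw k n"
 have lt: "g \<bullet> n < real k * h" if "?f n ~= 0" for n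
 by (rule remove_row[OF less.prems(1,2) _ less.prems(3) c_def that]) (use p k in auto)
 have fin': "finite (supp ?f)" by (rule finite_supp_diff[OF less.prems(1)])
 have pl': "e \<bullet> n = 0" if "?f n ~= 0" for n
 using less.prems(2)[of n] pw_plane[OF planeA, where k = k and n = n] that by fastforce
 have ad': "Ad ?f n = 0" for n by (simp add: ad_diff_scale ad_pw less.prems(3))
 have "\<exists>N q. \<forall>n. ?f n = (\<Sum>k<N. q k * Pw k n)"
 proof (cases "?f = (%n. 0)")
 case True
 then show ?thesis by (intro exI[of _ 0] exI[of _ "%_. 0"]) (simp add: fun_eq_iff)
 next
 case False
 obtain p' where p': "?f p' ~= 0" "lev g ?f (g \<bullet> p')" using exists_top_level[OF fin' False] by blast
 obtain i' j' where ij': "g \<bullet> p' = real (i' + j') * h"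
 using row_level[OF fin' pl' p'(2) ad' p'(1) refl] by blast
 have "i' + j' < k" using lt[OF p'(1)] ij' h0 by simp
 then show ?thesis using less.IH[of "i' + j'" ?f] ks fin' pl' ad' p'(2) ij' by simp
 qed
 then obtain N q where q: "!!n. ?f n = (\<Sum>k<N. q k * Pw k n)" by blast
 define q' where "q' j = (if j < N then q j else 0) + (if j = k then c else 0)" for j
 have "f n = (\<Sum>j<max N (Suc k). q' j * Pw j n)" for n
 proof -
 have "(\<Sum>j<max N (Suc k). q' j * Pw j n)
 = (\<Sum>j<max N (Suc k). if j < N then q j * Pw j n else 0) + (\<Sum>j<max N (Suc k). if j = k then c * Pw j n else 0)"
 unfolding sum.distrib[symmetric] q'_def by (intro sum.cong) (auto simp: algebra_simps)
 also have "(\<Sum>j<max N (Suc k). if j < N then q j * Pw j n else 0) = (\<Sum>j<N. q j * Pw j n)"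
 by (rule sum.mono_neutral_cong_right) auto
 also have "(\<Sum>j<max N (Suc k). if j = k then c * Pw j n else 0) = c * Pw k n"
 by (subst sum.delta) auto
 finally show ?thesis using q[of n] by (simp add: algebra_simps)
 qed
 then show ?thesis by blast
 qed
 qed
 moreover obtain s :: nat where "lev g f (real s * h)"
 proof -
 have "finite ((%n. g \<bullet> n) ` supp f)" using assms(1) by simp
 then obtain B where B: "!!n. n : supp f ==> g \<bullet> n <= B" by (meson bdd_above_finite bdd_above.unfold imageI)
 obtain s :: nat where "B / h < s" using reals_Archimedean2 by blast
 then have "B <= real s * h" using h0 by (simp add: field_simps)
 then have "lev g f (real s * h)" unfolding lev_def using B by (force simp: supp_def)
 then show ?thesis by (rule that)
 qed
 ultimately show ?thesis using assms by blast
qed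

end

section \<open>Iterated advection with bounded support\<close>

context plane_edge
begin

lemma plane_ad: 
 assumes "!!n. f n ~= 0 ==> e \<bullet> n = 0" "Ad f n ~= 0" 
 shows "e \<bullet> n = 0"
proof -
 obtain l where l: "l : A" "f (n - l) ~= 0" using ad_neq_0D[OF assms(2)] by blast
 then have "e \<bullet> (n - l) = 0" "e \<bullet> l = 0" using assms(1) planeA by auto
 then show ?thesis by (simp add: inner_diff_right)
qed

text \<open>The supports stay in a finite set under iteration only if the iteration reaches zero.\<close>

lemma ad_nilpotent:
 assumes finB: "finite B" and B: "!!k n. (Ad ^^ k) f n ~= 0 ==> n : B"
 and pl: "!!n. f n ~= 0 ==> e \<bullet> n = 0"
 shows "\<exists>k. (Ad ^^ k) f = (%n. 0)"
proof (rule ccontr)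
 assume no: "~ ?thesis"
 define F where "F k = (Ad ^^ k) f" for k
 have FS: "F (Suc k) = Ad (F k)" for k by (simp add: F_def)
 have F0: "F k ~= (%n. 0)" for k using no by (simp add: F_def)
 have finF: "finite (supp (F k))" for k
 by (rule finite_subset[OF _ finB]) (use B in \<open>auto simp: supp_def F_def\<close>)
 have plF: "e \<bullet> n = 0" if "F k n ~= 0" for k n
 using that
 proof (induction k arbitrary: n)
 case 0 then show ?case using pl by (simp add: F_def)
 next
 case (Suc k) then show ?case using plane_ad[of "F k" n] by (simp add: FS)
 qed
 have "\<exists>p. F k p ~= 0 & lev g (F k) (g \<bullet> p)" for k
 using exists_top_level[OF finF F0] by metis
 then obtain p where p: "!!k. F k (p k) ~= 0" "!!k. lev g (F k) (g \<bullet> p k)" by metis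
 define T where "T k = g \<bullet> p k" for k
 have rT: "range T \<subseteq> (%n. g \<bullet> n) ` B" using p(1) B by (auto simp: T_def F_def)
 then have finT: "finite (range T)" using finB finite_subset by blast
 \<comment> \<open>\<open>L\<close> holds the top levels that recur infinitely often, and
   \<open>H\<close> is the greatest of them; from \<open>K\<close> on no higher level
   occurs.\<close>
 define L where "L = {x : range T. infinite {k. T k = x}}"
 have "L ~= {}"
 proof
 assume "L = {}"
 then have "finite (\<Union>x\<in>range T. {k. T k = x})" using finT by (intro finite_UN_I) (auto simp: L_def)
 moreover have "(\<Union>x\<in>range T. {k. T k = x}) = UNIV" by auto
 ultimately show False by simp
 qed
 moreover have finL: "finite L" using finT by (simp add: L_def)
 ultimately obtain H where H: "H : L" "!!x. x : L ==> x <= H"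
 using finite_argmax[of L "%x. x"] by blast
 have "finite (\<Union>x\<in>range T - L. {k. T k = x})" using finT by (intro finite_UN_I) (auto simp: L_def)
 then obtain K where "ALL k:(\<Union>x\<in>range T - L. {k. T k = x}). k < K"
 unfolding finite_nat_set_iff_bounded by blast
 then have K: "k < K" if "x : range T - L" "T k = x" for k x using that by blast
 have late: "T k <= H" if "k >= K" for k using H(2)[of "T k"] K[of "T k" k] that by fastforce
 obtain k where k: "k > K" "T k = H"
 using H(1) unfolding L_def infinite_nat_iff_unbounded by auto
 then obtain m where m: "k = Suc m" "m >= K" by (cases k) auto
 \<comment> \<open>The consecutive iterates \<open>a\<close>, \<open>b = Ad a\<close> and
   \<open>Ad b\<close> all have level at most \<open>H\<close>, and \<open>b\<close> attains
   it.\<close>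
 define a where "a = F m"
 define b where "b = F k"
 have ba: "b = Ad a" by (simp add: a_def b_def m FS)
 have la: "lev g a H" using p(2)[of m] late[OF m(2)] by (force simp: lev_def a_def T_def)
 have lb: "lev g b H" using p(2)[of k] k by (simp add: b_def T_def)
 have lab: "lev g (Ad b) H" using p(2)[of "Suc k"] late[of "Suc k"] k by (force simp: lev_def b_def FS T_def)
 have pb: "b (p k) ~= 0" "g \<bullet> p k = H" using p(1)[of k] k by (simp_all add: b_def T_def)
 have vanb: "Ad b n = 0" if "g \<bullet> n = H + h" for n using lab that h0 by (force simp: lev_def)
 note rows = row_level[OF finF[of k, folded b_def] plF[of k, folded b_def] lb vanb]
 obtain i j :: nat where ij: "H = real (i + j) * h" "b (real (i + j) *\<^sub>R v) ~= 0"
 using rows[OF _ _ pb] by blast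
 define s where "s = i + j"
 have s: "H = real s * h" "b (real s *\<^sub>R v) ~= 0" using ij by (simp_all add: s_def)
 define c where "c = a (real s *\<^sub>R v) / ps v ^ s"
 \<comment> \<open>Removing the top row of \<open>a\<close> does not change the image
   \<open>b\<close>, because powers lie in the kernel.\<close>
 define a' where "a' n = a n - c * Pw s n" for n
 have vana: "Ad a n = 0" if "g \<bullet> n = H + h" for n using lb that h0 by (force simp: lev_def ba)
 have lt: "g \<bullet> n < H" if "a' n ~= 0" for n
 unfolding s(1)
 by (rule remove_row[OF finF[of m, folded a_def] plF[of m, folded a_def]])
 (use la vana c_def that s(1) in \<open>auto simp: a'_def\<close>)
 have ba': "Ad a' = b" by (rule ext) (simp add: a'_def[abs_def] ad_diff_scale ad_pw ba)
 have fin': "finite (supp a')" unfolding a'_def[abs_def] by (rule finite_supp_diff) (use finF[of m] in \<open>simp add: a_def\<close>)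
 have pl': "e \<bullet> n = 0" if "a' n ~= 0" for n
 using plF[of m n] pw_plane[OF planeA, where k = s and n = n] that by (fastforce simp: a'_def a_def)
 have "a' ~= (%n. 0)" using ba' F0[of k] by (auto simp: b_def)
 then obtain p' where p': "a' p' ~= 0" "lev g a' (g \<bullet> p')" using exists_top_level[OF fin'] by metis
 define H' where "H' = g \<bullet> p'"
 have H'H: "H' < H" using lt[OF p'(1)] by (simp add: H'_def)
 have low: "H <= H' + h"
 proof -
 have "lev g b (H' + h)" unfolding ba'[symmetric] by (rule lev_ad[OF gle]) (use p' in \<open>auto simp: H'_def\<close>)
 then show ?thesis using pb by (auto simp: lev_def)
 qed
 show False
 \<comment> \<open>If \<open>H'\<close> exceeds \<open>H - h\<close>, the row analysis makes it a
   multiple of \<open>h\<close> strictly between \<open>(s - 1) * h\<close> and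
   \<open>s * h\<close>. If it equals \<open>H - h\<close>, the vertex value of \<open>b\<close>
   forces \<open>a'\<close> to be nonzero at the coordinates \<open>s\<close>, \<open>- 1\<close>,
   from where the row never ends.\<close>
 proof (cases "H = H' + h")
 case False
 have "Ad a' n = 0" if "g \<bullet> n = g \<bullet> p' + h" for n
 using lb that low False unfolding ba' H'_def by (force simp: lev_def)
 then obtain i' j' :: nat where "g \<bullet> p' = real (i' + j') * h"
 using row_level[OF fin' pl' p'(2) _ p'(1) refl] by blast
 then have e: "H' = real (i' + j') * h" by (simp add: H'_def)
 have "real (i' + j') * h < real s * h" using H'H e s(1) by simp
 then have 1: "i' + j' < s" using h0 by simp
 have "real s * h < (real (i' + j') + 1) * h" using low False e s(1) by (simp add: algebra_simps)
 then have "real s < real (i' + j') + 1" using h0 by (simp add: mult_less_cancel_right_disj)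
 then show False using 1 by linarith
 next
 case True
 have la': "lev g a' ((x + y) * h)" if "x + y = real s - 1" for x y
 proof -
 have "(x + y) * h = H'" unfolding that using True s(1) by (simp add: algebra_simps)
 then show ?thesis using p'(2) by (simp add: H'_def)
 qed
 have rel: "b (pt (x + 1) y) = of_real (dd v w) *
 (of_real y * ps v * a' (pt x y) - of_real (x + 1) * ps w * a' (pt (x + 1) (y - 1)))"
 if "x + y = real s - 1" for x y
 using row_rel[OF la'[OF that]] unfolding ba' .
 have nonneg: "b (pt x y) = 0" if "x + y = real s" "y < 0" for x y
 proof (rule ccontr)
 assume "b (pt x y) ~= 0"
 moreover have "g \<bullet> pt x y = H" using that s(1) by (simp add: g_pt)
 ultimately obtain i j :: nat where "pt x y = pt i j" using rows by blast
 then show False using that by (simp add: pt_inj)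
 qed
 have "pt (real s) 0 = real s *\<^sub>R v" by (simp add: pt_def)
 then have "a' (pt (real s) (-1)) ~= 0"
 using rel[of "real s - 1" 0] s(2) by auto
 then obtain k :: nat where "- 1 = real k"
 proof (rule chain_up[OF fin'])
 fix k :: nat assume nz: "a' (pt (real s + real k) (- 1 - real k)) ~= 0"
 have "b (pt (real s + real k + 1) (- 1 - real k)) = 0" by (rule nonneg) auto
 then have "of_real (- 1 - real k) * ps v * a' (pt (real s + real k) (- 1 - real k)) =
 of_real (real s + real k + 1) * ps w * a' (pt (real s + real k + 1) (- 1 - real k - 1))"
 using rel[of "real s + real k" "- 1 - real k"] D by simp
 moreover have "complex_of_real (- 1 - real k) ~= 0" unfolding of_real_eq_0_iff by linarith
 then have "of_real (- 1 - real k) * ps v * a' (pt (real s + real k) (- 1 - real k)) ~= 0"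
 using nz psA[OF vw(1)] by simp
 ultimately show "a' (pt (real s + real k + 1) (- 1 - real k - 1)) ~= 0" by auto
 qed auto
 then show False by linarith
 qed
qed

end

section \<open>Skew symmetry of advection\<close>

context plane
begin

text \<open>For the Hermitian product of coefficients advection by a real function is skew, so the
  square norm of \<open>ad A ps f\<close> is minus the product of \<open>f\<close> with the second
  iterate.\<close>

lemma ad_skew:
 assumes finA: "finite A" and symA: "!!l. l : A ==> - l : A" and ps: "!!l. l : A ==> ps (- l) = cnj (ps l)"
 and finf: "finite (supp f)" and z: "!!n. ad A ps (ad A ps f) n = 0"
 shows "ad A ps f n = 0"
proof -
 define b where "b = ad A ps f"
 have finb: "finite (supp b)" unfolding b_def by (rule finite_supp_ad[OF finA finf])
 have inner: "(\<Sum>l\<in>A. of_real (dd l m) * ps l * cnj (b (m + l))) = 0" for m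
 proof -
 have "(\<Sum>l\<in>A. of_real (dd l m) * ps l * cnj (b (m + l)))
 = (\<Sum>l\<in>A. of_real (dd (- l) m) * ps (- l) * cnj (b (m - l)))"
 by (rule sum.reindex_bij_witness[of _ uminus uminus]) (use symA in auto)
 also have "\<dots> = - cnj (ad A ps b m)"
 unfolding ad_def by (simp add: sum_negf ps)
 finally show ?thesis using z by (simp add: b_def)
 qed
 have "(\<Sum>n\<in>supp b. b n * cnj (b n)) = (\<Sum>n\<in>supp b. \<Sum>l\<in>A. of_real (dd l n) * ps l * f (n - l) * cnj (b n))"
 by (simp add: b_def ad_def sum_distrib_right)
 also have "\<dots> = (\<Sum>l\<in>A. \<Sum>n\<in>supp b. of_real (dd l n) * ps l * f (n - l) * cnj (b n))" by (rule sum.swap)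
 also have "\<dots> = (\<Sum>l\<in>A. \<Sum>m\<in>supp f. of_real (dd l m) * ps l * f m * cnj (b (m + l)))"
 proof (rule sum.cong[OF refl])
 fix l assume "l : A"
 let ?T = "{n : supp b. n - l : supp f}"
 have "(\<Sum>n\<in>supp b. of_real (dd l n) * ps l * f (n - l) * cnj (b n))
 = (\<Sum>n\<in>?T. of_real (dd l n) * ps l * f (n - l) * cnj (b n))"
 by (rule sum.mono_neutral_right[OF finb]) (auto simp: supp_def)
 also have "\<dots> = (\<Sum>m\<in>{m : supp f. m + l : supp b}. of_real (dd l m) * ps l * f m * cnj (b (m + l)))"
 by (rule sum.reindex_bij_witness[of _ "%m. m + l" "%n. n - l"]) (auto simp: dd_diff)
 also have "\<dots> = (\<Sum>m\<in>supp f. of_real (dd l m) * ps l * f m * cnj (b (m + l)))"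
 by (rule sum.mono_neutral_left[OF finf]) (auto simp: supp_def)
 finally show "(\<Sum>n\<in>supp b. of_real (dd l n) * ps l * f (n - l) * cnj (b n))
 = (\<Sum>m\<in>supp f. of_real (dd l m) * ps l * f m * cnj (b (m + l)))" .
 qed
 also have "\<dots> = (\<Sum>m\<in>supp f. f m * (\<Sum>l\<in>A. of_real (dd l m) * ps l * cnj (b (m + l))))"
 by (subst sum.swap) (simp add: sum_distrib_left mult_ac)
 also have "\<dots> = 0" by (simp add: inner)
 finally have "(\<Sum>n\<in>supp b. of_real ((cmod (b n))\<^sup>2)) = (0::complex)"
 by (simp only: complex_norm_square)
 then have "complex_of_real (\<Sum>n\<in>supp b. (cmod (b n))\<^sup>2) = 0" by (simp only: of_real_sum)
 then have "(\<Sum>n\<in>supp b. (cmod (b n))\<^sup>2) = 0" by (simp only: of_real_eq_0_iff)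
 then have "ALL n:supp b. (cmod (b n))\<^sup>2 = 0" using finb by (simp add: sum_nonneg_eq_0_iff)
 then have "b n = 0" by (auto simp: supp_def)
 then show ?thesis by (simp add: b_def)
qed

lemma ad_nilpotent_zero:
 assumes finA: "finite A" and symA: "!!l. l : A ==> - l : A" and ps: "!!l. l : A ==> ps (- l) = cnj (ps l)"
 and finf: "finite (supp f)" and z: "(ad A ps ^^ k) f = (%n. 0)"
 shows "ad A ps f n = 0"
 using z
proof (induction k)
 case 0
 then show ?case by simp
next
 case (Suc k)
 show ?case
 proof (cases k)
 case 0
 then show ?thesis using Suc.prems by simp
 next
 case (Suc j)
 have fin: "finite (supp ((ad A ps ^^ i) f))" for i
 by (induction i) (use finf finite_supp_ad[OF finA] in auto)
 have "ad A ps ((ad A ps ^^ j) f) n = 0" for n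
 using ad_skew[of A ps "(ad A ps ^^ j) f" n] finA symA ps fin[of j] Suc.prems Suc by auto
 then have "(ad A ps ^^ k) f = (%n. 0)" using Suc by auto
 then show ?thesis by (rule Suc.IH)
 qed
qed

end

context plane
begin

lemma cross_plane:
 assumes "e \<bullet> x = 0" "e \<bullet> y = 0"
 shows "cross3 x y = dd x y *\<^sub>R e"
proof -
 have "cross3 e (cross3 x y) = 0" using assms by (simp add: Lagrange)
 then have "cross3 e (cross3 e (cross3 x y)) = 0" by simp
 then show ?thesis unfolding Lagrange[of e e] by (simp add: e1 dd_def det3_def)
qed

lemma plane_inner:
 assumes "e \<bullet> x = 0" "e \<bullet> y = 0" "e \<bullet> z = 0"
 shows "(x \<bullet> x) * (y \<bullet> z) = (x \<bullet> y) * (x \<bullet> z) + dd x y * dd x z"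
 using cross3_dot_cross3[of x y z] cross_plane[OF assms(1,2)] cross_plane[OF assms(1,3)]
 by (simp add: e1 algebra_simps)

end

section \<open>In-plane frequencies on a circle\<close>

locale plane_circle = plane +
 fixes A :: "(real^3) set" and ps :: "real^3 => complex" and lam :: real
 assumes finA: "finite A" and planeA: "!!z. z : A ==> e \<bullet> z = 0" and psA: "!!z. z : A ==> ps z ~= 0"
 and normA: "!!z. z : A ==> norm z = lam" and lam0: "lam > 0"
 and symA: "!!z. z : A ==> - z : A" and ps_cnj: "!!z. z : A ==> ps (- z) = cnj (ps z)"
 and spanA: "EX x:A. EX y:A. dd x y ~= 0"
begin

abbreviation edge where "edge v w \<equiv> plane_edge e A ps v w (v + w) (lam\<^sup>2 + v \<bullet> w)"

lemma selfA: "z : A ==> z \<bullet> z = lam\<^sup>2"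
 using normA by (simp add: dot_square_norm)

lemma ltA: "x : A ==> y : A ==> x ~= y ==> x \<bullet> y < lam\<^sup>2"
proof -
 assume xy: "x : A" "y : A" "x ~= y"
 have "0 < (x - y) \<bullet> (x - y)" using xy by simp
 also have "\<dots> = 2 * lam\<^sup>2 - 2 * (x \<bullet> y)"
 using selfA xy by (simp add: inner_diff inner_commute)
 finally show ?thesis by simp
qed

lemma gtA: "x : A ==> y : A ==> x ~= - y ==> - (lam\<^sup>2) < x \<bullet> y"
 using ltA[of x "- y"] symA[of y] by simp

lemma span_at: "x : A ==> EX y:A. dd x y ~= 0"
proof (rule ccontr)
 assume x: "x : A" and no: "~ (EX y:A. dd x y ~= 0)"
 obtain y z where yz: "y : A" "z : A" "dd y z ~= 0" using spanA by blast
 have "dd x y = 0" "dd x z = 0" using no yz by auto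
 have "(x \<bullet> x) *\<^sub>R cross3 y z = 0"
 proof -
 have "dd x y = 0 ==> e \<bullet> y = 0 ==> (x \<bullet> x) *\<^sub>R y = (x \<bullet> y) *\<^sub>R x" for y
 using cross_plane[of x y] planeA[OF x] Lagrange[of x x y] by simp
 from this[OF \<open>dd x y = 0\<close> planeA[OF yz(1)]] this[OF \<open>dd x z = 0\<close> planeA[OF yz(2)]]
 have "cross3 ((x \<bullet> x) *\<^sub>R y) ((x \<bullet> x) *\<^sub>R z) = 0" by (simp add: cross_mult_left cross_mult_right)
 then show ?thesis using selfA[OF x] lam0 by (simp add: cross_mult_left cross_mult_right)
 qed
 then have "cross3 y z = 0" using selfA[OF x] lam0 by simp
 then show False using yz(3) by (simp add: dd_def det3_def)
qed

lemma dd_nonzero: "x : A ==> y : A ==> x ~= y ==> x ~= - y ==> dd x y ~= 0"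
proof
 assume xy: "x : A" "y : A" "x ~= y" "x ~= - y" "dd x y = 0"
 have "(x \<bullet> x) * (y \<bullet> y) = (x \<bullet> y) * (x \<bullet> y) + dd x y * dd x y"
 by (rule plane_inner) (use planeA xy in auto)
 then have "(lam\<^sup>2 - x \<bullet> y) * (lam\<^sup>2 + x \<bullet> y) = 0"
 using selfA xy by (simp add: algebra_simps)
 then show False using ltA[OF xy(1-3)] gtA[OF xy(1,2,4)] by simp
qed

lemma edgeI:
 assumes "x : A" "y : A" "x ~= y" "x ~= - y"
 and top: "!!z. z : A ==> z ~= x ==> z ~= y ==> x \<bullet> z + y \<bullet> z < lam\<^sup>2 + x \<bullet> y"
 shows "edge x y"
proof
 show "dd x y ~= 0" by (rule dd_nonzero) (use assms in auto)
 show "(x + y) \<bullet> x = lam\<^sup>2 + x \<bullet> y" "(x + y) \<bullet> y = lam\<^sup>2 + x \<bullet> y"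
 using selfA assms(1,2) by (simp_all add: inner_add_left inner_commute[of y x])
 show "lam\<^sup>2 + x \<bullet> y > 0" using gtA[OF assms(1,2,4)] by simp
 show "(x + y) \<bullet> z < lam\<^sup>2 + x \<bullet> y" if "z : A" "z ~= x" "z ~= y" for z
 using top[OF that] by (simp add: inner_add_left)
 show "x \<bullet> z < x \<bullet> x" if "z : A" "z ~= x" for z using ltA[of x z] that assms selfA by auto
 show "y \<bullet> z < y \<bullet> y" if "z : A" "z ~= y" for z using ltA[of y z] that assms selfA by auto
qed (use finA planeA psA assms in auto)

text \<open>A closest pair across a partition of \<open>A\<close> is an edge.\<close>

lemma edge_across:
 assumes C: "C \<subseteq> A" "C ~= {}" "A - C ~= {}"
 obtains x y where "x : C" "y : A - C" "edge x y"
proof -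
 let ?X = "C \<times> (A - C)"
 have "finite C" using finite_subset[OF C(1) finA] .
 then have X: "finite ?X" "?X ~= {}" using finA C by auto
 obtain z where z: "z : ?X" "!!u. u : ?X ==> fst u \<bullet> snd u <= fst z \<bullet> snd z"
 using finite_argmax[OF X, of "%u. fst u \<bullet> snd u"] by blast
 obtain x y where xy: "z = (x, y)" by (cases z)
 have x: "x : C" "x : A" and y: "y : A - C" using z xy C by auto
 have mx: "u \<bullet> t <= x \<bullet> y" if "u : C" "t : A - C" for u t using z(2)[of "(u, t)"] that xy by simp
 \<comment> \<open>If the closest pair were antipodal, all pairs across the partition would be; a
   point \<open>t\<close> in a third direction contradicts this, on whichever side it lies.\<close>
 have "x ~= - y"
 proof
 assume xm: "x = - y"
 have anti: "u = - t" if "u : C" "t : A - C" for u t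
 proof (rule ccontr)
 assume "u ~= - t"
 then have "- (lam\<^sup>2) < u \<bullet> t" using gtA[of u t] that C by auto
 also have "\<dots> <= x \<bullet> y" by (rule mx[OF that])
 finally show False using xm selfA[of y] y by simp
 qed
 obtain t where t: "t : A" "dd x t ~= 0" using span_at[OF x(2)] by blast
 have "t ~= x" "t ~= - x" using t by auto
 show False
 proof (cases "t : C")
 case True
 then show False using anti[OF True y] xm \<open>t ~= x\<close> by simp
 next
 case False
 then show False using anti[OF x(1), of t] t \<open>t ~= - x\<close> by auto
 qed
 qed
 then have "edge x y"
 proof (intro edgeI)
 fix t assume t: "t : A" "t ~= x" "t ~= y"
 show "x \<bullet> t + y \<bullet> t < lam\<^sup>2 + x \<bullet> y"
 proof (cases "t : C")
 case True
 then have "t \<bullet> y <= x \<bullet> y" using mx y by auto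
 then show ?thesis using ltA[of x t] x t by (simp add: inner_commute)
 next
 case False
 then have "x \<bullet> t <= x \<bullet> y" using mx x t by auto
 then show ?thesis using ltA[of y t] y t by (simp add: inner_commute)
 qed
 qed (use x y in auto)
 then show ?thesis using that x y by blast
qed

text \<open>The point nearest to \<open>x\<close> on the prescribed side works. Other points of that
  side are no closer to \<open>x\<close>; for the opposite side the product of the two determinants
  is nonpositive, which bounds \<open>w \<bullet> z\<close>.\<close>

lemma edge_oriented:
 assumes x: "x : A" and sg: "sg ~= 0"
 obtains w where "edge x w" "sg * dd x w > 0"
proof -
 let ?X = "{w : A. sg * dd x w > 0}"
 obtain y where y: "y : A" "dd x y ~= 0" using span_at[OF x] by blast
 have "?X ~= {}"
 proof (cases "sg * dd x y > 0")
 case True then show ?thesis using y by auto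
 next
 case False
 then have "sg * dd x y < 0" using y sg by (simp add: less_le)
 then have "- y : ?X" using symA[OF y(1)] by simp
 then show ?thesis by blast
 qed
 then obtain w where w: "w : ?X" "!!z. z : ?X ==> x \<bullet> z <= x \<bullet> w"
 using finite_argmax[of ?X "%z. x \<bullet> z"] finA by auto
 have xw: "x ~= w" "x ~= - w" using w by auto
 have "edge x w"
 proof (rule edgeI[OF x _ xw])
 show "w : A" using w by simp
 fix z assume z: "z : A" "z ~= x" "z ~= w"
 show "x \<bullet> z + w \<bullet> z < lam\<^sup>2 + x \<bullet> w"
 proof (cases "sg * dd x z > 0")
 case True
 then show ?thesis using w(2)[of z] z ltA[of w z] w(1) by auto
 next
 case False
 have l2: "lam\<^sup>2 > 0" using lam0 by simp
 have id: "lam\<^sup>2 * (w \<bullet> z) = (x \<bullet> w) * (x \<bullet> z) + dd x w * dd x z"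
 using plane_inner[of x w z] planeA x w z selfA[OF x] by auto
 have "0 <= sg * dd x w" "sg * dd x z <= 0" using w(1) False by auto
 then have "(sg * dd x w) * (sg * dd x z) <= 0" by (rule mult_nonneg_nonpos)
 then have "(sg * sg) * (dd x w * dd x z) <= 0" by (simp add: mult_ac)
 moreover have "sg * sg > 0" using sg not_real_square_gt_zero[of sg] by blast
 ultimately have "dd x w * dd x z <= 0" by (meson mult_pos_pos not_le)
 then have "lam\<^sup>2 * (x \<bullet> z + w \<bullet> z) <= (lam\<^sup>2 + x \<bullet> w) * (x \<bullet> z)"
 using id by (simp add: algebra_simps)
 also have "\<dots> < (lam\<^sup>2 + x \<bullet> w) * lam\<^sup>2"
 using gtA[of x w] w(1) xw x ltA[of x z] z by (intro mult_strict_left_mono) auto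
 finally have "lam\<^sup>2 * (x \<bullet> z + w \<bullet> z) < lam\<^sup>2 * (lam\<^sup>2 + x \<bullet> w)" by (simp add: mult.commute)
 then show ?thesis using l2 by simp
 qed
 qed
 then show ?thesis using that w by auto
qed

end

section \<open>The second row under viscosity\<close>

context plane_edge
begin

text \<open>The binomial theorem on the top row, obtained from the recursion that expresses the
  vanishing advection of the power.\<close>

lemma pw_row: "a <= s ==> Pw s (pt a (real s - real a)) = of_nat (s choose a) * ps v ^ a * ps w ^ (s - a)"
proof (induction a)
 case 0
 then show ?case using pw_w[of s] by (simp add: pt_def)
next
 case (Suc a)
 define b where "b = real s - real a"
 have bn: "b = real (s - a)" using Suc by (simp add: b_def of_nat_diff)
 have IH: "Pw s (pt a b) = of_nat (s choose a) * ps v ^ a * ps w ^ (s - a)" using Suc by (simp add: b_def)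
 have "Ad (Pw s) (pt (real a + 1) b) = of_real (dd v w) *
 (of_real b * ps v * Pw s (pt a b) - of_real (real a + 1) * ps w * Pw s (pt (real a + 1) (b - 1)))"
 by (rule row_rel) (use lev_Pw[of s] in \<open>simp add: b_def\<close>)
 then have rel: "of_real b * ps v * Pw s (pt a b) = of_real (real a + 1) * ps w * Pw s (pt (real a + 1) (b - 1))"
 using D by (simp add: ad_pw)
 have sa: "s - a = Suc (s - Suc a)" using Suc by simp
 have ch: "(s - a) * (s choose a) = Suc a * (s choose Suc a)"
 by (metis binomial_absorb_comp binomial_absorption mult.commute)
 have "of_nat (Suc a) * ps w * Pw s (pt (real a + 1) (b - 1))
 = of_nat ((s - a) * (s choose a)) * ps v ^ Suc a * ps w ^ (s - a)"
 proof -
 have "of_nat (Suc a) * ps w * Pw s (pt (real a + 1) (b - 1))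
 = of_real (real a + 1) * ps w * Pw s (pt (real a + 1) (b - 1))" by simp
 also have "\<dots> = of_nat (s - a) * ps v * (of_nat (s choose a) * ps v ^ a * ps w ^ (s - a))"
 unfolding rel[symmetric] IH by (simp only: bn of_real_of_nat_eq)
 finally show ?thesis by (simp only: of_nat_mult power_Suc mult_ac)
 qed
 also have "\<dots> = of_nat (Suc a) * ps w * (of_nat (s choose Suc a) * ps v ^ Suc a * ps w ^ (s - Suc a))"
 unfolding ch unfolding sa power_Suc of_nat_mult by (simp only: mult_ac)
 finally have "Pw s (pt (real a + 1) (b - 1)) = of_nat (s choose Suc a) * ps v ^ Suc a * ps w ^ (s - Suc a)"
 using psA[OF vw(2)] by (simp del: of_nat_Suc)
 moreover have "pt (real a + 1) (b - 1) = pt (real (Suc a)) (real s - real (Suc a))" by (simp add: b_def algebra_simps)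
 ultimately show ?case by simp
qed

text \<open>The top row of \<open>f\<close> is binomial, and its advection is a source for the row
  below. At \<open>pt (a + 1) b\<close> the factor
  \<open>(real s)\<^sup>2 * r2 - n \<bullet> n\<close> equals
  \<open>2 * (a + 1) * b * (r2 - v \<bullet> w)\<close>, so after division by the binomial weights
  the source is constant. The normalized values of the second row form an arithmetic progression,
  whose ends differ by \<open>s - 1\<close> steps of size \<open>s * K * c\<close>.\<close>

lemma row_shift:
 assumes fin: "finite (supp f)" and pl: "!!n. f n ~= 0 ==> e \<bullet> n = 0" and lv: "lev g f (real s * h)"
 and van: "!!n. g \<bullet> n = real s * h + h ==> e \<bullet> n = 0 ==> Ad f n = 0" and s: "s >= 1"
 and low: "!!n. Ad f n ~= 0 ==> g \<bullet> n <= real s * h"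
 and c: "c = f (real s *\<^sub>R v) / ps v ^ s"
 and nv: "v \<bullet> v = r2" "w \<bullet> w = r2"
 and row: "!!n. g \<bullet> n = real s * h ==> Ad f n = of_real (kap * ((real s)\<^sup>2 * r2 - n \<bullet> n)) * f n"
 defines "K \<equiv> 2 * kap * (r2 - v \<bullet> w) / dd v w"
 shows "(f (real (s - 1) *\<^sub>R v) - c * Pw s (real (s - 1) *\<^sub>R v)) / ps v ^ (s - 1)
 = (f (real (s - 1) *\<^sub>R w) - c * Pw s (real (s - 1) *\<^sub>R w)) / ps w ^ (s - 1) - of_real (real (s - 1) * real s * K) * c"
proof -
 define f' where "f' n = f n - c * Pw s n" for n
 note nz = psA[OF vw(1)] psA[OF vw(2)]
 have adf: "Ad f' n = Ad f n" for n by (simp add: f'_def[abs_def] ad_diff_scale ad_pw)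
 have lt: "g \<bullet> n < real s * h" if "f' n ~= 0" for n
 by (rule remove_row[OF fin pl lv van c]) (use that in \<open>auto simp: f'_def\<close>)
 have fin': "finite (supp f')" unfolding f'_def[abs_def] by (rule finite_supp_diff[OF fin])
 have pl': "e \<bullet> n = 0" if "f' n ~= 0" for n
 using pl[of n] pw_plane[OF planeA, where k = s and n = n] that by (fastforce simp: f'_def)
 \<comment> \<open>A top level strictly between \<open>(s - 1) * h\<close> and \<open>s * h\<close>
   is impossible, because with no advection above it it would be a multiple of
   \<open>h\<close>.\<close>
 have lv': "lev g f' ((real s - 1) * h)"
 proof (cases "f' = (%n. 0)")
 case True then show ?thesis by (simp add: lev_def)
 next
 case False
 obtain p where p: "f' p ~= 0" "lev g f' (g \<bullet> p)" using exists_top_level[OF fin' False] by metis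
 have "g \<bullet> p <= (real s - 1) * h"
 proof (rule ccontr)
 assume no: "~ ?thesis"
 have "Ad f' n = 0" if "g \<bullet> n = g \<bullet> p + h" for n
 using low[of n] that no by (force simp: adf algebra_simps)
 then obtain i j :: nat where ij: "g \<bullet> p = real (i + j) * h"
 using row_level[OF fin' pl' p(2) _ p(1) refl] by blast
 have "real (i + j) * h < real s * h" using lt[OF p(1)] ij by simp
 then have 1: "i + j < s" using h0 by simp
 have "(real s - 1) * h < real (i + j) * h" using no ij by simp
 then have "real s - 1 < real (i + j)" using h0 by (simp only: mult_less_cancel_right_pos)
 then show False using 1 by linarith
 qed
 then show ?thesis using p(2) by (force simp: lev_def)
 qed
 define z0 where "z0 = f' (pt 0 (real s - 1)) / ps w ^ (s - 1)"
 have frow: "f n = c * Pw s n" if "g \<bullet> n = real s * h" for n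
 using lt[of n] that by (auto simp: f'_def)
 have main: "f' (pt a (real s - 1 - real a)) = ps v ^ a * ps w ^ (s - 1 - a) *
 of_nat (s - 1 choose a) * (z0 - of_real (real a * real s * K) * c)" if "a <= s - 1" for a
 using that
 proof (induction a)
 case 0
 then show ?case using nz by (simp add: z0_def)
 next
 case (Suc a)
 define b where "b = s - 1 - a"
 have b: "real s - 1 - real a = real b" "s - 1 - a = b" "b >= 1" "s - 1 - Suc a = b - 1" "s = Suc (a + b)"
 using Suc.prems s by (auto simp: b_def of_nat_diff)
 have IH: "f' (pt a b) = ps v ^ a * ps w ^ b * of_nat (s - 1 choose a) * (z0 - of_real (real a * real s * K) * c)"
 using Suc b by simp
 have rel: "Ad f' (pt (real a + 1) b) = of_real (dd v w) *
 (of_real b * ps v * f' (pt a b) - of_real (real a + 1) * ps w * f' (pt (real a + 1) (real b - 1)))"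
 by (rule row_rel) (use lv' b in simp)
 let ?n = "pt (real a + 1) b"
 have gn: "g \<bullet> ?n = real s * h" using b by (simp add: g_pt)
 have nn: "(real s)\<^sup>2 * r2 - ?n \<bullet> ?n = 2 * (real a + 1) * real b * (r2 - v \<bullet> w)"
 unfolding b(5) by (simp add: pt_def inner_add_left inner_add_right nv inner_commute[of w v] power2_eq_square algebra_simps)
 have fn: "f ?n = c * (of_nat (s choose Suc a) * ps v ^ Suc a * ps w ^ b)"
 proof -
 have e: "real s - real (Suc a) = real b" "s - Suc a = b" using b by auto
 have "Pw s (pt (real (Suc a)) (real s - real (Suc a))) = of_nat (s choose Suc a) * ps v ^ Suc a * ps w ^ (s - Suc a)"
 by (rule pw_row) (use b in simp)
 then show ?thesis using frow[OF gn] unfolding e by (simp add: add.commute)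
 qed
 have "of_real (dd v w) *
 (of_real b * ps v * f' (pt a b) - of_real (real a + 1) * ps w * f' (pt (real a + 1) (real b - 1)))
 = of_real (kap * (2 * (real a + 1) * real b * (r2 - v \<bullet> w))) * f ?n"
 using rel row[OF gn] unfolding adf nn by simp
 also have "\<dots> = of_real (dd v w) * (of_real (K * (real a + 1) * real b) * f ?n)"
 using D by (simp add: K_def field_simps)
 finally have "of_real b * ps v * f' (pt a b) - of_real (real a + 1) * ps w * f' (pt (real a + 1) (real b - 1))
 = of_real (K * (real a + 1) * real b) * f ?n"
 using D by simp
 then have "of_nat (Suc a) * ps w * f' (pt (real a + 1) (real b - 1))
 = of_nat b * ps v * f' (pt a b) - of_real (K * real b) * of_nat (Suc a) * f ?n"
 by (simp add: algebra_simps)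
 also have "\<dots> = ps v ^ Suc a * ps w ^ b * (of_nat (b * (s - 1 choose a)) * (z0 - of_real (real a * real s * K) * c)
  - of_real K * c * of_nat (b * (Suc a * (s choose Suc a))))"
 unfolding IH fn by (simp add: algebra_simps)
 also have "Suc a * (s choose Suc a) = s * (s - 1 choose a)"
 by (rule binomial_absorption)
 also have "b * (s * (s - 1 choose a)) = s * (b * (s - 1 choose a))" by simp
 also have "b * (s - 1 choose a) = Suc a * (s - 1 choose Suc a)"
 unfolding b(2)[symmetric] by (metis binomial_absorb_comp binomial_absorption mult.commute)
 also have "ps w ^ b = ps w * ps w ^ (b - 1)" using b(3) by (cases b) auto
 also have "ps v ^ Suc a * (ps w * ps w ^ (b - 1)) * (of_nat (Suc a * (s - 1 choose Suc a)) * (z0 - of_real (real a * real s * K) * c)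
  - of_real K * c * of_nat (s * (Suc a * (s - 1 choose Suc a))))
 = of_nat (Suc a) * ps w * (ps v ^ Suc a * ps w ^ (b - 1) * of_nat (s - 1 choose Suc a) * (z0 - of_real (real (Suc a) * real s * K) * c))"
 by (simp add: algebra_simps)
 finally have "f' (pt (real a + 1) (real b - 1)) = ps v ^ Suc a * ps w ^ (b - 1) * of_nat (s - 1 choose Suc a) * (z0 - of_real (real (Suc a) * real s * K) * c)"
 using nz(2) by (simp del: of_nat_Suc)
 moreover have "real s - 1 - real (Suc a) = real b - 1" using b by simp
 ultimately show ?case unfolding b(4) by (simp add: add.commute)
 qed
 have s1: "real s - 1 - real (s - 1) = 0" "real (s - 1) = real s - 1" using s by (simp_all add: of_nat_diff)
 have "f' (real (s - 1) *\<^sub>R v) = ps v ^ (s - 1) * (z0 - of_real (real (s - 1) * real s * K) * c)"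
 using main[of "s - 1"] unfolding s1(1) by (simp add: pt_def)
 moreover have "z0 = f' (real (s - 1) *\<^sub>R w) / ps w ^ (s - 1)" unfolding z0_def s1(2) by (simp add: pt_def)
 ultimately show ?thesis using nz by (simp add: f'_def)
qed

end

context plane_edge
begin

text \<open>A nonzero value at the vertex would enter the recursion at the coordinates
  \<open>s\<close>, \<open>- 1\<close> and then propagate without end, since there is no source at
  negative \<open>y\<close>.\<close>

lemma ad_vertex_zero:
 assumes fin: "finite (supp f)" and lv: "lev g f ((real s - 1) * h)"
 and nonneg: "!!x y. x + y = real s ==> y < 0 ==> Ad f (pt x y) = 0"
 shows "Ad f (real s *\<^sub>R v) = 0"
proof (rule ccontr)
 assume nz: "Ad f (real s *\<^sub>R v) ~= 0"
 have rel: "Ad f (pt (x + 1) y) = of_real (dd v w) *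
 (of_real y * ps v * f (pt x y) - of_real (x + 1) * ps w * f (pt (x + 1) (y - 1)))"
 if "x + y = real s - 1" for x y
 by (rule row_rel) (use lv that in simp)
 have "pt (real s) 0 = real s *\<^sub>R v" by (simp add: pt_def)
 then have "f (pt (real s) (-1)) ~= 0" using rel[of "real s - 1" 0] nz by auto
 then obtain k :: nat where "- 1 = real k"
 proof (rule chain_up[OF fin])
 fix k :: nat assume nz: "f (pt (real s + real k) (- 1 - real k)) ~= 0"
 have "Ad f (pt (real s + real k + 1) (- 1 - real k)) = 0" by (rule nonneg) auto
 then have "of_real (- 1 - real k) * ps v * f (pt (real s + real k) (- 1 - real k)) =
 of_real (real s + real k + 1) * ps w * f (pt (real s + real k + 1) (- 1 - real k - 1))"
 using rel[of "real s + real k" "- 1 - real k"] D by simp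
 moreover have "complex_of_real (- 1 - real k) ~= 0" unfolding of_real_eq_0_iff by linarith
 then have "of_real (- 1 - real k) * ps v * f (pt (real s + real k) (- 1 - real k)) ~= 0"
 using nz psA[OF vw(1)] by simp
 ultimately show "f (pt (real s + real k + 1) (- 1 - real k - 1)) ~= 0" by auto
 qed auto
 then show False by linarith
qed

lemma row_recursion_unique:
 assumes f: "!!x y. x + y = real s ==>
 of_real y * ps v * f (pt x y) = of_real (x + 1) * ps w * f (pt (x + 1) (y - 1))"
 and G: "!!x y. x + y = real s ==>
 of_real y * ps v * G (pt x y) = of_real (x + 1) * ps w * G (pt (x + 1) (y - 1))"
 and base: "G (real s *\<^sub>R v) = K * f (real s *\<^sub>R v)" and j: "j <= s"
 shows "G (pt (real s - real j) (real j)) = K * f (pt (real s - real j) (real j))"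
 using j
proof (induction j)
 case 0
 then show ?case using base by (simp add: pt_def)
next
 case (Suc j)
 let ?x = "real s - real (Suc j)" and ?y = "real (Suc j)"
 have e: "?x + 1 = real s - real j" "?y - 1 = real j" by simp_all
 have "of_real ?y * ps v * G (pt ?x ?y) = of_real (?x + 1) * ps w * G (pt (?x + 1) (?y - 1))"
 by (rule G) simp
 also have "\<dots> = K * (of_real (?x + 1) * ps w * f (pt (?x + 1) (?y - 1)))"
 using Suc unfolding e by simp
 also have "\<dots> = K * (of_real ?y * ps v * f (pt ?x ?y))" using f[of ?x ?y] by simp
 finally have "of_real ?y * ps v * G (pt ?x ?y) = of_real ?y * ps v * (K * f (pt ?x ?y))" by (simp only: mult_ac)
 moreover have "complex_of_real ?y * ps v ~= 0" using psA[OF vw(1)] by (simp del: of_nat_Suc)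
 ultimately show ?case by (metis mult_left_cancel)
qed

end

context plane_circle
begin

lemma pw_1: "pw A ps 1 n = (if n : A then ps n else 0)"
proof -
 have "pw A ps 1 n = (\<Sum>l\<in>A. if l = n then ps l else 0)"
 by (simp add: if_distrib cong: if_cong) (intro sum.cong refl, auto)
 also have "\<dots> = (if n : A then ps n else 0)" by (subst sum.delta'[OF finA, symmetric]) (auto intro: sum.cong)
 finally show ?thesis .
qed

lemma zero_notin: "0 ~: A"
 using normA lam0 by fastforce

lemma exists_edge: obtains v w where "v : A" "edge v w"
proof -
 obtain x where x: "x : A" using spanA by blast
 obtain w where "edge x w" using edge_oriented[OF x, of 1] by auto
 then show ?thesis using that x by blast
qed

text \<open>Neighbouring vertices share the top exponent \<open>tp\<close> and the leading
  coefficient \<open>cc\<close>. If the exponent exceeded one, the normalized value in the second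
  row would increase strictly along a suitably oriented edge, which is impossible at its maximum. So
  \<open>f\<close> begins with a linear term, and nothing can remain below it.\<close>

lemma decay_linear:
 assumes fin: "finite (supp f)" and pl: "!!n. f n ~= 0 ==> e \<bullet> n = 0" and f0: "f 0 = 0"
 and symf: "!!n. f (- n) = cnj (f n)" and sup: "!!n. ad A ps f n ~= 0 ==> f n ~= 0" and kap: "kap ~= 0"
 and row: "!!v w H n. edge v w ==> lev (v + w) f H ==> (v + w) \<bullet> n = H ==>
  ad A ps f n = of_real (kap * ((H / (lam\<^sup>2 + v \<bullet> w))\<^sup>2 * lam\<^sup>2 - n \<bullet> n)) * f n"
 shows "\<exists>c::real. \<forall>n. f n = (if n : A then of_real c * ps n else 0)"
proof (cases "f = (%n. 0)")
 case True
 then show ?thesis by (intro exI[of _ 0]) simp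
next
 case fnz: False
 define tp where "tp v = (GREATEST j::nat. f (real j *\<^sub>R v) ~= 0)" for v
 define cc where "cc v = f (real (tp v) *\<^sub>R v) / ps v ^ tp v" for v
 have data: "tp v >= 1 & lev (v + w) f (real (tp v) * (lam\<^sup>2 + v \<bullet> w)) & tp w = tp v & cc w = cc v & f (real (tp v) *\<^sub>R v) ~= 0"
 if ed: "edge v w" for v w
 proof -
 interpret plane_edge e A ps v w "v + w" "lam\<^sup>2 + v \<bullet> w" by (rule ed)
 let ?g = "v + w" and ?h = "lam\<^sup>2 + v \<bullet> w"
 obtain p where p: "f p ~= 0" "lev ?g f (?g \<bullet> p)" using exists_top_level[OF fin fnz] by blast
 have van: "ad A ps f n = 0" if "?g \<bullet> n = ?g \<bullet> p + ?h" for n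
 using sup[of n] p(2) that h0 by (force simp: lev_def)
 obtain i j :: nat where ij: "?g \<bullet> p = real (i + j) * ?h" "f (real (i + j) *\<^sub>R v) ~= 0" "f (real (i + j) *\<^sub>R w) ~= 0"
 using row_level[OF fin pl p(2) _ p(1) refl] van by blast
 define s where "s = i + j"
 have s: "?g \<bullet> p = real s * ?h" "f (real s *\<^sub>R v) ~= 0" "f (real s *\<^sub>R w) ~= 0" using ij by (simp_all add: s_def)
 have top: "tp x = s" if x: "x = v | x = w" for x
 unfolding tp_def
 proof (rule Greatest_equality)
 show "f (real s *\<^sub>R x) ~= 0" using x s by auto
 fix k :: nat assume "f (real k *\<^sub>R x) ~= 0"
 then have "?g \<bullet> (real k *\<^sub>R x) <= real s * ?h" using p(2) s(1) by (auto simp: lev_def)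
 then have "real k * ?h <= real s * ?h" using x gv by auto
 then show "k <= s" using h0 by simp
 qed
 have tv: "tp v = s" "tp w = s" using top by auto
 have "s ~= 0" using s(2) f0 by (cases s) auto
 have "f (real s *\<^sub>R w) - cc v * Pw s (real s *\<^sub>R w) = 0"
 proof (rule ccontr)
 assume "~ ?thesis"
 then have "?g \<bullet> (real s *\<^sub>R w) < real s * ?h"
 using remove_row[OF fin pl, of s "cc v" "real s *\<^sub>R w"] p(2) s(1) van by (simp add: cc_def tv)
 then show False using gv by simp
 qed
 then have "cc w = cc v" using pw_w[of s] psA[OF vw(2)] by (simp add: cc_def tv)
 then show ?thesis using tv \<open>s ~= 0\<close> s p(2) by simp
 qed
 have one: "tp v = 1" if v: "v : A" for v
 proof (rule ccontr)
 assume ne: "tp v ~= 1"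
 define X where "X x = (f (real (tp x - 1) *\<^sub>R x) - cc x * pw A ps (tp x) (real (tp x - 1) *\<^sub>R x)) / ps x ^ (tp x - 1) / cc x" for x
 let ?A2 = "{x : A. tp x ~= 1}"
 obtain x where x: "x : ?A2" "!!y. y : ?A2 ==> Re (X y) <= Re (X x)"
 using finite_argmax[of ?A2 "%x. Re (X x)"] finA v ne by auto
 \<comment> \<open>The side of the neighbour is chosen by the sign of \<open>kap\<close>, so that
   the increment \<open>K\<close> is positive.\<close>
 obtain w where w: "edge x w" "kap * dd x w > 0" using edge_oriented[OF _ kap, of x] x by auto
 interpret plane_edge e A ps x w "x + w" "lam\<^sup>2 + x \<bullet> w" by (rule w(1))
 let ?h = "lam\<^sup>2 + x \<bullet> w" and ?s = "tp x"
 note d = data[OF w(1)]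
 have wA: "w : ?A2" using vw d x by auto
 have s2: "?s >= 2" using d x by auto
 define K where "K = 2 * kap * (lam\<^sup>2 - x \<bullet> w) / dd x w"
 have Kpos: "K > 0"
 proof -
 have "lam\<^sup>2 - x \<bullet> w > 0" using ltA[OF vw] vneqw by simp
 moreover have "K * (dd x w)\<^sup>2 = 2 * (lam\<^sup>2 - x \<bullet> w) * (kap * dd x w)"
 using D by (simp add: K_def power2_eq_square field_simps)
 ultimately have "K * (dd x w)\<^sup>2 > 0" using w(2) by simp
 then show ?thesis by (simp add: zero_less_mult_iff)
 qed
 have c0: "cc x ~= 0" using d psA[OF vw(1)] by (simp add: cc_def)
 have "(f (real (?s - 1) *\<^sub>R x) - cc x * Pw ?s (real (?s - 1) *\<^sub>R x)) / ps x ^ (?s - 1)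
 = (f (real (?s - 1) *\<^sub>R w) - cc x * Pw ?s (real (?s - 1) *\<^sub>R w)) / ps w ^ (?s - 1)
 - of_real (real (?s - 1) * real ?s * (2 * kap * (lam\<^sup>2 - x \<bullet> w) / dd x w)) * cc x"
 proof (rule row_shift[OF fin pl])
 show "lev (x + w) f (real ?s * ?h)" using d by simp
 show "ad A ps f n = 0" if "(x + w) \<bullet> n = real ?s * ?h + ?h" for n
 using sup[of n] d that h0 by (force simp: lev_def)
 show "(x + w) \<bullet> n <= real ?s * ?h" if "ad A ps f n ~= 0" for n
 using sup[OF that] d by (auto simp: lev_def)
 show "1 <= ?s" using d by simp
 show "cc x = f (real ?s *\<^sub>R x) / ps x ^ ?s" by (simp add: cc_def)
 show "x \<bullet> x = lam\<^sup>2" "w \<bullet> w = lam\<^sup>2" using selfA vw by auto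
 show "ad A ps f n = of_real (kap * ((real ?s)\<^sup>2 * lam\<^sup>2 - n \<bullet> n)) * f n" if "(x + w) \<bullet> n = real ?s * ?h" for n
 using row[OF w(1) _ that] d h0 by simp
 qed auto
 then have "X x = X w - of_real (real (?s - 1) * real ?s * K)"
 using c0 d unfolding X_def K_def[symmetric] by (simp add: diff_divide_distrib)
 then have "Re (X w) = Re (X x) + real (?s - 1) * real ?s * K" by simp
 moreover have "real (?s - 1) * real ?s * K > 0" using s2 Kpos by simp
 ultimately show False using x(2)[OF wA] by linarith
 qed
 obtain v0 where v0: "v0 : A" using spanA by blast
 have const: "cc x = cc v0" if "x : A" for x
 proof (rule ccontr)
 assume "cc x ~= cc v0"
 let ?C = "{y : A. cc y = cc v0}"
 have "?C \<subseteq> A" by blast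
 moreover have "?C ~= {}" using v0 by blast
 moreover have "A - ?C ~= {}" using that \<open>cc x ~= cc v0\<close> by blast
 ultimately obtain y z where "y : ?C" "z : A - ?C" "edge y z" by (rule edge_across)
 then show False using data[of y z] by auto
 qed
 define c where "c = cc v0"
 have fA: "f x = c * ps x" if "x : A" for x
 using const[OF that] one[OF that] psA[OF that] unfolding cc_def c_def by (simp add: field_simps)
 have "c = cnj c"
 proof -
 have "c * cnj (ps v0) = cnj (c * ps v0)"
 unfolding ps_cnj[OF v0, symmetric] fA[OF v0, symmetric] fA[OF symA[OF v0], symmetric] by (rule symf)
 then have "cnj c = c" using psA[OF v0] by auto
 then show ?thesis by (rule sym)
 qed
 then have cr: "c = of_real (Re c)" by (metis Reals_cnj_iff of_real_Re)
 define f' where "f' n = f n - c * pw A ps 1 n" for n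
 have adf: "ad A ps f' n = ad A ps f n" for n by (simp add: f'_def[abs_def] ad_diff_scale ad_pw del: pw.simps)
 have symf': "f' (- n) = cnj (f' n)" for n
 using symA[of n] symA[of "- n"] ps_cnj[of n] symf[of n] \<open>c = cnj c\<close> unfolding f'_def pw_1 by auto
 have f'0: "f' 0 = 0" unfolding f'_def pw_1 using f0 zero_notin by simp
 have "f' = (%n. 0)"
 proof (rule ccontr)
 assume nz: "f' ~= (%n. 0)"
 obtain v w where v: "v : A" and ed: "edge v w" by (rule exists_edge)
 interpret plane_edge e A ps v w "v + w" "lam\<^sup>2 + v \<bullet> w" by (rule ed)
 let ?g = "v + w" and ?h = "lam\<^sup>2 + v \<bullet> w"
 have lf: "lev ?g f (real 1 * ?h)" using data[OF ed] one[OF v] by simp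
 have van: "ad A ps f n = 0" if "?g \<bullet> n > ?h" for n
 using sup[of n] lf that by (force simp: lev_def)
 have lt: "?g \<bullet> n < real 1 * ?h" if "f' n ~= 0" for n
 proof (rule remove_row[OF fin pl lf])
 show "ad A ps f n = 0" if "?g \<bullet> n = real 1 * ?h + ?h" for n using van[of n] that h0 by simp
 show "c = f (real 1 *\<^sub>R v) / ps v ^ 1" using fA[OF v] psA[OF v] by simp
 show "f n - c * Pw 1 n ~= 0" using that by (simp add: f'_def del: pw.simps)
 qed auto
 have fin': "finite (supp f')" unfolding f'_def[abs_def] by (rule finite_supp_diff[OF fin])
 have pl': "e \<bullet> n = 0" if "f' n ~= 0" for n
 using pl[of n] pw_plane[OF planeA, where k = 1 and n = n] that by (fastforce simp: f'_def simp del: pw.simps)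
 obtain p where p: "f' p ~= 0" "lev ?g f' (?g \<bullet> p)" using exists_top_level[OF fin' nz] by blast
 \<comment> \<open>By symmetry the top level of the remainder is nonnegative, and it is below
   \<open>h\<close>. A positive level would be a multiple of \<open>h\<close>; at level zero, a
   chain starting away from the origin would never end.\<close>
 have "f' (- p) ~= 0" using p(1) symf' by simp
 then have "?g \<bullet> (- p) <= ?g \<bullet> p" using p(2) unfolding lev_def by blast
 then have H0: "?g \<bullet> p >= 0" by simp
 have Hh: "?g \<bullet> p < ?h" using lt[OF p(1)] by simp
 show False
 proof (cases "?g \<bullet> p = 0")
 case False
 then have Hp: "?g \<bullet> p > 0" using H0 by simp
 have "ad A ps f' n = 0" if "?g \<bullet> n = ?g \<bullet> p + ?h" for n unfolding adf using van[of n] that Hp by simp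
 then obtain i j :: nat where ij: "?g \<bullet> p = real (i + j) * ?h"
 using row_level[OF fin' pl' p(2) _ p(1) refl] by blast
 have "real (i + j) * ?h < 1 * ?h" using Hh ij by simp
 then have "real (i + j) < 1" using h0 by (simp only: mult_less_cancel_right_pos)
 then have "i + j = 0" by linarith
 then show False using ij Hp by simp
 next
 case True
 have l0: "lev ?g f' 0" using p(2) True by simp
 obtain a0 b0 where p0: "p = pt a0 b0" using plane_pt[OF pl'[OF p(1)]] by blast
 have b0: "b0 = - a0"
 proof -
 have "(a0 + b0) * ?h = 0" using True p0 g_pt by simp
 then show ?thesis using h0 by (simp add: add_eq_0_iff)
 qed
 have "a0 ~= 0" using p0 b0 p(1) f'0 by (auto simp: pt_def)
 have "\<exists>a>0. f' (pt a (- a)) ~= 0"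
 proof (cases "a0 > 0")
 case True then show ?thesis using p p0 b0 by blast
 next
 case False
 have "pt (- a0) (- (- a0)) = - p" using p0 b0 by (simp add: pt_def)
 then show ?thesis using False \<open>a0 ~= 0\<close> \<open>f' (- p) ~= 0\<close> by (intro exI[of _ "- a0"]) auto
 qed
 then obtain a where a: "a > 0" "f' (pt a (- a)) ~= 0" by blast
 have rel: "ad A ps f' (pt (x + 1) y) = of_real (dd v w) *
 (of_real y * ps v * f' (pt x y) - of_real (x + 1) * ps w * f' (pt (x + 1) (y - 1)))"
 if "x + y = 0" for x y
 by (rule row_rel) (use l0 that in simp)
 have noneg: "ad A ps f' (pt x y) = 0" if "x + y = 1" "y < 0" for x y
 proof (rule ccontr)
 assume "ad A ps f' (pt x y) ~= 0"
 then have "f (pt x y) ~= 0" using sup adf by simp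
 moreover have "?g \<bullet> pt x y = real 1 * ?h" using that by (simp add: g_pt)
 moreover have "ad A ps f n = 0" if "?g \<bullet> n = real 1 * ?h + ?h" for n using van[of n] that h0 by simp
 ultimately obtain i j :: nat where "pt x y = pt i j"
 using row_level[OF fin pl lf] by blast
 then show False using that by (simp add: pt_inj)
 qed
 obtain k :: nat where "- a = real k"
 proof (rule chain_up[OF fin' a(2)])
 fix k :: nat assume nz: "f' (pt (a + real k) (- a - real k)) ~= 0"
 have "ad A ps f' (pt (a + real k + 1) (- a - real k)) = 0" by (rule noneg) (use a in auto)
 then have "of_real (- a - real k) * ps v * f' (pt (a + real k) (- a - real k)) =
 of_real (a + real k + 1) * ps w * f' (pt (a + real k + 1) (- a - real k - 1))"
 using rel[of "a + real k" "- a - real k"] D by simp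
 moreover have "complex_of_real (- a - real k) ~= 0" unfolding of_real_eq_0_iff using a(1) by linarith
 then have "of_real (- a - real k) * ps v * f' (pt (a + real k) (- a - real k)) ~= 0"
 using nz psA[OF vw(1)] by simp
 ultimately show "f' (pt (a + real k + 1) (- a - real k - 1)) ~= 0" by auto
 qed auto
 then show False using a(1) by linarith
 qed
 qed
 then have "f n = c * pw A ps 1 n" for n by (simp add: f'_def fun_eq_iff del: pw.simps)
 then have "f n = (if n : A then of_real (Re c) * ps n else 0)" for n
 unfolding pw_1 cr[symmetric] by simp
 then show ?thesis by blast
qed

lemma ad_iterates_zero:
 assumes finB: "finite B" and B: "!!k n. (ad A ps ^^ k) f n ~= 0 ==> n : B" and pl: "!!n. f n ~= 0 ==> e \<bullet> n = 0"
 shows "ad A ps f n = 0"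
proof -
 obtain v w where "edge v w" by (rule exists_edge)
 then interpret plane_edge e A ps v w "v + w" "lam\<^sup>2 + v \<bullet> w" .
 have "\<exists>k. (ad A ps ^^ k) f = (%n. 0)"
 by (rule ad_nilpotent[OF finB, of f]) (fact B, fact pl)
 then obtain k where "(ad A ps ^^ k) f = (%n. 0)" by blast
 moreover have "finite (supp f)"
 by (rule finite_subset[OF _ finB]) (use B[of 0] in \<open>auto simp: supp_def\<close>)
 ultimately show ?thesis using ad_nilpotent_zero[of A ps f k n] finA symA ps_cnj by blast
qed

lemma ad_kernel_polynomial:
 assumes "finite (supp f)" "!!n. f n ~= 0 ==> e \<bullet> n = 0" "!!n. ad A ps f n = 0"
 shows "\<exists>N q. \<forall>n. f n = (\<Sum>k<N. q k * pw A ps k n)"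
proof -
 obtain v w where "edge v w" by (rule exists_edge)
 then interpret plane_edge e A ps v w "v + w" "lam\<^sup>2 + v \<bullet> w" .
 show ?thesis by (rule kernel_polynomial) (use assms in auto)
qed

end

section \<open>Planar evolution\<close>

text \<open>The projected interaction sum of the equation without its factor
  \<open>\<i> / 2\<close>; a pair of frequencies is recorded by its first member.\<close>

definition nl :: "(real^3) set => (real^3 => complex^3) => real^3 => complex^3" where
 "nl S V n = (\<Sum>m\<in>{m\<in>S. n - m : S}. inter V m (n - m))"

text \<open>In this form the Coriolis operator is a rotation about \<open>n\<close>, which commutes
  with curl.\<close>

lemma Jmat_cross: "Jmat n *v v = of_real (n$3 / (norm n)\<^sup>2) *s ccross (cvec n) v"
 by (simp add: Jmat_def vec_eq_iff forall_3 matrix_vector_mult_def sum_3 cvec_def ccross_def algebra_simps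
 diff_divide_distrib add_divide_distrib)

lemma bounded_linear_cdot: "bounded_linear (%v. cdot v c)"
proof -
 have "linear (%v. cdot v c)"
 by (rule linearI) (simp only: cdot_add, simp only: cdot_scaleR scaleR_conv_of_real[where 'a=complex])
 then show ?thesis by (simp add: linear_conv_bounded_linear)
qed

lemma cdot_has_derivative:
 "(f has_vector_derivative D) (at t) ==> ((%s. cdot (f s) c) has_vector_derivative cdot D c) (at t)"
 by (rule bounded_linear.has_vector_derivative[OF bounded_linear_cdot])

lemma has_vector_derivative_vanishing:
 fixes f :: "real => 'a::real_normed_vector"
 assumes "open J" "t : J" "!!s. s : J ==> f s = 0" "(f has_vector_derivative D) (at t)"
 shows "D = 0"
proof -
 have "((%s. 0) has_vector_derivative D) (at t)"
 by (rule has_vector_derivative_transform_within_open[OF assms(4,1,2)]) (use assms(3) in auto)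
 then show ?thesis using vector_derivative_unique_at[of "%s. 0" D t 0] by auto
qed

context plane
begin

text \<open>An amplitude orthogonal to \<open>n\<close> is \<open>al\<close> times
  \<open>cross3 e n\<close> plus \<open>be\<close> times \<open>e\<close>. Up to a constant factor
  \<open>al\<close> is the stream function of the in-plane part.\<close>

definition al :: "(real^3 => complex^3) => real^3 => complex" where
 "al V n = cdot (V n) (cvec (cross3 e n)) / of_real (n \<bullet> n)"

definition be :: "(real^3 => complex^3) => real^3 => complex" where
 "be V n = cdot (V n) (cvec e)"

definition plane_field :: "(real^3 => complex^3) => bool" where
 "plane_field V \<longleftrightarrow> (\<forall>n. V n ~= 0 --> n ~= 0 & e \<bullet> n = 0 & cdot (cvec n) (V n) = 0)"

lemma al_be_zero [simp]: "V n = 0 ==> al V n = 0" "V n = 0 ==> be V n = 0"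
 by (simp_all add: al_def be_def)

lemma cross_e_inner: "e \<bullet> x = 0 ==> cross3 e x \<bullet> cross3 e y = x \<bullet> y"
 by (simp add: cross3_dot_cross3 e1 inner_commute)

lemma dd_cross_e: "cross3 e x \<bullet> y = dd x y"
 unfolding dd_def det3_def by (metis cross_triple inner_commute)

lemma plane_decomp:
 assumes "e \<bullet> n = 0" "n ~= 0" "cdot (cvec n) u = 0"
 shows "u = (cdot u (cvec (cross3 e n)) / of_real (n \<bullet> n)) *s cvec (cross3 e n) + cdot u (cvec e) *s cvec e"
proof -
 have m: "cross3 n e = - cross3 e n" by (metis cross_skew)
 have mm: "cross3 n e \<bullet> cross3 n e = n \<bullet> n" unfolding m using cross_e_inner[OF assms(1), of n] by simp
 have mn: "cross3 (cross3 n e) n = (n \<bullet> n) *\<^sub>R e"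
 unfolding m cross_skew[of "- cross3 e n"] using Lagrange[of n e n] assms(1) by (simp add: inner_commute cross_minus_right)
 have "of_real (n \<bullet> n) *s u = cdot u (cvec e) *s (of_real (n \<bullet> n) *s cvec e) + cdot u (cvec (cross3 e n)) *s cvec (cross3 e n)"
 using dual_basis[of n e u] assms(3) unfolding mm mn unfolding m by (simp add: cdot_commute[of u "cvec n"] cdot_minus)
 then have "of_real (n \<bullet> n) *s u = of_real (n \<bullet> n) *s ((cdot u (cvec (cross3 e n)) / of_real (n \<bullet> n)) *s cvec (cross3 e n) + cdot u (cvec e) *s cvec e)"
 using assms(2) by (simp add: vec_eq_iff field_simps)
 moreover have "complex_of_real (n \<bullet> n) ~= 0" using assms(2) by simp
 ultimately show ?thesis by (metis vector_mul_lcancel)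
qed

lemma plane_field_decomp: "plane_field V ==> V n = al V n *s cvec (cross3 e n) + be V n *s cvec e"
 using plane_decomp[of n "V n"] by (cases "V n = 0") (simp_all add: plane_field_def al_def be_def)

lemma cdot_plane_field:
 assumes V: "plane_field V"
 shows "e \<bullet> k = 0 ==> cdot (V n) (cvec k) = al V n * of_real (dd n k)"
 and "cdot (V n) (cvec (cross3 e k)) = al V n * of_real (n \<bullet> k)"
proof -
 have *: "cdot (V n) c = al V n * cdot (cvec (cross3 e n)) c + be V n * cdot (cvec e) c" for c
 by (subst plane_field_decomp[OF V]) (simp add: cdot_add cdot_simps)
 show "cdot (V n) (cvec k) = al V n * of_real (dd n k)" if "e \<bullet> k = 0"
 unfolding * cdot_cvec_cvec dd_cross_e that by simp
 show "cdot (V n) (cvec (cross3 e k)) = al V n * of_real (n \<bullet> k)"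
 proof (cases "V n = 0")
 case False
 then have "e \<bullet> n = 0" using V by (simp add: plane_field_def)
 then show ?thesis unfolding * cdot_cvec_cvec by (simp add: cross_e_inner dot_cross_self)
 qed simp
qed

text \<open>The transverse component is advected by the in-plane part. The other one carries the
  factor \<open>k \<bullet> k - m \<bullet> m\<close>, so in-plane modes of equal length have no
  effect on each other there.\<close>

lemma inter_components:
 assumes V: "plane_field V" and m: "e \<bullet> m = 0" and k: "e \<bullet> k = 0"
 shows "cdot (inter V m k) (cvec e) = of_real (dd m k) * (al V m * be V k - al V k * be V m)"
 and "cdot (inter V m k) (cvec (cross3 e (m + k))) = of_real (dd m k * (k \<bullet> k - m \<bullet> m)) * (al V m * al V k)"
proof -
 have d: "dd k m = - dd m k" by (rule dd_swap)
 have e: "e \<bullet> (m + k) = 0" using m k by (simp add: inner_add_right)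
 have "cdot (cvec e) (inter V m k) = cdot (cvec e) (bilin (V m) m (V k) k)"
 unfolding inter_def by (rule cdot_proj_perp[OF e])
 then show "cdot (inter V m k) (cvec e) = of_real (dd m k) * (al V m * be V k - al V k * be V m)"
 unfolding cdot_commute[of "inter V m k"] bilin_def cdot_plane_field(1)[OF V k] cdot_plane_field(1)[OF V m] d
 by (simp add: cdot_add cdot_simps be_def cdot_commute[of "cvec e"] algebra_simps)
 have "cross3 e (m + k) \<bullet> (m + k) = 0" by (simp add: dd_cross_e)
 then have "cdot (cvec (cross3 e (m + k))) (inter V m k) = cdot (cvec (cross3 e (m + k))) (bilin (V m) m (V k) k)"
 unfolding inter_def by (rule cdot_proj_perp)
 also have "\<dots> = al V m * of_real (dd m k) * cdot (V k) (cvec (cross3 e (m + k)))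
 + al V k * of_real (dd k m) * cdot (V m) (cvec (cross3 e (m + k)))"
 unfolding bilin_def cdot_plane_field(1)[OF V k] cdot_plane_field(1)[OF V m]
 by (simp add: cdot_add cdot_simps cdot_commute[of "cvec (cross3 e (m + k))"])
 also have "\<dots> = of_real (dd m k * (k \<bullet> k - m \<bullet> m)) * (al V m * al V k)"
 unfolding cdot_plane_field(2)[OF V] d by (simp add: inner_add_right inner_commute[of k m] algebra_simps)
 finally show "cdot (inter V m k) (cvec (cross3 e (m + k))) = of_real (dd m k * (k \<bullet> k - m \<bullet> m)) * (al V m * al V k)"
 by (simp add: cdot_commute)
qed

lemma inter_eq_0_plane:
 assumes V: "plane_field V" and m: "e \<bullet> m = 0" and k: "e \<bullet> k = 0"
 and 1: "of_real (dd m k) * (al V m * be V k - al V k * be V m) = 0"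
 and 2: "of_real (dd m k * (k \<bullet> k - m \<bullet> m)) * (al V m * al V k) = 0"
 shows "inter V m k = 0"
proof (cases "m + k = 0")
 case True
 then have "dd m k = 0" by (simp add: add_eq_0_iff2)
 then show ?thesis using cdot_plane_field(1)[OF V k, of m] cdot_plane_field(1)[OF V m, of k] dd_swap[of m k]
 by (simp add: inter_def bilin_def)
next
 case False
 have "e \<bullet> (m + k) = 0" using m k by (simp add: inner_add_right)
 moreover have "cdot (cvec (m + k)) (inter V m k) = 0" unfolding inter_def by (rule proj_perp_range[OF False])
 ultimately have "inter V m k = (cdot (inter V m k) (cvec (cross3 e (m + k))) / of_real ((m + k) \<bullet> (m + k))) *s cvec (cross3 e (m + k))
 + cdot (inter V m k) (cvec e) *s cvec e" using False by (intro plane_decomp)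
 then show ?thesis unfolding inter_components[OF V m k] 1 2 by simp
qed

definition quad :: "(real^3) set => (real^3 => complex^3) => real^3 => complex" where
 "quad S V n = (\<Sum>m\<in>{m\<in>S. n - m : S}.
  of_real (dd m (n - m) * ((n - m) \<bullet> (n - m) - m \<bullet> m)) * (al V m * al V (n - m)))"

lemma nl_components:
 assumes fin: "finite S" and V: "plane_field V" and S: "!!n. n : S ==> e \<bullet> n = 0" and off: "!!n. n ~: S ==> V n = 0"
 shows "cdot (nl S V n) (cvec e) = 2 * ad S (al V) (be V) n"
 and "cdot (nl S V n) (cvec (cross3 e n)) = quad S V n"
proof -
 let ?M = "{m\<in>S. n - m : S}"
 have rev: "dd (n - m) n = - dd m n" for m
 proof -
 have "dd (n - m) n = - dd n (n - m)" "dd n m = - dd m n" by (rule dd_swap)+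
 then show ?thesis by (simp add: dd_diff)
 qed
 have "cdot (nl S V n) (cvec e) = (\<Sum>m\<in>?M. cdot (inter V m (n - m)) (cvec e))"
 unfolding nl_def cdot_commute[of _ "cvec e"] by (rule cdot_sum)
 also have "\<dots> = (\<Sum>m\<in>?M. of_real (dd m n) * al V m * be V (n - m)) - (\<Sum>m\<in>?M. of_real (dd m n) * al V (n - m) * be V m)"
 unfolding sum_subtractf[symmetric]
 proof (rule sum.cong[OF refl])
 fix x assume "x : ?M"
 then have "e \<bullet> x = 0" "e \<bullet> (n - x) = 0" using S by blast+
 then show "cdot (inter V x (n - x)) (cvec e) = of_real (dd x n) * al V x * be V (n - x) - of_real (dd x n) * al V (n - x) * be V x"
 by (simp add: inter_components(1)[OF V] dd_diff algebra_simps)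
 qed
 \<comment> \<open>Exchanging the two frequencies turns the second sum into minus the first, hence
   the factor 2.\<close>
 also have "(\<Sum>m\<in>?M. of_real (dd m n) * al V (n - m) * be V m) = (\<Sum>m\<in>?M. of_real (dd (n - m) n) * al V (n - (n - m)) * be V (n - m))"
 by (rule sum.reindex_bij_witness[of _ "%m. n - m" "%m. n - m"]) auto
 also have "\<dots> = - (\<Sum>m\<in>?M. of_real (dd m n) * al V m * be V (n - m))"
 unfolding sum_negf[symmetric]
 by (rule sum.cong) (simp_all add: rev)
 finally have 1: "cdot (nl S V n) (cvec e) = 2 * (\<Sum>m\<in>?M. of_real (dd m n) * al V m * be V (n - m))" by simp
 have "ad S (al V) (be V) n = (\<Sum>m\<in>?M. of_real (dd m n) * al V m * be V (n - m))"
 unfolding ad_def by (rule sum.mono_neutral_right) (use fin off in auto)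
 then show "cdot (nl S V n) (cvec e) = 2 * ad S (al V) (be V) n" using 1 by simp
 have "cdot (nl S V n) (cvec (cross3 e n)) = (\<Sum>m\<in>?M. cdot (inter V m (n - m)) (cvec (cross3 e n)))"
 unfolding nl_def cdot_commute[of _ "cvec (cross3 e n)"] by (rule cdot_sum)
 also have "\<dots> = quad S V n" unfolding quad_def
 proof (rule sum.cong[OF refl])
 fix x assume "x : ?M"
 then have "e \<bullet> x = 0" "e \<bullet> (n - x) = 0" using S by blast+
 from inter_components(2)[OF V this]
 show "cdot (inter V x (n - x)) (cvec (cross3 e n)) =
 of_real (dd x (n - x) * ((n - x) \<bullet> (n - x) - x \<bullet> x)) * (al V x * al V (n - x))" by simp
 qed
 finally show "cdot (nl S V n) (cvec (cross3 e n)) = quad S V n" .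
qed

lemma al_be_cnj:
 assumes "V (- n) = cnjv (V n)"
 shows "al V (- n) = - cnj (al V n)" "be V (- n) = cnj (be V n)"
proof -
 have "cdot (cnjv (V n)) (cvec y) = cnj (cdot (V n) (cvec y))" for y
 using cnjv_simps(2)[of "V n" "cvec y"] by (simp add: cnjv_simps(3))
 then show "al V (- n) = - cnj (al V n)" "be V (- n) = cnj (be V n)"
 unfolding al_def be_def assms by (simp_all add: cross_minus_right cdot_minus)
qed

end

text \<open>The equation is required at every nonzero frequency; outside \<open>S\<close> the
  amplitude is zero and it becomes the cancellation condition.\<close>

locale flow =
 fixes S :: "(real^3) set" and J :: "real set" and nu Om :: real and U :: "real => real^3 => complex^3"
 assumes fin: "finite S" and zero: "0 ~: S" and sym: "!!n. n : S ==> - n : S" and openJ: "open J"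
 and off: "!!t n. t : J ==> n ~: S ==> U t n = 0"
 and perp: "!!t n. t : J ==> cdot (cvec n) (U t n) = 0"
 and conj: "!!t n. t : J ==> U t (- n) = cnjv (U t n)"
 and ode: "!!t n. t : J ==> n ~= 0 ==> ((%s. U s n) has_vector_derivative
 - (nu * (norm n)\<^sup>2) *\<^sub>R U t n - Om *\<^sub>R (Jmat n *v U t n) - (\<i> / 2) *s nl S (U t) n) (at t)"
begin

lemma nl_outside: "t : J ==> n ~: S ==> n ~= 0 ==> nl S (U t) n = 0"
proof -
 assume n: "t : J" "n ~: S" "n ~= 0"
 have "- (nu * (norm n)\<^sup>2) *\<^sub>R U t n - Om *\<^sub>R (Jmat n *v U t n) - (\<i> / 2) *s nl S (U t) n = 0"
 by (rule has_vector_derivative_vanishing[OF openJ n(1) _ ode]) (use n off in auto)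
 then show "nl S (U t) n = 0" using off[OF n(1,2)] by (simp add: Jmat_cross vec_eq_iff)
qed

lemma steady: "t : J ==> steady_outside S (inter (U t))"
 unfolding steady_outside_def using nl_outside by (auto simp: nl_def intro: inter_commute)

end

locale planar_flow = flow + plane +
 assumes planeS: "!!n. n : S ==> e \<bullet> n = 0"
begin

lemma plane_field_U: "t : J ==> plane_field (U t)"
 unfolding plane_field_def using off perp planeS zero by metis

text \<open>The component of the equation along \<open>e\<close>. The zero frequency and frequencies
  off the plane are included with both sides zero, so that whole coefficient functions can be
  differentiated.\<close>

lemma be_deriv:
 assumes t: "t : J"
 shows "((%s. be (U s) n) has_vector_derivative - of_real (nu * (n \<bullet> n)) * be (U t) n
 - of_real (Om * n$3) * al (U t) n - \<i> * ad S (al (U t)) (be (U t)) n) (at t)"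
proof (cases "n ~= 0 & e \<bullet> n = 0")
 case True
 have d: "((%s. be (U s) n) has_vector_derivative
 cdot (- (nu * (norm n)\<^sup>2) *\<^sub>R U t n - Om *\<^sub>R (Jmat n *v U t n) - (\<i> / 2) *s nl S (U t) n) (cvec e)) (at t)"
 unfolding be_def by (rule cdot_has_derivative[OF ode[OF t]]) (use True in simp)
 have J: "cdot (ccross (cvec n) (U t n)) (cvec e) = al (U t) n * of_real (n \<bullet> n)"
 unfolding cdot_ccross_left ccross_cvec by (rule cdot_plane_field(2)[OF plane_field_U[OF t]])
 have "cdot (Jmat n *v U t n) (cvec e) = of_real (n$3) * al (U t) n"
 unfolding Jmat_cross cdot_simps J using True by (simp add: dot_square_norm)
 then show ?thesis using d nl_components(1)[OF fin plane_field_U[OF t] planeS off[OF t], of n]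
 by (simp add: cdot_diff cdot_scaleR cdot_simps cdot_minus be_def power2_norm_eq_inner mult_ac)
next
 case False
 then have z: "U s n = 0" if "s : J" for s using off[OF that] zero planeS by blast
 have "ad S (al (U t)) (be (U t)) n = 0"
 unfolding ad_def
 proof (rule sum.neutral, rule ballI)
 fix l assume l: "l : S"
 show "of_real (dd l n) * al (U t) l * be (U t) (n - l) = 0"
 proof (cases "n = 0")
 case False
 then have "e \<bullet> (n - l) ~= 0" using \<open>~ (n ~= 0 & e \<bullet> n = 0)\<close> planeS[OF l] by (simp add: inner_diff_right)
 then have "be (U t) (n - l) = 0" using off[OF t, of "n - l"] planeS al_be_zero(2) by blast
 then show ?thesis by simp
 qed simp
 qed
 moreover have "((%s. be (U s) n) has_vector_derivative 0) (at t)"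
 by (rule has_vector_derivative_transform_within_open[OF has_vector_derivative_const openJ t]) (simp add: z)
 ultimately show ?thesis using z[OF t] by simp
qed

lemma al_deriv:
 assumes t: "t : J"
 shows "((%s. al (U s) n) has_vector_derivative - of_real (nu * (n \<bullet> n)) * al (U t) n
 + of_real (Om * n$3 / (n \<bullet> n)) * be (U t) n - \<i> / 2 * quad S (U t) n / of_real (n \<bullet> n)) (at t)"
proof (cases "n ~= 0 & e \<bullet> n = 0")
 case True
 have "((%s. cdot (U s n) (cvec (cross3 e n))) has_vector_derivative
 cdot (- (nu * (norm n)\<^sup>2) *\<^sub>R U t n - Om *\<^sub>R (Jmat n *v U t n) - (\<i> / 2) *s nl S (U t) n) (cvec (cross3 e n))) (at t)"
 by (rule cdot_has_derivative[OF ode[OF t]]) (use True in simp)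
 then have d: "((%s. al (U s) n) has_vector_derivative
 cdot (- (nu * (norm n)\<^sup>2) *\<^sub>R U t n - Om *\<^sub>R (Jmat n *v U t n) - (\<i> / 2) *s nl S (U t) n) (cvec (cross3 e n)) / of_real (n \<bullet> n)) (at t)"
 unfolding al_def by (rule has_vector_derivative_divide)
 have "cross3 (cross3 e n) n = - ((n \<bullet> n) *\<^sub>R e)"
 unfolding cross_skew[of "cross3 e n"] using Lagrange[of n e n] True by (simp add: inner_commute)
 then have J: "cdot (ccross (cvec n) (U t n)) (cvec (cross3 e n)) = - (of_real (n \<bullet> n) * be (U t) n)"
 unfolding cdot_ccross_left ccross_cvec by (simp add: cdot_minus cdot_simps be_def)
 have Jn: "cdot (Jmat n *v U t n) (cvec (cross3 e n)) = - (of_real (n$3) * be (U t) n)"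
 unfolding Jmat_cross cdot_simps J using True by (simp add: dot_square_norm)
 have nn: "complex_of_real (n \<bullet> n) ~= 0" using True by simp
 show ?thesis
 by (rule has_vector_derivative_eq_rhs[OF d])
 (use nn in \<open>simp add: cdot_diff cdot_scaleR cdot_simps cdot_minus Jn nl_components(2)[OF fin plane_field_U[OF t] planeS off[OF t]]
 al_def power2_norm_eq_inner diff_divide_distrib\<close>)
next
 case False
 then have z: "U s n = 0" if "s : J" for s using off[OF that] zero planeS by blast
 \<comment> \<open>For \<open>n = 0\<close> the quotient is zero by the convention on division by
   zero; off the plane no pair sums to \<open>n\<close>.\<close>
 have "quad S (U t) n / of_real (n \<bullet> n) = 0"
 proof (cases "n = 0")
 case False
 have "{m : S. n - m : S} = {}"
 using False \<open>~ (n ~= 0 & e \<bullet> n = 0)\<close> planeS by (auto simp: inner_diff_right) (metis diff_0_right inner_diff_right planeS)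
 then show ?thesis by (simp only: quad_def sum.empty div_0)
 qed simp
 moreover have "((%s. al (U s) n) has_vector_derivative 0) (at t)"
 by (rule has_vector_derivative_transform_within_open[OF has_vector_derivative_const openJ t]) (simp add: z)
 ultimately show ?thesis using z[OF t] by (auto elim!: has_vector_derivative_eq_rhs)
qed

end

context plane
begin

lemma parallelI:
 assumes "e \<bullet> x = 0" "e \<bullet> y = 0" "dd x y = 0" "x ~= 0"
 shows "y = ((x \<bullet> y) / (x \<bullet> x)) *\<^sub>R x"
proof -
 have "cross3 x y = 0" using cross_plane[OF assms(1,2)] assms(3) by simp
 then have "(x \<bullet> y) *\<^sub>R x - (x \<bullet> x) *\<^sub>R y = 0" using Lagrange[of x x y] by simp
 then have "(x \<bullet> x) *\<^sub>R y = (x \<bullet> y) *\<^sub>R x" by simp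
 then have "(1 / (x \<bullet> x)) *\<^sub>R ((x \<bullet> x) *\<^sub>R y) = (1 / (x \<bullet> x)) *\<^sub>R ((x \<bullet> y) *\<^sub>R x)" by simp
 then show ?thesis using assms(4) by simp
qed

lemma dd_not_parallel: "e \<bullet> x = 0 ==> e \<bullet> y = 0 ==> x ~= 0 ==> (!!c. y ~= c *\<^sub>R x) ==> dd x y ~= 0"
 using parallelI by blast

lemma dd_span_not_line:
 assumes "EX x:A. EX y:A. dd x y ~= 0"
 shows "EX n:A. \<forall>c. n ~= c *\<^sub>R x"
proof (rule ccontr)
 assume "~ ?thesis"
 then have "ALL n:A. \<exists>c. n = c *\<^sub>R x" by blast
 moreover obtain y z where yz: "y : A" "z : A" "dd y z ~= 0" using assms by blast
 ultimately obtain b c where "y = b *\<^sub>R x" "z = c *\<^sub>R x" by blast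
 then show False using yz(3) by (simp add: dd_scale)
qed

lemma ad_mono: "finite S ==> A \<subseteq> S ==> (!!l. l : S - A ==> ps l = 0) ==> ad A ps f n = ad S ps f n"
 unfolding ad_def by (rule sum.mono_neutral_left) auto

lemma ad_smult: "ad A (%n. c * ps n) f n = c * ad A ps f n"
 unfolding ad_def sum_distrib_left by (rule sum.cong) (auto simp: mult_ac)

text \<open>If the in-plane part of a mode set lies on a line, the extreme interaction of that line with the remaining modes
  cannot be cancelled.\<close>

lemma advection_line_escape:
 assumes finA: "finite A" and finB: "finite B" and A: "A ~= {}" and zA: "0 ~: A"
 and pA: "!!n. n : A ==> e \<bullet> n = 0" and pB: "!!n. n : B ==> e \<bullet> n = 0"
 and symB: "!!n. n : B ==> - n : B" and symA: "!!n. n : A ==> - n : A"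
 and psA: "!!n. n : A ==> ps n ~= 0" and fB: "!!n. f n ~= 0 \<longleftrightarrow> n : B"
 and ad: "!!n. n ~: B ==> ad A ps f n = 0" and sp: "EX x:A \<union> B. EX y:A \<union> B. dd x y ~= 0"
 shows "EX x:A. EX y:A. dd x y ~= 0"
proof (rule ccontr)
 assume no: "~ ?thesis"
 obtain a0 where a0: "a0 : A" using A by blast
 have a00: "a0 ~= 0" using a0 zA by blast
 obtain a where a: "a : A" "!!m. m : A ==> a0 \<bullet> m <= a0 \<bullet> a" using finite_argmax[OF finA A, of "%m. a0 \<bullet> m"] by blast
 have par: "m = ((a0 \<bullet> m) / (a0 \<bullet> a0)) *\<^sub>R a0" if "m : A" for m
 by (rule parallelI) (use no that a0 a00 pA in auto)
 have apos: "a0 \<bullet> a > 0" using a(2)[OF a0] a00 by (metis inner_gt_zero_iff less_le_trans)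
 have "EX q:B. dd a0 q ~= 0"
 proof (rule ccontr)
 assume "~ ?thesis"
 then have "dd a0 q = 0" if "q : A \<union> B" for q using that no a0 by blast
 then have "q = ((a0 \<bullet> q) / (a0 \<bullet> a0)) *\<^sub>R a0" if "q : A \<union> B" for q
 by (rule parallelI[rotated 2]) (use that a0 a00 pA pB in auto)
 then have "\<exists>c. x = c *\<^sub>R a0" if "x : A \<union> B" for x using that by blast
 then show False using dd_span_not_line[OF sp, of a0] by blast
 qed
 then obtain q where q: "q : B" "dd a0 q ~= 0" by blast
 \<comment> \<open>All of \<open>A\<close> lies on the line of \<open>a0\<close>. Since
   \<open>p\<close> is farthest from this line and then farthest along it, \<open>a\<close> and
   \<open>p\<close> are the only pair from \<open>A\<close> and \<open>B\<close> with their sum, and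
   this sum is outside \<open>B\<close>.\<close>
 obtain p where p: "p : B" "!!y. y : B ==> dd a0 y <= dd a0 p" "!!y. y : B ==> dd a0 y = dd a0 p ==> a0 \<bullet> y <= a0 \<bullet> p"
 using finite_argmax_lex[of B "dd a0" "%y. a0 \<bullet> y"] finB q by blast
 have pp: "dd a0 p > 0" using p(2)[OF q(1)] p(2)[OF symB[OF q(1)]] q(2) by (auto simp: abs_if not_less split: if_splits)
 have da: "dd a0 m = 0" if "m : A" for m using no a0 that by blast
 let ?n = "a + p"
 have "?n ~: B" using p(3)[of ?n] da[OF a(1)] apos by (auto simp: dd_add inner_add_right)
 then have "ad A ps f ?n = 0" by (rule ad)
 moreover have "ad A ps f ?n = (\<Sum>l\<in>{a}. of_real (dd l ?n) * ps l * f (?n - l))"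
 unfolding ad_def
 proof (rule sum.mono_neutral_right[OF finA])
 show "ALL l:A - {a}. of_real (dd l ?n) * ps l * f (?n - l) = 0"
 proof
 fix l assume l: "l : A - {a}"
 have "?n - l ~: B"
 proof
 assume "?n - l : B"
 moreover have "dd a0 (?n - l) = dd a0 p" using l da a by (simp add: dd_add dd_diff)
 ultimately have "a0 \<bullet> (?n - l) <= a0 \<bullet> p" using p(3) by blast
 then have "a0 \<bullet> l = a0 \<bullet> a" using a(2)[of l] l by (simp add: inner_add_right inner_diff_right)
 then have "l = a" using par[of l] par[OF a(1)] l by simp
 then show False using l by simp
 qed
 then show "of_real (dd l ?n) * ps l * f (?n - l) = 0" using fB by auto
 qed
 qed (use a in auto)
 ultimately have "dd a p = 0" using psA[OF a(1)] fB p(1) by (auto simp: dd_add)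
 moreover have "dd a p = (a0 \<bullet> a) / (a0 \<bullet> a0) * dd a0 p" by (subst par[OF a(1)]) (simp add: dd_scale)
 ultimately show False using apos pp a00 by simp
qed

text \<open>The terms \<open>\<i> * of_real lam * al V l\<close> are the coefficients of the scalar
  \<omega> in the theorem: for frequencies of length \<open>lam\<close> the curl of the in-plane
  part has these coefficients times \<open>lam\<close> along \<open>e\<close>.\<close>

definition polynomial_profile :: "(real^3) set => real => (real^3 => complex^3) => real => bool" where
 "polynomial_profile S nu V lam \<longleftrightarrow> lam > 0 & (ALL n:S. al V n ~= 0 --> norm n = lam) &
 (\<exists>N q. \<forall>n. be V n = (\<Sum>k<N. q k * pw S (%l. \<i> * of_real lam * al V l) k n)) &
 (nu ~= 0 --> (\<exists>c::real. \<forall>n. be V n = of_real c * (\<i> * of_real lam * al V n)))"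

lemma pw_mono: "finite S ==> A \<subseteq> S ==> (!!l. l : S - A ==> ps l = 0) ==> pw A ps k n = pw S ps k n"
proof (induction k arbitrary: n)
 case (Suc k)
 then show ?case by (simp add: sum.mono_neutral_left[of S A])
qed simp

end

context planar_flow
begin

lemma be_cnj: "t : J ==> be (U t) (- n) = cnj (be (U t) n)"
 and al_cnj: "t : J ==> al (U t) (- n) = - cnj (al (U t) n)"
 using al_be_cnj[of "U t" n] conj by auto

text \<open>Without Coriolis coupling the in-plane modes satisfy a closed system. The longest ones
  form a leading class: among themselves the factor \<open>k \<bullet> k - m \<bullet> m\<close>
  vanishes, against a shorter mode of another direction it does not. So all have the same
  length.\<close>

lemma in_plane_circle:
 assumes J: "J ~= {}" and Om: "!!n. n : S ==> Om * n$3 = 0"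
 and A: "!!t n. t : J ==> al (U t) n ~= 0 \<longleftrightarrow> n : A" and B: "!!t n. t : J ==> be (U t) n ~= 0 \<longleftrightarrow> n : B"
 and sp: "EX x:A \<union> B. EX y:A \<union> B. dd x y ~= 0" and An: "A ~= {}"
 shows "\<exists>lam>0. (ALL n:A. norm n = lam) & (EX x:A. EX y:A. dd x y ~= 0)"
proof -
 obtain t where t: "t : J" using J by blast
 have AS: "A \<subseteq> S" using A[OF t] off[OF t] al_be_zero(1) by blast
 have BS: "B \<subseteq> S" using B[OF t] off[OF t] al_be_zero(2) by blast
 have finA: "finite A" and finB: "finite B" using AS BS fin finite_subset by auto
 have symA: "- n : A" if "n : A" for n using A[OF t] al_cnj[OF t, of n] that by (metis complex_cnj_zero_iff neg_equal_0_iff_equal)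
 have symB: "- n : B" if "n : B" for n using B[OF t] be_cnj[OF t, of n] that by (metis complex_cnj_zero_iff)
 have zA: "0 ~: A" using zero AS by blast
 have van: "Om * n$3 = 0" if "n : S" for n using Om that .
 have adB: "ad A (al (U t)) (be (U t)) n = 0" if n: "n ~: B" for n
 proof -
 have "- of_real (nu * (n \<bullet> n)) * be (U t) n - of_real (Om * n$3) * al (U t) n - \<i> * ad S (al (U t)) (be (U t)) n = 0"
 by (rule has_vector_derivative_vanishing[OF openJ t _ be_deriv[OF t]]) (use B n in blast)
 moreover have "of_real (Om * n$3) * al (U t) n = 0"
 using Om[of n] off[OF t, of n] by (cases "n : S") auto
 moreover have "be (U t) n = 0" using B[OF t] n by blast
 ultimately have "\<i> * ad S (al (U t)) (be (U t)) n = 0"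
 by (simp only: mult_zero_right diff_self diff_0 neg_equal_0_iff_equal)
 then have "ad S (al (U t)) (be (U t)) n = 0" by simp
 moreover have "ad A (al (U t)) (be (U t)) n = ad S (al (U t)) (be (U t)) n"
 by (rule ad_mono[OF fin AS]) (use A[OF t] in blast)
 ultimately show ?thesis by simp
 qed
 have spA: "EX x:A. EX y:A. dd x y ~= 0"
 by (rule advection_line_escape[OF finA finB An zA _ _ symB symA _ _ adB sp])
 (use AS BS planeS A[OF t] B[OF t] in auto)
 define w where "w m k = of_real (dd m k * (k \<bullet> k - m \<bullet> m)) * (al (U t) m * al (U t) k)" for m k
 have "steady_outside A w"
 unfolding steady_outside_def
 proof (intro conjI allI impI)
 fix m k show "w m k = w k m" unfolding w_def dd_swap[of k m] by (simp add: algebra_simps)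
 next
 fix n :: "real^3" assume n: "n ~: A" "n ~= 0"
 have "- of_real (nu * (n \<bullet> n)) * al (U t) n
 + of_real (Om * n$3 / (n \<bullet> n)) * be (U t) n - \<i> / 2 * quad S (U t) n / of_real (n \<bullet> n) = 0"
 by (rule has_vector_derivative_vanishing[OF openJ t _ al_deriv[OF t]]) (use A n in blast)
 moreover have "of_real (Om * n$3 / (n \<bullet> n)) * be (U t) n = 0"
 using Om[of n] off[OF t, of n] by (cases "n : S") auto
 moreover have "al (U t) n = 0" using A[OF t] n by blast
 ultimately have "quad S (U t) n = 0" using n(2) by simp
 moreover have "quad S (U t) n = (\<Sum>m\<in>{m : A. n - m : A}. w m (n - m))"
 unfolding quad_def w_def by (rule sum.mono_neutral_right) (use fin AS A[OF t] in auto)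
 ultimately show "(\<Sum>m\<in>{m : A. n - m : A}. w m (n - m)) = 0" by simp
 qed
 obtain a where a: "a : A" "!!y. y : A ==> norm y <= norm a" using finite_argmax[OF finA An, of norm] by blast
 let ?A' = "{b : A. norm b = norm a}"
 have "?A' = A"
 proof (rule leading_class_is_all[OF finA zA _ \<open>steady_outside A w\<close> symA, where r = "norm a"])
 show "norm a > 0" using a(1) zA by auto
 show "w m k = 0" if "m : ?A'" "k : ?A'" for m k using that by (simp add: w_def dot_square_norm)
 show "w b p ~= 0" if b: "b : ?A'" and p: "p : A - ?A'" and np: "!!c. p ~= c *\<^sub>R b" for b p
 proof -
 have "dd b p ~= 0" by (rule dd_not_parallel) (use b p np AS planeS zA in auto)
 moreover have "norm p < norm b" using a(2)[of p] b p by fastforce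
 then have "p \<bullet> p - b \<bullet> b ~= 0" unfolding dot_square_norm by (simp add: power2_eq_iff_nonneg)
 ultimately show ?thesis using A[OF t] b p by (simp add: w_def del: of_real_diff)
 qed
 show "EX b:?A'. ALL p:A - ?A'. a \<bullet> p < a \<bullet> b"
 proof (intro bexI[of _ a] ballI)
 fix p assume p: "p : A - ?A'"
 have "norm p < norm a" using a(2)[of p] p by fastforce
 then have "norm a * norm p < norm a * norm a" using a(1) zA by (auto intro!: mult_strict_left_mono)
 then show "a \<bullet> p < a \<bullet> a" using norm_cauchy_schwarz[of a p] by (simp add: dot_square_norm power2_eq_square)
 qed (use a in simp)
 show "EX n:A. \<forall>c. n ~= c *\<^sub>R x" for x by (rule dd_span_not_line[OF spA])
 qed (use symA in auto)
 then have "ALL n:A. norm n = norm a" by blast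
 moreover have "norm a > 0" using a(1) zA by auto
 ultimately show ?thesis using spA by blast
qed

text \<open>If \<open>nu = 0\<close>, the in-plane part is stationary, so the time derivatives of
  \<open>be\<close> are iterates of advection up to factors, and all stay supported in
  \<open>B\<close>. Otherwise the top-row recursion is differentiated in time: the right-hand side
  \<open>G\<close> is then proportional to \<open>be\<close> along the row, which determines the
  advection there.\<close>

theorem planar_profile:
 assumes J: "J ~= {}" and Om: "!!n. n : S ==> Om * n$3 = 0"
 and A: "!!t n. t : J ==> al (U t) n ~= 0 \<longleftrightarrow> n : A" and B: "!!t n. t : J ==> be (U t) n ~= 0 \<longleftrightarrow> n : B"
 and sp: "EX x:A \<union> B. EX y:A \<union> B. dd x y ~= 0" and An: "A ~= {}"
 obtains lam where "EX x:A. EX y:A. dd x y ~= 0" "!!t. t : J ==> polynomial_profile S nu (U t) lam"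
proof -
 obtain lam where lam: "lam > 0" "!!n. n : A ==> norm n = lam" and spA: "EX x:A. EX y:A. dd x y ~= 0"
 using in_plane_circle[OF assms] by blast
 define om where "om t n = \<i> * of_real lam * al (U t) n" for t n
 obtain t0 where t0: "t0 : J" using J by blast
 have AS: "A \<subseteq> S" using A[OF t0] off[OF t0] al_be_zero(1) by blast
 have BS: "B \<subseteq> S" using B[OF t0] off[OF t0] al_be_zero(2) by blast
 have finA: "finite A" and finB: "finite B" using AS BS fin finite_subset by auto
 have om0: "om t n ~= 0 \<longleftrightarrow> n : A" if "t : J" for t n using A[OF that] lam(1) by (simp add: om_def)
 have circle: "plane_circle e A (om t) lam" if t: "t : J" for t
 proof
 show "- z : A" if "z : A" for z using A[OF t] al_cnj[OF t, of z] that by (metis complex_cnj_zero_iff neg_equal_0_iff_equal)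
 show "om t (- z) = cnj (om t z)" for z by (simp add: om_def al_cnj[OF t])
 qed (use finA AS planeS lam spA om0[OF t] in auto)
 \<comment> \<open>All in-plane modes have the same length.\<close>
 have quad0: "quad S (U t) n = 0" if t: "t : J" for t n
 unfolding quad_def
 proof (rule sum.neutral, rule ballI)
 fix m assume "m : {m : S. n - m : S}"
 show "of_real (dd m (n - m) * ((n - m) \<bullet> (n - m) - m \<bullet> m)) * (al (U t) m * al (U t) (n - m)) = 0"
 using A[OF t] lam(2)[of m] lam(2)[of "n - m"] by (cases "m : A"; cases "n - m : A") (auto simp: dot_square_norm)
 qed
 have Om0: "of_real (Om * n$3) * al (U t) n = 0" "of_real (Om * n$3 / (n \<bullet> n)) * be (U t) n = 0" if "t : J" for t n
 using Om[of n] off[OF that, of n] by (cases "n : S"; auto)+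
 have om_deriv: "((%s. om s n) has_vector_derivative - of_real (nu * lam\<^sup>2) * om t n) (at t)" if t: "t : J" for t n
 proof -
 have "((%s. al (U s) n) has_vector_derivative - of_real (nu * (n \<bullet> n)) * al (U t) n) (at t)"
 using al_deriv[OF t, of n] by (simp only: Om0(2)[OF t] quad0[OF t] add_0_right mult_zero_right div_0 diff_0_right)
 then have "((%s. om s n) has_vector_derivative \<i> * of_real lam * (- of_real (nu * (n \<bullet> n)) * al (U t) n)) (at t)"
 unfolding om_def by (rule has_vector_derivative_mult_right)
 moreover have "\<i> * of_real lam * (- of_real (nu * (n \<bullet> n)) * al (U t) n) = - of_real (nu * lam\<^sup>2) * om t n"
 using A[OF t, of n] lam(2)[of n] by (cases "n : A") (auto simp: om_def dot_square_norm)
 ultimately show ?thesis by (rule has_vector_derivative_eq_rhs)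
 qed
 define G where "G t n = - of_real (nu * (n \<bullet> n)) * be (U t) n - of_real (1 / lam) * ad A (om t) (be (U t)) n" for t n
 have be_der: "((%s. be (U s) n) has_vector_derivative G t n) (at t)" if t: "t : J" for t n
 proof -
 have "ad S (al (U t)) (be (U t)) n = ad A (al (U t)) (be (U t)) n"
 by (rule ad_mono[OF fin AS, symmetric]) (use A[OF t] in blast)
 moreover have "ad A (om t) (be (U t)) n = \<i> * of_real lam * ad A (al (U t)) (be (U t)) n"
 unfolding om_def[abs_def] by (rule ad_smult)
 ultimately have "\<i> * ad S (al (U t)) (be (U t)) n = of_real (1 / lam) * ad A (om t) (be (U t)) n"
 using lam(1) by simp
 then show ?thesis using be_deriv[OF t, of n] unfolding G_def by (simp only: Om0(1)[OF t] diff_0_right)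
 qed
 have adB: "n : B" if t: "t : J" and "ad A (om t) (be (U t)) n ~= 0" for t n
 proof (rule ccontr)
 assume n: "n ~: B"
 have "G t n = 0" by (rule has_vector_derivative_vanishing[OF openJ t _ be_der[OF t]]) (use B n in blast)
 moreover have "be (U t) n = 0" using B[OF t] n by blast
 ultimately show False using that(2) lam(1) by (simp add: G_def)
 qed
 have pwS: "pw A (om t) k n = pw S (om t) k n" if "t : J" for t k n
 by (rule pw_mono[OF fin AS]) (use om0[OF that] in blast)
 have finf: "finite (supp (be (U t)))" if "t : J" for t
 by (rule finite_subset[OF _ finB]) (use B[OF that] in \<open>auto simp: supp_def\<close>)
 have plf: "e \<bullet> n = 0" if "t : J" "be (U t) n ~= 0" for t n using B[OF that(1)] that(2) BS planeS by blast
 have profile: "(nu = 0 --> (\<exists>N q. \<forall>n. be (U t) n = (\<Sum>k<N. q k * pw S (om t) k n))) &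
 (nu ~= 0 --> (\<exists>c::real. \<forall>n. be (U t) n = of_real c * om t n))" if t: "t : J" for t
 proof (intro conjI impI)
 assume nu: "nu = 0"
 interpret C: plane_circle e A "om t" lam by (rule circle[OF t])
 have der: "((%s. (ad A (om s) ^^ k) (be (U s)) n) has_vector_derivative
 - of_real (1 / lam) * (ad A (om s) ^^ Suc k) (be (U s)) n) (at s)" if s: "s : J" for k s n
 using s
 proof (induction k arbitrary: s n)
 case 0
 then show ?case using be_der[of s n] nu by (simp add: G_def)
 next
 case (Suc k)
 let ?F = "%k s. (ad A (om s) ^^ k) (be (U s))"
 have "((%s. \<Sum>l\<in>A. of_real (dd l n) * om s l * ?F k s (n - l)) has_vector_derivative
 (\<Sum>l\<in>A. of_real (dd l n) * om s l * (- of_real (1 / lam) * ?F (Suc k) s (n - l)))) (at s)"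
 proof (rule has_vector_derivative_sum)
 fix l assume "l : A"
 have 0: "((%s. of_real (dd l n) * om s l) has_vector_derivative 0) (at s)"
 using has_vector_derivative_mult_right[OF om_deriv[OF Suc.prems, of l], of "of_real (dd l n)"] nu by simp
 show "((%s. of_real (dd l n) * om s l * ?F k s (n - l)) has_vector_derivative
 of_real (dd l n) * om s l * (- of_real (1 / lam) * ?F (Suc k) s (n - l))) (at s)"
 using has_vector_derivative_mult[OF 0 Suc.IH[OF Suc.prems, of "n - l"]] by simp
 qed
 moreover have "(\<Sum>l\<in>A. of_real (dd l n) * om s l * (- of_real (1 / lam) * ?F (Suc k) s (n - l)))
 = - of_real (1 / lam) * ?F (Suc (Suc k)) s n"
 unfolding funpow.simps(2)[of "Suc k"] comp_def ad_def[of A "om s" "?F (Suc k) s"] sum_distrib_left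
 by (rule sum.cong) (auto simp: mult_ac)
 ultimately show ?case by (simp only: funpow.simps(2)[of k] comp_def ad_def[of A "om _" "?F k _"])
 qed
 \<comment> \<open>If an iterate vanishes at \<open>n\<close> at all times, so does its time
   derivative, which is the next iterate up to a factor.\<close>
 have it: "n : B" if s: "s : J" and nz: "(ad A (om s) ^^ k) (be (U s)) n ~= 0" for k s n
 using s nz
 proof (induction k arbitrary: s n)
 case 0
 then show ?case using B by simp
 next
 case (Suc k)
 show ?case
 proof (rule ccontr)
 assume "n ~: B"
 then have "(ad A (om s') ^^ k) (be (U s')) n = 0" if "s' : J" for s' using Suc.IH[OF that] by blast
 then have "- of_real (1 / lam) * (ad A (om s) ^^ Suc k) (be (U s)) n = 0"
 by (rule has_vector_derivative_vanishing[OF openJ Suc.prems(1) _ der[OF Suc.prems(1)]])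
 then show False using Suc.prems(2) lam(1) by simp
 qed
 qed
 have "ad A (om t) (be (U t)) n = 0" for n
 by (rule C.ad_iterates_zero[OF finB]) (use it[OF t] plf[OF t] in blast)+
 then obtain N q where "\<forall>n. be (U t) n = (\<Sum>k<N. q k * pw A (om t) k n)"
 using C.ad_kernel_polynomial[OF finf[OF t] plf[OF t]] by blast
 then show "\<exists>N q. \<forall>n. be (U t) n = (\<Sum>k<N. q k * pw S (om t) k n)" unfolding pwS[OF t] by blast
 next
 assume nu: "nu ~= 0"
 interpret C: plane_circle e A "om t" lam by (rule circle[OF t])
 have "\<exists>c::real. \<forall>n. be (U t) n = (if n : A then of_real c * om t n else 0)"
 proof (rule C.decay_linear[OF finf[OF t] plf[OF t], where kap = "nu * lam"])
 show "be (U t) 0 = 0" using B[OF t] BS zero by blast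
 show "be (U t) (- n) = cnj (be (U t) n)" for n by (rule be_cnj[OF t])
 show "be (U t) n ~= 0" if "ad A (om t) (be (U t)) n ~= 0" for n using adB[OF t that] B[OF t] by blast
 show "nu * lam ~= 0" using nu lam(1) by simp
 fix v w H n assume ed: "C.edge v w" and lv: "lev (v + w) (be (U t)) H" and nH: "(v + w) \<bullet> n = H"
 let ?h = "lam\<^sup>2 + v \<bullet> w"
 have levs: "lev (v + w) (be (U s)) H" if "s : J" for s using lv B[OF t] B[OF that] by (auto simp: lev_def)
 show "ad A (om t) (be (U t)) n = of_real (nu * lam * ((H / ?h)\<^sup>2 * lam\<^sup>2 - n \<bullet> n)) * be (U t) n"
 proof (cases "be (U t) n = 0")
 case True
 then have "ad A (om t) (be (U t)) n = 0" using adB[OF t, of n] B[OF t] by blast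
 then show ?thesis using True by simp
 next
 case nz: False
 interpret E: plane_edge e A "om t" v w "v + w" ?h by (rule ed)
 have top0: "ad A (om s) (be (U s)) x = 0" if "s : J" "(v + w) \<bullet> x > H" for s x
 using adB[OF that(1), of x] levs[OF that(1)] B[OF that(1)] that(2) by (force simp: lev_def)
 obtain i j :: nat where ij: "n = E.pt i j" "H = real (i + j) * ?h" "be (U t) (real (i + j) *\<^sub>R v) ~= 0"
 using E.row_level[OF finf[OF t] plf[OF t] lv _ nz nH] top0[OF t] E.h0 by (metis less_add_same_cancel1)
 define s where "s = i + j"
 have Hs: "H = real s * ?h" using ij(2) by (simp add: s_def)
 have rec: "of_real y * om r v * be (U r) (E.pt x y) = of_real (x + 1) * om r w * be (U r) (E.pt (x + 1) (y - 1))"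
 if r: "r : J" and xy: "x + y = real s" for r x y
 proof -
 interpret R: plane_circle e A "om r" lam by (rule circle[OF r])
 have "R.edge v w" by (rule R.edgeI) (use E.vw E.vneqw E.D E.gless in \<open>auto simp: inner_add_left\<close>)
 then interpret F: plane_edge e A "om r" v w "v + w" ?h .
 have lv': "lev (v + w) (be (U r)) ((x + y) * ?h)" using levs[OF r] Hs xy by simp
 have "ad A (om r) (be (U r)) (E.pt (x + 1) y) = of_real (dd v w) *
 (of_real y * om r v * be (U r) (E.pt x y) - of_real (x + 1) * om r w * be (U r) (E.pt (x + 1) (y - 1)))"
 using F.row_rel[OF lv'] unfolding F.pt_def E.pt_def .
 moreover have "ad A (om r) (be (U r)) (E.pt (x + 1) y) = 0"
 proof (rule top0[OF r])
 have "x + 1 + y = real s + 1" using xy by simp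
 then show "H < (v + w) \<bullet> E.pt (x + 1) y" unfolding E.g_pt Hs using E.h0 by simp
 qed
 ultimately show ?thesis using E.D by simp
 qed
 \<comment> \<open>The coefficients \<open>om\<close> on both sides decay at the same rate, so the
   time derivative of the recursion is the same recursion for \<open>G\<close>.\<close>
 have recG: "of_real y * om t v * G t (E.pt x y) = of_real (x + 1) * om t w * G t (E.pt (x + 1) (y - 1))"
 if xy: "x + y = real s" for x y
 proof -
 have pd: "((%s. of_real a * om s l * be (U s) m) has_vector_derivative
 of_real a * om t l * G t m + - of_real (nu * lam\<^sup>2) * (of_real a * om t l * be (U t) m)) (at t)" for a l m
 using has_vector_derivative_mult[OF has_vector_derivative_mult_right[OF om_deriv[OF t, of l], of "of_real a"] be_der[OF t, of m]]
 by (simp add: algebra_simps)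
 have "((%s. of_real y * om s v * be (U s) (E.pt x y)) has_vector_derivative
 of_real (x + 1) * om t w * G t (E.pt (x + 1) (y - 1))
 + - of_real (nu * lam\<^sup>2) * (of_real (x + 1) * om t w * be (U t) (E.pt (x + 1) (y - 1)))) (at t)"
 by (rule has_vector_derivative_transform_within_open[OF pd openJ t]) (rule rec[OF _ xy, symmetric])
 from vector_derivative_unique_at[OF this pd] show ?thesis unfolding rec[OF t xy] by simp
 qed
 \<comment> \<open>Removing the top row leaves the advection unchanged and lowers the function by a
   full level; from there no advection can arrive at the vertex.\<close>
 have adv: "ad A (om t) (be (U t)) (real s *\<^sub>R v) = 0"
 proof -
 define c where "c = be (U t) (real s *\<^sub>R v) / om t v ^ s"
 define f' where "f' n = be (U t) n - c * pw A (om t) s n" for n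
 have adf: "ad A (om t) f' n = ad A (om t) (be (U t)) n" for n by (simp add: f'_def[abs_def] ad_diff_scale ad_pw)
 have lt: "(v + w) \<bullet> p < real s * ?h" if "f' p ~= 0" for p
 by (rule E.remove_row[OF finf[OF t] plf[OF t] _ _ c_def])
 (use that lv Hs top0[OF t] E.h0 in \<open>auto simp: f'_def\<close>)
 have finf': "finite (supp f')" unfolding f'_def[abs_def] by (rule E.finite_supp_diff[OF finf[OF t]])
 have plf': "e \<bullet> n = 0" if "f' n ~= 0" for n
 using plf[OF t, of n] pw_plane[OF E.planeA, where k = s and n = n] that by (fastforce simp: f'_def)
 have low: "lev (v + w) f' ((real s - 1) * ?h)"
 proof (cases "f' = (%n. 0)")
 case True
 then show ?thesis by (simp add: lev_def)
 next
 case False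
 obtain p where p: "f' p ~= 0" "lev (v + w) f' ((v + w) \<bullet> p)" using exists_top_level[OF finf' False] by blast
 have "(v + w) \<bullet> p <= (real s - 1) * ?h"
 proof (rule ccontr)
 assume gt: "~ ?thesis"
 have "ad A (om t) f' n = 0" if "(v + w) \<bullet> n = (v + w) \<bullet> p + ?h" for n
 unfolding adf by (rule top0[OF t]) (use that gt Hs in \<open>simp add: algebra_simps\<close>)
 then obtain i' j' :: nat where ij': "(v + w) \<bullet> p = real (i' + j') * ?h"
 using E.row_level[OF finf' plf' p(2) _ p(1) refl] by blast
 have "real (i' + j') * ?h < real s * ?h" "(real s - 1) * ?h < real (i' + j') * ?h"
 using lt[OF p(1)] gt ij' by simp_all
 then have "real (i' + j') < real s" "real s - 1 < real (i' + j')"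
 using E.h0 by (simp_all only: mult_less_cancel_right_pos)
 then have "real (i' + j') < real s" "real s < real (i' + j' + 1)" by simp_all
 then have "i' + j' < s" "s < i' + j' + 1" by (simp_all only: of_nat_less_iff)
 then show False by simp
 qed
 then show ?thesis using p(2) unfolding lev_def by force
 qed
 have "ad A (om t) f' (real s *\<^sub>R v) = 0"
 proof (rule E.ad_vertex_zero[OF finf' low])
 fix x y assume xy: "x + y = real s" "y < 0"
 show "ad A (om t) f' (E.pt x y) = 0"
 proof (rule ccontr)
 assume "ad A (om t) f' (E.pt x y) ~= 0"
 then have "be (U t) (E.pt x y) ~= 0" using adB[OF t] B[OF t] unfolding adf by blast
 moreover have "(v + w) \<bullet> E.pt x y = H" using xy(1) by (simp add: E.g_pt Hs)
 moreover have "ad A (om t) (be (U t)) n = 0" if "(v + w) \<bullet> n = H + ?h" for n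
 by (rule top0[OF t]) (use that E.h0 in simp)
 ultimately obtain i' j' :: nat where "E.pt x y = E.pt i' j'"
 using E.row_level[OF finf[OF t] plf[OF t] lv] by blast
 then show False using xy(2) by (simp add: E.pt_inj)
 qed
 qed
 then show ?thesis unfolding adf .
 qed
 have js: "j <= s" unfolding s_def by simp
 have vv: "v \<bullet> v = lam\<^sup>2" using C.selfA E.vw by blast
 \<comment> \<open>At the vertex only diffusion acts, and the recursion carries its rate along the
   row. Comparison with the definition of \<open>G\<close> then yields the advection with the
   constant \<open>nu * lam\<close>.\<close>
 have "G t (E.pt (real s - real j) (real j)) = - of_real (nu * ((real s)\<^sup>2 * lam\<^sup>2)) * be (U t) (E.pt (real s - real j) (real j))"
 proof (rule E.row_recursion_unique[OF rec[OF t] recG])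
 show "G t (real s *\<^sub>R v) = - of_real (nu * ((real s)\<^sup>2 * lam\<^sup>2)) * be (U t) (real s *\<^sub>R v)"
 unfolding G_def adv by (simp add: vv power2_eq_square)
 qed (fact js | assumption)+
 then have "G t n = - of_real (nu * ((real s)\<^sup>2 * lam\<^sup>2)) * be (U t) n" using ij(1) by (simp add: s_def)
 moreover have "H / ?h = real s" using Hs E.h0 by simp
 ultimately show ?thesis unfolding G_def using lam(1) by (simp add: field_simps)
 qed
 qed
 then obtain c :: real where "\<forall>n. be (U t) n = (if n : A then of_real c * om t n else 0)" by blast
 then have "be (U t) n = of_real c * om t n" for n using om0[OF t, of n] by auto
 then show "\<exists>c::real. \<forall>n. be (U t) n = of_real c * om t n" by blast
 qed
 have "polynomial_profile S nu (U t) lam" if t: "t : J" for t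
 unfolding polynomial_profile_def om_def[symmetric]
 proof (intro conjI)
 show "ALL n:S. al (U t) n ~= 0 --> norm n = lam" using A[OF t] lam(2) by blast
 show "\<exists>N q. \<forall>n. be (U t) n = (\<Sum>k<N. q k * pw S (om t) k n)"
 proof (cases "nu = 0")
 case False
 then obtain c :: real where c: "!!n. be (U t) n = of_real c * om t n" using profile[OF t] by blast
 interpret C: plane_circle e A "om t" lam by (rule circle[OF t])
 have "pw S (om t) 1 n = om t n" for n unfolding pwS[OF t, symmetric] C.pw_1 using om0[OF t] by auto
 then have "be (U t) n = (\<Sum>k<2. (if k = 1 then of_real c else 0) * pw S (om t) k n)" for n
 by (simp add: c numeral_2_eq_2)
 then show ?thesis by (intro exI[of _ 2] exI[of _ "%k. if k = 1 then of_real c else 0"] allI)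
 qed (use profile[OF t] in blast)
 show "nu ~= 0 --> (\<exists>c::real. \<forall>n. be (U t) n = of_real c * om t n)" using profile[OF t] by blast
 qed (rule lam(1))
 then show ?thesis using that spA by blast
qed

end

section \<open>Tilted planes\<close>

locale planar_modes = modes + plane +
 assumes planeS: "!!n. n : S ==> e \<bullet> n = 0" and offS: "!!n. n ~: S ==> U n = 0"
 and spanS: "EX x:S. EX y:S. dd x y ~= 0"
begin

lemma pf: "plane_field U"
 unfolding plane_field_def
proof (intro allI impI)
 fix n assume "U n ~= 0"
 then have "n : S" using offS[of n] by (cases "n : S") simp_all
 then show "n ~= 0 & e \<bullet> n = 0 & cdot (cvec n) (U n) = 0" using perp[of n] planeS[of n] zero by auto
qed

lemma parts_nonzero: "n : S ==> al U n = 0 ==> be U n ~= 0"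
proof
 assume n: "n : S" and z: "al U n = 0" "be U n = 0"
 have "U n = al U n *s cvec (cross3 e n) + be U n *s cvec e" by (rule plane_field_decomp[OF pf])
 also have "\<dots> = 0" unfolding z by simp
 finally show False using nz[OF n] by contradiction
qed

lemma cnj_al: "n : S ==> al U (- n) = - cnj (al U n)" and cnj_be: "n : S ==> be U (- n) = cnj (be U n)"
 using al_be_cnj[of U n] conj[of n] by auto

lemma steady_quad: "steady_outside S (%m k. of_real (dd m k * (k \<bullet> k - m \<bullet> m)) * (al U m * al U k))"
 and nl_zero: "n ~: S ==> n ~= 0 ==> nl S U n = 0"
proof -
 show z: "nl S U n = 0" if "n ~: S" "n ~= 0" for n using steady that by (simp add: steady_outside_def nl_def)
 show "steady_outside S (%m k. of_real (dd m k * (k \<bullet> k - m \<bullet> m)) * (al U m * al U k))"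
 unfolding steady_outside_def
 proof (intro conjI allI impI)
 fix m k :: "real^3"
 show "of_real (dd m k * (k \<bullet> k - m \<bullet> m)) * (al U m * al U k) = of_real (dd k m * (m \<bullet> m - k \<bullet> k)) * (al U k * al U m)"
 unfolding dd_swap[of k m] by (simp add: algebra_simps)
 next
 fix n :: "real^3" assume n: "n ~: S" "n ~= 0"
 show "(\<Sum>m | m : S & n - m : S. of_real (dd m (n - m) * ((n - m) \<bullet> (n - m) - m \<bullet> m)) * (al U m * al U (n - m))) = 0"
 using nl_components(2)[OF fin pf planeS offS, of n] z[OF n] by (simp add: quad_def)
 qed
qed

lemma ad_zero_outside: "n ~: S ==> n ~= 0 ==> ad S (al U) (be U) n = 0"
 using nl_components(1)[OF fin pf planeS offS, of n] nl_zero by simp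

definition expo :: "real^3 => real^3 => bool" where
 "expo l p \<longleftrightarrow> p : S & (ALL q:S. q ~= p --> l \<bullet> q < l \<bullet> p)"

lemma expo_pos:
 assumes "expo l p"
 shows "l \<bullet> p > 0"
proof -
 have pS: "p : S" using assms by (simp add: expo_def)
 have "- p ~= p"
 proof
 assume "- p = p"
 then have "- (p \<bullet> p) = p \<bullet> p" by (metis inner_minus_left)
 then show False using pS zero by simp
 qed
 moreover have "- p : S" by (rule sym[OF pS])
 ultimately have "- p : S" "- p ~= p" by auto
 then have "l \<bullet> (- p) < l \<bullet> p" using assms unfolding expo_def by blast
 then show ?thesis by simp
qed

lemma positive_value:
 assumes f: "e \<bullet> f = 0" "f ~= 0"
 shows "EX n:S. f \<bullet> n > 0"
proof (rule ccontr)
 assume no: "~ ?thesis"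
 have z: "f \<bullet> n = 0" if "n : S" for n
 proof -
 have "f \<bullet> n <= 0" "f \<bullet> (- n) <= 0" using no that sym[OF that] not_less by blast+
 then show ?thesis by simp
 qed
 obtain x y where xy: "x : S" "y : S" "dd x y ~= 0" using spanS by blast
 have "f = (dd f y / dd x y) *\<^sub>R x + (dd x f / dd x y) *\<^sub>R y"
 by (rule plane_basis[OF xy(3) planeS[OF xy(1)] planeS[OF xy(2)] f(1)])
 then have "f \<bullet> f = f \<bullet> ((dd f y / dd x y) *\<^sub>R x + (dd x f / dd x y) *\<^sub>R y)" by simp
 then have "f \<bullet> f = 0" using z[OF xy(1)] z[OF xy(2)] by (simp add: inner_add_right)
 then show False using f(2) by simp
qed

text \<open>Leadership is carried from the in-plane part \<open>f\<close> of \<open>l\<close> to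
  \<open>- f\<close> through the quarter turn \<open>cross3 e f\<close>; neither segment meets a
  functional that vanishes on \<open>S\<close>.\<close>

lemma opposite_vertex:
 assumes ex: "expo l p" and AS: "A \<subseteq> S" and pA: "p : A"
 and AA: "!!a b. a : A ==> b : A ==> inter U a b = 0"
 and AR: "!!a q. a : A ==> q : S - A ==> (!!c. q ~= c *\<^sub>R a) ==> inter U a q ~= 0"
 shows "- p : A"
proof -
 define f where "f = l - (l \<bullet> e) *\<^sub>R e"
 have fl: "f \<bullet> n = l \<bullet> n" if "n : S" for n using planeS[OF that] by (simp add: f_def inner_diff_left)
 have fe: "e \<bullet> f = 0" by (simp add: f_def inner_diff_right e1 inner_commute)
 have pS: "p : S" using ex by (simp add: expo_def)
 have f0: "f ~= 0" using expo_pos[OF ex] fl[OF pS] by auto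
 let ?g = "cross3 e f"
 have ge: "e \<bullet> ?g = 0" by (simp add: dot_cross_self)
 have gf: "f \<bullet> ?g = 0" by (simp add: dot_cross_self)
 have gg: "?g \<bullet> ?g = f \<bullet> f" by (rule cross_e_inner[OF fe])
 have seg: "EX n:S. (a *\<^sub>R f + b *\<^sub>R ?g) \<bullet> n > 0" if "a ~= 0 | b ~= 0" for a b
 proof (rule positive_value)
 show "e \<bullet> (a *\<^sub>R f + b *\<^sub>R ?g) = 0" by (simp add: inner_add_right fe ge)
 have "(a *\<^sub>R f + b *\<^sub>R ?g) \<bullet> (a *\<^sub>R f + b *\<^sub>R ?g) = (a\<^sup>2 + b\<^sup>2) * (f \<bullet> f)"
 by (simp add: inner_add_left inner_add_right gf inner_commute[of ?g f] gg power2_eq_square algebra_simps)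
 moreover have "(a\<^sup>2 + b\<^sup>2) * (f \<bullet> f) ~= 0" using that f0 by (simp add: sum_power2_eq_zero_iff)
 ultimately show "a *\<^sub>R f + b *\<^sub>R ?g ~= 0" by auto
 qed
 have "EX a:A. ALL q:S - A. ?g \<bullet> q < ?g \<bullet> a"
 proof (rule leading_class_propagates[where ?l0.0 = f, OF fin AS steady AA AR])
 show "EX a:A. ALL q:S - A. f \<bullet> q < f \<bullet> a"
 using ex pA fl pS unfolding expo_def by (intro bexI[of _ p]) auto
 show "EX n:S. ((1 - t) *\<^sub>R f + t *\<^sub>R ?g) \<bullet> n > 0" for t :: real by (rule seg) auto
 qed auto
 then have "EX a:A. ALL q:S - A. (- f) \<bullet> q < (- f) \<bullet> a"
 proof (rule leading_class_propagates[OF fin AS steady AA AR, rotated -2])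
 show "EX n:S. ((1 - t) *\<^sub>R ?g + t *\<^sub>R (- f)) \<bullet> n > 0" for t :: real
 using seg[of "- t" "1 - t"] by (auto simp: add.commute)
 qed auto
 then obtain a where a: "a : A" "!!q. q : S - A ==> (- f) \<bullet> q < (- f) \<bullet> a" by blast
 show ?thesis
 proof (rule ccontr)
 assume "- p ~: A"
 then have "f \<bullet> p < f \<bullet> (- a)" using a(2)[of "- p"] sym[OF pS] by simp
 moreover have "- a : S" using a(1) AS sym by blast
 ultimately show False using ex fl[OF pS] fl[of "- a"] unfolding expo_def by force
 qed
qed

text \<open>Modes that have the length and the component ratio of \<open>p\<close> do not interact
  among themselves, but interact with every other mode of a different direction, so they form a
  leading class.\<close>

theorem common_ratio:
 assumes ex: "expo l p" and ap: "al U p ~= 0"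
 obtains kap where "!!n. n : S ==> norm n = norm p & al U n ~= 0 & be U n = kap * al U n"
proof -
 define kap where "kap = be U p / al U p"
 define A where "A = {n : S. norm n = norm p & al U n ~= 0 & be U n = kap * al U n}"
 have pS: "p : S" using ex by (simp add: expo_def)
 have pA: "p : A" using pS ap by (simp add: A_def kap_def)
 have AS: "A \<subseteq> S" by (auto simp: A_def)
 have AA: "inter U a b = 0" if "a : A" "b : A" for a b
 by (rule inter_eq_0_plane[OF pf]) (use that planeS in \<open>auto simp: A_def dot_square_norm\<close>)
 have AR: "inter U a q ~= 0" if a: "a : A" and q: "q : S - A" and np: "!!c. q ~= c *\<^sub>R a" for a q
 proof
 assume z: "inter U a q = 0"
 have aS: "a : S" "al U a ~= 0" "be U a = kap * al U a" "norm a = norm p" using a by (simp_all add: A_def)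
 have D: "dd a q ~= 0" by (rule dd_not_parallel) (use aS q np planeS zero in auto)
 have "of_real (dd a q) * (al U a * be U q - al U q * be U a) = 0"
 "of_real (dd a q * (q \<bullet> q - a \<bullet> a)) * (al U a * al U q) = 0"
 using inter_components[OF pf planeS[OF aS(1)] planeS, of q] q z by auto
 then have 1: "al U a * be U q = al U q * be U a" and 2: "q \<bullet> q = a \<bullet> a | al U q = 0" using D aS by auto
 have 3: "be U q = kap * al U q" using 1 aS by simp
 then have "al U q ~= 0" using parts_nonzero q by auto
 then have "norm q = norm a" using 2 by (simp add: norm_eq)
 then show False using 3 \<open>al U q ~= 0\<close> q aS by (simp add: A_def)
 qed
 \<comment> \<open>For the class to be symmetric \<open>kap\<close> must be purely imaginary; this
   follows once \<open>- p\<close> is known to have the ratio of \<open>p\<close>.\<close>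
 have "- p : A" by (rule opposite_vertex[OF ex AS pA AA AR])
 then have "cnj (be U p) = - kap * cnj (al U p)" by (simp add: A_def cnj_al[OF pS] cnj_be[OF pS])
 moreover have "be U p = kap * al U p" using ap by (simp add: kap_def)
 ultimately have "cnj kap * cnj (al U p) = - kap * cnj (al U p)" by simp
 then have kap: "cnj kap = - kap" using ap by (metis complex_cnj_zero_iff mult_right_cancel)
 have "A = S"
 proof (rule leading_class_is_all[OF fin zero AS steady sym, where r = "norm p"])
 show "- n : A" if "n : A" for n
 using that sym kap by (auto simp: A_def cnj_al cnj_be)
 show "norm a = norm p" if "a : A" for a using that by (simp add: A_def)
 show "norm p > 0" using pS zero by auto
 show "EX a:A. ALL q:S - A. l \<bullet> q < l \<bullet> a" using pA ex by (intro bexI[of _ p]) (auto simp: expo_def)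
 show "EX n:S. \<forall>c. n ~= c *\<^sub>R x" for x by (rule dd_span_not_line[OF spanS])
 qed (use AA AR in auto)
 then have "!!n. n : S ==> norm n = norm p & al U n ~= 0 & be U n = kap * al U n" unfolding A_def by blast
 then show ?thesis using that by blast
qed

text \<open>When the exposed modes are purely transverse, the top of the in-plane part is parallel to each exposed mode.\<close>

lemma in_plane_top:
 assumes ex: "expo l p" and ap: "al U p = 0" and a: "a : S" "al U a ~= 0"
 and top: "!!m. al U m ~= 0 ==> l \<bullet> m <= l \<bullet> a"
 obtains sg where "0 < sg" "sg < 1" "a = sg *\<^sub>R p"
proof -
 have pS: "p : S" and lt: "!!q. q : S ==> q ~= p ==> l \<bullet> q < l \<bullet> p" using ex by (auto simp: expo_def)
 have "al U (- a) ~= 0" using a by (simp add: cnj_al)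
 from top[OF this] have la: "l \<bullet> a >= 0" by simp
 have bp: "be U p ~= 0" by (rule parts_nonzero[OF pS ap])
 have "a ~= 0" using a zero by auto
 then have out: "a + p ~: S" using lt[of "a + p"] la by (auto simp: inner_add_right)
 have n0: "a + p ~= 0"
 proof
 assume "a + p = 0"
 then have "a = - p" by (simp add: add_eq_0_iff2)
 then show False using la expo_pos[OF ex] by simp
 qed
 have "ad S (al U) (be U) (a + p) = (\<Sum>l\<in>{a}. of_real (dd l (a + p)) * al U l * be U (a + p - l))"
 unfolding ad_def
 proof (rule sum.mono_neutral_right[OF fin], use a in simp, rule ballI)
 fix m assume m: "m : S - {a}"
 have "be U (a + p - m) = 0" if am: "al U m ~= 0"
 proof (rule ccontr)
 assume "be U (a + p - m) ~= 0"
 then have "a + p - m : S" using offS by fastforce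
 moreover have "a + p - m ~= p" using m by auto
 ultimately have "l \<bullet> (a + p - m) < l \<bullet> p" by (rule lt)
 then show False using top[OF am] by (simp add: inner_add_right inner_diff_right)
 qed
 then show "of_real (dd m (a + p)) * al U m * be U (a + p - m) = 0" by auto
 qed
 then have "dd a p = 0" using ad_zero_outside[OF out n0] a(2) bp by (simp add: dd_add)
 then have "dd p a = 0" using dd_swap[of p a] by simp
 then have ap': "a = ((p \<bullet> a) / (p \<bullet> p)) *\<^sub>R p" by (rule parallelI[rotated 2]) (use pS a planeS zero in auto)
 define sg where "sg = (p \<bullet> a) / (p \<bullet> p)"
 have s: "a = sg *\<^sub>R p" using ap' by (simp add: sg_def)
 have "sg ~= 0" using s \<open>a ~= 0\<close> by auto
 moreover have "sg * (l \<bullet> p) >= 0" using la s by simp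
 ultimately have "sg > 0" using expo_pos[OF ex] by (simp add: zero_le_mult_iff)
 moreover have "a ~= p" using a ap by auto
 then have "sg * (l \<bullet> p) < 1 * (l \<bullet> p)" using lt[OF a(1)] s by simp
 then have "sg < 1" using expo_pos[OF ex] by (simp only: mult_less_cancel_right_pos)
 ultimately show ?thesis using that s by blast
qed

text \<open>The supporting line is rotated about \<open>p\<close> until it first meets another mode:
  \<open>tau y\<close> is the amount needed for \<open>y\<close>, and the farthest mode met is the
  other end of the edge.\<close>

lemma adjacent_vertex:
 assumes ex: "expo l p"
 obtains q g where "q : S" "q ~= p" "g \<bullet> q = g \<bullet> p" "!!y. y : S ==> g \<bullet> y <= g \<bullet> p" "dd p q > 0" "e \<bullet> g = 0"
 "!!y. y : S ==> g \<bullet> y = g \<bullet> p ==> 0 <= dd p y & dd p y <= dd p q"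
proof -
 have pS: "p : S" and lt: "!!q. q : S ==> q ~= p ==> l \<bullet> q < l \<bullet> p" using ex by (auto simp: expo_def)
 let ?d = "cross3 e p"
 let ?Y = "{y : S. dd p y > 0}"
 define tau where "tau y = (l \<bullet> p - l \<bullet> y) / dd p y" for y
 have "?Y ~= {}"
 proof -
 have "?d ~= 0" using cross_e_inner[OF planeS[OF pS], of p] pS zero by force
 then obtain n where "n : S" "?d \<bullet> n > 0" using positive_value[of ?d] by (auto simp: dot_cross_self)
 then show ?thesis by (auto simp: dd_cross_e)
 qed
 moreover have "finite ?Y" using fin by simp
 ultimately obtain q where q: "q : ?Y" "!!y. y : ?Y ==> - tau y <= - tau q" "!!y. y : ?Y ==> - tau y = - tau q ==> dd p y <= dd p q"
 using finite_argmax_lex[of ?Y "%y. - tau y" "dd p"] by blast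
 have qp: "q ~= p" using q(1) by auto
 have tq: "tau q > 0" using lt[of q] q(1) qp by (simp add: tau_def)
 define g0 where "g0 = l + tau q *\<^sub>R ?d"
 define g where "g = g0 - (g0 \<bullet> e) *\<^sub>R e"
 have ge: "e \<bullet> g = 0" by (simp add: g_def inner_diff_right e1 inner_commute)
 have gy: "g \<bullet> y = l \<bullet> y + tau q * dd p y" if "y : S" for y
 using planeS[OF that] by (simp add: g_def g0_def inner_diff_left inner_add_left dd_cross_e)
 have lq: "l \<bullet> p = l \<bullet> y + tau y * dd p y" if "y : ?Y" for y using that by (simp add: tau_def)
 have gp: "g \<bullet> p = l \<bullet> p" using gy[OF pS] by simp
 have neg: "g \<bullet> y < g \<bullet> p" if "y : S" "y ~= p" "dd p y <= 0" for y
 proof -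
 have "tau q * dd p y <= 0" using tq that(3) by (simp add: mult_nonneg_nonpos)
 then show ?thesis using lt[OF that(1,2)] gy[OF that(1)] gp by simp
 qed
 show ?thesis
 proof (rule that[of q g])
 show "q : S" "dd p q > 0" using q(1) by auto
 show "g \<bullet> q = g \<bullet> p" using gy[of q] lq[OF q(1)] gp q(1) by simp
 fix y assume y: "y : S"
 have pos: "g \<bullet> p - g \<bullet> y = (tau y - tau q) * dd p y" if "dd p y > 0"
 using gy[OF y] lq[of y] that y gp by (simp add: algebra_simps)
 show "g \<bullet> y <= g \<bullet> p"
 proof (cases "dd p y > 0")
 case True
 then have "(tau y - tau q) * dd p y >= 0" using q(2)[of y] y by simp
 then show ?thesis using pos[OF True] by simp
 next
 case False
 then show ?thesis using neg[OF y] by (cases "y = p") auto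
 qed
 assume eq: "g \<bullet> y = g \<bullet> p"
 show "0 <= dd p y & dd p y <= dd p q"
 proof (cases "dd p y > 0")
 case True
 then have "tau y = tau q" using pos[OF True] eq by simp
 then show ?thesis using q(3)[of y] True y by simp
 next
 case False
 then have "y = p" using neg[OF y] eq by fastforce
 then show ?thesis using q(1) by simp
 qed
 qed (use qp ge in auto)
qed

text \<open>A small tilt of the edge functional \<open>g\<close>, to the side given by
  \<open>sg\<close>, exposes the end \<open>q\<close> and at the same time singles out one topmost
  in-plane mode, which therefore is a fraction of \<open>q\<close>.\<close>

lemma exposed_perturb:
 assumes ge: "e \<bullet> g = 0" and gp: "g \<bullet> p > 0" and p: "e \<bullet> p = 0" and q: "q : S" "g \<bullet> q = g \<bullet> p"
 and top: "!!y. y : S ==> g \<bullet> y <= g \<bullet> p" and sg: "!!y. y : S ==> g \<bullet> y = g \<bullet> p ==> sg * dd p y <= sg * dd p q" "sg ~= 0"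
 and a: "al U a0 ~= 0" and outer: "!!l x. expo l x ==> al U x = 0"
 obtains r a where "0 < r" "r < 1" "a = r *\<^sub>R q" "a : S" "al U a ~= 0" "!!m. al U m ~= 0 ==> g \<bullet> m <= g \<bullet> a"
 "!!m. al U m ~= 0 ==> g \<bullet> m = g \<bullet> a ==> sg * dd p m <= sg * dd p a"
proof -
 let ?d = "sg *\<^sub>R cross3 e p"
 have d: "?d \<bullet> y = sg * dd p y" for y by (simp add: dd_cross_e)
 let ?A = "{m : S. al U m ~= 0}"
 have inA: "m : ?A \<longleftrightarrow> al U m ~= 0" for m using offS[of m] by (cases "m : S") auto
 have uniq: "y = x" if "y : S" "x : S" "g \<bullet> y = g \<bullet> x" "?d \<bullet> y = ?d \<bullet> x" for x y
 proof (rule ccontr)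
 assume "y ~= x"
 have "dd p (y - x) = 0" using that(4) sg(2) unfolding d by (simp add: dd_diff)
 then have yx: "y - x = ((p \<bullet> (y - x)) / (p \<bullet> p)) *\<^sub>R p"
 by (rule parallelI[rotated 2]) (use p gp planeS that(1,2) in \<open>auto simp: inner_diff_right\<close>)
 then have "g \<bullet> (y - x) = ((p \<bullet> (y - x)) / (p \<bullet> p)) * (g \<bullet> p)" by (metis inner_scaleR_right)
 then have k0: "(p \<bullet> (y - x)) / (p \<bullet> p) = 0" using that(3) gp by (simp add: inner_diff_right)
 have "y - x = 0" by (rule trans[OF yx]) (subst k0, simp)
 then show False using \<open>y ~= x\<close> by simp
 qed
 have fA: "finite ?A" using fin by simp
 have neA: "?A ~= {}" using a inA[of a0] by blast
 obtain a where aA: "a : ?A" "!!y. y : ?A ==> g \<bullet> y <= g \<bullet> a" "!!y. y : ?A ==> g \<bullet> y = g \<bullet> a ==> ?d \<bullet> y <= ?d \<bullet> a"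
 by (rule finite_argmax_lex[OF fA neA, of "%y. g \<bullet> y" "%y. ?d \<bullet> y"]) (rule that; blast)
 have "eventually (%eps. ALL y:?A - {a}. g \<bullet> y + eps * (?d \<bullet> y) < g \<bullet> a + eps * (?d \<bullet> a)) (at_right 0)"
 proof (rule finite_perturb)
 fix y assume y: "y : ?A - {a}"
 then have "g \<bullet> y = g \<bullet> a ==> ?d \<bullet> y ~= ?d \<bullet> a" using uniq[of y a] aA(1) by blast
 moreover have "g \<bullet> y <= g \<bullet> a" by (rule aA(2)) (use y in blast)
 moreover have "g \<bullet> y = g \<bullet> a ==> ?d \<bullet> y <= ?d \<bullet> a" by (rule aA(3)) (use y in blast)+
 ultimately show "g \<bullet> y < g \<bullet> a | g \<bullet> y = g \<bullet> a & ?d \<bullet> y < ?d \<bullet> a" unfolding less_le by blast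
 qed (use fin in simp)
 moreover have "eventually (%eps. ALL y:S - {q}. g \<bullet> y + eps * (?d \<bullet> y) < g \<bullet> q + eps * (?d \<bullet> q)) (at_right 0)"
 proof (rule finite_perturb)
 fix y assume y: "y : S - {q}"
 then have "g \<bullet> y = g \<bullet> q ==> ?d \<bullet> y ~= ?d \<bullet> q" using uniq[of y q] q(1) by blast
 moreover have "g \<bullet> y = g \<bullet> q ==> ?d \<bullet> y <= ?d \<bullet> q" using sg(1)[of y] y q(2) unfolding d by simp
 moreover have "g \<bullet> y <= g \<bullet> q" unfolding q(2) by (rule top) (use y in blast)
 ultimately show "g \<bullet> y < g \<bullet> q | g \<bullet> y = g \<bullet> q & ?d \<bullet> y < ?d \<bullet> q" unfolding less_le by blast
 qed (use fin in simp)
 ultimately have "eventually (%eps. (ALL y:?A - {a}. g \<bullet> y + eps * (?d \<bullet> y) < g \<bullet> a + eps * (?d \<bullet> a)) &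
 (ALL y:S - {q}. g \<bullet> y + eps * (?d \<bullet> y) < g \<bullet> q + eps * (?d \<bullet> q))) (at_right 0)" by (rule eventually_conj)
 then obtain eps where eps: "ALL y:?A - {a}. g \<bullet> y + eps * (?d \<bullet> y) < g \<bullet> a + eps * (?d \<bullet> a)"
 "ALL y:S - {q}. g \<bullet> y + eps * (?d \<bullet> y) < g \<bullet> q + eps * (?d \<bullet> q)"
 by (rule obtain_at_right) blast
 let ?l = "g + eps *\<^sub>R ?d"
 have l: "?l \<bullet> y = g \<bullet> y + eps * (?d \<bullet> y)" for y by (simp add: inner_add_left)
 have exq: "expo ?l q" unfolding expo_def l using eps(2) q(1) by blast
 have topa: "?l \<bullet> m <= ?l \<bullet> a" if "al U m ~= 0" for m
 unfolding l using eps(1) that inA[of m] by (cases "m = a") (auto simp: less_imp_le)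
 obtain r where r: "0 < r" "r < 1" "a = r *\<^sub>R q"
 using in_plane_top[OF exq outer[OF exq] _ _ topa] aA(1) by blast
 show ?thesis
 by (rule that[OF r]) (use aA inA in \<open>auto simp: dd_cross_e\<close>)
qed

text \<open>The in-plane hull has a top row parallel to the edge, from \<open>r1\<close> times
  \<open>p\<close> to \<open>r1\<close> times \<open>q\<close>. In-plane modes that sum to
  \<open>p\<close> and interact require \<open>r1 > 1 / 2\<close>, while the recursion in the
  transverse top row makes \<open>1\<close> an integer multiple of \<open>r1\<close>. This is
  impossible for \<open>r1 < 1\<close>.\<close>

theorem transverse_hull_contradiction:
 assumes ex: "expo l p" and outer: "!!l x. expo l x ==> al U x = 0" and quad: "quad S U p ~= 0"
 shows False
proof -
 have pS: "p : S" using ex by (simp add: expo_def)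
 have pe: "e \<bullet> p = 0" by (rule planeS[OF pS])
 obtain m0 where m0: "m0 : S" "p - m0 : S" "dd m0 (p - m0) ~= 0" "al U m0 ~= 0" "al U (p - m0) ~= 0"
 proof -
 obtain m where "m : {m : S. p - m : S}"
 "complex_of_real (dd m (p - m) * ((p - m) \<bullet> (p - m) - m \<bullet> m)) * (al U m * al U (p - m)) ~= 0"
 using sum.not_neutral_contains_not_neutral[OF quad[unfolded quad_def]] .
 then show ?thesis using that[of m] by auto
 qed
 obtain q g where gq: "q : S" "q ~= p" "g \<bullet> q = g \<bullet> p" "!!y. y : S ==> g \<bullet> y <= g \<bullet> p" "dd p q > 0" "e \<bullet> g = 0"
 and row: "!!y. y : S ==> g \<bullet> y = g \<bullet> p ==> 0 <= dd p y & dd p y <= dd p q"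
 by (rule adjacent_vertex[OF ex]) (rule that; blast)
 have g0: "g ~= 0"
 proof
 assume "g = 0"
 then have "- q : S ==> 0 <= dd p (- q)" using row[of "- q"] by simp
 then show False using sym[OF gq(1)] gq(5) by simp
 qed
 obtain n where "n : S" "g \<bullet> n > 0" using positive_value[OF gq(6) g0] by blast
 then have gp: "g \<bullet> p > 0" using gq(4)[of n] by simp
 obtain r1 a1 where r1: "0 < r1" "r1 < 1" "a1 = r1 *\<^sub>R p" and a1: "a1 : S" "al U a1 ~= 0"
 "!!m. al U m ~= 0 ==> g \<bullet> m <= g \<bullet> a1" "!!m. al U m ~= 0 ==> g \<bullet> m = g \<bullet> a1 ==> (- 1) * dd p m <= (- 1) * dd p a1"
 by (rule exposed_perturb[OF gq(6) gp pe pS refl gq(4), of "- 1" m0]) (use row m0(4) outer in auto)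
 obtain r2 a2 where r2: "0 < r2" "r2 < 1" "a2 = r2 *\<^sub>R q" and a2: "a2 : S" "al U a2 ~= 0"
 "!!m. al U m ~= 0 ==> g \<bullet> m <= g \<bullet> a2" "!!m. al U m ~= 0 ==> g \<bullet> m = g \<bullet> a2 ==> 1 * dd p m <= 1 * dd p a2"
 by (rule exposed_perturb[OF gq(6) gp pe gq(1,3,4), of 1 m0]) (use row m0(4) outer in auto)
 have lev: "g \<bullet> a2 = g \<bullet> a1" using a1(3)[OF a2(2)] a2(3)[OF a1(2)] by simp
 then have r12: "r2 = r1" using r1(3) r2(3) gq(3) gp by simp
 have ga: "g \<bullet> a1 = r1 * (g \<bullet> p)" using r1(3) by simp
 have da1: "dd p a1 = 0" using r1(3) by (simp add: dd_scale)
 have da2: "dd p a2 > 0" using r2(1,3) gq(5) by (simp add: dd_scale)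
 define R where "R = {m : S. al U m ~= 0 & g \<bullet> m = g \<bullet> a1}"
 have Rd: "0 <= dd p m & dd p m <= dd p a2" if "m : R" for m
 using a1(4)[of m] a2(4)[of m] that da1 lev by (auto simp: R_def)
 \<comment> \<open>In a row the determinant of two points is proportional to the difference of their
   positions \<open>dd p\<close>, so distinct points of the row are never parallel.\<close>
 have Rdd: "dd x y = (g \<bullet> a1) / (g \<bullet> p) * (dd p y - dd p x)" if "x : R" "y : R" for x y
 proof -
 have gx: "g \<bullet> x = g \<bullet> a1" "g \<bullet> y = g \<bullet> a1" using that by (simp_all add: R_def)
 have pl: "e \<bullet> x = 0" "e \<bullet> y = 0" using that planeS by (auto simp: R_def)
 have D: "dd p q ~= 0" using gq(5) by simp
 have xe: "x = (dd x q / dd p q) *\<^sub>R p + (dd p x / dd p q) *\<^sub>R q" by (rule plane_basis[OF D pe planeS[OF gq(1)] pl(1)])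
 have ye: "y = (dd y q / dd p q) *\<^sub>R p + (dd p y / dd p q) *\<^sub>R q" by (rule plane_basis[OF D pe planeS[OF gq(1)] pl(2)])
 define a b a' b' where ab: "a = dd x q / dd p q" "b = dd p x / dd p q" "a' = dd y q / dd p q" "b' = dd p y / dd p q"
 have x: "x = a *\<^sub>R p + b *\<^sub>R q" and y: "y = a' *\<^sub>R p + b' *\<^sub>R q" using xe ye unfolding ab by auto
 have s: "(a + b) * (g \<bullet> p) = g \<bullet> a1" "(a' + b') * (g \<bullet> p) = g \<bullet> a1"
 using gx unfolding x y by (simp_all add: inner_add_right gq(3) algebra_simps)
 then have s': "a + b = (g \<bullet> a1) / (g \<bullet> p)" "a' + b' = (g \<bullet> a1) / (g \<bullet> p)" using gp by (simp_all add: field_simps)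
 have "dd x y = (a * b' - b * a') * dd p q"
 unfolding x y by (simp add: dd_add dd_scale dd_swap[of q p] algebra_simps)
 also have "a * b' - b * a' = (a + b) * (b' - b)"
 proof -
 have aa: "a' = a + b - b'" using s' by simp
 show ?thesis unfolding aa by (simp add: algebra_simps)
 qed
 also have "(a + b) * (b' - b) * dd p q = (g \<bullet> a1) / (g \<bullet> p) * (dd p y - dd p x)"
 proof -
 have "(b' - b) * dd p q = dd p y - dd p x" unfolding ab using D by (simp add: field_simps)
 then show ?thesis unfolding s' mult.assoc by simp
 qed
 finally show ?thesis .
 qed
 have Runiq: "x = y" if "x : R" "y : R" "dd p x = dd p y" for x y
 proof -
 have x: "x : S" and y: "y : S" using that by (simp_all add: R_def)
 have "dd x y = 0" using Rdd[OF that(1,2)] that(3) by simp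
 then have "y = ((x \<bullet> y) / (x \<bullet> x)) *\<^sub>R x"
 by (rule parallelI[rotated 2]) (use x y planeS zero in auto)
 then obtain k where k: "y = k *\<^sub>R x" by blast
 have "g \<bullet> y = g \<bullet> x" "g \<bullet> x ~= 0" using that(1,2) ga r1(1) gp by (simp_all add: R_def)
 then have "k = 1" unfolding k by simp
 then show ?thesis using k by simp
 qed
 have aR: "a1 : R" "a2 : R" using a1 a2 lev by (auto simp: R_def)
 \<comment> \<open>The modes \<open>m0\<close> and \<open>p - m0\<close> sum to \<open>p\<close>. If
   both were in the top row, their positions would be nonnegative with sum zero, and the two would
   be parallel.\<close>
 have half: "r1 > 1 / 2"
 proof -
 have "g \<bullet> m0 + g \<bullet> (p - m0) = g \<bullet> p" by (simp add: inner_diff_right)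
 moreover have le: "g \<bullet> m0 <= g \<bullet> a1" "g \<bullet> (p - m0) <= g \<bullet> a1" using a1(3) m0 by auto
 moreover have "~ (g \<bullet> m0 = g \<bullet> a1 & g \<bullet> (p - m0) = g \<bullet> a1)"
 proof
 assume "g \<bullet> m0 = g \<bullet> a1 & g \<bullet> (p - m0) = g \<bullet> a1"
 then have R: "m0 : R" "p - m0 : R" using m0 by (simp_all add: R_def)
 have "dd p m0 + dd p (p - m0) = 0" by (simp add: dd_diff)
 then have "dd p m0 = dd p (p - m0)" using Rd[OF R(1)] Rd[OF R(2)] by linarith
 then show False using Rdd[OF R] m0(3) by simp
 qed
 ultimately have "1 * (g \<bullet> p) < (2 * r1) * (g \<bullet> p)" unfolding ga by linarith
 then have "1 < 2 * r1" using gp by (simp only: mult_less_cancel_right_pos)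
 then show ?thesis by simp
 qed
 have outS: "x + y ~: S" if "x : R" "y : R" for x y
 proof
 assume "x + y : S"
 then have "2 * (g \<bullet> a1) <= g \<bullet> p" using gq(4)[of "x + y"] that by (simp add: inner_add_right R_def)
 moreover have "1 * (g \<bullet> p) < (2 * r1) * (g \<bullet> p)" using half gp by (intro mult_strict_right_mono) auto
 ultimately show False unfolding ga by simp
 qed
 \<comment> \<open>Sums of two modes of the row are outside \<open>S\<close>, so a pair of the row
   without competitor has vanishing in-plane interaction.\<close>
 have equal_norm: "x \<bullet> x = y \<bullet> y" if x: "x : R" and y: "y : R" "y ~= x"
 and only: "!!m k. m : R ==> k : R ==> m + k = x + y ==> m = x | m = y" for x y
 proof -
 let ?w = "%m k. complex_of_real (dd m k * (k \<bullet> k - m \<bullet> m)) * (al U m * al U k)"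
 have xS: "x : S" "y : S" "al U x ~= 0" "al U y ~= 0" using x y by (simp_all add: R_def)
 have "?w x y = 0"
 proof (rule steady_outside_unique[OF fin steady_quad xS(1,2) _ outS[OF x y(1)]])
 show "x ~= y" using y by simp
 have "g \<bullet> (x + y) = 2 * (g \<bullet> a1)" using x y by (simp add: R_def inner_add_right)
 then show "x + y ~= 0" using ga r1(1) gp by auto
 fix m k assume mk: "m : S" "k : S" "m + k = x + y" "m ~= x" "m ~= y"
 show "?w m k = 0"
 proof (cases "al U m = 0 | al U k = 0")
 case False
 then have "g \<bullet> m <= g \<bullet> a1" "g \<bullet> k <= g \<bullet> a1" using a1(3) by auto
 moreover have "g \<bullet> m + g \<bullet> k = 2 * (g \<bullet> a1)"
 using arg_cong[OF mk(3), of "%z. g \<bullet> z"] x y by (simp add: R_def inner_add_right)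
 ultimately have "g \<bullet> m = g \<bullet> a1" "g \<bullet> k = g \<bullet> a1" by linarith+
 then have "m : R" "k : R" using False mk by (simp_all add: R_def)
 then show ?thesis using only mk by blast
 qed auto
 qed
 moreover have "dd x y ~= 0" using Rdd[OF x y(1)] Runiq[OF x y(1)] y(2) ga r1(1) gp by auto
 ultimately show ?thesis using xS by simp
 qed
 have finR: "finite R" using fin by (simp add: R_def)
 have ne: "a1 ~= a2" using da1 da2 by auto
 \<comment> \<open>\<open>b\<close> is the neighbour of \<open>a1\<close> in the row and
   \<open>c\<close> that of \<open>a2\<close>; an extreme mode and its neighbour have no
   competitor.\<close>
 obtain b where b: "b : R - {a1}" "!!y. y : R - {a1} ==> - dd p y <= - dd p b"
 using finite_argmax[of "R - {a1}" "%y. - dd p y"] finR aR ne by blast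
 obtain c where c: "c : R - {a2}" "!!y. y : R - {a2} ==> dd p y <= dd p c"
 using finite_argmax[of "R - {a2}" "dd p"] finR aR ne by blast
 have pos: "dd p y > 0" if "y : R" "y ~= a1" for y
 using Rd[OF that(1)] Runiq[OF that(1) aR(1)] that(2) da1 by force
 have lt2: "dd p y < dd p a2" if "y : R" "y ~= a2" for y
 using Rd[OF that(1)] Runiq[OF that(1) aR(2)] that(2) by force
 have sum_dd: "dd p m + dd p k = dd p x + dd p y" if "m + k = x + y" for m k x y
 using arg_cong[OF that, of "dd p"] by (simp add: dd_add)
 have nb: "a1 \<bullet> a1 = b \<bullet> b"
 proof (rule equal_norm[OF aR(1)])
 show "m = a1 | m = b" if mk: "m : R" "k : R" "m + k = a1 + b" for m k
 proof (rule ccontr)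
 assume "~ ?thesis"
 then have m: "m ~= a1" "m ~= b" by auto
 have "k ~= a1" using mk(3) m(2) by (auto simp: add.commute)
 then have "dd p b <= dd p m" "dd p b <= dd p k" using b(2)[of m] b(2)[of k] mk m by auto
 moreover have "dd p b > 0" using pos b(1) by blast
 ultimately show False using sum_dd[OF mk(3)] da1 by simp
 qed
 qed (use b in auto)
 have nc: "a2 \<bullet> a2 = c \<bullet> c"
 proof (rule equal_norm[OF aR(2)])
 show "m = a2 | m = c" if mk: "m : R" "k : R" "m + k = a2 + c" for m k
 proof (rule ccontr)
 assume "~ ?thesis"
 then have m: "m ~= a2" "m ~= c" by auto
 have "k ~= a2" using mk(3) m(2) by (auto simp: add.commute)
 then have "dd p m <= dd p c" "dd p k <= dd p c" using c(2)[of m] c(2)[of k] mk m by auto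
 moreover have "dd p c < dd p a2" using lt2 c(1) by blast
 ultimately show False using sum_dd[OF mk(3)] by simp
 qed
 qed (use c in auto)
 define u where "u = a2 - a1"
 define s where "s y = dd p y / dd p a2" for y
 have line: "y = a1 + s y *\<^sub>R u" if "y : R" for y
 proof -
 have ya: "y : S" using that by (simp add: R_def)
 have D: "dd p a2 ~= 0" using da2 by simp
 have "y = (dd y a2 / dd p a2) *\<^sub>R p + (dd p y / dd p a2) *\<^sub>R a2"
 by (rule plane_basis[OF D pe planeS[OF a2(1)] planeS[OF ya]])
 then obtain k where k: "y = k *\<^sub>R p + s y *\<^sub>R a2" unfolding s_def by blast
 then have "g \<bullet> y = k * (g \<bullet> p) + s y * (g \<bullet> a2)" by (metis inner_add_right inner_scaleR_right)
 then have "r1 * (g \<bullet> p) = (k + s y * r1) * (g \<bullet> p)" using that lev ga by (simp add: R_def algebra_simps)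
 then have kk: "k = r1 - s y * r1" using gp by simp
 have "k *\<^sub>R p + s y *\<^sub>R a2 = a1 + s y *\<^sub>R u"
 unfolding kk u_def r1(3) by (simp add: algebra_simps)
 then show ?thesis by (rule trans[OF k])
 qed
 have u0: "u \<bullet> u > 0" using ne by (simp add: u_def)
 \<comment> \<open>The squared length is a quadratic function of the position in the row. Equal
   values at \<open>0\<close> and \<open>s b\<close>, and at \<open>s c\<close> and
   \<open>1\<close>, give \<open>s b = 1 + s c\<close>, which leaves no mode between
   \<open>a1\<close> and \<open>a2\<close>.\<close>
 have phi: "(a1 + x *\<^sub>R u) \<bullet> (a1 + x *\<^sub>R u) = a1 \<bullet> a1 + x * (2 * (a1 \<bullet> u)) + x\<^sup>2 * (u \<bullet> u)" for x
 by (simp add: inner_add_left inner_add_right inner_commute[of u a1] power2_eq_square algebra_simps)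
 have bs: "s b > 0" using pos[of b] b(1) da2 by (simp add: s_def)
 have cs: "0 <= s c" "s c < 1" using Rd[of c] lt2[of c] c(1) da2 by (simp_all add: s_def)
 have "s b * (2 * (a1 \<bullet> u)) + (s b)\<^sup>2 * (u \<bullet> u) = 0" using nb line[of b] b(1) phi[of "s b"] by simp
 then have "s b * (2 * (a1 \<bullet> u) + s b * (u \<bullet> u)) = 0" by (simp add: power2_eq_square algebra_simps)
 then have e1': "2 * (a1 \<bullet> u) = - s b * (u \<bullet> u)" using bs by simp
 have "a2 = a1 + 1 *\<^sub>R u" by (simp add: u_def)
 then have "a1 \<bullet> a1 + 1 * (2 * (a1 \<bullet> u)) + 1\<^sup>2 * (u \<bullet> u) = a1 \<bullet> a1 + s c * (2 * (a1 \<bullet> u)) + (s c)\<^sup>2 * (u \<bullet> u)"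
 using nc line[of c] c(1) phi[of 1] phi[of "s c"] by simp
 then have "(1 - s c) * (1 + s c - s b) * (u \<bullet> u) = 0" unfolding e1' by (simp add: power2_eq_square algebra_simps)
 then have "s b = 1 + s c" using cs u0 by simp
 moreover have "s b <= 1" using Rd[of b] b(1) da2 by (simp add: s_def)
 ultimately have sb: "s b = 1" using cs by simp
 then have "dd p b = dd p a2" using da2 by (simp add: s_def)
 then have ba2: "b = a2" using Runiq[of b a2] b(1) aR by blast
 have R2: "R = {a1, a2}"
 proof
 show "R \<subseteq> {a1, a2}"
 proof
 fix y assume y: "y : R"
 show "y : {a1, a2}"
 proof (cases "y = a1")
 case False
 then have "dd p a2 <= dd p y" using b(2)[of y] y ba2 by simp
 then have "dd p y = dd p a2" using Rd[OF y] by simp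
 then show ?thesis using Runiq[OF y aR(2)] by simp
 qed simp
 qed
 qed (use aR in auto)
 have nn: "a1 \<bullet> a1 = a2 \<bullet> a2" using nb ba2 by simp
 have "0 < (a1 - a2) \<bullet> (a1 - a2)" using ne by simp
 then have strict: "a1 \<bullet> a2 < a1 \<bullet> a1" using nn by (simp add: inner_diff_left inner_diff_right inner_commute[of a2 a1])
 \<comment> \<open>With just two modes in the in-plane top row, the row analysis applies to the
   transverse part, advected by these two alone.\<close>
 interpret E: plane_edge e "{a1, a2}" "al U" a1 a2 g "g \<bullet> a1"
 proof
 show "dd a1 a2 ~= 0" using Rdd[OF aR] da1 da2 ga r1(1) gp by simp
 show "g \<bullet> a1 > 0" using ga r1(1) gp by simp
 qed (use a1 a2 planeS lev strict nn in \<open>auto simp: inner_commute[of a2 a1]\<close>)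
 have finb: "finite (supp (be U))"
 proof (rule finite_subset[OF _ fin], rule subsetI)
 show "n : S" if "n : supp (be U)" for n using that offS[of n] by (cases "n : S") (simp_all add: supp_def)
 qed
 have plb: "e \<bullet> n = 0" if "be U n ~= 0" for n
 using that offS[of n] planeS by (cases "n : S") simp_all
 have levb: "lev g (be U) (g \<bullet> p)" unfolding lev_def
 proof (intro allI impI)
 show "g \<bullet> n <= g \<bullet> p" if "be U n ~= 0" for n using that offS[of n] gq(4) by (cases "n : S") simp_all
 qed
 have van: "ad {a1, a2} (al U) (be U) n = 0" if "g \<bullet> n = g \<bullet> p + g \<bullet> a1" "e \<bullet> n = 0" for n
 proof -
 have "g \<bullet> n > g \<bullet> p" using that ga r1(1) gp by simp
 then have "n ~: S" "n ~= 0" using gq(4)[of n] gp by auto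
 then have "ad S (al U) (be U) n = 0" by (rule ad_zero_outside)
 moreover have "ad {a1, a2} (al U) (be U) n = ad S (al U) (be U) n"
 unfolding ad_def
 proof (rule sum.mono_neutral_left[OF fin], use a1 a2 in simp, rule ballI)
 fix m assume m: "m : S - {a1, a2}"
 show "of_real (dd m n) * al U m * be U (n - m) = 0"
 proof (cases "al U m = 0")
 case False
 have "g \<bullet> m ~= g \<bullet> a1" using m R2 False unfolding R_def by blast
 moreover have "g \<bullet> m <= g \<bullet> a1" by (rule a1(3)[OF False])
 ultimately have "g \<bullet> m < g \<bullet> a1" by simp
 then have "~ g \<bullet> (n - m) <= g \<bullet> p" using that by (simp add: inner_diff_right)
 then have "be U (n - m) = 0" using levb unfolding lev_def by blast
 then show ?thesis by simp
 qed simp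
 qed
 ultimately show ?thesis by simp
 qed
 have bp: "be U p ~= 0" by (rule parts_nonzero[OF pS outer[OF ex]])
 obtain i j :: nat where "g \<bullet> p = real (i + j) * (g \<bullet> a1)"
 by (rule E.row_level[OF finb plb levb van bp refl]) (assumption | rule that)+
 then have "1 * (g \<bullet> p) = real (i + j) * r1 * (g \<bullet> p)" unfolding ga by simp
 then have N: "real (i + j) * r1 = 1" using gp by (simp only: mult_cancel_right) auto
 consider "i + j = 0" | "i + j = 1" | "i + j >= 2" by linarith
 then show False
 proof cases
 case 3
 have "1 < 2 * r1" using half by simp
 also have "2 * r1 <= real (i + j) * r1" using 3 r1(1) by (intro mult_right_mono) auto
 also have "\<dots> = 1" by (rule N)
 finally show False by simp
 qed (use N r1 in auto)
qed

end

section \<open>Quiet structures and linear evolution\<close>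

lemma tendsto_smult_vec:
 fixes v :: "'a => complex^3"
 assumes "(a \<longlongrightarrow> A) F" "(v \<longlongrightarrow> V) F"
 shows "((%x. a x *s v x) \<longlongrightarrow> A *s V) F"
 by (rule vec_tendstoI, simp only: vector_smult_component, intro tendsto_mult tendsto_vec_nth assms)

lemma scaleR_smult: "r *\<^sub>R (v :: complex^3) = of_real r *s v"
 by (simp add: vec_eq_iff scaleR_conv_of_real[where 'a=complex])

lemma bounded_linear_proj_perp: "bounded_linear (proj_perp n)"
proof -
 have "linear (proj_perp n)"
 by (rule linearI) (simp_all only: proj_perp_add scaleR_smult proj_perp_smult)
 then show ?thesis by (simp add: linear_conv_bounded_linear)
qed

lemma tendsto_nl:
 assumes "!!m. ((%s. U s m) \<longlongrightarrow> V m) F"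
 shows "((%s. nl S (U s) n) \<longlongrightarrow> nl S V n) F"
 unfolding nl_def inter_def bilin_def
 by (intro tendsto_sum bounded_linear.tendsto[OF bounded_linear_proj_perp] tendsto_add tendsto_smult_vec
 bounded_linear.tendsto[OF bounded_linear_cdot] assms)

lemma isCont_eventually_nonzero:
 fixes g :: "real => 'c::real_normed_vector"
 assumes "isCont g t" "g t ~= 0"
 shows "eventually (%s. g s ~= 0) (nhds t)"
 using tendsto_imp_eventually_ne[of g "g t" "nhds t" 0] assms
 by (simp add: isCont_def tendsto_at_iff_tendsto_nhds)

text \<open>At a time with the greatest number of nonzero coefficients these stay nonzero nearby by
  continuity, and no others can appear.\<close>

lemma constant_support:
 fixes f :: "real => 'b => 'c::real_normed_vector"
 assumes X: "finite X" and J: "open J" "J ~= {}" and c: "!!t x. t : J ==> x : X ==> isCont (%s. f s x) t"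
 shows "\<exists>J' X'. J' \<subseteq> J & open J' & J' ~= {} & X' \<subseteq> X & (ALL t:J'. ALL x:X. f t x ~= 0 \<longleftrightarrow> x : X')"
proof -
 define N where "N t = {x\<in>X. f t x ~= 0}" for t
 let ?C = "(%t. card (N t)) ` J"
 have fin: "finite ?C"
 by (rule finite_subset[of _ "{..card X}"]) (auto simp: N_def intro!: card_mono X)
 have "Max ?C : ?C" using fin J by (intro Max_in) auto
 then obtain t0 where t0: "t0 : J" "Max ?C = card (N t0)" by blast
 have mx: "card (N t) <= card (N t0)" if "t : J" for t
 unfolding t0(2)[symmetric] by (rule Max_ge[OF fin]) (use that in blast)
 have "eventually (%t. ALL x:N t0. f t x ~= 0) (nhds t0)"
 proof (rule eventually_ball_finite)
 show "ALL x:N t0. eventually (%t. f t x ~= 0) (nhds t0)"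
 using isCont_eventually_nonzero[OF c[OF t0(1)]] by (auto simp: N_def)
 qed (use X in \<open>simp add: N_def\<close>)
 then obtain T where T: "open T" "t0 : T" "!!t. t : T ==> ALL x:N t0. f t x ~= 0"
 unfolding eventually_nhds by blast
 have "N t0 = N t" if t: "t : J \<inter> T" for t
 proof (rule card_seteq)
 show "N t0 \<subseteq> N t" using T(3)[of t] t by (auto simp: N_def)
 show "card (N t) <= card (N t0)" using mx t by blast
 show "finite (N t)" using X by (simp add: N_def)
 qed
 then have "ALL t:J \<inter> T. ALL x:X. f t x ~= 0 \<longleftrightarrow> x : N t0" unfolding N_def by blast
 moreover have "N t0 \<subseteq> X" by (auto simp: N_def)
 moreover have "open (J \<inter> T)" "J \<inter> T ~= {}" using J T t0 by auto
 ultimately show ?thesis by (intro exI[of _ "J \<inter> T"] exI[of _ "N t0"]) blast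
qed

lemma nl_mono:
 assumes "finite S" "S' \<subseteq> S" "!!n. n : S - S' ==> V n = 0"
 shows "nl S' V n = nl S V n"
 unfolding nl_def
proof (rule sum.mono_neutral_left)
 show "ALL m:{m : S. n - m : S} - {m : S'. n - m : S'}. inter V m (n - m) = 0"
 proof
 fix m assume "m : {m : S. n - m : S} - {m : S'. n - m : S'}"
 then have "m : S - S' | n - m : S - S'" by blast
 then show "inter V m (n - m) = 0" using assms(3)[of m] assms(3)[of "n - m"] by auto
 qed
qed (use assms(1,2) in auto)

definition line_structure :: "(real^3) set => bool" where
 "line_structure S \<longleftrightarrow> (\<exists>x. ALL n:S. \<exists>c. n = c *\<^sub>R x)"

definition helical_structure :: "(real^3) set => (real^3 => complex^3) => bool" where
 "helical_structure S V \<longleftrightarrow> (\<exists>mu r. r > 0 & mu : {r, - r} & (ALL n:S. norm n = r & helical (of_real mu) n (V n)))"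

text \<open>Only planar supports on which the Coriolis term vanishes are meant. The planar
  alternative with profile \<omega> or \<open>- \<omega>\<close> consists of curl eigenvectors and
  is counted under \<open>helical_structure\<close>, which admits supports of any dimension.\<close>

definition planar_structure :: "real => real => (real^3) set => (real^3 => complex^3) => bool" where
 "planar_structure nu Om S V \<longleftrightarrow> (\<exists>e. e \<bullet> e = 1 & (ALL n:S. e \<bullet> n = 0 & Om * n$3 = 0) &
  (EX x:S. EX y:S. det3 e x y ~= 0) &
  ((ALL n:S. plane.al e V n = 0) |
 (\<exists>lam. plane.polynomial_profile e S nu V lam &
 (EX x:S. EX y:S. plane.al e V x ~= 0 & plane.al e V y ~= 0 & det3 e x y ~= 0))))"

definition mode_structure :: "real => real => (real^3) set => (real^3 => complex^3) => bool" where
 "mode_structure nu Om S V \<longleftrightarrow> line_structure S | planar_structure nu Om S V | helical_structure S V"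

lemma dimension_cases:
 fixes S :: "(real^3) set"
 obtains "line_structure S"
 | e where "e \<bullet> e = 1" "!!n. n : S ==> e \<bullet> n = 0" "EX x:S. EX y:S. det3 e x y ~= 0"
 | "span S = UNIV" "~ line_structure S"
proof (cases "EX x:S. EX y:S. cross3 x y ~= 0")
 case False
 have "line_structure S"
 proof (cases "S \<subseteq> {0}")
 case True
 then show ?thesis unfolding line_structure_def by (intro exI[of _ 0]) auto
 next
 case nz: False
 then obtain x where x: "x : S" "x ~= 0" by blast
 have "n = ((x \<bullet> n) / (x \<bullet> x)) *\<^sub>R x" if "n : S" for n
 proof -
 have "cross3 x n = 0" using False x that by blast
 then have "(x \<bullet> x) *\<^sub>R n = (x \<bullet> n) *\<^sub>R x" using Lagrange[of x x n] by simp
 then have "(1 / (x \<bullet> x)) *\<^sub>R ((x \<bullet> x) *\<^sub>R n) = (1 / (x \<bullet> x)) *\<^sub>R ((x \<bullet> n) *\<^sub>R x)" by simp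
 then show ?thesis using x(2) by simp
 qed
 then show ?thesis unfolding line_structure_def by blast
 qed
 then show ?thesis by (rule that(1))
next
 case True
 then obtain x y where xy: "x : S" "y : S" "cross3 x y ~= 0" by blast
 let ?c = "cross3 x y"
 define e where "e = (1 / norm ?c) *\<^sub>R ?c"
 have ee: "e \<bullet> e = 1" using xy(3) by (simp add: e_def dot_square_norm power2_eq_square)
 have ec: "det3 e x y ~= 0" using xy(3) by (simp add: det3_def e_def dot_square_norm)
 show ?thesis
 proof (cases "ALL n:S. e \<bullet> n = 0")
 case True
 show ?thesis
 proof (rule that(2)[OF ee])
 show "e \<bullet> n = 0" if "n : S" for n using True that by simp
 show "EX x:S. EX y:S. det3 e x y ~= 0" using ec xy(1,2) by blast
 qed
 next
 case False
 then obtain z where z: "z : S" "e \<bullet> z ~= 0" by blast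
 then have cz: "?c \<bullet> z ~= 0" by (auto simp: e_def)
 have "span S = UNIV"
 proof (rule ccontr)
 assume "span S ~= UNIV"
 then obtain a where a: "a ~= 0" "ALL x:span S. a \<bullet> x = 0" using span_not_UNIV_orthogonal by blast
 have s: "a \<bullet> x = 0" "a \<bullet> y = 0" "a \<bullet> z = 0" using a(2) xy z span_base by blast+
 have "cross3 a ?c = 0" using Lagrange[of a x y] s by simp
 then have "(a \<bullet> ?c) *\<^sub>R a = (a \<bullet> a) *\<^sub>R ?c" using Lagrange[of a a ?c] by simp
 then have "(a \<bullet> ?c) * (a \<bullet> z) = (a \<bullet> a) * (?c \<bullet> z)" by (metis inner_scaleR_left)
 then show False using s(3) cz a(1) by simp
 qed
 moreover have "~ line_structure S"
 proof
 assume "line_structure S"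
 then obtain w where w: "ALL n:S. \<exists>c. n = c *\<^sub>R w" unfolding line_structure_def ..
 obtain a where "x = a *\<^sub>R w" using bspec[OF w xy(1)] ..
 moreover obtain b where "y = b *\<^sub>R w" using bspec[OF w xy(2)] ..
 ultimately show False using xy(3) by (simp add: cross_mult_left cross_mult_right)
 qed
 ultimately show ?thesis by (rule that(3))
 qed
qed

lemma helical_quiet: "helical_structure S V ==> nl S V n = 0"
proof -
 assume "helical_structure S V"
 then obtain mu where h: "!!k. k : S ==> helical mu k (V k)" unfolding helical_structure_def by blast
 show "nl S V n = 0"
 unfolding nl_def
 proof (intro sum.neutral ballI)
 fix m assume m: "m : {m : S. n - m : S}"
 show "inter V m (n - m) = 0" by (rule inter_helical) (use m h in auto)
 qed
qed

lemma (in modes) spatial_structure: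
 assumes sp: "span S = UNIV"
 shows "helical_structure S U"
proof (rule spatial_helical[OF sp])
 fix mu r assume a: "r > 0" "mu : {r, - r}" "!!n. n : S ==> norm n = r & helical (of_real mu) n (U n)"
 show "helical_structure S U"
 unfolding helical_structure_def by (intro exI[of _ mu] exI[of _ r] conjI ballI a(1,2)) (use a(3) in auto)
qed

lemma line_quiet:
 assumes "line_structure S" "0 ~: S" "!!n. n : S ==> cdot (cvec n) (V n) = 0"
 shows "nl S V n = 0"
 unfolding nl_def
proof (intro sum.neutral ballI)
 fix m assume "m : {m : S. n - m : S}"
 \<comment> \<open>An amplitude is orthogonal to its own frequency, hence to the whole line.\<close>
 moreover have "cdot (V a) (cvec b) = 0" if "a : S" "b : S" for a b
 proof -
 obtain x where x: "ALL n:S. \<exists>c. n = c *\<^sub>R x" using assms(1) unfolding line_structure_def ..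
 have "\<exists>c. a = c *\<^sub>R x" "\<exists>d. b = d *\<^sub>R x" by (rule bspec[OF x]; fact that)+
 then obtain c d where a: "a = c *\<^sub>R x" and b: "b = d *\<^sub>R x" by (elim exE) (rule that)
 have "c ~= 0" using a that(1) assms(2) by auto
 moreover have "of_real c * cdot (V a) (cvec x) = 0"
 proof -
 have "cdot (V a) (cvec a) = 0" using assms(3)[OF that(1)] by (simp only: cdot_commute)
 moreover have "cvec a = of_real c *s cvec x" by (simp add: a)
 ultimately show ?thesis by (simp only: cdot_simps)
 qed
 ultimately show ?thesis unfolding b by (simp add: cdot_simps)
 qed
 ultimately have z: "cdot (V m) (cvec (n - m)) = 0" "cdot (V (n - m)) (cvec m) = 0" by blast+
 show "inter V m (n - m) = 0" unfolding inter_def bilin_def z by simp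
qed

context plane
begin

lemma nl_eq_0:
 assumes fin: "finite S" and V: "plane_field V" and S: "!!n. n : S ==> e \<bullet> n = 0" and off: "!!n. n ~: S ==> V n = 0"
 and 1: "ad S (al V) (be V) n = 0" and 2: "quad S V n = 0"
 shows "nl S V n = 0"
proof (cases "n = 0")
 case True
 show ?thesis unfolding nl_def
 proof (intro sum.neutral ballI)
 fix m assume "m : {m : S. n - m : S}"
 then show "inter V m (n - m) = 0" using True S by (intro inter_eq_0_plane[OF V]) auto
 qed
next
 case n: False
 show ?thesis
 proof (cases "e \<bullet> n = 0")
 case True
 have "cdot (cvec n) (nl S V n) = 0"
 unfolding nl_def cdot_sum by (intro sum.neutral ballI) (use proj_perp_range[OF n] in \<open>simp add: inter_def\<close>)
 then have d: "nl S V n = (cdot (nl S V n) (cvec (cross3 e n)) / of_real (n \<bullet> n)) *s cvec (cross3 e n)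
 + cdot (nl S V n) (cvec e) *s cvec e" by (rule plane_decomp[OF True n])
 have c1: "cdot (nl S V n) (cvec e) = 2 * ad S (al V) (be V) n" by (rule nl_components(1)[OF fin V S off])
 have c2: "cdot (nl S V n) (cvec (cross3 e n)) = quad S V n" by (rule nl_components(2)[OF fin V S off])
 show ?thesis by (rule trans[OF d]) (simp add: c1 c2 1 2)
 next
 case False
 have "{m : S. n - m : S} = {}"
 proof -
 have "e \<bullet> n = 0" if "m : S" "n - m : S" for m using S[OF that(1)] S[OF that(2)] by (simp add: inner_diff_right)
 then show ?thesis using False by blast
 qed
 then show ?thesis unfolding nl_def by (simp only: sum.empty)
 qed
qed

lemma transverse_quiet:
 assumes V: "plane_field V" and S: "!!n. n : S ==> e \<bullet> n = 0" and z: "!!n. n : S ==> al V n = 0"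
 shows "nl S V n = 0"
 unfolding nl_def by (intro sum.neutral ballI inter_eq_0_plane[OF V]) (use S z in auto)

text \<open>The constant ratio cancels the transverse interaction, the common length the in-plane
  one.\<close>

lemma proportional_quiet:
 assumes V: "plane_field V" and S: "!!n. n : S ==> e \<bullet> n = 0" and k: "!!n. n : S ==> be V n = kap * al V n"
 and r: "!!n. n : S ==> al V n ~= 0 ==> norm n = r"
 shows "nl S V n = 0"
 unfolding nl_def
proof (intro sum.neutral ballI)
 fix m assume m: "m : {m : S. n - m : S}"
 show "inter V m (n - m) = 0"
 proof (rule inter_eq_0_plane[OF V])
 show "of_real (dd m (n - m)) * (al V m * be V (n - m) - al V (n - m) * be V m) = 0" using m k by simp
 show "of_real (dd m (n - m) * ((n - m) \<bullet> (n - m) - m \<bullet> m)) * (al V m * al V (n - m)) = 0"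
 using m r[of m] r[of "n - m"] by (cases "al V m = 0"; cases "al V (n - m) = 0") (auto simp: dot_square_norm)
 qed (use m S in auto)
qed

lemma ad_linear: "ad A ps (%n. \<Sum>k<N. q k * F k n) n = (\<Sum>k<N. q k * ad A ps (F k) n)"
 unfolding ad_def sum_distrib_left by (subst sum.swap) (simp add: mult_ac)

lemma profile_quiet:
 assumes fin: "finite S" and V: "plane_field V" and S: "!!n. n : S ==> e \<bullet> n = 0" and off: "!!n. n ~: S ==> V n = 0"
 and pr: "polynomial_profile S nu V lam"
 shows "nl S V n = 0"
proof (rule nl_eq_0[OF fin V S off])
 let ?om = "%l. \<i> * of_real lam * al V l"
 have lam: "lam > 0" and nlam: "!!n. n : S ==> al V n ~= 0 ==> norm n = lam" using pr by (auto simp: polynomial_profile_def)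
 obtain N q where q: "!!n. be V n = (\<Sum>k<N. q k * pw S ?om k n)" using pr by (auto simp: polynomial_profile_def)
 have "be V = (%n. \<Sum>k<N. q k * pw S ?om k n)" using q by (simp add: fun_eq_iff)
 then have "ad S ?om (be V) n = 0" by (simp add: ad_linear ad_pw)
 then show "ad S (al V) (be V) n = 0" unfolding ad_smult using lam by simp
 show "quad S V n = 0"
 unfolding quad_def
 proof (intro sum.neutral ballI)
 fix m assume m: "m : {m : S. n - m : S}"
 show "of_real (dd m (n - m) * ((n - m) \<bullet> (n - m) - m \<bullet> m)) * (al V m * al V (n - m)) = 0"
 using m nlam[of m] nlam[of "n - m"] by (cases "al V m = 0"; cases "al V (n - m) = 0") (auto simp: dot_square_norm)
 qed
qed

text \<open>Cross product with \<open>n\<close> takes \<open>cross3 e n\<close> to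
  \<open>n \<bullet> n\<close> times \<open>e\<close>, and \<open>e\<close> to minus
  \<open>cross3 e n\<close>, so the eigenvalue equation becomes a relation between the two
  components.\<close>

lemma helical_plane:
 assumes V: "plane_field V" and n: "e \<bullet> n = 0" and b: "be V n = \<i> * mu * al V n" and mu: "mu\<^sup>2 = of_real (n \<bullet> n)"
 shows "helical mu n (V n)"
proof (rule helicalI)
 have d: "V n = al V n *s cvec (cross3 e n) + be V n *s cvec e" by (rule plane_field_decomp[OF V])
 have c1: "cross3 n (cross3 e n) = (n \<bullet> n) *\<^sub>R e" using n by (simp add: Lagrange inner_commute)
 have c2: "cross3 n e = - cross3 e n" by (rule cross_skew)
 have "ccross (cvec n) (al V n *s cvec (cross3 e n) + be V n *s cvec e)
 = (al V n * of_real (n \<bullet> n)) *s cvec e + (- be V n) *s cvec (cross3 e n)"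
 unfolding ccross_add ccross_smult ccross_cvec c1 c2 by (simp add: vec_eq_iff)
 also have "\<dots> = (- \<i> * mu) *s (al V n *s cvec (cross3 e n) + be V n *s cvec e)"
 unfolding mu[symmetric] b by (simp add: vec_eq_iff algebra_simps power2_eq_square)
 finally show "ccross (cvec n) (V n) = (- \<i> * mu) *s V n" unfolding d[symmetric] .
qed

end

text \<open>The integrating factor \<open>exp (a * s)\<close> removes the damping; what remains is a
  rotation about \<open>n\<close>, which preserves the length.\<close>

lemma rotation_decay:
 fixes x :: "real => complex^3"
 assumes J: "convex J" and d: "!!t. t : J ==> (x has_vector_derivative (- a) *\<^sub>R x t - b *\<^sub>R ccross (cvec n) (x t)) (at t)"
 and t: "t : J" "t' : J" and z: "x t = 0"
 shows "x t' = 0"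
proof -
 define y where "y s = exp (a * s) *\<^sub>R x s" for s
 have yd: "(y has_vector_derivative (- b) *\<^sub>R ccross (cvec n) (y s)) (at s)" if s: "s : J" for s
 proof -
 have "((%s. exp (a * s)) has_real_derivative a * exp (a * s)) (at s)" by (auto intro!: derivative_eq_intros)
 then have "(y has_vector_derivative exp (a * s) *\<^sub>R ((- a) *\<^sub>R x s - b *\<^sub>R ccross (cvec n) (x s)) + (a * exp (a * s)) *\<^sub>R x s) (at s)"
 unfolding y_def by (rule has_vector_derivative_scaleR) (rule d[OF s])
 moreover have "exp (a * s) *\<^sub>R ((- a) *\<^sub>R x s - b *\<^sub>R ccross (cvec n) (x s)) + (a * exp (a * s)) *\<^sub>R x s
 = (- b) *\<^sub>R ccross (cvec n) (y s)"
 unfolding y_def scaleR_smult ccross_smult by (simp add: vec_eq_iff algebra_simps)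
 ultimately show ?thesis by simp
 qed
 have orth: "v \<bullet> ccross (cvec n) v = 0" for v :: "complex^3"
 by (simp add: inner_vec_def sum_3 ccross_def cvec_def inner_complex_def algebra_simps)
 have "((%s. y s \<bullet> y s) has_vector_derivative 0) (at s within J)" if s: "s : J" for s
 proof -
 have "((%s. y s \<bullet> y s) has_vector_derivative y s \<bullet> ((- b) *\<^sub>R ccross (cvec n) (y s)) + ((- b) *\<^sub>R ccross (cvec n) (y s)) \<bullet> y s) (at s)"
 by (rule bounded_bilinear.has_vector_derivative[OF bounded_bilinear_inner yd[OF s] yd[OF s]])
 then have "((%s. y s \<bullet> y s) has_vector_derivative 0) (at s)"
 by (simp add: inner_commute[of "ccross (cvec n) (y s)"] orth)
 then show ?thesis by (rule has_vector_derivative_at_within)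
 qed
 then obtain c where c: "!!s. s : J ==> y s \<bullet> y s = c"
 using has_vector_derivative_zero_constant[OF J] by blast
 have "y t' \<bullet> y t' = y t \<bullet> y t" using c t by simp
 then show ?thesis using z by (simp add: y_def)
qed

lemma exponential_decay:
 fixes x :: "real => complex^3"
 assumes J: "convex J" and d: "!!t. t : J ==> (x has_vector_derivative (- a) *\<^sub>R x t) (at t)" and t: "t : J" "t' : J"
 shows "x t' = of_real (exp (a * (t - t'))) *s x t"
proof -
 define y where "y s = exp (a * s) *\<^sub>R x s" for s
 have "(y has_vector_derivative 0) (at s within J)" if s: "s : J" for s
 proof -
 have "((%s. exp (a * s)) has_real_derivative a * exp (a * s)) (at s)" by (auto intro!: derivative_eq_intros)
 then have "(y has_vector_derivative exp (a * s) *\<^sub>R ((- a) *\<^sub>R x s) + (a * exp (a * s)) *\<^sub>R x s) (at s)"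
 unfolding y_def by (rule has_vector_derivative_scaleR) (rule d[OF s])
 then have "(y has_vector_derivative 0) (at s)" by (simp add: mult.commute)
 then show ?thesis by (rule has_vector_derivative_at_within)
 qed
 then obtain c where c: "!!s. s : J ==> y s = c"
 using has_vector_derivative_zero_constant[OF J] by blast
 have "exp (a * t') *\<^sub>R x t' = exp (a * t) *\<^sub>R x t" using c[OF t(1)] c[OF t(2)] by (simp add: y_def)
 then have "exp (- (a * t')) *\<^sub>R exp (a * t') *\<^sub>R x t' = exp (- (a * t')) *\<^sub>R exp (a * t) *\<^sub>R x t" by simp
 then have "x t' = exp (- (a * t') + a * t) *\<^sub>R x t" by (simp add: exp_add[symmetric])
 then show ?thesis unfolding scaleR_smult by (simp add: right_diff_distrib)
qed

lemma linear_rhs: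
 "- (nu * (norm n)\<^sup>2) *\<^sub>R u - Om *\<^sub>R (Jmat n *v u) =
 (- (nu * (norm n)\<^sup>2)) *\<^sub>R u - (Om * (n$3 / (norm n)\<^sup>2)) *\<^sub>R ccross (cvec n) u"
 unfolding Jmat_cross scaleR_smult by (simp add: vec_eq_iff)

section \<open>Structures under the linear evolution\<close>

locale linear_flow =
 fixes S :: "(real^3) set" and J :: "real set" and nu Om :: real and U :: "real => real^3 => complex^3"
 assumes fin: "finite S" and zero: "0 ~: S" and sym: "!!n. n : S ==> - n : S" and openJ: "open J" and convexJ: "convex J"
 and off: "!!t n. t : J ==> n ~: S ==> U t n = 0"
 and perp: "!!t n. t : J ==> cdot (cvec n) (U t n) = 0"
 and conj: "!!t n. t : J ==> U t (- n) = cnjv (U t n)"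
 and lin: "!!t n. t : J ==> n : S ==> ((%s. U s n) has_vector_derivative
 - (nu * (norm n)\<^sup>2) *\<^sub>R U t n - Om *\<^sub>R (Jmat n *v U t n)) (at t)"
begin

lemma vanish: "n : S ==> t : J ==> t' : J ==> U t n = 0 ==> U t' n = 0"
proof -
 assume n: "n : S" and t: "t : J" "t' : J" and z: "U t n = 0"
 show "U t' n = 0" by (rule rotation_decay[OF convexJ lin[unfolded linear_rhs, OF _ n] t z])
qed

lemma helical_preserved:
 assumes n: "n : S" and t: "t : J" "t' : J" and h: "helical mu n (U t n)"
 shows "helical mu n (U t' n)"
proof -
 \<comment> \<open>\<open>L\<close> measures the failure of the eigenvalue equation. It commutes
   with the cross product by \<open>n\<close>, so \<open>L (U s n)\<close> satisfies the same linear
   equation and stays zero.\<close>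
 define L :: "complex^3 => complex^3" where "L v = ccross (cvec n) v - (- \<i> * mu) *s v" for v
 have "linear L"
 by (rule linearI) (simp_all add: L_def scaleR_smult ccross_add ccross_smult vec_eq_iff algebra_simps)
 then have bl: "bounded_linear L" by (simp add: linear_conv_bounded_linear)
 have Lc: "L (ccross (cvec n) v) = ccross (cvec n) (L v)" for v
 unfolding L_def ccross_diff ccross_smult by (rule refl)
 have "L (U t' n) = 0"
 proof (rule rotation_decay[OF convexJ _ t])
 show "((%s. L (U s n)) has_vector_derivative (- (nu * (norm n)\<^sup>2)) *\<^sub>R L (U s n)
 - (Om * (n$3 / (norm n)\<^sup>2)) *\<^sub>R ccross (cvec n) (L (U s n))) (at s)" if "s : J" for s
 using bounded_linear.has_vector_derivative[OF bl lin[OF that n, unfolded linear_rhs]]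
 by (simp only: linear_diff[OF \<open>linear L\<close>] linear_scale[OF \<open>linear L\<close>] Lc)
 show "L (U t n) = 0" using helicalD[OF h] by (simp add: L_def)
 qed
 then have "ccross (cvec n) (U t' n) - (- \<i> * mu) *s U t' n = 0" by (simp only: L_def)
 then show ?thesis by (intro helicalI) (simp only: right_minus_eq)
qed

lemma level_decay:
 assumes n: "n : S" "Om * n$3 = 0" and t: "t : J" "t' : J"
 shows "U t' n = of_real (exp (nu * (norm n)\<^sup>2 * (t - t'))) *s U t n"
proof (rule exponential_decay[OF convexJ _ t])
 have "Om * (n$3 / (norm n)\<^sup>2) = 0" using n(2) by auto
 then show "((%s. U s n) has_vector_derivative (- (nu * (norm n)\<^sup>2)) *\<^sub>R U s n) (at s)" if "s : J" for s
 using lin[OF that n(1), unfolded linear_rhs] by (simp only: scaleR_zero_left diff_0_right)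
qed

text \<open>Curl eigenvectors are preserved. In the planar case both components of a mode are
  multiplied by the same factor: for \<open>nu = 0\<close> the modes are constant, otherwise the
  profile is linear and its ratio is kept.\<close>

theorem structure_quiet:
 assumes t: "t : J" "t' : J" and st: "mode_structure nu Om S (U t)"
 shows "nl S (U t') n = 0"
proof -
 consider "line_structure S" | "planar_structure nu Om S (U t)" | "helical_structure S (U t)"
 using st unfolding mode_structure_def by blast
 then show ?thesis
 proof cases
 case 1
 then show ?thesis by (rule line_quiet) (use zero perp[OF t(2)] in auto)
 next
 case 3
 then obtain mu r where r: "r > 0" "mu : {r, - r}" "ALL n:S. norm n = r & helical (of_real mu) n (U t n)"
 unfolding helical_structure_def by blast
 have "norm n = r & helical (of_real mu) n (U t' n)" if "n : S" for n
 using bspec[OF r(3) that] helical_preserved[OF that t, of "of_real mu"] by simp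
 then have "helical_structure S (U t')" unfolding helical_structure_def using r(1,2) by blast
 then show ?thesis by (rule helical_quiet)
 next
 case 2
 then obtain e where e1: "e \<bullet> e = 1" and eS: "!!n. n : S ==> e \<bullet> n = 0 & Om * n$3 = 0"
 and alt: "(ALL n:S. plane.al e (U t) n = 0) | (\<exists>lam. plane.polynomial_profile e S nu (U t) lam)"
 unfolding planar_structure_def by blast
 interpret plane e by unfold_locales (rule e1)
 have pS: "e \<bullet> n = 0" if "n : S" for n using eS[OF that] by blast
 have V: "plane_field (U s)" if "s : J" for s
 unfolding plane_field_def
 proof (intro allI impI)
 fix n assume "U s n ~= 0"
 then have "n : S" using off[OF that, of n] by (cases "n : S") simp_all
 then show "n ~= 0 & e \<bullet> n = 0 & cdot (cvec n) (U s n) = 0" using perp[OF that, of n] pS[of n] zero by auto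
 qed
 define f where "f n = complex_of_real (exp (nu * (norm n)\<^sup>2 * (t - t')))" for n :: "real^3"
 have dec: "al (U t') n = f n * al (U t) n" "be (U t') n = f n * be (U t) n" if "n : S" for n
 unfolding al_def be_def level_decay[OF that _ t, OF conjunct2[OF eS[OF that]]] f_def by (simp_all add: cdot_simps)
 show ?thesis
 proof (cases "ALL n:S. al (U t) n = 0")
 case True
 then show ?thesis by (intro transverse_quiet[OF V[OF t(2)] pS]) (use dec in auto)
 next
 case False
 then obtain lam where pr: "polynomial_profile S nu (U t) lam" using alt by blast
 show ?thesis
 proof (cases "nu = 0")
 case True
 have "U t' n = U t n" for n
 using level_decay[OF _ _ t, of n] eS[of n] off[OF t(1), of n] off[OF t(2), of n] True by (cases "n : S") simp_all
 then have "U t' = U t" by (simp add: fun_eq_iff)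
 then show ?thesis using profile_quiet[OF fin V[OF t(1)] pS off[OF t(1)] pr] by simp
 next
 case nu: False
 obtain c :: real where c: "!!n. be (U t) n = of_real c * (\<i> * of_real lam * al (U t) n)"
 using pr nu unfolding polynomial_profile_def by blast
 show ?thesis
 proof (rule proportional_quiet[OF V[OF t(2)] pS, where kap = "of_real c * (\<i> * of_real lam)" and r = lam])
 show "be (U t') n = of_real c * (\<i> * of_real lam) * al (U t') n" if "n : S" for n
 unfolding dec[OF that] c by (simp only: mult_ac)
 show "norm n = lam" if "n : S" "al (U t') n ~= 0" for n
 using that pr dec(1)[OF that(1)] unfolding polynomial_profile_def by auto
 qed
 qed
 qed
 qed
qed

end

section \<open>Solutions without active nonlinearity\<close>

context flow
begin

lemma U0: "t : J ==> U t 0 = 0"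
 using off zero by blast

lemma cont:
 assumes t: "t : J"
 shows "isCont (%s. U s n) t"
proof (cases "n = 0")
 case False
 show ?thesis by (rule has_vector_derivative_continuous[OF ode[OF t False]])
next
 case True
 have "((%s. U s 0) has_vector_derivative 0) (at t)"
 by (rule has_vector_derivative_transform_within_open[OF has_vector_derivative_const openJ t]) (simp add: U0)
 then show ?thesis unfolding True by (rule has_vector_derivative_continuous)
qed

lemma subflow:
 assumes J': "J' \<subseteq> J" "open J'" and S': "S' \<subseteq> S" "!!n. n : S' ==> - n : S'"
 and U: "!!t n. t : J' ==> n : S - S' ==> U t n = 0"
 shows "flow S' J' nu Om U"
proof
 show "finite S'" using fin S'(1) by (rule rev_finite_subset)
 show "0 ~: S'" using zero S'(1) by blast
 fix t n assume t: "t : J'"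
 then have tJ: "t : J" using J' by blast
 show "U t n = 0" if "n ~: S'" using U[OF t, of n] off[OF tJ, of n] that by blast
 show "cdot (cvec n) (U t n) = 0" by (rule perp[OF tJ])
 show "U t (- n) = cnjv (U t n)" by (rule conj[OF tJ])
 have e: "nl S' (U t) n = nl S (U t) n" by (rule nl_mono[OF fin S'(1)]) (use U[OF t] in blast)
 show "((%s. U s n) has_vector_derivative - (nu * (norm n)\<^sup>2) *\<^sub>R U t n - Om *\<^sub>R (Jmat n *v U t n)
 - (\<i> / 2) *s nl S' (U t) n) (at t)" if "n ~= 0"
 unfolding e by (rule ode[OF tJ that])
qed (use J' S' in auto)

end

locale full_flow = flow +
 assumes full: "!!t n. t : J ==> n : S ==> U t n ~= 0" and Jne: "J ~= {}"
begin

lemma modes: "t : J ==> modes S (U t)"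
 unfolding modes_def using fin zero sym full perp conj steady by blast

end

locale full_planar = full_flow + plane +
 assumes planeS: "!!n. n : S ==> e \<bullet> n = 0" and spanS: "EX x:S. EX y:S. dd x y ~= 0"
begin

sublocale planar_flow S J nu Om U e
 by unfold_locales (rule planeS)

lemma planar_modes:
 assumes t: "t : J"
 shows "planar_modes S (U t) e"
proof -
 interpret M: modes S "U t" by (rule modes[OF t])
 show ?thesis
 proof
 show "U t n = 0" if "n ~: S" for n by (rule off[OF t that])
 qed (use planeS spanS in auto)
qed

lemma parts: "t : J ==> n : S ==> al (U t) n = 0 ==> be (U t) n ~= 0"
 using planar_modes.parts_nonzero[OF planar_modes] by blast

lemma al_cont: "t : J ==> isCont (%s. al (U s) n) t" and be_cont: "t : J ==> isCont (%s. be (U s) n) t"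
 using has_vector_derivative_continuous[OF al_deriv] has_vector_derivative_continuous[OF be_deriv] by blast+

text \<open>Otherwise \<open>al\<close> would vanish throughout at an exposed mode \<open>p\<close>
  of largest third component, and in its equation the Coriolis term could only be balanced by
  in-plane interactions summing to \<open>p\<close>.\<close>

lemma tilted_exposed:
 assumes n0: "n0 : S" "Om * n0$3 ~= 0"
 shows "EX t:J. \<exists>l x. x : S & (ALL q:S. q ~= x --> l \<bullet> q < l \<bullet> x) & al (U t) x ~= 0"
proof (rule ccontr)
 assume no: "~ ?thesis"
 obtain t where t: "t : J" using Jne by blast
 interpret M: planar_modes S "U t" e by (rule planar_modes[OF t])
 obtain c where c: "inj_on (%x. c \<bullet> x) S" by (rule injective_functional[OF fin])
 have Sne: "S ~= {}" using n0 by blast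
 obtain p where p: "p : S" "!!y. y : S ==> y$3 <= p$3" "!!y. y : S ==> y$3 = p$3 ==> c \<bullet> y <= c \<bullet> p"
 by (rule finite_argmax_lex[OF fin Sne, of "%y. y$3" "%y. c \<bullet> y"]) (rule that; blast)
 have p3: "p$3 ~= 0" using p(2)[OF n0(1)] p(2)[OF sym[OF n0(1)]] n0(2) by auto
 have "eventually (%eps. ALL y:S - {p}. y$3 + eps * (c \<bullet> y) < p$3 + eps * (c \<bullet> p)) (at_right 0)"
 proof (rule finite_perturb)
 fix y assume y: "y : S - {p}"
 then have "c \<bullet> y ~= c \<bullet> p" using inj_onD[OF c, of y p] p(1) by blast
 moreover have "y$3 <= p$3" "y$3 = p$3 ==> c \<bullet> y <= c \<bullet> p" using p(2,3) y by blast+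
 ultimately show "y$3 < p$3 | y$3 = p$3 & c \<bullet> y < c \<bullet> p" unfolding less_le by blast
 qed (use fin in simp)
 then obtain eps where eps: "eps > 0" "ALL y:S - {p}. y$3 + eps * (c \<bullet> y) < p$3 + eps * (c \<bullet> p)"
 by (rule obtain_at_right)
 define l where "l = (axis 3 1 :: real^3) + eps *\<^sub>R c"
 have l: "l \<bullet> y = y$3 + eps * (c \<bullet> y)" for y by (simp add: l_def inner_add_left inner_axis')
 have ex: "M.expo l p" unfolding M.expo_def l using eps(2) p(1) by blast
 have outer: "al (U s) x = 0" if "s : J" "M.expo l x" for s l x
 proof (rule ccontr)
 assume "al (U s) x ~= 0"
 then have "\<exists>l x. x : S & (ALL q:S. q ~= x --> l \<bullet> q < l \<bullet> x) & al (U s) x ~= 0"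
 using that(2) unfolding M.expo_def by (intro exI[of _ l] exI[of _ x]) simp
 then show False using no that(1) by blast
 qed
 have "- of_real (nu * (p \<bullet> p)) * al (U t) p + of_real (Om * p$3 / (p \<bullet> p)) * be (U t) p - \<i> / 2 * quad S (U t) p / of_real (p \<bullet> p) = 0"
 by (rule has_vector_derivative_vanishing[OF openJ t _ al_deriv[OF t]]) (rule outer[OF _ ex])
 moreover have "al (U t) p = 0" by (rule outer[OF t ex])
 moreover have "of_real (Om * p$3 / (p \<bullet> p)) * be (U t) p ~= 0"
 using parts[OF t p(1) outer[OF t ex]] p3 n0(2) by auto
 ultimately have q: "quad S (U t) p ~= 0" by auto
 show False by (rule M.transverse_hull_contradiction[OF ex _ q]) (rule outer[OF t])
qed

text \<open>The exposed mode keeps a nonzero in-plane component for a short time; at each of these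
  times all modes share one ratio, which may still vary with time.\<close>

lemma tilted_ratio:
 assumes n0: "n0 : S" "Om * n0$3 ~= 0"
 shows "\<exists>J' r. J' \<subseteq> J & open J' & J' ~= {} &
 (ALL t:J'. \<exists>kap. ALL n:S. norm n = r & al (U t) n ~= 0 & be (U t) n = kap * al (U t) n)"
proof -
 obtain t l x where t: "t : J" and x: "x : S" "ALL q:S. q ~= x --> l \<bullet> q < l \<bullet> x" and nz: "al (U t) x ~= 0"
 using tilted_exposed[OF n0] by blast
 obtain T where T: "open T" "t : T" "!!s. s : T ==> al (U s) x ~= 0"
 using isCont_eventually_nonzero[OF al_cont[OF t] nz] unfolding eventually_nhds by blast
 have "\<exists>kap. ALL n:S. norm n = norm x & al (U s) n ~= 0 & be (U s) n = kap * al (U s) n" if s: "s : J \<inter> T" for s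
 proof -
 interpret M: planar_modes S "U s" e by (rule planar_modes) (use s in blast)
 have "M.expo l x" unfolding M.expo_def using x by blast
 moreover have "al (U s) x ~= 0" using T(3) s by blast
 ultimately show ?thesis
 proof (rule M.common_ratio)
 fix kap assume "!!n. n : S ==> norm n = norm x & al (U s) n ~= 0 & be (U s) n = kap * al (U s) n"
 then show ?thesis by (intro exI[of _ kap] ballI)
 qed
 qed
 then show ?thesis using t T(1,2) openJ by (intro exI[of _ "J \<inter> T"] exI[of _ "norm x"]) auto
qed

lemma level_profile:
 assumes Om: "!!n. n : S ==> Om * n$3 = 0"
 and A: "!!t n. t : J ==> al (U t) n ~= 0 \<longleftrightarrow> n : A" and B: "!!t n. t : J ==> be (U t) n ~= 0 \<longleftrightarrow> n : B"
 and t: "t : J"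
 shows "planar_structure nu Om S (U t) & (\<forall>n. nl S (U t) n = 0)"
proof (cases "A = {}")
 case True
 then have z: "al (U t) n = 0" for n using A[OF t] by blast
 have "nl S (U t) n = 0" for n by (rule transverse_quiet[OF plane_field_U[OF t] planeS z])
 moreover have "planar_structure nu Om S (U t)"
 unfolding planar_structure_def dd_def[symmetric]
 using e1 planeS Om spanS z by (intro exI[of _ e]) (simp add: dd_def[symmetric])
 ultimately show ?thesis by blast
next
 case False
 obtain x y where xy: "x : S" "y : S" "dd x y ~= 0" using spanS by blast
 have "n : A \<union> B" if "n : S" for n
 using parts[OF t that] unfolding A[OF t, of n, symmetric] B[OF t, of n, symmetric] Un_iff by blast
 then have sp: "EX x:A \<union> B. EX y:A \<union> B. dd x y ~= 0" using xy by blast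
 obtain lam where spA: "EX x:A. EX y:A. dd x y ~= 0" and pr: "polynomial_profile S nu (U t) lam"
 proof (rule planar_profile[OF Jne _ _ _ sp False])
 show "Om * n$3 = 0" if "n : S" for n by (rule Om[OF that])
 show "al (U t) n ~= 0 \<longleftrightarrow> n : A" if "t : J" for t n by (rule A[OF that])
 show "be (U t) n ~= 0 \<longleftrightarrow> n : B" if "t : J" for t n by (rule B[OF that])
 fix lam assume "EX x:A. EX y:A. dd x y ~= 0" "!!t. t : J ==> polynomial_profile S nu (U t) lam"
 then show thesis using that t by blast
 qed
 have AS: "n : S" if "n : A" for n using A[OF t, of n] off[OF t, of n] that by (cases "n : S") simp_all
 have "nl S (U t) n = 0" for n by (rule profile_quiet[OF fin plane_field_U[OF t] planeS off[OF t] pr])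
 moreover have spS: "EX x:S. EX y:S. al (U t) x ~= 0 & al (U t) y ~= 0 & dd x y ~= 0"
 proof -
 obtain x y where "x : A" "y : A" "dd x y ~= 0" using spA by blast
 then show ?thesis unfolding A[OF t] using AS by blast
 qed
 have "planar_structure nu Om S (U t)"
 unfolding planar_structure_def
 proof (intro exI[of _ e] conjI)
 show "ALL n:S. e \<bullet> n = 0 & Om * n$3 = 0" using planeS Om by blast
 show "EX x:S. EX y:S. det3 e x y ~= 0" using spanS unfolding dd_def .
 show "(ALL n:S. al (U t) n = 0) | (\<exists>lam. polynomial_profile S nu (U t) lam &
 (EX x:S. EX y:S. al (U t) x ~= 0 & al (U t) y ~= 0 & det3 e x y ~= 0))"
 using pr spS unfolding dd_def by (intro disjI2 exI[of _ lam] conjI)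
 qed (rule e1)
 ultimately show ?thesis by blast
qed

lemma full_planar_subflow:
 assumes "J' \<subseteq> J" "open J'" "J' ~= {}"
 shows "full_planar S J' nu Om U e"
proof -
 have *: "flow S J' nu Om U" by (rule subflow[OF assms(1,2)]) (use sym in auto)
 interpret F: flow S J' nu Om U by (rule *)
 show ?thesis
 by unfold_locales (use full planeS spanS assms in auto)
qed

lemma planar_quiet_somewhere: "\<exists>J'. J' \<subseteq> J & open J' & J' ~= {} & (ALL t:J'. \<forall>n. nl S (U t) n = 0)"
proof (cases "EX n:S. Om * n$3 ~= 0")
 case True
 then obtain n0 where n0: "n0 : S" "Om * n0$3 ~= 0" by blast
 obtain J' r where J': "J' \<subseteq> J" "open J'" "J' ~= {}"
 and k: "!!t. t : J' ==> \<exists>kap. ALL n:S. norm n = r & al (U t) n ~= 0 & be (U t) n = kap * al (U t) n"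
 using tilted_ratio[OF n0] by blast
 have "nl S (U t) n = 0" if t: "t : J'" for t n
 proof -
 have tJ: "t : J" using t J' by blast
 obtain kap where kap: "ALL n:S. norm n = r & al (U t) n ~= 0 & be (U t) n = kap * al (U t) n" using k[OF t] by blast
 show ?thesis
 by (rule proportional_quiet[OF plane_field_U[OF tJ] planeS, where kap = kap and r = r]) (use kap in auto)
 qed
 then show ?thesis using J' by blast
next
 case False
 have "\<exists>J' X'. J' \<subseteq> J & open J' & J' ~= {} & X' \<subseteq> S & (ALL t:J'. ALL x:S. al (U t) x ~= 0 \<longleftrightarrow> x : X')"
 by (rule constant_support[OF fin openJ Jne al_cont])
 then obtain J1 A where J1: "J1 \<subseteq> J" "open J1" "J1 ~= {}" and A: "A \<subseteq> S" "ALL t:J1. ALL x:S. al (U t) x ~= 0 \<longleftrightarrow> x : A" by blast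
 have "\<exists>J' X'. J' \<subseteq> J1 & open J' & J' ~= {} & X' \<subseteq> S & (ALL t:J'. ALL x:S. be (U t) x ~= 0 \<longleftrightarrow> x : X')"
 by (rule constant_support[OF fin J1(2,3) be_cont]) (use J1 in blast)
 then obtain J2 B where J2: "J2 \<subseteq> J1" "open J2" "J2 ~= {}" and B: "B \<subseteq> S" "ALL t:J2. ALL x:S. be (U t) x ~= 0 \<longleftrightarrow> x : B" by blast
 have J2J: "J2 \<subseteq> J" using J1 J2 by blast
 interpret F: full_planar S J2 nu Om U e by (rule full_planar_subflow[OF J2J J2(2,3)])
 have A': "al (U t) n ~= 0 \<longleftrightarrow> n : A" if "t : J2" for t n
 using A J2(1) that F.off[OF that, of n] by (cases "n : S") auto
 have B': "be (U t) n ~= 0 \<longleftrightarrow> n : B" if "t : J2" for t n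
 using B that F.off[OF that, of n] by (cases "n : S") auto
 have "planar_structure nu Om S (U t) & (\<forall>n. nl S (U t) n = 0)" if t: "t : J2" for t
 proof (rule F.level_profile)
 show "Om * n$3 = 0" if "n : S" for n using False that by blast
 qed (use A' B' t in blast)+
 then have "ALL t:J2. \<forall>n. nl S (U t) n = 0" by blast
 then show ?thesis using J2J J2(2,3) by blast
qed

text \<open>The modes at \<open>n0\<close> and \<open>- n0\<close> have the same ratio on an
  interval of times, although the Coriolis term acts on them with opposite signs. Differentiating
  the equality of the ratios gives \<open>kap\<^sup>2 = - of_real (r\<^sup>2)\<close>, the
  eigenvalue equation of curl.\<close>

lemma tilted_helical:
 assumes n0: "n0 : S" "Om * n0$3 ~= 0" and quiet: "!!t n. t : J ==> nl S (U t) n = 0"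
 shows "EX t:J. helical_structure S (U t)"
proof -
 obtain J' r where J': "J' \<subseteq> J" "open J'" "J' ~= {}"
 and k: "!!t. t : J' ==> \<exists>kap. ALL n:S. norm n = r & al (U t) n ~= 0 & be (U t) n = kap * al (U t) n"
 using tilted_ratio[OF n0] by blast
 obtain t where t: "t : J'" using J' by blast
 have tJ: "t : J" using t J' by blast
 obtain kap where kap: "!!n. n : S ==> norm n = r & al (U t) n ~= 0 & be (U t) n = kap * al (U t) n" using k[OF t] by blast
 have m: "- n0 : S" by (rule sym[OF n0(1)])
 have r0: "r > 0" using kap[OF n0(1)] zero n0(1) by auto
 have z: "ad S (al (U t)) (be (U t)) n = 0" "quad S (U t) n = 0" for n
 using nl_components[OF fin plane_field_U[OF tJ] planeS off[OF tJ], of n] quiet[OF tJ] by simp_all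
 define X Y c w where "X = al (U t) n0" "Y = al (U t) (- n0)" "c = complex_of_real (nu * r\<^sup>2)" "w = complex_of_real (Om * n0$3)"
 note defs = this
 have nn: "n0 \<bullet> n0 = r\<^sup>2" using kap[OF n0(1)] by (simp add: dot_square_norm)
 have d1: "((%s. be (U s) n0) has_vector_derivative - c * (kap * X) - w * X) (at t)"
 using be_deriv[OF tJ, of n0] kap[OF n0(1)] by (simp add: z nn defs)
 have d2: "((%s. be (U s) (- n0)) has_vector_derivative - c * (kap * Y) + w * Y) (at t)"
 using be_deriv[OF tJ, of "- n0"] kap[OF m] by (simp add: z nn defs)
 have d3: "((%s. al (U s) n0) has_vector_derivative - c * X + w / of_real (r\<^sup>2) * (kap * X)) (at t)"
 using al_deriv[OF tJ, of n0] kap[OF n0(1)] by (simp add: z nn defs)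
 have d4: "((%s. al (U s) (- n0)) has_vector_derivative - c * Y - w / of_real (r\<^sup>2) * (kap * Y)) (at t)"
 using al_deriv[OF tJ, of "- n0"] kap[OF m] by (simp add: z nn defs)
 have bb: "be (U t) n0 = kap * X" "be (U t) (- n0) = kap * Y" using kap[OF n0(1)] kap[OF m] by (simp_all add: defs)
 \<comment> \<open>The equality of the two ratios in cross-multiplied form, as a function that
   vanishes near \<open>t\<close>.\<close>
 have "((%s. be (U s) (- n0) * al (U s) n0 - be (U s) n0 * al (U s) (- n0)) has_vector_derivative
 (be (U t) (- n0) * (- c * X + w / of_real (r\<^sup>2) * (kap * X)) + (- c * (kap * Y) + w * Y) * al (U t) n0)
 - (be (U t) n0 * (- c * Y - w / of_real (r\<^sup>2) * (kap * Y)) + (- c * (kap * X) - w * X) * al (U t) (- n0))) (at t)"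
 by (rule has_vector_derivative_diff[OF has_vector_derivative_mult[OF d2 d3] has_vector_derivative_mult[OF d1 d4]])
 then have "(be (U t) (- n0) * (- c * X + w / of_real (r\<^sup>2) * (kap * X)) + (- c * (kap * Y) + w * Y) * al (U t) n0)
 - (be (U t) n0 * (- c * Y - w / of_real (r\<^sup>2) * (kap * Y)) + (- c * (kap * X) - w * X) * al (U t) (- n0)) = 0"
 proof (rule has_vector_derivative_vanishing[OF J'(2) t, rotated])
 fix s assume "s : J'"
 then obtain kap' where k': "ALL n:S. norm n = r & al (U s) n ~= 0 & be (U s) n = kap' * al (U s) n" using k by blast
 have "be (U s) n0 = kap' * al (U s) n0" "be (U s) (- n0) = kap' * al (U s) (- n0)" using k' n0(1) m by blast+
 then show "be (U s) (- n0) * al (U s) n0 - be (U s) n0 * al (U s) (- n0) = 0" by simp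
 qed
 then have "2 * (w * (X * Y)) * (kap\<^sup>2 / of_real (r\<^sup>2) + 1) = 0"
 unfolding bb defs(1,2)[symmetric] by (simp add: power2_eq_square algebra_simps)
 moreover have "w * (X * Y) ~= 0" using n0(2) kap[OF n0(1)] kap[OF m] by (simp add: defs)
 ultimately have "kap\<^sup>2 / of_real (r\<^sup>2) = - 1" by (simp add: add_eq_0_iff2)
 then have k2: "kap\<^sup>2 = - of_real (r\<^sup>2)" using r0 by (simp add: field_simps)
 define mu where "mu = - \<i> * kap"
 have "mu\<^sup>2 = of_real (r\<^sup>2)" unfolding mu_def power_mult_distrib k2 by simp
 then have "(mu - of_real r) * (mu + of_real r) = 0" by (simp add: power2_eq_square algebra_simps)
 then have "mu = of_real r | mu = of_real (- r)" by (auto simp: add_eq_0_iff2)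
 then obtain mu' where mu': "mu' : {r, - r}" "mu = of_real mu'" by blast
 have "norm n = r & helical (of_real mu') n (U t n)" if n: "n : S" for n
 proof
 show "norm n = r" using kap[OF n] by blast
 then have nr: "n \<bullet> n = r\<^sup>2" by (simp add: dot_square_norm)
 show "helical (of_real mu') n (U t n)"
 unfolding mu'(2)[symmetric]
 proof (rule helical_plane[OF plane_field_U[OF tJ] planeS[OF n]])
 show "be (U t) n = \<i> * mu * al (U t) n" using kap[OF n] by (simp add: mu_def)
 show "mu\<^sup>2 = of_real (n \<bullet> n)" unfolding nr by fact
 qed
 qed
 then have "helical_structure S (U t)" unfolding helical_structure_def using r0 mu'(1) by blast
 then show ?thesis using tJ by blast
qed

end

context full_flow
begin

lemma quiet_somewhere_full: "\<exists>J'. J' \<subseteq> J & open J' & J' ~= {} & (ALL t:J'. \<forall>n. nl S (U t) n = 0)"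
proof (rule dimension_cases[of S])
 assume "line_structure S"
 then have "nl S (U t) n = 0" if "t : J" for t n by (rule line_quiet[OF _ zero]) (rule perp[OF that])
 then show ?thesis using openJ Jne by blast
next
 fix e assume e: "e \<bullet> e = 1" "!!n. n : S ==> e \<bullet> n = 0" "EX x:S. EX y:S. det3 e x y ~= 0"
 interpret P: plane e by unfold_locales (rule e(1))
 interpret full_planar S J nu Om U e
 by unfold_locales (use e in \<open>auto simp: P.dd_def\<close>)
 show ?thesis by (rule planar_quiet_somewhere)
next
 assume sp: "span S = UNIV"
 have "nl S (U t) n = 0" if t: "t : J" for t n
 proof -
 interpret M: modes S "U t" by (rule modes[OF t])
 have "helical_structure S (U t)" by (rule M.spatial_structure[OF sp])
 then show ?thesis by (rule helical_quiet)
 qed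
 then show ?thesis using openJ Jne by blast
qed

end

context flow
begin

lemma quiet_somewhere:
 assumes Jne: "J ~= {}"
 shows "\<exists>J'. J' \<subseteq> J & open J' & J' ~= {} & (ALL t:J'. \<forall>n. nl S (U t) n = 0)"
proof -
 have "\<exists>J' X'. J' \<subseteq> J & open J' & J' ~= {} & X' \<subseteq> S & (ALL t:J'. ALL x:S. U t x ~= 0 \<longleftrightarrow> x : X')"
 by (rule constant_support[OF fin openJ Jne cont])
 then obtain J1 S1 where J1: "J1 \<subseteq> J" "open J1" "J1 ~= {}" and S1: "S1 \<subseteq> S" "ALL t:J1. ALL x:S. U t x ~= 0 \<longleftrightarrow> x : S1" by blast
 obtain t1 where t1: "t1 : J1" "t1 : J" using J1 by blast
 have sym1: "- n : S1" if n: "n : S1" for n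
 proof -
 have nS: "n : S" using S1(1) n by blast
 have "U t1 n ~= 0" using S1(2) t1(1) nS n by blast
 then have "U t1 (- n) ~= 0" unfolding conj[OF t1(2)] by (simp add: cnjv_simps)
 then show ?thesis using S1(2) t1(1) sym[OF nS] by blast
 qed
 have z: "U t n = 0" if "t : J1" "n : S - S1" for t n using S1(2) that by blast
 interpret F: flow S1 J1 nu Om U by (rule subflow[OF J1(1,2) S1(1) sym1 z])
 interpret F: full_flow S1 J1 nu Om U
 by unfold_locales (use S1 J1 in auto)
 obtain J2 where J2: "J2 \<subseteq> J1" "open J2" "J2 ~= {}" "ALL t:J2. \<forall>n. nl S1 (U t) n = 0"
 using F.quiet_somewhere_full by blast
 have "nl S (U t) n = 0" if t: "t : J2" for t n
 proof -
 have "nl S1 (U t) n = nl S (U t) n" by (rule nl_mono[OF fin S1(1)]) (use z t J2(1) in blast)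
 then show ?thesis using J2(4) t by simp
 qed
 moreover have "J2 \<subseteq> J" using J1 J2 by blast
 ultimately show ?thesis using J2(2,3) by blast
qed

theorem quiet:
 assumes t: "t : J"
 shows "nl S (U t) n = 0"
proof (rule ccontr)
 assume nz: "nl S (U t) n ~= 0"
 have "isCont (%s. nl S (U s) n) t"
 unfolding isCont_def by (rule tendsto_nl) (use cont[OF t] in \<open>simp add: isCont_def\<close>)
 from isCont_eventually_nonzero[OF this nz] obtain T where T: "open T" "t : T" "!!s. s : T ==> nl S (U s) n ~= 0"
 unfolding eventually_nhds by blast
 have F: "flow S (J \<inter> T) nu Om U" by (rule subflow) (use openJ T(1) sym in auto)
 have ne: "J \<inter> T ~= {}" using t T(2) by blast
 obtain J' where J': "J' \<subseteq> J \<inter> T" "J' ~= {}" "ALL t:J'. \<forall>n. nl S (U t) n = 0"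
 using flow.quiet_somewhere[OF F ne] by blast
 then obtain s where "s : J'" by blast
 then show False using T(3)[of s] J' by blast
qed

text \<open>Once the evolution is linear, no mode of \<open>S\<close> ever vanishes, so the analysis
  applies at the given \<open>t\<close> with the full support. Only in the tilted case is the
  structure found at some other time and then carried over.\<close>

theorem solution_structure:
 assumes cJ: "convex J" and ex: "!!n. n : S ==> EX t:J. U t n ~= 0" and t: "t : J"
 shows "mode_structure nu Om S (U t)"
proof -
 have lin: "((%s. U s n) has_vector_derivative - (nu * (norm n)\<^sup>2) *\<^sub>R U t n - Om *\<^sub>R (Jmat n *v U t n)) (at t)"
 if "t : J" "n : S" for t n
 proof -
 have "n ~= 0" using that(2) zero by blast
 from ode[OF that(1) this] show ?thesis unfolding quiet[OF that(1)] by simp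
 qed
 interpret L: linear_flow S J nu Om U
 proof
 show "finite S" by (rule fin)
 show "0 ~: S" by (rule zero)
 show "- n : S" if "n : S" for n by (rule sym[OF that])
 show "open J" by (rule openJ)
 show "convex J" by (rule cJ)
 show "U t n = 0" if "t : J" "n ~: S" for t n by (rule off[OF that])
 show "cdot (cvec n) (U t n) = 0" if "t : J" for t n by (rule perp[OF that])
 show "U t (- n) = cnjv (U t n)" if "t : J" for t n by (rule conj[OF that])
 qed (rule lin)
 have full: "U t n ~= 0" if "t : J" "n : S" for t n using ex[OF that(2)] L.vanish[OF that(2,1)] by blast
 interpret F: full_flow S J nu Om U
 by unfold_locales (use full t in auto)
 show ?thesis
 proof (rule dimension_cases[of S])
 assume "line_structure S"
 then show ?thesis by (simp add: mode_structure_def)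
 next
 assume sp: "span S = UNIV"
 interpret M: modes S "U t" by (rule F.modes[OF t])
 have "helical_structure S (U t)" by (rule M.spatial_structure[OF sp])
 then show ?thesis by (simp add: mode_structure_def)
 next
 fix e assume e: "e \<bullet> e = 1" "!!n. n : S ==> e \<bullet> n = 0" "EX x:S. EX y:S. det3 e x y ~= 0"
 interpret P: plane e by unfold_locales (rule e(1))
 interpret Q: full_planar S J nu Om U e
 by unfold_locales (use e in \<open>auto simp: P.dd_def\<close>)
 show ?thesis
 proof (cases "EX n:S. Om * n$3 ~= 0")
 case True
 then obtain n0 where n0: "n0 : S" "Om * n0$3 ~= 0" by blast
 obtain t' where t': "t' : J" "helical_structure S (U t')"
 proof -
 have "EX t:J. helical_structure S (U t)" by (rule Q.tilted_helical[OF n0]) (rule quiet)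
 then show ?thesis using that by blast
 qed
 then obtain mu r where r: "r > 0" "mu : {r, - r}" "ALL n:S. norm n = r & helical (of_real mu) n (U t' n)"
 unfolding helical_structure_def by blast
 have "norm n = r & helical (of_real mu) n (U t n)" if "n : S" for n
 using bspec[OF r(3) that] L.helical_preserved[OF that t'(1) t, of "of_real mu"] by simp
 then have "helical_structure S (U t)" unfolding helical_structure_def using r(1,2) by blast
 then show ?thesis by (simp add: mode_structure_def)
 next
 case False
 \<comment> \<open>Without Coriolis effect the evolution multiplies a mode by a nonzero scalar, so
   the supports of both components are constant in time.\<close>
 have ratio: "\<exists>f. f ~= 0 & P.al (U s) n = f * P.al (U t) n & P.be (U s) n = f * P.be (U t) n" if s: "s : J" for s n
 proof (cases "n : S")
 case True
 then have o: "Om * n$3 = 0" using False by blast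
 have d: "U s n = of_real (exp (nu * (norm n)\<^sup>2 * (t - s))) *s U t n" by (rule L.level_decay[OF True o t s])
 show ?thesis unfolding P.al_def P.be_def d
 by (intro exI[of _ "of_real (exp (nu * (norm n)\<^sup>2 * (t - s)))"]) (simp add: cdot_simps)
 next
 case False
 then show ?thesis using off[OF s False] off[OF t False] by (intro exI[of _ 1]) simp
 qed
 have A: "P.al (U s) n ~= 0 \<longleftrightarrow> n : {n. P.al (U t) n ~= 0}" if "s : J" for s n using ratio[OF that, of n] by auto
 have B: "P.be (U s) n ~= 0 \<longleftrightarrow> n : {n. P.be (U t) n ~= 0}" if "s : J" for s n using ratio[OF that, of n] by auto
 have "planar_structure nu Om S (U t) & (\<forall>n. nl S (U t) n = 0)"
 by (rule Q.level_profile[OF _ A B t]) (use False in blast)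
 then show ?thesis by (simp add: mode_structure_def)
 qed
 qed
qed

end

section \<open>From coefficients to fields\<close>

lemma trig_expansionI:
 assumes "finite X" "!!n. n ~: X ==> c n = 0" "!!x. f x = (\<Sum>n\<in>X. c n * cis (n \<bullet> x))"
 shows "trig_expansion f c"
 unfolding trig_expansion_def
proof (intro conjI allI)
 have s: "{n. c n ~= 0} \<subseteq> X" using assms(2) by blast
 then show "finite {n. c n ~= 0}" using assms(1) by (rule finite_subset)
 show "f x = (\<Sum>n | c n ~= 0. c n * cis (n \<bullet> x))" for x
 unfolding assms(3) by (rule sum.mono_neutral_right[OF assms(1) s]) simp
qed

lemma trig_expansionD:
 assumes "trig_expansion f c" "finite X" "{n. c n ~= 0} \<subseteq> X"
 shows "f x = (\<Sum>n\<in>X. c n * cis (n \<bullet> x))"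
proof -
 have "f x = (\<Sum>n | c n ~= 0. c n * cis (n \<bullet> x))" using assms(1) by (simp add: trig_expansion_def)
 also have "\<dots> = (\<Sum>n\<in>X. c n * cis (n \<bullet> x))" by (rule sum.mono_neutral_left[OF assms(2,3)]) simp
 finally show ?thesis .
qed

lemma trig_expansion_fun_unique: "trig_expansion f c ==> trig_expansion g c ==> f x = g x"
 by (simp add: trig_expansion_def)

lemma trig_expansion_add:
 assumes "trig_expansion f c" "trig_expansion g d"
 shows "trig_expansion (%x. f x + g x) (%n. c n + d n)"
proof (rule trig_expansionI)
 let ?X = "{n. c n ~= 0} \<union> {n. d n ~= 0}"
 show fin: "finite ?X" using assms by (simp add: trig_expansion_def)
 show "f x + g x = (\<Sum>n\<in>?X. (c n + d n) * cis (n \<bullet> x))" for x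
 unfolding trig_expansionD[OF assms(1) fin Un_upper1] trig_expansionD[OF assms(2) fin Un_upper2]
 by (simp add: sum.distrib distrib_right)
qed auto

lemma trig_expansion_scale:
 assumes "trig_expansion f c"
 shows "trig_expansion (%x. a * f x) (%n. a * c n)"
proof (rule trig_expansionI)
 show fin: "finite {n. c n ~= 0}" using assms by (simp add: trig_expansion_def)
 show "a * f x = (\<Sum>n | c n ~= 0. (a * c n) * cis (n \<bullet> x))" for x
 unfolding trig_expansionD[OF assms fin subset_refl] sum_distrib_left by (simp add: mult_ac)
qed auto

lemma trig_expansion_zero: "trig_expansion (%x. 0) (%n. 0)"
 by (simp add: trig_expansion_def)

lemma trig_expansion_sum:
 "finite K ==> (!!k. k : K ==> trig_expansion (f k) (c k)) ==> trig_expansion (%x. \<Sum>k\<in>K. f k x) (%n. \<Sum>k\<in>K. c k n)"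
proof (induction K rule: finite_induct)
 case empty
 then show ?case by (simp add: trig_expansion_zero)
next
 case (insert k K)
 then show ?case by (simp add: trig_expansion_add)
qed

lemma trig_expansion_shift:
 assumes "trig_expansion f c"
 shows "trig_expansion (%x. cis (l \<bullet> x) * f x) (%n. c (n - l))"
proof (rule trig_expansionI)
 let ?X = "{n. c n ~= 0}"
 have fin: "finite ?X" using assms by (simp add: trig_expansion_def)
 then show "finite ((%n. n + l) ` ?X)" by simp
 show "c (n - l) = 0" if "n ~: (%n. n + l) ` ?X" for n
 proof (rule ccontr)
 assume "c (n - l) ~= 0"
 then have "n - l + l : (%n. n + l) ` ?X" by (intro imageI) simp
 then show False using that by simp
 qed
 show "cis (l \<bullet> x) * f x = (\<Sum>n\<in>(%n. n + l) ` ?X. c (n - l) * cis (n \<bullet> x))" for x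
 unfolding trig_expansionD[OF assms fin subset_refl]
 by (subst sum.reindex) (auto simp: inj_on_def sum_distrib_left cis_mult[symmetric] inner_add_left mult_ac intro!: sum.cong)
qed


text \<open>Coefficients are zero off the support, so that their symmetry and orthogonality hold at
  every \<open>n\<close>.\<close>

definition modes_of :: "(real^3 => real^3) => (real^3) set => (real^3 => complex^3) => bool" where
 "modes_of v S C \<longleftrightarrow> finite S & 0 ~: S & (ALL n:S. - n : S) & (\<forall>n. C n ~= 0 \<longleftrightarrow> n : S) &
  (\<forall>n. C (- n) = cnjv (C n)) & (\<forall>n. cdot (cvec n) (C n) = 0) &
  (\<forall>x. cvec (v x) = (\<Sum>n\<in>S. cis (n \<bullet> x) *s C n))"

lemma modes_of_component:
 assumes "finite S" "!!n. n ~: S ==> C n = 0" "!!x. cvec (v x) = (\<Sum>n\<in>S. cis (n \<bullet> x) *s C n)"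
 shows "trig_expansion (%x. of_real (v x \<bullet> y)) (%n. cdot (C n) (cvec y))"
proof (rule trig_expansionI[OF assms(1)])
 show "cdot (C n) (cvec y) = 0" if "n ~: S" for n using assms(2)[OF that] by simp
 fix x
 have "complex_of_real (v x \<bullet> y) = cdot (cvec y) (cvec (v x))" by (simp add: cdot_cvec_cvec inner_commute)
 also have "\<dots> = (\<Sum>n\<in>S. cdot (C n) (cvec y) * cis (n \<bullet> x))"
 unfolding assms(3) cdot_sum cdot_simps by (simp add: cdot_commute[of "cvec y"] mult.commute)
 finally show "complex_of_real (v x \<bullet> y) = (\<Sum>n\<in>S. cdot (C n) (cvec y) * cis (n \<bullet> x))" .
qed

lemma Hfields_modes_of:
 assumes "v : Hfields"
 shows "modes_of v (fourier_support v) (field_coeff v)"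
proof -
 obtain S c where S: "finite S" "0 ~: S" "uminus ` S = S"
 and c: "ALL n:S. c n ~= 0 & c (- n) = cnjv (c n) & cdot (cvec n) (c n) = 0"
 and ex: "\<forall>x. cvec (v x) = (\<Sum>n\<in>S. cis (n \<bullet> x) *s c n)"
 using assms unfolding Hfields_def by blast
 have C: "field_coeff v n = (if n : S then c n else 0)" for n
 by (rule field_coeff_eq[OF S(1)]) (use ex in blast)
 have supp: "fourier_support v = S"
 by (rule fourier_support_eq[OF S(1), of c]) (use c ex in auto)
 have neg: "- n : S \<longleftrightarrow> n : S" for n using S(3) by (metis image_eqI minus_minus)
 have "cnjv 0 = 0" by (simp add: cnjv_simps)
 then show ?thesis
 unfolding modes_of_def supp using S(1,2) c ex neg by (auto simp: C)
qed

lemma modes_of_Hfields: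
 assumes "modes_of v S C"
 shows "v : Hfields & fourier_support v = S & field_coeff v = C"
proof (intro conjI)
 have S: "finite S" "0 ~: S" and sym: "!!n. n : S ==> - n : S" and C: "!!n. C n ~= 0 \<longleftrightarrow> n : S" "!!n. C (- n) = cnjv (C n)"
 "!!n. cdot (cvec n) (C n) = 0" and ex: "!!x. cvec (v x) = (\<Sum>n\<in>S. cis (n \<bullet> x) *s C n)"
 using assms unfolding modes_of_def by blast+
 have "uminus ` S = S"
 proof
 show "uminus ` S \<subseteq> S" using sym by blast
 show "S \<subseteq> uminus ` S"
 proof
 fix n assume "n : S"
 then have "- (- n) : uminus ` S" by (intro imageI sym)
 then show "n : uminus ` S" by simp
 qed
 qed
 then show "v : Hfields" unfolding Hfields_def
 using S C ex by (intro CollectI exI[of _ S] exI[of _ C] conjI ballI allI) auto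
 show "fourier_support v = S" by (rule fourier_support_eq[OF S(1), of C]) (use C ex in auto)
 show "field_coeff v = C"
 proof
 fix n
 have "field_coeff v n = (if n : S then C n else 0)" by (rule field_coeff_eq[OF S(1) ex])
 then show "field_coeff v n = C n" using C(1)[of n] by auto
 qed
qed

lemma curl_expansion:
 assumes S: "finite S" and ex: "!!x. cvec (v x) = (\<Sum>n\<in>S. cis (n \<bullet> x) *s C n)"
 shows "cvec (curl v x) = (\<Sum>n\<in>S. cis (n \<bullet> x) *s (\<i> *s ccross (cvec n) (C n)))"
proof -
 define G where "G i h = (\<Sum>n\<in>S. \<i> * of_real (n \<bullet> h) * (cis (n \<bullet> x) * C n $ i))" for i :: 3 and h
 have cis: "cis \<theta> = of_real (cos \<theta>) + \<i> * of_real (sin \<theta>)" for \<theta> by (simp add: complex_eq_iff)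
 have comp: "complex_of_real (v y $ i) = (\<Sum>n\<in>S. cis (n \<bullet> y) * C n $ i)" for y i
 using arg_cong[OF ex[of y], of "%w. w $ i"] by (simp add: cvec_def)
 have d1: "((%y. cis (n \<bullet> y) * C n $ i) has_derivative (%h. \<i> * of_real (n \<bullet> h) * (cis (n \<bullet> x) * C n $ i))) (at x)" for n i
 proof -
 have "((%y. complex_of_real (cos (n \<bullet> y)) + \<i> * of_real (sin (n \<bullet> y))) has_derivative
 (%h. complex_of_real (- sin (n \<bullet> x) * (n \<bullet> h)) + \<i> * of_real (cos (n \<bullet> x) * (n \<bullet> h)))) (at x)"
 by (auto intro!: derivative_eq_intros)
 from has_derivative_mult_left[OF this, of "C n $ i"] show ?thesis
 unfolding cis by (rule has_derivative_eq_rhs) (simp add: fun_eq_iff algebra_simps)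
 qed
 have dc: "((%y. complex_of_real (v y $ i)) has_derivative G i) (at x)" for i
 unfolding comp G_def by (rule has_derivative_sum) (rule d1)
 have dr: "((%y. v y $ i) has_derivative (%h. Re (G i h))) (at x)" for i
 using bounded_linear.has_derivative[OF bounded_linear_Re dc[of i]] by simp
 \<comment> \<open>The derivative of a real function is real; by uniqueness it agrees with its own
   real part.\<close>
 have G: "complex_of_real (Re (G i h)) = G i h" for i h
 proof -
 have "((%y. complex_of_real (v y $ i)) has_derivative (%h. complex_of_real (Re (G i h)))) (at x)"
 by (rule bounded_linear.has_derivative[OF bounded_linear_of_real dr])
 from has_derivative_unique[OF this dc] show ?thesis by (simp add: fun_eq_iff)
 qed
 have "(v has_derivative (%h. \<chi> i. Re (G i h))) (at x)"
 unfolding has_derivative_componentwise_within[of v]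
 proof
 fix b :: "real^3" assume "b : Basis"
 then obtain i where b: "b = axis i 1" by (auto simp: Basis_vec_def)
 show "((%y. v y \<bullet> b) has_derivative (%h. (\<chi> i. Re (G i h)) \<bullet> b)) (at x)"
 unfolding b by (simp add: inner_axis dr)
 qed
 from frechet_derivative_at[OF this] have D: "frechet_derivative v (at x) h $ i = Re (G i h)" for h i
 by (metis vec_lambda_beta)
 have ax: "n \<bullet> axis j 1 = n $ j" for n :: "real^3" and j by (simp add: inner_axis)
 have GG: "G i (axis j 1) - G j' (axis i' 1) = (\<Sum>n\<in>S. cis (n \<bullet> x) * (\<i> * (of_real (n $ j) * C n $ i - of_real (n $ i') * C n $ j')))" for i j i' j'
 unfolding G_def ax sum_subtractf[symmetric] by (rule sum.cong) (simp_all add: algebra_simps)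
 show ?thesis
 unfolding vec_eq_iff forall_3 sum_component vector_smult_component
 by (simp add: curl_def Let_def D cvec_def ccross_def G GG)
qed

section \<open>From planar coefficients to the alternatives for the field\<close>

context plane
begin

lemma trig_expansion_pw:
 assumes A: "finite A" and W: "!!x. W x = (\<Sum>l\<in>A. ps l * cis (l \<bullet> x))"
 shows "trig_expansion (%x. W x ^ k) (pw A ps k)"
proof (induction k)
 case 0
 show ?case by (rule trig_expansionI[of "{0}"]) auto
next
 case (Suc k)
 have "trig_expansion (%x. \<Sum>l\<in>A. ps l * (cis (l \<bullet> x) * W x ^ k)) (%n. \<Sum>l\<in>A. ps l * pw A ps k (n - l))"
 by (rule trig_expansion_sum[OF A]) (rule trig_expansion_scale, rule trig_expansion_shift, rule Suc.IH)
 moreover have "(%x. \<Sum>l\<in>A. ps l * (cis (l \<bullet> x) * W x ^ k)) = (%x. W x ^ Suc k)"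
 proof
 fix x
 have "(\<Sum>l\<in>A. ps l * (cis (l \<bullet> x) * W x ^ k)) = (\<Sum>l\<in>A. ps l * cis (l \<bullet> x)) * W x ^ k"
 by (simp only: sum_distrib_right mult.assoc)
 also have "\<dots> = W x ^ Suc k" unfolding W[symmetric] by simp
 finally show "(\<Sum>l\<in>A. ps l * (cis (l \<bullet> x) * W x ^ k)) = W x ^ Suc k" .
 qed
 ultimately show ?case by simp
qed

lemma trig_expansion_polynomial:
 assumes A: "finite A" and W: "!!x. W x = (\<Sum>l\<in>A. ps l * cis (l \<bullet> x))"
 shows "trig_expansion (%x. \<Sum>k<N. q k * W x ^ k) (%n. \<Sum>k<N. q k * pw A ps k n)"
 by (rule trig_expansion_sum) (auto intro!: trig_expansion_scale trig_expansion_pw[OF A W] simp del: pw.simps)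

lemma pw_cnj:
 assumes "finite A" "!!l. l : A ==> - l : A" "!!l. ps (- l) = cnj (ps l)"
 shows "pw A ps k (- n) = cnj (pw A ps k n)"
proof (induction k arbitrary: n)
 case (Suc k)
 have "pw A ps (Suc k) (- n) = (\<Sum>l\<in>A. ps (- l) * pw A ps k (- n - - l))"
 unfolding pw.simps by (rule sum.reindex_bij_witness[of _ uminus uminus]) (use assms(2) in auto)
 also have "\<dots> = (\<Sum>l\<in>A. cnj (ps l * pw A ps k (n - l)))"
 proof (rule sum.cong[OF refl])
 fix l
 have "- n - - l = - (n - l)" by simp
 then show "ps (- l) * pw A ps k (- n - - l) = cnj (ps l * pw A ps k (n - l))" by (simp only: assms(3) Suc.IH complex_cnj_mult)
 qed
 finally show ?case by (simp add: cnj_sum)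
qed auto

lemma independent_pair: "dd x y ~= 0 ==> x ~= y & independent {x, y}"
proof -
 assume D: "dd x y ~= 0"
 have "x ~= y" "y ~= 0" using D by auto
 moreover have "x ~: span {y}"
 proof
 assume "x : span {y}"
 then obtain k where "x = k *\<^sub>R y" unfolding span_singleton by blast
 then show False using D by (simp add: dd_scale)
 qed
 ultimately show ?thesis by (simp add: independent_insert)
qed

lemma independent_dd:
 assumes "independent {x, y}" "x ~= y" "e \<bullet> x = 0" "e \<bullet> y = 0"
 shows "dd x y ~= 0"
proof
 assume D: "dd x y = 0"
 have i: "independent {y}" "x ~: span {y}" using assms(1,2) by (simp_all add: independent_insert)
 then have "y ~= 0" by (auto simp: dependent_single)
 moreover have "dd y x = 0" using D dd_swap[of y x] by simp
 ultimately have "x = ((y \<bullet> x) / (y \<bullet> y)) *\<^sub>R y" using parallelI[OF assms(4,3)] by blast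
 then show False using i(2) unfolding span_singleton by blast
qed

abbreviation "perp_plane \<equiv> {n. e \<bullet> n = 0}"

lemma perp_plane: "subspace perp_plane" "dim perp_plane = 2"
proof -
 have "e ~= 0" using e1 by auto
 then show "dim perp_plane = 2" by (simp add: dim_hyperplane)
qed (rule subspace_hyperplane)

lemma P3_eq: "P3 = {n. e3 \<bullet> n = 0}"
 by (auto simp: P3_def inner_commute)

lemma e3_inner: "e3 \<bullet> n = n$3"
 by (simp add: e3_def inner_axis')

lemma perp_plane_P3:
 assumes x: "e \<bullet> x = 0" "e \<bullet> y = 0" "dd x y ~= 0" "x$3 = 0" "y$3 = 0"
 shows "perp_plane = P3"
proof (rule subspace_dim_equal)
 show "subspace P3" unfolding P3_eq by (rule subspace_hyperplane)
 have "e3 ~= 0" by (simp add: e3_def)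
 then have "dim P3 = 2" unfolding P3_eq by (simp add: dim_hyperplane)
 then show "dim P3 <= dim perp_plane" using perp_plane(2) by simp
 show "perp_plane \<subseteq> P3"
 proof
 fix n assume "n : perp_plane"
 then have "n = (dd n y / dd x y) *\<^sub>R x + (dd x n / dd x y) *\<^sub>R y" using plane_basis[OF x(3,1,2)] by blast
 then have "n $ 3 = (dd n y / dd x y) * x $ 3 + (dd x n / dd x y) * y $ 3"
 by (metis vector_add_component vector_scaleR_component real_scaleR_def)
 then have "n $ 3 = 0" using x(4,5) by simp
 then show "n : P3" unfolding P3_eq by (simp add: e3_inner)
 qed
qed (rule perp_plane(1))

lemma subspace_perp_plane:
 assumes "subspace P" "dim P = 2" "!!p. p : P ==> e \<bullet> p = 0"
 shows "P = perp_plane"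
 by (rule subspace_dim_equal[OF assms(1) perp_plane(1)]) (use assms perp_plane(2) in auto)

lemma modes_plane_field:
 assumes m: "modes_of v S C" and S: "!!n. n : S ==> e \<bullet> n = 0"
 shows "plane_field C"
 unfolding plane_field_def
proof (intro allI impI)
 fix n assume "C n ~= 0"
 then have "n : S" using m by (simp add: modes_of_def)
 then show "n ~= 0 & e \<bullet> n = 0 & cdot (cvec n) (C n) = 0" using m S[of n] by (auto simp: modes_of_def)
qed

lemma case_planeI:
 assumes m: "modes_of v S C" and S: "!!n. n : S ==> e \<bullet> n = 0" and sp: "x : S" "y : S" "dd x y ~= 0"
 and ab: "planar_a Om perp_plane v | planar_b nu Om perp_plane v"
 shows "case_plane nu Om v"
proof -
 have s: "fourier_support v = S" using modes_of_Hfields[OF m] by blast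
 have "S \<subseteq> perp_plane" using S by blast
 then show ?thesis
 unfolding case_plane_def s using independent_pair[OF sp(3)] sp(1,2) ab perp_plane
 by (intro conjI bexI[of _ x] bexI[of _ y] exI[of _ perp_plane]) simp_all
qed

text \<open>Here \<open>Q\<close> reproduces the transverse coefficients exactly. Since
  \<open>be C\<close> is zero at the zero frequency, the mean of this polynomial in the vorticity is
  zero.\<close>

lemma planar_bI:
 assumes m: "modes_of v S C" and S: "!!n. n : S ==> e \<bullet> n = 0"
 and lam: "lam > 0" "!!n. n : S ==> al C n ~= 0 ==> norm n = lam"
 and sp: "x0 : S" "y0 : S" "al C x0 ~= 0" "al C y0 ~= 0" "dd x0 y0 ~= 0"
 and w: "!!x. of_real (w x) = (\<Sum>n\<in>S. (\<i> * of_real lam * al C n) * cis (n \<bullet> x))"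
 and Q: "trig_expansion (%x. of_real (poly Q (w x))) (be C)"
 and br: "(Om = 0 | perp_plane = P3) & nu = 0
  | (Om = 0 | perp_plane = P3) & nu ~= 0 & (\<exists>kap. Q = [:0, kap:])
  | Om ~= 0 & perp_plane ~= P3 & (Q = [:0, 1:] | Q = [:0, - 1:])"
 shows "planar_b nu Om perp_plane v"
proof -
 have fin: "finite S" "0 ~: S" and sym: "!!n. n : S ==> - n : S" and C: "!!n. C n ~= 0 \<longleftrightarrow> n : S" "!!n. C (- n) = cnjv (C n)"
 "!!n. cdot (cvec n) (C n) = 0" and ex: "!!x. cvec (v x) = (\<Sum>n\<in>S. cis (n \<bullet> x) *s C n)"
 using m unfolding modes_of_def by blast+
 have off: "C n = 0" if "n ~: S" for n using C(1)[of n] that by blast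
 have V: "plane_field C" by (rule modes_plane_field[OF m S])
 define vpar where "vpar x = v x - (v x \<bullet> e) *\<^sub>R e" for x
 define D where "D n = al C n *s cvec (cross3 e n)" for n
 define A where "A = {n : S. al C n ~= 0}"
 have Dn: "C n = D n + be C n *s cvec e" for n unfolding D_def by (rule plane_field_decomp[OF V])
 have teb: "trig_expansion (%x. of_real (v x \<bullet> e)) (be C)"
 using modes_of_component[OF fin(1) off ex, of e] unfolding be_def[abs_def] by simp
 have bes: "be C n = 0" if "n ~: S" for n using off[OF that] by simp
 have exS: "cvec (vpar x) = (\<Sum>n\<in>S. cis (n \<bullet> x) *s D n)" for x
 proof -
 have "complex_of_real (v x \<bullet> e) = (\<Sum>n\<in>S. be C n * cis (n \<bullet> x))"
 by (rule trig_expansionD[OF teb fin(1)]) (use bes in blast)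
 then have 1: "of_real (v x \<bullet> e) *s cvec e = (\<Sum>n\<in>S. cis (n \<bullet> x) *s (be C n *s cvec e))"
 by (simp add: vec_eq_iff sum_distrib_left sum_distrib_right mult_ac)
 have "cvec (v x) = (\<Sum>n\<in>S. cis (n \<bullet> x) *s (D n + be C n *s cvec e))" unfolding ex Dn[symmetric] ..
 also have "\<dots> = (\<Sum>n\<in>S. cis (n \<bullet> x) *s D n) + of_real (v x \<bullet> e) *s cvec e"
 unfolding 1 sum.distrib[symmetric] by (rule sum.cong) (simp_all add: vec_eq_iff algebra_simps)
 finally show ?thesis by (simp add: vpar_def)
 qed
 have exA: "cvec (vpar x) = (\<Sum>n\<in>A. cis (n \<bullet> x) *s D n)" for x
 unfolding exS by (rule sum.mono_neutral_right[OF fin(1)]) (auto simp: A_def D_def)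
 have alS: "n : S" if "al C n ~= 0" for n using off[of n] that by (cases "n : S") simp_all
 have acn: "al C (- n) = - cnj (al C n)" for n by (rule al_be_cnj(1)[of C, OF C(2)])
 have symA: "- n : A" if "n : A" for n using that sym by (simp add: A_def acn)
 have finA: "finite A" using fin(1) by (simp add: A_def)
 have cne: "cross3 e n ~= 0" if "n : S" for n
 proof
 assume "cross3 e n = 0"
 then have "n \<bullet> n = 0" using cross_e_inner[OF S[OF that], of n] by simp
 then show False using that fin(2) by simp
 qed
 have mp: "modes_of vpar A D"
 unfolding modes_of_def
 proof (intro conjI allI ballI)
 show "0 ~: A" using fin(2) by (simp add: A_def)
 show "- n : A" if "n : A" for n by (rule symA[OF that])
 show "D n ~= 0 \<longleftrightarrow> n : A" for n using alS[of n] cne[of n] by (auto simp: D_def A_def)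
 show "D (- n) = cnjv (D n)" for n
 unfolding D_def acn cnjv_simps by (simp add: cross_minus_right vec_eq_iff)
 show "cdot (cvec n) (D n) = 0" for n
 unfolding D_def cdot_simps cdot_cvec_cvec by (simp add: dot_cross_self)
 show "cvec (vpar x) = (\<Sum>n\<in>A. cis (n \<bullet> x) *s D n)" for x by (rule exA)
 qed (rule finA)
 have H: "vpar : Hfields" "fourier_support vpar = A" using modes_of_Hfields[OF mp] by blast+
 \<comment> \<open>\<open>x0\<close>, \<open>y0\<close> and their negatives are distinct because the
   determinant is nonzero.\<close>
 have "card A >= 4"
 proof -
 have "x0 ~= y0" "x0 ~= - y0" "x0 ~= - x0" "y0 ~= - y0"
 proof -
 show "x0 ~= y0" "x0 ~= - y0" using sp(5) by auto
 have "dd x0 y0 ~= dd (- x0) y0" "dd x0 y0 ~= dd x0 (- y0)" using sp(5) by simp_all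
 then show "x0 ~= - x0" "y0 ~= - y0" by metis+
 qed
 moreover from this have "y0 ~= - x0" by (metis minus_minus)
 ultimately have "card {x0, - x0, y0, - y0} = 4" by simp
 moreover have "{x0, - x0, y0, - y0} \<subseteq> A" using sp symA by (auto simp: A_def)
 ultimately show ?thesis using card_mono[OF finA] by metis
 qed
 have curl: "curl vpar x = (lam * w x) *\<^sub>R e" for x
 proof -
 have "cvec (curl vpar x) = (\<Sum>n\<in>S. cis (n \<bullet> x) *s (\<i> *s ccross (cvec n) (D n)))"
 by (rule curl_expansion[OF fin(1) exS])
 also have "\<dots> = (\<Sum>n\<in>S. ((of_real lam * ((\<i> * of_real lam * al C n) * cis (n \<bullet> x))) *s cvec e))"
 proof (rule sum.cong[OF refl])
 fix n assume n: "n : S"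
 have c1: "cross3 n (cross3 e n) = (n \<bullet> n) *\<^sub>R e" using S[OF n] by (simp add: Lagrange inner_commute)
 have "ccross (cvec n) (D n) = (al C n * of_real (n \<bullet> n)) *s cvec e"
 unfolding D_def ccross_smult ccross_cvec c1 by (simp add: vec_eq_iff)
 moreover have "al C n * of_real (n \<bullet> n) = al C n * of_real (lam * lam)"
 using lam(2)[OF n] by (cases "al C n = 0") (auto simp: dot_square_norm power2_eq_square)
 ultimately show "cis (n \<bullet> x) *s (\<i> *s ccross (cvec n) (D n)) = (of_real lam * ((\<i> * of_real lam * al C n) * cis (n \<bullet> x))) *s cvec e"
 by (simp add: vec_eq_iff mult_ac)
 qed
 also have "\<dots> = of_real (lam * w x) *s cvec e"
 unfolding of_real_mult w by (simp add: vec_eq_iff sum_distrib_left sum_distrib_right mult_ac)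
 also have "\<dots> = cvec ((lam * w x) *\<^sub>R e)" by simp
 finally have "cvec (curl vpar x - (lam * w x) *\<^sub>R e) = 0" unfolding cvec_simps by simp
 then show ?thesis unfolding cvec_eq_0_iff by simp
 qed
 have zm: "zero_mode (%y. poly Q (w y)) = 0"
 unfolding zero_mode_def fourier_coeff_eq[OF Q] using bes[of 0] fin(2) by simp
 have vp: "v x \<bullet> e = poly Q (w x)" for x
 using trig_expansion_fun_unique[OF teb Q, of x] by simp
 show ?thesis
 unfolding planar_b_def
 proof (intro exI conjI allI ballI)
 show "norm e = 1" using e1 by (simp add: norm_eq_sqrt_inner)
 show "orthogonal e p" if "p : perp_plane" for p using that by (simp add: orthogonal_def)
 show "v x = vpar x + (v x \<bullet> e) *\<^sub>R e" for x by (simp add: vpar_def)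
 show "vpar : Hfields" by (rule H)
 show "vpar x : perp_plane" for x using e1 by (simp add: vpar_def inner_diff_right inner_commute)
 show "lam > 0" by (rule lam)
 show "fourier_support vpar \<subseteq> perp_plane \<inter> sphere 0 lam" unfolding H using S lam(2) by (auto simp: A_def)
 show "4 <= card (fourier_support vpar)" unfolding H by fact
 show "curl vpar x = (lam * w x) *\<^sub>R e" for x by (rule curl)
 show "v x \<bullet> e = poly Q (w x) - zero_mode (%y. poly Q (w y))" for x unfolding zm vp by simp
 qed (rule br)
qed

lemma planar_aI:
 assumes m: "modes_of v S C" and S: "!!n. n : S ==> e \<bullet> n = 0" and z: "!!n. n : S ==> al C n = 0"
 and br: "Om = 0 | perp_plane = P3"
 shows "planar_a Om perp_plane v"
 unfolding planar_a_def
proof (intro conjI allI ballI br)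
 fix x p assume p: "p : perp_plane"
 have V: "plane_field C" by (rule modes_plane_field[OF m S])
 have fin: "finite S" and off: "!!n. n ~: S ==> C n = 0" and ex: "!!x. cvec (v x) = (\<Sum>n\<in>S. cis (n \<bullet> x) *s C n)"
 using m unfolding modes_of_def by blast+
 have "al C n = 0" for n using z[of n] off[of n] by (cases "n : S") simp_all
 then have "cdot (C n) (cvec p) = 0" for n using cdot_plane_field(1)[OF V, of p n] p by simp
 then have "trig_expansion (%x. of_real (v x \<bullet> p)) (%n. 0)" using modes_of_component[OF fin off ex, of p] by simp
 from trig_expansion_fun_unique[OF this trig_expansion_zero, of x] show "orthogonal (v x) p" by (simp add: orthogonal_def)
qed

text \<open>Reflection turns \<open>al\<close> into minus its conjugate, and the factor
  \<open>\<i>\<close> makes up for the sign, so the sum equals its own conjugate.\<close>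

lemma real_vorticity:
 assumes m: "modes_of v S C"
 obtains w where "!!x. complex_of_real (w x) = (\<Sum>n\<in>S. (\<i> * of_real lam * al C n) * cis (n \<bullet> x))"
proof -
 have fin: "finite S" and sym: "!!n. n : S ==> - n : S" and C: "!!n. C (- n) = cnjv (C n)"
 using m unfolding modes_of_def by blast+
 define W where "W x = (\<Sum>n\<in>S. (\<i> * of_real lam * al C n) * cis (n \<bullet> x))" for x
 have "cnj (W x) = W x" for x
 proof -
 have "W x = (\<Sum>n\<in>S. (\<i> * of_real lam * al C (- n)) * cis (- n \<bullet> x))"
 unfolding W_def by (rule sum.reindex_bij_witness[of _ uminus uminus]) (use sym in auto)
 also have "\<dots> = cnj (W x)"
 unfolding W_def cnj_sum by (rule sum.cong) (simp_all add: al_be_cnj(1)[of C, OF C] cis_cnj[symmetric])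
 finally show ?thesis by simp
 qed
 then have "complex_of_real (Re (W x)) = W x" for x by (metis Reals_cnj_iff of_real_Re)
 then show ?thesis using that[of "%x. Re (W x)"] unfolding W_def by blast
qed

end

lemma cdot_axis: "cdot a (cvec (axis j 1)) = a $ j"
 using exhaust_3[of j] by (auto simp: scalar_product_def sum_3 cvec_def axis_def)

lemma case_lineI:
 assumes "modes_of v S C" "line_structure S"
 shows "case_line v"
proof -
 obtain x where x: "ALL n:S. \<exists>c. n = c *\<^sub>R x" using assms(2) unfolding line_structure_def ..
 have s: "fourier_support v = S" using modes_of_Hfields[OF assms(1)] by blast
 define y :: "real^3" where "y = (if x = 0 then axis 1 1 else x)"
 have "y ~= 0" by (simp add: y_def)
 then have "dim (span {y}) = 1" by simp
 moreover have "S \<subseteq> span {y}"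
 proof
 fix n assume n: "n : S"
 obtain c where c: "n = c *\<^sub>R x" using bspec[OF x n] ..
 have "n ~= 0" using n assms(1) by (auto simp: modes_of_def)
 then have "y = x" using c by (auto simp: y_def)
 then show "n : span {y}" unfolding span_singleton using c by blast
 qed
 ultimately show ?thesis unfolding case_line_def s by (intro exI[of _ "span {y}"]) simp
qed

context plane
begin

lemma planar_case:
 assumes m: "modes_of v S C" and S: "!!n. n : S ==> e \<bullet> n = 0" and Om: "!!n. n : S ==> Om * n$3 = 0"
 and sp: "x : S" "y : S" "dd x y ~= 0"
 and alt: "(ALL n:S. al C n = 0) | (\<exists>lam. polynomial_profile S nu C lam &
 (EX x:S. EX y:S. al C x ~= 0 & al C y ~= 0 & dd x y ~= 0))"
 shows "case_plane nu Om v"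
proof (rule case_planeI[OF m S sp])
 have br: "Om = 0 | perp_plane = P3"
 using perp_plane_P3[OF S[OF sp(1)] S[OF sp(2)] sp(3)] Om[OF sp(1)] Om[OF sp(2)] by auto
 have fin: "finite S" and sym: "!!n. n : S ==> - n : S" and C: "!!n. C (- n) = cnjv (C n)"
 and off: "!!n. n ~: S ==> C n = 0"
 using m unfolding modes_of_def by blast+
 show "planar_a Om perp_plane v | planar_b nu Om perp_plane v"
 proof (cases "ALL n:S. al C n = 0")
 case True
 then show ?thesis using planar_aI[OF m S _ br] by blast
 next
 case False
 then obtain lam x0 y0 where pr: "polynomial_profile S nu C lam"
 and s0: "x0 : S" "y0 : S" "al C x0 ~= 0" "al C y0 ~= 0" "dd x0 y0 ~= 0" using alt by blast
 let ?om = "%n. \<i> * of_real lam * al C n"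
 have lam: "lam > 0" "!!n. n : S ==> al C n ~= 0 ==> norm n = lam" using pr by (auto simp: polynomial_profile_def)
 obtain w where w: "!!x. complex_of_real (w x) = (\<Sum>n\<in>S. ?om n * cis (n \<bullet> x))"
 proof (rule real_vorticity[where lam = lam, OF m])
 fix w assume a: "!!x. complex_of_real (w x) = (\<Sum>n\<in>S. \<i> * of_real lam * al C n * cis (n \<bullet> x))"
 show thesis by (rule that) (rule a)
 qed
 have omc: "?om (- n) = cnj (?om n)" for n by (simp add: al_be_cnj(1)[of C, OF C])
 have tew: "trig_expansion (%x. complex_of_real (w x)) ?om"
 by (rule trig_expansionI[OF fin _ w]) (simp add: off)
 have "\<exists>Q. trig_expansion (%x. of_real (poly Q (w x))) (be C) & (nu ~= 0 --> (\<exists>kap. Q = [:0, kap:]))"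
 proof (cases "nu = 0")
 case False
 then obtain c :: real where c: "!!n. be C n = of_real c * ?om n" using pr unfolding polynomial_profile_def by blast
 have "be C = (%n. of_real c * ?om n)" using c by (simp add: fun_eq_iff)
 then have "trig_expansion (%x. of_real (poly [:0, c:] (w x))) (be C)"
 using trig_expansion_scale[OF tew, of "of_real c"] by (simp add: mult.commute)
 then show ?thesis by blast
 next
 case True
 obtain N q where q: "!!n. be C n = (\<Sum>k<N. q k * pw S ?om k n)" using pr unfolding polynomial_profile_def by blast
 define Q where "Q = (\<Sum>k<N. monom (Re (q k)) k)"
 have pc: "pw S ?om k (- n) = cnj (pw S ?om k n)" for k n
 by (rule pw_cnj[of S ?om, OF fin sym omc])
 \<comment> \<open>The transverse coefficients are symmetric under conjugation, so averaging the
   expansion with its conjugate replaces each \<open>q k\<close> by its real part.\<close>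
 have b: "be C n = (\<Sum>k<N. of_real (Re (q k)) * pw S ?om k n)" for n
 proof -
 have "be C n = cnj (be C (- n))" unfolding al_be_cnj(2)[of C, OF C] by simp
 also have "\<dots> = (\<Sum>k<N. cnj (q k) * pw S ?om k n)"
 unfolding q cnj_sum complex_cnj_mult pc complex_cnj_cnj ..
 finally have "be C n + be C n = (\<Sum>k<N. q k * pw S ?om k n) + (\<Sum>k<N. cnj (q k) * pw S ?om k n)" using q by simp
 also have "\<dots> = (\<Sum>k<N. 2 * (of_real (Re (q k)) * pw S ?om k n))"
 unfolding sum.distrib[symmetric] distrib_right[symmetric] complex_add_cnj by (simp add: mult_ac)
 also have "\<dots> = 2 * (\<Sum>k<N. of_real (Re (q k)) * pw S ?om k n)" by (simp only: sum_distrib_left)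
 finally show ?thesis by simp
 qed
 have "be C = (%n. \<Sum>k<N. of_real (Re (q k)) * pw S ?om k n)" using b by (simp add: fun_eq_iff)
 moreover have "complex_of_real (poly Q (w x)) = (\<Sum>k<N. of_real (Re (q k)) * of_real (w x) ^ k)" for x
 by (simp add: Q_def poly_sum poly_monom)
 ultimately have "trig_expansion (%x. of_real (poly Q (w x))) (be C)"
 using trig_expansion_polynomial[where N = N and q = "%k. of_real (Re (q k))", OF fin w] by simp
 then show ?thesis using True by blast
 qed
 then obtain Q where Q: "trig_expansion (%x. of_real (poly Q (w x))) (be C)" "nu ~= 0 --> (\<exists>kap. Q = [:0, kap:])" by blast
 have "planar_b nu Om perp_plane v"
 by (rule planar_bI[OF m S lam s0 w Q(1)]) (use br Q(2) in blast)+
 then show ?thesis by blast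
 qed
qed

text \<open>For planar curl eigenvectors the transverse part is \<omega> or
  \<open>- \<omega>\<close>, according to the sign of the eigenvalue; this profile fits all branches
  for \<open>Q\<close>.\<close>

lemma helical_case:
 assumes m: "modes_of v S C" and S: "!!n. n : S ==> e \<bullet> n = 0" and sp: "x : S" "y : S" "dd x y ~= 0"
 and r: "r > 0" and mu: "mu : {r, - r}" and h: "!!n. n : S ==> norm n = r & helical (of_real mu) n (C n)"
 shows "case_plane nu Om v"
proof (rule case_planeI[OF m S sp])
 have fin: "finite S" and C: "!!n. C n ~= 0 \<longleftrightarrow> n : S" and off: "!!n. n ~: S ==> C n = 0"
 using m unfolding modes_of_def by blast+
 have V: "plane_field C" by (rule modes_plane_field[OF m S])
 let ?om = "%n. \<i> * of_real r * al C n"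
 obtain w where w: "!!x. complex_of_real (w x) = (\<Sum>n\<in>S. ?om n * cis (n \<bullet> x))"
 proof (rule real_vorticity[where lam = r, OF m])
 fix w assume a: "!!x. complex_of_real (w x) = (\<Sum>n\<in>S. \<i> * of_real r * al C n * cis (n \<bullet> x))"
 show thesis by (rule that) (rule a)
 qed
 have tew: "trig_expansion (%x. complex_of_real (w x)) ?om"
 by (rule trig_expansionI[OF fin _ w]) (simp add: off)
 define s where "s = mu / r"
 have s: "s = 1 | s = - 1" "mu = s * r" "s * s = 1" using mu r by (auto simp: s_def)
 have b: "be C n = of_real s * ?om n" for n
 proof (cases "n : S")
 case True
 have "cdot (ccross (cvec n) (C n)) (cvec e) = al C n * of_real (n \<bullet> n)"
 unfolding cdot_ccross_left ccross_cvec by (rule cdot_plane_field(2)[OF V])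
 moreover have "n \<bullet> n = r * r" using h[OF True] by (simp add: dot_square_norm power2_eq_square)
 moreover have "ccross (cvec n) (C n) = (- \<i> * of_real mu) *s C n" by (rule helicalD) (use h[OF True] in blast)
 ultimately have "(- \<i> * of_real mu) * be C n = al C n * of_real (r * r)" by (simp only: cdot_simps be_def)
 then have "of_real r * (- \<i> * of_real s * be C n) = of_real r * (of_real r * al C n)" unfolding s(2) by (simp add: mult_ac)
 moreover have r0: "complex_of_real r ~= 0" using r by simp
 ultimately have "- \<i> * of_real s * be C n = of_real r * al C n" by (simp only: mult_left_cancel[OF r0])
 then have E: "(\<i> * of_real s) * (- \<i> * of_real s * be C n) = (\<i> * of_real s) * (of_real r * al C n)" by simp
 have "be C n = of_real (s * s) * be C n" unfolding s(3) by simp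
 also have "\<dots> = (\<i> * of_real s) * (- \<i> * of_real s * be C n)" by (simp add: algebra_simps)
 also have "\<dots> = (\<i> * of_real s) * (of_real r * al C n)" by (rule E)
 also have "\<dots> = of_real s * ?om n" by (simp only: mult_ac)
 finally show ?thesis .
 qed (simp add: off)
 have al0: "al C n ~= 0" if "n : S" for n
 proof
 assume z: "al C n = 0"
 then have "be C n = 0" using b[of n] by simp
 then have "C n = 0" using plane_field_decomp[OF V, of n] unfolding z by (metis add_0 vector_smult_lzero)
 then show False using C that by blast
 qed
 have "be C = (%n. of_real s * ?om n)" using b by (simp add: fun_eq_iff)
 then have Q: "trig_expansion (%x. of_real (poly [:0, s:] (w x))) (be C)"
 using trig_expansion_scale[OF tew, of "of_real s"] by (simp add: mult.commute)
 have "planar_b nu Om perp_plane v"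
 proof (rule planar_bI[OF m S r _ sp(1,2) al0[OF sp(1)] al0[OF sp(2)] sp(3) w Q])
 show "norm n = r" if "n : S" for n using h[OF that] by blast
 show "(Om = 0 | perp_plane = P3) & nu = 0
  | (Om = 0 | perp_plane = P3) & nu ~= 0 & (\<exists>kap. [:0, s:] = [:0, kap:])
  | Om ~= 0 & perp_plane ~= P3 & ([:0, s:] = [:0, 1:] | [:0, s:] = [:0, - 1:])"
 using s(1) by blast
 qed
 then show "planar_a Om perp_plane v | planar_b nu Om perp_plane v" ..
qed

end

lemma sphere_case:
 assumes m: "modes_of v S C" and sp: "span S = UNIV"
 and r: "r > 0" and h: "!!n. n : S ==> norm n = r & helical mu n (C n)"
 shows "case_sphere v"
proof -
 have H: "v : Hfields" "fourier_support v = S" using modes_of_Hfields[OF m] by blast+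
 have fin: "finite S" and ex: "!!x. cvec (v x) = (\<Sum>n\<in>S. cis (n \<bullet> x) *s C n)"
 using m unfolding modes_of_def by blast+
 obtain B where B: "B \<subseteq> S" "independent B" "card B = dim S"
 proof (rule basis_exists[of S])
 fix B assume "B \<subseteq> S" "independent B" "card B = dim S"
 then show thesis by (rule that)
 qed
 have "3 = dim S" using dim_span[of S] unfolding sp by simp
 then have "card B = 3" using B(3) by simp
 then obtain a b c where abc: "B = {a, b, c}" "a ~= b" "b ~= c" "a ~= c" unfolding card_3_iff by blast
 have "cvec (curl v x) = mu *s cvec (v x)" for x
 proof -
 have "cvec (curl v x) = (\<Sum>n\<in>S. cis (n \<bullet> x) *s (\<i> *s ccross (cvec n) (C n)))" by (rule curl_expansion[OF fin ex])
 also have "\<dots> = (\<Sum>n\<in>S. mu *s (cis (n \<bullet> x) *s C n))"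
 by (rule sum.cong) (use h in \<open>auto simp: helical_def vec_eq_iff mult_ac\<close>)
 also have "\<dots> = mu *s cvec (v x)" unfolding ex by (simp add: vec_eq_iff sum_distrib_left mult_ac)
 finally show ?thesis .
 qed
 then have "beltrami v" unfolding beltrami_def using H(1) by blast
 then show ?thesis
 unfolding case_sphere_def H(2)
 using B(1,2) abc r h
 by (intro conjI bexI[of _ a] bexI[of _ b] bexI[of _ c] exI[of _ r]) auto
qed

lemma flow_structureI:
 assumes m: "modes_of v S C" and st: "mode_structure nu Om S C"
 shows "flow_structure nu Om v"
proof -
 consider "line_structure S" | "planar_structure nu Om S C" | "helical_structure S C"
 using st unfolding mode_structure_def by blast
 then show ?thesis
 proof cases
 case 1
 then show ?thesis using case_lineI[OF m] by (simp add: flow_structure_def)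
 next
 case 2
 then obtain e x y where e1: "e \<bullet> e = 1" and eS: "!!n. n : S ==> e \<bullet> n = 0" "!!n. n : S ==> Om * n$3 = 0"
 and sp: "x : S" "y : S" "det3 e x y ~= 0"
 and alt: "(ALL n:S. plane.al e C n = 0) | (\<exists>lam. plane.polynomial_profile e S nu C lam &
 (EX x:S. EX y:S. plane.al e C x ~= 0 & plane.al e C y ~= 0 & det3 e x y ~= 0))"
 unfolding planar_structure_def by blast
 interpret plane e by unfold_locales (rule e1)
 have "case_plane nu Om v"
 by (rule planar_case[OF m eS sp(1,2)]) (use sp(3) alt in \<open>simp_all only: dd_def not_False_eq_True\<close>)
 then show ?thesis by (simp add: flow_structure_def)
 next
 case 3
 then obtain mu r where r: "r > 0" "mu : {r, - r}" and h: "ALL n:S. norm n = r & helical (of_real mu) n (C n)"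
 unfolding helical_structure_def by blast
 have hh: "norm n = r & helical (of_real mu) n (C n)" if "n : S" for n by (rule bspec[OF h that])
 show ?thesis
 proof (rule dimension_cases[of S])
 assume "line_structure S"
 then show ?thesis using case_lineI[OF m] by (simp add: flow_structure_def)
 next
 assume sp: "span S = UNIV"
 have "case_sphere v" by (rule sphere_case[OF m sp r(1) hh])
 then show ?thesis by (simp add: flow_structure_def)
 next
 fix e assume e: "e \<bullet> e = 1" "!!n. n : S ==> e \<bullet> n = 0" "EX x:S. EX y:S. det3 e x y ~= 0"
 interpret plane e by unfold_locales (rule e(1))
 obtain x y where xy: "x : S" "y : S" "dd x y ~= 0" using e(3) unfolding dd_def by blast
 have "case_plane nu Om v" by (rule helical_case[OF m e(2) xy r hh])
 then show ?thesis by (simp add: flow_structure_def)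
 qed
 qed
qed

section \<open>From the alternatives for the field back to coefficients\<close>

context plane
begin

lemma planar_aD:
 assumes m: "modes_of v S C" and S: "!!n. n : S ==> e \<bullet> n = 0" and a: "!!x p. e \<bullet> p = 0 ==> v x \<bullet> p = 0"
 shows "al C n = 0"
proof -
 have fin: "finite S" and off: "!!n. n ~: S ==> C n = 0" and ex: "!!x. cvec (v x) = (\<Sum>n\<in>S. cis (n \<bullet> x) *s C n)"
 using m unfolding modes_of_def by blast+
 have "v x \<bullet> cross3 e n = 0" for x by (rule a) (simp add: dot_cross_self)
 then have "trig_expansion (%x. 0) (%k. cdot (C k) (cvec (cross3 e n)))"
 using modes_of_component[OF fin off ex, of "cross3 e n"] by simp
 from trig_expansion_unique[OF this trig_expansion_zero] have "cdot (C n) (cvec (cross3 e n)) = 0" by (simp add: fun_eq_iff)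
 then show ?thesis by (simp add: al_def)
qed

text \<open>Uniqueness of expansions identifies the coefficients: testing against vectors of the
  plane compares the field with \<open>vpar\<close>, testing against \<open>e\<close> yields the
  polynomial in \<omega>.\<close>

lemma planar_bD:
 assumes m: "modes_of v S C" and S: "!!n. n : S ==> e \<bullet> n = 0" and sp: "EX x:S. EX y:S. dd x y ~= 0"
 and dec: "!!x. v x = vpar x + vperp x *\<^sub>R e" and H: "vpar : Hfields" and par: "!!x. e \<bullet> vpar x = 0"
 and lam: "lam > 0" and sph: "fourier_support vpar \<subseteq> sphere 0 lam" and c4: "card (fourier_support vpar) >= 4"
 and curl: "!!x. curl vpar x = (lam * \<omega> x) *\<^sub>R e"
 and perp: "!!x. vperp x = poly Q (\<omega> x) - z"
 and br: "(ALL n:S. Om * n$3 = 0) & (nu ~= 0 --> (\<exists>kap. Q = [:0, kap:])) | Q = [:0, 1:] | Q = [:0, - 1:]"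
 shows "mode_structure nu Om S C"
proof -
 have fin: "finite S" and zS: "0 ~: S" and C: "!!n. C n ~= 0 \<longleftrightarrow> n : S" and off: "!!n. n ~: S ==> C n = 0"
 and ex: "!!x. cvec (v x) = (\<Sum>n\<in>S. cis (n \<bullet> x) *s C n)"
 using m unfolding modes_of_def by blast+
 have V: "plane_field C" by (rule modes_plane_field[OF m S])
 have teC: "trig_expansion (%x. of_real (v x \<bullet> y)) (%k. cdot (C k) (cvec y))" for y
 by (rule modes_of_component[OF fin off ex])
 let ?A = "fourier_support vpar" and ?D = "field_coeff vpar"
 let ?om = "%n. \<i> * of_real lam * al C n"
 have mA: "modes_of vpar ?A ?D" by (rule Hfields_modes_of[OF H])
 have finA: "finite ?A" and symA: "!!n. n : ?A ==> - n : ?A" and D: "!!n. ?D n ~= 0 \<longleftrightarrow> n : ?A" and offA: "!!n. n ~: ?A ==> ?D n = 0"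
 and exA: "!!x. cvec (vpar x) = (\<Sum>n\<in>?A. cis (n \<bullet> x) *s ?D n)" and zA: "0 ~: ?A" and pA: "!!n. cdot (cvec n) (?D n) = 0"
 using mA unfolding modes_of_def by blast+
 have teD: "trig_expansion (%x. of_real (vpar x \<bullet> y)) (%k. cdot (?D k) (cvec y))" for y
 by (rule modes_of_component[OF finA offA exA])
 have De: "cdot (?D n) (cvec e) = 0" for n
 proof -
 have "trig_expansion (%x. 0) (%k. cdot (?D k) (cvec e))"
 using teD[of e] par by (simp add: inner_commute)
 from trig_expansion_unique[OF this trig_expansion_zero] show ?thesis by (simp add: fun_eq_iff)
 qed
 have same: "cdot (C n) (cvec y) = cdot (?D n) (cvec y)" if "e \<bullet> y = 0" for n y
 proof -
 have "v x \<bullet> y = vpar x \<bullet> y" for x using that unfolding dec by (simp add: inner_add_left)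
 then have "trig_expansion (%x. of_real (v x \<bullet> y)) (%k. cdot (?D k) (cvec y))"
 using teD[of y] by simp
 from trig_expansion_unique[OF teC[of y] this] show ?thesis by (simp add: fun_eq_iff)
 qed
 have alD: "cdot (?D n) (cvec (cross3 e n)) = al C n * of_real (n \<bullet> n)" for n
 unfolding same[of "cross3 e n" n, symmetric, OF dot_cross_self(1)] by (rule cdot_plane_field(2)[OF V])
 have nlam: "norm n = lam" if "al C n ~= 0" for n
 proof -
 have "n ~= 0" using that by (auto simp: al_def)
 then have "?D n ~= 0" using alD[of n] that by auto
 then have "n : ?A" using D by blast
 then show ?thesis using sph by auto
 qed
 have AS: "n : S & al C n ~= 0" if n: "n : ?A" for n
 proof -
 have "?D n ~= 0" using D n by blast
 have "n : S"
 proof (rule ccontr)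
 assume "n ~: S"
 then have z: "cdot (?D n) (cvec y) = 0" if "e \<bullet> y = 0" for y using same[OF that, of n] off by simp
 have z0: "cdot (?D n) (cvec y) = 0" for y
 proof -
 have y: "y = (y - (y \<bullet> e) *\<^sub>R e) + (y \<bullet> e) *\<^sub>R e" by simp
 have "cdot (?D n) (cvec (y - (y \<bullet> e) *\<^sub>R e)) = 0"
 by (rule z) (simp add: inner_diff_right e1 inner_commute)
 then show ?thesis by (subst y, subst cvec_simps(3)) (simp add: cdot_add cdot_simps De del: cvec_simps(4))
 qed
 have "?D n $ j = 0" for j using z0[of "axis j 1"] by (simp only: cdot_axis)
 then have "?D n = 0" by (simp add: vec_eq_iff)
 then show False using \<open>?D n ~= 0\<close> by simp
 qed
 moreover have "al C n ~= 0"
 proof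
 assume "al C n = 0"
 then have "cdot (?D n) (cvec (cross3 e n)) = 0" using alD[of n] by simp
 moreover have "n ~= 0" using zA n by blast
 ultimately have "?D n = 0" using plane_decomp[OF S[OF \<open>n : S\<close>] _ pA] De[of n] by simp
 then show False using \<open>?D n ~= 0\<close> by simp
 qed
 ultimately show ?thesis ..
 qed
 have tew: "trig_expansion (%x. complex_of_real (\<omega> x)) ?om"
 proof -
 have "trig_expansion (%x. complex_of_real (curl vpar x \<bullet> e)) (%n. cdot (\<i> *s ccross (cvec n) (?D n)) (cvec e))"
 by (rule modes_of_component[OF finA _ curl_expansion[OF finA exA]]) (simp add: offA)
 moreover have "cdot (\<i> *s ccross (cvec n) (?D n)) (cvec e) = of_real lam * ?om n" for n
 proof -
 have "cdot (ccross (cvec n) (?D n)) (cvec e) = al C n * of_real (n \<bullet> n)"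
 unfolding cdot_ccross_left ccross_cvec by (rule alD)
 moreover have "al C n * of_real (n \<bullet> n) = al C n * of_real (lam * lam)"
 using nlam[of n] by (cases "al C n = 0") (auto simp: dot_square_norm power2_eq_square)
 ultimately show ?thesis unfolding cdot_simps by (simp add: mult_ac)
 qed
 ultimately have "trig_expansion (%x. complex_of_real (lam * \<omega> x)) (%n. of_real lam * ?om n)"
 unfolding curl by (simp add: e1)
 from trig_expansion_scale[OF this, of "of_real (1 / lam)"] show ?thesis using lam by simp
 qed
 have suppom: "{n. ?om n ~= 0} \<subseteq> S"
 proof
 fix n assume "n : {n. ?om n ~= 0}"
 then have "al C n ~= 0" by simp
 then show "n : S" using off[of n] by (cases "n : S") simp_all
 qed
 have w: "complex_of_real (\<omega> x) = (\<Sum>n\<in>S. ?om n * cis (n \<bullet> x))" for x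
 by (rule trig_expansionD[OF tew fin suppom])
 have vp: "v x \<bullet> e = poly Q (\<omega> x) - z" for x
 unfolding dec perp using par[of x] by (simp add: inner_add_left inner_add_right e1 inner_commute)
 \<comment> \<open>The subtracted mean \<open>z\<close> affects only the zeroth power.\<close>
 define q where "q k = complex_of_real (coeff Q k) - (if k = 0 then of_real z else 0)" for k
 have "be C n = (\<Sum>k<Suc (degree Q). q k * pw S ?om k n)" for n
 proof -
 have "complex_of_real (v x \<bullet> e) = (\<Sum>k<Suc (degree Q). q k * of_real (\<omega> x) ^ k)" for x
 proof -
 have "(\<Sum>k<Suc (degree Q). q k * complex_of_real (\<omega> x) ^ k)
 = (\<Sum>k<Suc (degree Q). of_real (coeff Q k) * complex_of_real (\<omega> x) ^ k) - (\<Sum>k<Suc (degree Q). if k = 0 then of_real z else 0)"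
 unfolding sum_subtractf[symmetric] q_def by (rule sum.cong) (auto simp: algebra_simps)
 also have "\<dots> = of_real (poly Q (\<omega> x)) - of_real z"
 by (simp add: poly_altdef lessThan_Suc_atMost del: sum.lessThan_Suc)
 finally show ?thesis by (simp add: vp)
 qed
 then have "trig_expansion (%x. complex_of_real (v x \<bullet> e)) (%n. \<Sum>k<Suc (degree Q). q k * pw S ?om k n)"
 using trig_expansion_polynomial[where N = "Suc (degree Q)" and q = q, OF fin w] by (simp only:)
 from trig_expansion_unique[OF teC[of e] this] show ?thesis by (simp only: be_def fun_eq_iff)
 qed
 then have poly: "\<exists>N q. \<forall>n. be C n = (\<Sum>k<N. q k * pw S ?om k n)" by blast
 \<comment> \<open>The mean enters only at the zero frequency, where both sides vanish.\<close>
 have lin: "be C n = of_real kap * ?om n" if Q: "Q = [:0, kap:]" for kap n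
 proof (cases "n = 0")
 case True
 then show ?thesis using off[of 0] zS by simp
 next
 case False
 have "trig_expansion (%x. of_real kap * complex_of_real (\<omega> x) + (- of_real z)) (%n. of_real kap * ?om n + (if n = 0 then - of_real z else 0))"
 proof (rule trig_expansion_add[OF trig_expansion_scale[OF tew]])
 show "trig_expansion (%x. - complex_of_real z) (%n. if n = 0 then - of_real z else 0)"
 by (rule trig_expansionI[of "{0}"]) auto
 qed
 moreover have "complex_of_real (v x \<bullet> e) = of_real kap * complex_of_real (\<omega> x) + (- of_real z)" for x
 unfolding vp Q by (simp add: mult.commute)
 ultimately have "trig_expansion (%x. complex_of_real (v x \<bullet> e)) (%n. of_real kap * ?om n + (if n = 0 then - of_real z else 0))"
 by (simp only:)
 from fun_cong[OF trig_expansion_unique[OF teC[of e] this], of n]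
 show ?thesis using False by (simp add: be_def)
 qed
 \<comment> \<open>A line through the origin meets the circle in two points, but the support of
   \<open>vpar\<close> has at least four.\<close>
 have spA: "EX x:S. EX y:S. al C x ~= 0 & al C y ~= 0 & det3 e x y ~= 0"
 proof (rule ccontr)
 assume no: "~ ?thesis"
 have "?A ~= {}" using c4 by auto
 then obtain x where x: "x : ?A" by blast
 have "?A \<subseteq> {x, - x}"
 proof
 fix y assume y: "y : ?A"
 have "dd x y = 0" using no AS[OF x] AS[OF y] unfolding dd_def by blast
 then have "y = ((x \<bullet> y) / (x \<bullet> x)) *\<^sub>R x"
 by (rule parallelI[rotated 2]) (use S AS x y zA in auto)
 then obtain k where k: "y = k *\<^sub>R x" by blast
 have "norm x = lam" "norm y = lam" using nlam AS x y by blast+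
 then have "\<bar>k\<bar> = 1" unfolding k using lam by simp
 then have "k = 1 | k = - 1" by linarith
 then show "y : {x, - x}" using k by auto
 qed
 then have "card ?A <= card {x, - x}" by (intro card_mono) auto
 also have "\<dots> <= 2" by (simp add: card_insert_if)
 finally show False using c4 by simp
 qed
 show ?thesis
 \<comment> \<open>Slope one or minus one means curl eigenvectors with eigenvalue \<open>lam\<close>
   or \<open>- lam\<close>; the other profiles come with the condition on the plane.\<close>
 proof (cases "Q = [:0, 1:] | Q = [:0, - 1:]")
 case True
 then obtain kap where kap: "Q = [:0, kap:]" "kap = 1 | kap = - 1" by blast
 have "norm n = lam & helical (of_real (kap * lam)) n (C n)" if n: "n : S" for n
 proof
 have "al C n ~= 0"
 proof
 assume a: "al C n = 0"
 then have "be C n = 0" using lin[OF kap(1), of n] by simp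
 then have "C n = 0" using plane_field_decomp[OF V, of n] a by (metis add_0 vector_smult_lzero)
 then show False using C n by blast
 qed
 then show nl': "norm n = lam" by (rule nlam)
 show "helical (of_real (kap * lam)) n (C n)"
 proof (rule helical_plane[OF V S[OF n]])
 show "be C n = \<i> * of_real (kap * lam) * al C n" unfolding lin[OF kap(1)] by (simp add: mult_ac)
 show "(complex_of_real (kap * lam))\<^sup>2 = of_real (n \<bullet> n)"
 using kap(2) nl' by (auto simp: dot_square_norm)
 qed
 qed
 then have "helical_structure S C"
 unfolding helical_structure_def using kap(2) lam by (intro exI[of _ "kap * lam"] exI[of _ lam]) auto
 then show ?thesis by (simp add: mode_structure_def)
 next
 case False
 then have b: "ALL n:S. Om * n$3 = 0" "nu ~= 0 --> (\<exists>kap. Q = [:0, kap:])" using br by blast+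
 have "polynomial_profile S nu C lam"
 unfolding polynomial_profile_def using lam nlam poly b(2) lin by blast
 then have "planar_structure nu Om S C"
 unfolding planar_structure_def using e1 S b(1) sp spA unfolding dd_def by blast
 then show ?thesis by (simp add: mode_structure_def)
 qed
qed

end

lemma planar_normal:
 fixes P :: "(real^3) set"
 assumes "subspace P" "dim P = 2"
 obtains e where "e \<bullet> e = 1" "!!p. p : P ==> e \<bullet> p = 0"
proof -
 have "P ~= UNIV" using assms(2) by auto
 then have "span P ~= UNIV" using span_eq_iff assms(1) by metis
 then obtain a where a: "a ~= 0" "ALL x:span P. a \<bullet> x = 0" using span_not_UNIV_orthogonal by blast
 show ?thesis
 proof (rule that[of "(1 / norm a) *\<^sub>R a"])
 show "((1 / norm a) *\<^sub>R a) \<bullet> ((1 / norm a) *\<^sub>R a) = 1" using a(1) by (simp add: dot_square_norm power2_eq_square)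
 show "((1 / norm a) *\<^sub>R a) \<bullet> p = 0" if "p : P" for p using a(2) span_base[OF that] by simp
 qed
qed

lemma level_of_P3: "Om = 0 | P = P3 ==> S \<subseteq> P ==> n : S ==> Om * n$3 = 0"
 by (auto simp: P3_def e3_def inner_axis)

text \<open>A priori the eigenvalue of a Beltrami flow is any complex number. Applying curl twice to
  one mode gives the squared radius, so the eigenvalue is the radius up to sign.\<close>

lemma sphere_structure:
 assumes m: "modes_of v S C" and c: "case_sphere v"
 shows "helical_structure S C"
proof -
 have s: "fourier_support v = S" using modes_of_Hfields[OF m] by blast
 have fin: "finite S" and C: "!!n. C n ~= 0 \<longleftrightarrow> n : S" and off: "!!n. n ~: S ==> C n = 0"
 and pr: "!!n. cdot (cvec n) (C n) = 0"
 and ex: "!!x. cvec (v x) = (\<Sum>n\<in>S. cis (n \<bullet> x) *s C n)"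
 using m unfolding modes_of_def by blast+
 obtain n1 where n1: "n1 : S" using c unfolding case_sphere_def s by blast
 obtain r where r: "r > 0" "S \<subseteq> sphere 0 r" using c unfolding case_sphere_def s by blast
 obtain mu where mu: "!!x. cvec (curl v x) = mu *s cvec (v x)" using c unfolding case_sphere_def beltrami_def by blast
 have h: "helical mu n (C n)" for n
 proof -
 have "cdot (\<i> *s ccross (cvec n) (C n)) (cvec y) = mu * cdot (C n) (cvec y)" for y
 proof -
 have 1: "trig_expansion (%x. complex_of_real (curl v x \<bullet> y)) (%n. cdot (\<i> *s ccross (cvec n) (C n)) (cvec y))"
 by (rule modes_of_component[OF fin _ curl_expansion[OF fin ex]]) (simp add: off)
 have te: "trig_expansion (%x. of_real (v x \<bullet> y)) (%n. cdot (C n) (cvec y))"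
 by (rule modes_of_component[OF fin off ex])
 have "complex_of_real (curl v x \<bullet> y) = mu * complex_of_real (v x \<bullet> y)" for x
 proof -
 have "cdot (cvec (curl v x)) (cvec y) = mu * cdot (cvec (v x)) (cvec y)" unfolding mu by (simp only: cdot_simps)
 then show ?thesis by (simp only: cdot_cvec_cvec)
 qed
 then have "trig_expansion (%x. complex_of_real (curl v x \<bullet> y)) (%n. mu * cdot (C n) (cvec y))"
 using trig_expansion_scale[OF te, of mu] by (simp only:)
 from fun_cong[OF trig_expansion_unique[OF 1 this], of n] show ?thesis .
 qed
 note y = this
 have "(\<i> *s ccross (cvec n) (C n)) $ j = (mu *s C n) $ j" for j
 using y[of "axis j 1"] exhaust_3[of j]
 by (auto simp: scalar_product_def sum_3 cvec_def axis_def)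
 then show ?thesis unfolding helical_def vec_eq_iff by blast
 qed
 have nr: "norm n = r" if "n : S" for n using r(2) that by auto
 have "mu\<^sup>2 = of_real ((norm n1)\<^sup>2)" by (rule helical_square[OF h pr]) (use C n1 in blast)
 then have "(mu - of_real r) * (mu + of_real r) = 0" using nr[OF n1] by (simp add: power2_eq_square algebra_simps)
 then have "mu = of_real r | mu = of_real (- r)" by (auto simp: add_eq_0_iff2)
 then obtain m' where m': "m' : {r, - r}" "mu = of_real m'" by blast
 have "ALL n:S. norm n = r & helical (of_real m') n (C n)"
 proof
 fix n assume "n : S"
 then show "norm n = r & helical (of_real m') n (C n)" using nr[of n] h[of n] unfolding m'(2) by simp
 qed
 then show ?thesis unfolding helical_structure_def using r(1) m'(1) by blast
qed

lemma flow_structureD: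
 assumes m: "modes_of v S C" and fs: "flow_structure nu Om v"
 shows "mode_structure nu Om S C"
proof -
 have s: "fourier_support v = S" using modes_of_Hfields[OF m] by blast
 consider "case_line v" | "case_plane nu Om v" | "case_sphere v"
 using fs unfolding flow_structure_def by blast
 then show ?thesis
 proof cases
 case 1
 then obtain L :: "(real^3) set" where L: "dim L = 1" "S \<subseteq> L" unfolding case_line_def s by blast
 obtain B where B: "L \<subseteq> span B" "card B = dim L"
 proof (rule basis_exists[of L])
 fix B assume "L \<subseteq> span B" "card B = dim L"
 then show thesis by (rule that)
 qed
 obtain b where "B = {b}" using B(2) L(1) card_1_singletonE[of B] by auto
 then have "ALL n:S. \<exists>c. n = c *\<^sub>R b" using B(1) L(2) unfolding span_singleton[of b, symmetric] by (auto simp: span_singleton)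
 then show ?thesis unfolding mode_structure_def line_structure_def by blast
 next
 case 3
 then show ?thesis using sphere_structure[OF m] by (simp add: mode_structure_def)
 next
 case 2
 then obtain n1 n2 P where n12: "n1 : S" "n2 : S" "n1 ~= n2" "independent {n1, n2}"
 and P: "subspace P" "dim P = 2" "S \<subseteq> P" and ab: "planar_a Om P v | planar_b nu Om P v"
 unfolding case_plane_def s by blast
 from ab show ?thesis
 proof
 assume a: "planar_a Om P v"
 obtain e where e: "e \<bullet> e = 1" "!!p. p : P ==> e \<bullet> p = 0"
 proof (rule planar_normal[OF P(1,2)])
 fix e assume a: "e \<bullet> e = 1" "!!p. p : P ==> e \<bullet> p = 0"
 show thesis by (rule that[of e]) (auto simp: a)
 qed
 interpret plane e by unfold_locales (rule e(1))
 have PP: "P = perp_plane" by (rule subspace_perp_plane[OF P(1,2) e(2)])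
 have S: "e \<bullet> n = 0" if "n : S" for n using e(2) P(3) that by blast
 have D: "dd n1 n2 ~= 0" by (rule independent_dd[OF n12(4,3) S[OF n12(1)] S[OF n12(2)]])
 have a': "v x \<bullet> p = 0" if "e \<bullet> p = 0" for x p
 using a that unfolding planar_a_def PP orthogonal_def by blast
 have z: "al C n = 0" for n by (rule planar_aD[OF m S a'])
 have Om: "Om * n$3 = 0" if "n : S" for n
 by (rule level_of_P3[OF _ P(3) that]) (use a in \<open>simp add: planar_a_def\<close>)
 have "planar_structure nu Om S C"
 unfolding planar_structure_def
 by (rule exI[of _ e]) (use e(1) S Om n12(1,2) D z in \<open>auto simp: dd_def\<close>)
 then show ?thesis by (simp add: mode_structure_def)
 next
 assume "planar_b nu Om P v"
 then obtain e vpar vperp lam \<omega> Q where e: "norm e = 1" "ALL p:P. orthogonal e p"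
 and b: "\<forall>x. v x = vpar x + vperp x *\<^sub>R e" "vpar : Hfields" "\<forall>x. vpar x : P" "lam > 0"
 "fourier_support vpar \<subseteq> P \<inter> sphere 0 lam" "card (fourier_support vpar) >= 4"
 "\<forall>x. curl vpar x = (lam * \<omega> x) *\<^sub>R e"
 "\<forall>x. vperp x = poly Q (\<omega> x) - zero_mode (%y. poly Q (\<omega> y))"
 and br: "(Om = 0 | P = P3) & nu = 0
  | (Om = 0 | P = P3) & nu ~= 0 & (\<exists>kap. Q = [:0, kap:])
  | Om ~= 0 & P ~= P3 & (Q = [:0, 1:] | Q = [:0, - 1:])"
 unfolding planar_b_def by blast
 have ee: "e \<bullet> e = 1" using e(1) by (simp add: dot_square_norm)
 have eP: "e \<bullet> p = 0" if "p : P" for p using e(2) that by (simp add: orthogonal_def)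
 interpret plane e by unfold_locales (rule ee)
 have S: "e \<bullet> n = 0" if "n : S" for n using eP P(3) that by blast
 have D: "dd n1 n2 ~= 0" by (rule independent_dd[OF n12(4,3) S[OF n12(1)] S[OF n12(2)]])
 have sp: "EX x:S. EX y:S. dd x y ~= 0" using n12(1,2) D by blast
 have lev: "ALL n:S. Om * n$3 = 0" if "Om = 0 | P = P3" using level_of_P3[OF that P(3)] by blast
 show ?thesis
 proof (rule planar_bD[OF m S sp, where vpar = vpar and vperp = vperp and lam = lam and \<omega> = \<omega> and Q = Q
 and z = "zero_mode (%y. poly Q (\<omega> y))"])
 show "v x = vpar x + vperp x *\<^sub>R e" for x using b(1) by blast
 show "vpar : Hfields" by (rule b(2))
 show "e \<bullet> vpar x = 0" for x using eP b(3) by blast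
 show "lam > 0" by (rule b(4))
 show "fourier_support vpar \<subseteq> sphere 0 lam" using b(5) by blast
 show "card (fourier_support vpar) >= 4" by (rule b(6))
 show "curl vpar x = (lam * \<omega> x) *\<^sub>R e" for x using b(7) by blast
 show "vperp x = poly Q (\<omega> x) - zero_mode (%y. poly Q (\<omega> y))" for x using b(8) by blast
 show "(ALL n:S. Om * n$3 = 0) & (nu ~= 0 --> (\<exists>kap. Q = [:0, kap:])) | Q = [:0, 1:] | Q = [:0, - 1:]"
 using br lev by blast
 qed
 qed
 qed
qed

lemma pair_sum_nl:
 assumes "finite S"
 shows "proj_perp n (\<Sum>(n1, n2)\<in>{(n1, n2). n1 : S & n2 : S & n1 + n2 = n}.
  cdot (V n1) (cvec n2) *s V n2 + cdot (V n2) (cvec n1) *s V n1) = nl S V n"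
 unfolding nl_def inter_def bilin_def proj_perp_sum
 by (rule sum.reindex_bij_witness[of _ "%m. (m, n - m)" fst]) auto

lemma derivative_equation:
 fixes f :: "real => complex^3"
 shows "(f has_vector_derivative - a - b - c) (at t) \<longleftrightarrow>
 f differentiable (at t) & vector_derivative f (at t) + a + b + c = 0"
proof
 assume d: "(f has_vector_derivative - a - b - c) (at t)"
 then have "f differentiable (at t)" by (rule differentiableI_vector)
 moreover have "vector_derivative f (at t) = - a - b - c" by (rule vector_derivative_at[OF d])
 ultimately show "f differentiable (at t) & vector_derivative f (at t) + a + b + c = 0" by simp
next
 assume d: "f differentiable (at t) & vector_derivative f (at t) + a + b + c = 0"
 then have "vector_derivative f (at t) = - a - b - c" by (simp add: algebra_simps eq_neg_iff_add_eq_0)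
 moreover have "(f has_vector_derivative vector_derivative f (at t)) (at t)"
 using d vector_derivative_works by blast
 ultimately show "(f has_vector_derivative - a - b - c) (at t)" by simp
qed

theorem theorem5p1:
  fixes \<nu> \<Omega> :: real and I :: "real set" and u :: "real \<Rightarrow> real^3 \<Rightarrow> real^3"
  assumes "open I" and "is_interval I" and "I \<noteq> {}"
    and "u \<in> Hfields_on I"
  shows "(nsc_solution \<nu> \<Omega> I u \<longleftrightarrow>
            linear_solution \<nu> \<Omega> I u \<and> (\<exists>t\<in>I. flow_structure \<nu> \<Omega> (u t)))
       \<and> (nsc_solution \<nu> \<Omega> I u \<longleftrightarrow>
            linear_solution \<nu> \<Omega> I u \<and> (\<forall>t\<in>I. flow_structure \<nu> \<Omega> (u t)))"
proof -
 obtain S c where H: "finite S & 0 ~: S & uminus ` S = S &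
 (ALL n:S. (EX t:I. c t n ~= 0) & (ALL t:I. c t (- n) = cnjv (c t n) & cdot (cvec n) (c t n) = 0)) &
 (ALL t:I. \<forall>x. cvec (u t x) = (\<Sum>n\<in>S. cis (n \<bullet> x) *s c t n))"
 using assms(4) unfolding Hfields_on_def mem_Collect_eq by (elim exE) (rule that)
 then have S: "finite S" "0 ~: S" "uminus ` S = S" by simp_all
 have c: "(EX t:I. c t n ~= 0) & (ALL t:I. c t (- n) = cnjv (c t n) & cdot (cvec n) (c t n) = 0)" if "n : S" for n
 using H that by simp
 have ex: "cvec (u t x) = (\<Sum>n\<in>S. cis (n \<bullet> x) *s c t n)" if "t : I" for t x
 using H that by simp
 have cI: "convex I" using assms(2) by (simp add: is_interval_convex_1)
 have sym: "- n : S" if "n : S" for n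
 proof -
 have "- n : uminus ` S" using that by (rule imageI)
 then show ?thesis unfolding S(3) .
 qed
 define U where "U t = field_coeff (u t)" for t
 have Uc: "U t n = (if n : S then c t n else 0)" if "t : I" for t n
 unfolding U_def by (rule field_coeff_eq[OF S(1) ex[OF that]])
 have FS: "fourier_support_on I u = S"
 by (rule fourier_support_on_eq[OF S(1) _ ex]) (use c in blast)
 have off: "U t n = 0" if "t : I" "n ~: S" for t n using Uc[OF that(1), of n] that(2) by simp
 have perp: "cdot (cvec n) (U t n) = 0" if "t : I" for t n
 using Uc[OF that, of n] c[of n] that by (cases "n : S") auto
 have cj0: "cnjv 0 = 0" by (simp add: cnjv_simps)
 have conj: "U t (- n) = cnjv (U t n)" if t: "t : I" for t n
 proof (cases "n : S")
 case True
 then show ?thesis using Uc[OF t, of n] Uc[OF t, of "- n"] sym[OF True] c[OF True] t by simp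
 next
 case False
 then have "- n ~: S" using sym[of "- n"] by auto
 then show ?thesis using False off[OF t] cj0 by simp
 qed
 have nonv: "EX t:I. U t n ~= 0" if "n : S" for n using c[OF that] Uc that by auto
 have exU: "cvec (u t x) = (\<Sum>n\<in>S. cis (n \<bullet> x) *s U t n)" if "t : I" for t x
 unfolding ex[OF that] by (rule sum.cong) (simp_all add: Uc[OF that])
 have modes: "modes_of (u t) S (U t)" if t: "t : I" and "!!n. n : S ==> U t n ~= 0" for t
 unfolding modes_of_def
 proof (intro conjI allI ballI)
 show "U t n ~= 0 \<longleftrightarrow> n : S" for n using that(2)[of n] off[OF t, of n] by (cases "n : S") simp_all
 qed (rule S(1) S(2) sym perp[OF t] conj[OF t] exU[OF t]; assumption?)+
 have lin_iff: "linear_solution \<nu> \<Omega> I u \<longleftrightarrow> (ALL t:I. ALL n:S. ((%s. U s n) has_vector_derivative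
 - (\<nu> * (norm n)\<^sup>2) *\<^sub>R U t n - \<Omega> *\<^sub>R (Jmat n *v U t n)) (at t))"
 using derivative_equation[where c = 0]
 unfolding linear_solution_def Let_def FS U_def scaleR_minus_left diff_0_right add_0_right by simp
 have nsc_iff: "nsc_solution \<nu> \<Omega> I u \<longleftrightarrow> (ALL t:I. ALL n:S \<union> ({n1 + n2 | n1 n2. n1 : S & n2 : S} - {0}).
 ((%s. U s n) has_vector_derivative
 - (\<nu> * (norm n)\<^sup>2) *\<^sub>R U t n - \<Omega> *\<^sub>R (Jmat n *v U t n) - (\<i> / 2) *s nl S (U t) n) (at t))"
 unfolding nsc_solution_def Let_def FS U_def[symmetric] pair_sum_nl[OF S(1)] scaleR_minus_left derivative_equation
 using perp by blast
 have linear_flow: "linear_flow S I \<nu> \<Omega> U" if "linear_solution \<nu> \<Omega> I u"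
 proof
 show "finite S" "0 ~: S" "open I" "convex I" by (rule S assms cI)+
 show "- n : S" if "n : S" for n by (rule sym[OF that])
 show "U t n = 0" if "t : I" "n ~: S" for t n by (rule off[OF that])
 show "cdot (cvec n) (U t n) = 0" if "t : I" for t n by (rule perp[OF that])
 show "U t (- n) = cnjv (U t n)" if "t : I" for t n by (rule conj[OF that])
 qed (use that lin_iff in blast)
 have A: "linear_solution \<nu> \<Omega> I u & (ALL t:I. flow_structure \<nu> \<Omega> (u t))" if ns: "nsc_solution \<nu> \<Omega> I u"
 proof -
 have fl: "flow S I \<nu> \<Omega> U"
 proof
 show "finite S" "0 ~: S" "open I" by (rule S assms)+
 show "- n : S" if "n : S" for n by (rule sym[OF that])
 show "U t n = 0" if "t : I" "n ~: S" for t n by (rule off[OF that])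
 show "cdot (cvec n) (U t n) = 0" if "t : I" for t n by (rule perp[OF that])
 show "U t (- n) = cnjv (U t n)" if "t : I" for t n by (rule conj[OF that])
 fix t and n :: "real^3" assume t: "t : I" and n: "n ~= 0"
 let ?S' = "S \<union> ({n1 + n2 | n1 n2. n1 : S & n2 : S} - {0})"
 show "((%s. U s n) has_vector_derivative
 - (\<nu> * (norm n)\<^sup>2) *\<^sub>R U t n - \<Omega> *\<^sub>R (Jmat n *v U t n) - (\<i> / 2) *s nl S (U t) n) (at t)"
 \<comment> \<open>The hypothesis speaks of \<open>?S'\<close> only; at other nonzero frequencies no
   pair of modes sums to \<open>n\<close>, and both sides are zero.\<close>
 proof (cases "n : ?S'")
 case True
 then show ?thesis using ns t unfolding nsc_iff by blast
 next
 case False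
 then have nS: "n ~: S" by blast
 have "~ (m : S & n - m : S)" for m
 proof
 assume mS: "m : S & n - m : S"
 have "n : {n1 + n2 | n1 n2. n1 : S & n2 : S}"
 unfolding mem_Collect_eq by (rule exI[of _ m], rule exI[of _ "n - m"]) (simp add: mS)
 then show False using False n by simp
 qed
 then have em: "{m : S. n - m : S} = {}" by blast
 have z: "nl S (U t) n = 0" unfolding nl_def em by simp
 have "((%s. U s n) has_vector_derivative 0) (at t)"
 by (rule has_vector_derivative_transform_within_open[OF has_vector_derivative_const assms(1) t]) (simp add: off[OF _ nS])
 then show ?thesis unfolding off[OF t nS] z by simp
 qed
 qed
 have quiet: "nl S (U t) n = 0" if "t : I" for t n by (rule flow.quiet[OF fl that])
 have lin: "linear_solution \<nu> \<Omega> I u"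
 unfolding lin_iff
 proof (intro ballI)
 fix t n assume t: "t : I" and n: "n : S"
 have "n ~= 0" using n S(2) by blast
 from flow.ode[OF fl t this] show "((%s. U s n) has_vector_derivative
 - (\<nu> * (norm n)\<^sup>2) *\<^sub>R U t n - \<Omega> *\<^sub>R (Jmat n *v U t n)) (at t)"
 unfolding quiet[OF t] by simp
 qed
 interpret L: linear_flow S I \<nu> \<Omega> U by (rule linear_flow[OF lin])
 have "flow_structure \<nu> \<Omega> (u t)" if t: "t : I" for t
 proof (rule flow_structureI[OF modes[OF t]])
 show "U t n ~= 0" if n: "n : S" for n using nonv[OF n] L.vanish[OF n t] by blast
 show "mode_structure \<nu> \<Omega> S (U t)" by (rule flow.solution_structure[OF fl cI nonv t])
 qed
 then show ?thesis using lin by blast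
 qed
 \<comment> \<open>The structure at the single time \<open>t\<close> rules out interactions at all
   times, so the linear solution satisfies the full equation as well.\<close>
 have B: "nsc_solution \<nu> \<Omega> I u" if lin: "linear_solution \<nu> \<Omega> I u" and t: "t : I" and fs: "flow_structure \<nu> \<Omega> (u t)" for t
 proof -
 interpret L: linear_flow S I \<nu> \<Omega> U by (rule linear_flow[OF lin])
 have "U t n ~= 0" if n: "n : S" for n using nonv[OF n] L.vanish[OF n t] by blast
 then have st: "mode_structure \<nu> \<Omega> S (U t)" by (rule flow_structureD[OF modes[OF t] fs])
 have quiet: "nl S (U s) n = 0" if "s : I" for s n by (rule L.structure_quiet[OF t that st])
 show ?thesis
 unfolding nsc_iff
 proof (intro ballI)
 fix s n assume s: "s : I"
 show "((%s. U s n) has_vector_derivative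
 - (\<nu> * (norm n)\<^sup>2) *\<^sub>R U s n - \<Omega> *\<^sub>R (Jmat n *v U s n) - (\<i> / 2) *s nl S (U s) n) (at s)"
 proof (cases "n : S")
 case True
 then show ?thesis unfolding quiet[OF s] using L.lin[OF s True] by simp
 next
 case False
 have "((%s. U s n) has_vector_derivative 0) (at s)"
 by (rule has_vector_derivative_transform_within_open[OF has_vector_derivative_const assms(1) s]) (simp add: off[OF _ False])
 then show ?thesis unfolding quiet[OF s] off[OF s False] by simp
 qed
 qed
 qed
 show ?thesis using A B assms(3) by blast
qed

end
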